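(* Let $1<\alpha_i\le 2$ for $i=1,2$, let $\varphi,\psi\in L^1(\mathbb{R})$ with $\varphi,\psi\neq 0$ be fixed, and let $X_T=(X_T(s,t))_{s,t\ge 0}$ be the rescaled occupation time fluctuation process (defined in the context) of the two-type particle system with Poisson initial configuration of Lebesgue intensity on $\mathbb{R}\times\mathbb{R}$ (the case $\gamma_1=\gamma_2=0$), with norming $$F_T=\prod_{i=1}^2T^{1-1/(2\alpha_i)}.$$ Then for every $\tau>0$, $X_T$ converges in law to $DW$ in the space of continuous functions $C([0,\tau]\times[0,\tau],\mathbb{R})$ as $T\to\infty$, where $W$ is the fractional Brownian sheet with parameters $\left(1-\frac{1}{2\alpha_1},\,1-\frac{1}{2\alpha_2}\right)$ (normalized as in the context), and $$D=\int_{\mathbb{R}}\varphi(x)\,dx\int_{\mathbb{R}}\psi(x)\,dx\left[\prod_{i=1}^2\frac{1}{1-1/\alpha_i}\,p_1^{\alpha_i}(0)\right]^{1/2},$$ with $$p_t^{\alpha}(x)=\frac{1}{2\pi}\int_{\mathbb{R}}\exp\{-(ixy+t|y|^{\alpha})\}\,dy$$ the transition density of the symmetric $\alpha$-stable Lévy process.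
   Context: Fractional Brownian sheet (normalization used here): $W=(W_{s,t})_{s,t\ge 0}$ is the centered Gaussian random field with covariance $E(W_{s,t}W_{s',t'})=C^{(1)}(s,s')C^{(2)}(t,t')$, where, with $b_i=1-1/\alpha_i$, $$C^{(i)}(u,v)=\int_0^{u\wedge v}\left[(u-r)^{b_i}+(v-r)^{b_i}\right]dr=\frac{1}{1+b_i}\left(u^{1+b_i}+v^{1+b_i}-|u-v|^{1+b_i}\right),$$ taken in a version with continuous trajectories. Its parameters (Hurst indices) are $\frac12(1+b_i)=1-\frac{1}{2\alpha_i}$. Particle system: let $N_{0,0}$ be a Poisson random measure on $\mathbb{R}\times\mathbb{R}$ with intensity Lebesgue measure $dx_1\,dx_2$. From each point $(x_1,x_2)$ of $N_{0,0}$ start two independent Lévy processes: $\xi^{x_1}$, symmetric $\alpha_1$-stable started at $x_1$, and $\zeta^{x_2}$, symmetric $\alpha_2$-stable started at $x_2$ (with transition densities $p_t^{\alpha_1}$, $p_t^{\alpha_2}$); the pairs attached to different points are independent of each other and, given the starting points, of $N_{0,0}$. For $u,v\ge 0$ put $$\langle N_{u,v},\varphi\otimes\psi\rangle=\sum_{(x_1,x_2)\in N_{0,0}}\varphi(\xi^{x_1}_u)\,\psi(\zeta^{x_2}_v),$$ and define the occupation time process $$\langle L_{s,t},\varphi\otimes\psi\rangle=\int_0^s\int_0^t\langle N_{u,v},\varphi\otimes\psi\rangle\,dv\,du,\qquad s,t\ge 0.$$ The rescaled occupation time fluctuation process is $$X_T(s,t)=\frac{1}{F_T}\Big(\langle L_{Ts,Tt},\varphi\otimes\psi\rangle-E\langle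 L_{Ts,Tt},\varphi\otimes\psi\rangle\Big),\qquad s,t\ge 0 .$$ *)

theory Defs
  imports "HOL-Probability.Probability"
begin

section \<open>Convergence in law in spaces of continuous functions\<close>

definition borel_of :: "'a topology \<Rightarrow> 'a measure" where
  "borel_of X = sigma (topspace X) {U. openin X U}"

definition weak_conv_on ::
    "'a topology \<Rightarrow> ('i \<Rightarrow> 'a measure) \<Rightarrow> 'a measure \<Rightarrow> 'i filter \<Rightarrow> bool" where
  "weak_conv_on X \<mu> \<nu> F \<longleftrightarrow>
     (\<forall>f. continuous_map X euclideanreal f \<and> bounded (f ` topspace X) \<longrightarrow>
        ((\<lambda>i. \<integral>x. f x \<partial>(\<mu> i)) \<longlongrightarrow> (\<integral>x. f x \<partial>\<nu>)) F)"

text \<open>The space \<open>C(S, \<real>)\<close> with the uniform metric; its elements are extensional, i.e.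
  \<open>undefined\<close> outside \<open>S\<close>.\<close>

definition C_space :: "'p::topological_space set \<Rightarrow> ('p \<Rightarrow> real) metric" where
  "C_space S = cfunspace (top_of_set S) euclidean_metric"

definition C_borel :: "'p::topological_space set \<Rightarrow> ('p \<Rightarrow> real) measure" where
  "C_borel S = borel_of (mtopology_of (C_space S))"

text \<open>\<open>Z\<close> is the random field \<open>X\<close>, restricted to \<open>S\<close>, regarded as a random element of
  \<open>C(S, \<real>)\<close>. The exceptional null set is needed because a field may have continuous paths on
  \<open>S\<close> only almost surely; the law of \<open>Z\<close> does not depend on the choice of \<open>Z\<close>.\<close>

definition C_element ::
    "'w measure \<Rightarrow> 'p::topological_space set \<Rightarrow> ('p \<Rightarrow> 'w \<Rightarrow> real) \<Rightarrow> ('w \<Rightarrow> 'p \<Rightarrow> real) \<Rightarrow> bool" where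
  "C_element M S X Z \<longleftrightarrow>
     Z \<in> M \<rightarrow>\<^sub>M C_borel S \<and> (AE \<omega> in M. \<forall>p\<in>S. Z \<omega> p = X p \<omega>)"

text \<open>Convergence in law in \<open>C(S, \<real>)\<close> of the fields \<open>X T\<close> (\<open>T > 0\<close>) on \<open>M\<close> to the field \<open>Y\<close> on
  \<open>M'\<close> as \<open>T \<rightarrow> \<infinity>\<close>. It includes the assertion that all these fields have almost surely
  continuous paths on \<open>S\<close>.\<close>

definition converges_in_law_C ::
    "'p::topological_space set \<Rightarrow> 'w measure \<Rightarrow> (real \<Rightarrow> 'p \<Rightarrow> 'w \<Rightarrow> real) \<Rightarrow>
     'v measure \<Rightarrow> ('p \<Rightarrow> 'v \<Rightarrow> real) \<Rightarrow> bool" where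
  "converges_in_law_C S M X M' Y \<longleftrightarrow>
     (\<exists>Z V. (\<forall>T>0. C_element M S (X T) (Z T)) \<and> C_element M' S Y V \<and>
        weak_conv_on (mtopology_of (C_space S))
          (\<lambda>T. distr M (C_borel S) (Z T)) (distr M' (C_borel S) V) at_top)"


section \<open>Fractional Brownian sheet\<close>

text \<open>Degenerate (almost surely constant) variables count as Gaussian.\<close>

definition gaussian_rv :: "'w measure \<Rightarrow> ('w \<Rightarrow> real) \<Rightarrow> bool" where
  "gaussian_rv M X \<longleftrightarrow> X \<in> borel_measurable M \<and>
     ((\<exists>m \<sigma>. \<sigma> > 0 \<and> distributed M lborel X (\<lambda>x. ennreal (normal_density m \<sigma> x))) \<or>
      (\<exists>m. AE \<omega> in M. X \<omega> = m))"

definition centered_gaussian_field :: "'w measure \<Rightarrow> 'p set \<Rightarrow> ('p \<Rightarrow> 'w \<Rightarrow> real) \<Rightarrow> bool" where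
  "centered_gaussian_field M I W \<longleftrightarrow>
     (\<forall>J c. finite J \<and> J \<subseteq> I \<longrightarrow> gaussian_rv M (\<lambda>\<omega>. \<Sum>p\<in>J. c p * W p \<omega>)) \<and>
     (\<forall>p\<in>I. prob_space.expectation M (W p) = 0)"

definition fbs_cov :: "real \<Rightarrow> real \<Rightarrow> real \<Rightarrow> real" where
  "fbs_cov \<alpha> u v =
     (LBINT r:{0..min u v}. (u - r) powr (1 - 1 / \<alpha>) + (v - r) powr (1 - 1 / \<alpha>))"

lemma set_integral_powr_reflect:
  fixes b u m :: real assumes "b > 0" "0 \<le> m" "m \<le> u"
  shows "set_integrable lborel {0..m} (\<lambda>r. (u - r) powr b)"
    "(LBINT r:{0..m}. (u - r) powr b) = (u powr (1+b) - (u-m) powr (1+b)) / (1+b)"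
proof -
  have c: "continuous_on {0..m} (\<lambda>r. (u - r) powr b)" 
    using assms by (intro continuous_on_powr' continuous_intros) auto
  show si: "set_integrable lborel {0..m} (\<lambda>r. (u - r) powr b)"
    using borel_integrable_atLeastAtMost'[OF c] .
  have "((\<lambda>r. (u - r) powr b) has_integral ((- ((u-m) powr (1+b) / (1+b))) - (- ((u-0) powr (1+b) / (1+b))))) {0..m}"
  proof (rule fundamental_theorem_of_calculus_interior)
    show "continuous_on {0..m} (\<lambda>r. - ((u-r) powr (1+b) / (1+b)))"
      using assms by (intro continuous_intros continuous_on_powr') auto
    fix r assume "r \<in> {0<..<m}"
    then have "u - r > 0" using assms by auto
    then have "((\<lambda>r. (u-r) powr (1+b)) has_real_derivative ((1+b) * (u-r) powr (1+b-1)) * (0 - 1)) (at r)"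
      by (intro DERIV_chain2[where f="\<lambda>z. z powr (1+b)"] has_real_derivative_powr DERIV_diff DERIV_const DERIV_ident)
    from DERIV_minus[OF DERIV_cdivide[OF this, of "1+b"]] assms
    show "((\<lambda>r. - ((u-r) powr (1+b) / (1+b))) has_vector_derivative (u - r) powr b) (at r)"
      by (simp add: has_real_derivative_iff_has_vector_derivative[symmetric])
  qed (use assms in auto)
  then show "(LBINT r:{0..m}. (u - r) powr b) = (u powr (1+b) - (u-m) powr (1+b)) / (1+b)"
    using set_borel_integral_eq_integral(2)[OF si] by (auto simp: has_integral_iff diff_divide_distrib)
qed

lemma fbs_cov_eq:
  assumes "1 < \<alpha>" "0 \<le> u" "0 \<le> v"
  defines "b \<equiv> 1 - 1 / \<alpha>"
  shows "fbs_cov \<alpha> u v =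
           1 / (1 + b) * (u powr (1 + b) + v powr (1 + b) - \<bar>u - v\<bar> powr (1 + b))"
proof -
  have b: "b > 0" using assms by (simp add: field_simps)
  show ?thesis unfolding fbs_cov_def b_def[symmetric]
    using set_integral_powr_reflect[OF b, of "min u v" u] set_integral_powr_reflect[OF b, of "min u v" v] assms(2,3) b
    by (subst set_integral_add(2)) (auto simp: min_def field_simps abs_if)
qed

text \<open>The sheet with Hurst indices \<open>1 - 1 / (2 * \<alpha>1)\<close> and \<open>1 - 1 / (2 * \<alpha>2)\<close>, in a version with
  continuous paths and in the normalization given by \<open>fbs_cov\<close>.\<close>

definition fractional_brownian_sheet ::
    "'w measure \<Rightarrow> real \<Rightarrow> real \<Rightarrow> (real \<times> real \<Rightarrow> 'w \<Rightarrow> real) \<Rightarrow> bool" where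
  "fractional_brownian_sheet M \<alpha>1 \<alpha>2 W \<longleftrightarrow>
     prob_space M \<and>
     centered_gaussian_field M ({0..} \<times> {0..}) W \<and>
     (\<forall>s\<ge>0. \<forall>t\<ge>0. \<forall>s'\<ge>0. \<forall>t'\<ge>0.
        prob_space.expectation M (\<lambda>\<omega>. W (s, t) \<omega> * W (s', t') \<omega>) =
          fbs_cov \<alpha>1 s s' * fbs_cov \<alpha>2 t t') \<and>
     (\<forall>\<omega>\<in>space M. continuous_on ({0..} \<times> {0..}) (\<lambda>p. W p \<omega>))"


section \<open>Symmetric stable Levy processes\<close>

text \<open>The integral is real; \<open>Re\<close> only fixes the type.\<close>

definition stable_density :: "real \<Rightarrow> real \<Rightarrow> real \<Rightarrow> real" where
  "stable_density \<alpha> t x =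
     Re (1 / (2 * complex_of_real pi) *
       (CLBINT y. exp (- (\<i> * complex_of_real (x * y) + complex_of_real (t * \<bar>y\<bar> powr \<alpha>)))))"

definition cadlag_on_nonneg :: "(real \<Rightarrow> real) \<Rightarrow> bool" where
  "cadlag_on_nonneg f \<longleftrightarrow>
     (\<forall>t\<ge>0. (f \<longlongrightarrow> f t) (at_right t)) \<and> (\<forall>t>0. \<exists>l. (f \<longlongrightarrow> l) (at_left t))"

definition levy_process :: "'w measure \<Rightarrow> (real \<Rightarrow> 'w \<Rightarrow> real) \<Rightarrow> bool" where
  "levy_process M Y \<longleftrightarrow>
     prob_space M \<and>
     (\<forall>t\<ge>0. Y t \<in> borel_measurable M) \<and>
     (AE \<omega> in M. Y 0 \<omega> = 0) \<and>
     (\<forall>n::nat. \<forall>t::nat \<Rightarrow> real. 0 \<le> t 0 \<and> (\<forall>i<n. t i \<le> t (Suc i)) \<longrightarrow>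
        prob_space.indep_vars M (\<lambda>_. borel) (\<lambda>i \<omega>. Y (t (Suc i)) \<omega> - Y (t i) \<omega>) {..<n}) \<and>
     (\<forall>s\<ge>0. \<forall>t\<ge>s. distr M borel (\<lambda>\<omega>. Y t \<omega> - Y s \<omega>) = distr M borel (Y (t - s))) \<and>
     (\<forall>\<omega>\<in>space M. cadlag_on_nonneg (\<lambda>t. Y t \<omega>))"

definition symmetric_stable_levy :: "'w measure \<Rightarrow> real \<Rightarrow> (real \<Rightarrow> 'w \<Rightarrow> real) \<Rightarrow> bool" where
  "symmetric_stable_levy M \<alpha> Y \<longleftrightarrow>
     levy_process M Y \<and>
     (\<forall>t>0. distributed M lborel (Y t) (\<lambda>x. ennreal (stable_density \<alpha> t x)))"


section \<open>The particle system\<close>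

text \<open>A random point configuration is given by a measurable enumeration \<open>x 0, x 1, \<dots>\<close> of its
  points (with multiplicity); \<open>N_count x A\<close> is the number of points in \<open>A\<close>. Enumeration by the
  naturals loses nothing for an intensity of infinite total mass.\<close>

definition N_count :: "(nat \<Rightarrow> 'w \<Rightarrow> 'e) \<Rightarrow> 'e set \<Rightarrow> 'w \<Rightarrow> ennreal" where
  "N_count x A \<omega> = emeasure (count_space UNIV) {n. x n \<omega> \<in> A}"

text \<open>The Poisson weights are written out since \<open>poisson_pmf\<close> requires a positive rate.\<close>

definition poisson_random_measure ::
    "'w measure \<Rightarrow> 'e measure \<Rightarrow> (nat \<Rightarrow> 'w \<Rightarrow> 'e) \<Rightarrow> bool" where
  "poisson_random_measure M \<nu> x \<longleftrightarrow>
     (\<forall>n. x n \<in> M \<rightarrow>\<^sub>M \<nu>) \<and>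
     (\<forall>A\<in>sets \<nu>. emeasure \<nu> A < \<infinity> \<longrightarrow>
        (\<forall>k::nat. measure M {\<omega> \<in> space M. N_count x A \<omega> = of_nat k} =
           measure \<nu> A ^ k / fact k * exp (- measure \<nu> A))) \<and>
     (\<forall>(I::nat set) A. finite I \<and> A ` I \<subseteq> sets \<nu> \<and> disjoint_family_on A I \<longrightarrow>
        prob_space.indep_vars M (\<lambda>_. borel) (\<lambda>i. N_count x (A i)) I)"

definition generated_events ::
    "'w measure \<Rightarrow> 'i set \<Rightarrow> ('i \<Rightarrow> 'w \<Rightarrow> 'b::topological_space) \<Rightarrow> 'w set set" where
  "generated_events M I Z =
     sigma_sets (space M) {Z i -` A \<inter> space M | i A. i \<in> I \<and> A \<in> sets borel}"

datatype source = Start | Motion1 nat | Motion2 nat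

fun source_events ::
    "'w measure \<Rightarrow> (nat \<Rightarrow> 'w \<Rightarrow> real \<times> real) \<Rightarrow> (nat \<Rightarrow> real \<Rightarrow> 'w \<Rightarrow> real) \<Rightarrow>
     (nat \<Rightarrow> real \<Rightarrow> 'w \<Rightarrow> real) \<Rightarrow> source \<Rightarrow> 'w set set" where
  "source_events M x Y1 Y2 Start = generated_events M UNIV x"
| "source_events M x Y1 Y2 (Motion1 n) = generated_events M {0..} (Y1 n)"
| "source_events M x Y1 Y2 (Motion2 n) = generated_events M {0..} (Y2 n)"

text \<open>The particle pair with index \<open>n\<close> starts from the point \<open>x n = (x1, x2)\<close> and moves along
  \<open>\<xi>\<^sub>u = x1 + Y1 n u\<close> and \<open>\<zeta>\<^sub>v = x2 + Y2 n v\<close>, where \<open>Y1 n\<close> and \<open>Y2 n\<close> start from 0.\<close>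

definition two_type_particle_system ::
    "'w measure \<Rightarrow> real \<Rightarrow> real \<Rightarrow> (nat \<Rightarrow> 'w \<Rightarrow> real \<times> real) \<Rightarrow>
     (nat \<Rightarrow> real \<Rightarrow> 'w \<Rightarrow> real) \<Rightarrow> (nat \<Rightarrow> real \<Rightarrow> 'w \<Rightarrow> real) \<Rightarrow> bool" where
  "two_type_particle_system M \<alpha>1 \<alpha>2 x Y1 Y2 \<longleftrightarrow>
     prob_space M \<and>
     poisson_random_measure M lborel x \<and>
     (\<forall>n. symmetric_stable_levy M \<alpha>1 (Y1 n)) \<and>
     (\<forall>n. symmetric_stable_levy M \<alpha>2 (Y2 n)) \<and>
     prob_space.indep_sets M (source_events M x Y1 Y2) UNIV"

definition N_pairing ::
    "(nat \<Rightarrow> 'w \<Rightarrow> real \<times> real) \<Rightarrow> (nat \<Rightarrow> real \<Rightarrow> 'w \<Rightarrow> real) \<Rightarrow> (nat \<Rightarrow> real \<Rightarrow> 'w \<Rightarrow> real) \<Rightarrow>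
     (real \<Rightarrow> real) \<Rightarrow> (real \<Rightarrow> real) \<Rightarrow> real \<Rightarrow> real \<Rightarrow> 'w \<Rightarrow> real" where
  "N_pairing x Y1 Y2 \<phi> \<psi> u v \<omega> =
     (\<Sum>\<^sub>\<infinity>n\<in>UNIV. \<phi> (fst (x n \<omega>) + Y1 n u \<omega>) * \<psi> (snd (x n \<omega>) + Y2 n v \<omega>))"

definition occupation_time ::
    "(nat \<Rightarrow> 'w \<Rightarrow> real \<times> real) \<Rightarrow> (nat \<Rightarrow> real \<Rightarrow> 'w \<Rightarrow> real) \<Rightarrow> (nat \<Rightarrow> real \<Rightarrow> 'w \<Rightarrow> real) \<Rightarrow>
     (real \<Rightarrow> real) \<Rightarrow> (real \<Rightarrow> real) \<Rightarrow> real \<Rightarrow> real \<Rightarrow> 'w \<Rightarrow> real" where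
  "occupation_time x Y1 Y2 \<phi> \<psi> s t \<omega> =
     (LBINT u:{0..s}. (LBINT v:{0..t}. N_pairing x Y1 Y2 \<phi> \<psi> u v \<omega>))"

definition fluctuation ::
    "'w measure \<Rightarrow> (nat \<Rightarrow> 'w \<Rightarrow> real \<times> real) \<Rightarrow> (nat \<Rightarrow> real \<Rightarrow> 'w \<Rightarrow> real) \<Rightarrow>
     (nat \<Rightarrow> real \<Rightarrow> 'w \<Rightarrow> real) \<Rightarrow> (real \<Rightarrow> real) \<Rightarrow> (real \<Rightarrow> real) \<Rightarrow> (real \<Rightarrow> real) \<Rightarrow>
     real \<Rightarrow> real \<times> real \<Rightarrow> 'w \<Rightarrow> real" where
  "fluctuation M x Y1 Y2 \<phi> \<psi> F T = (\<lambda>(s, t) \<omega>.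
     1 / F T * (occupation_time x Y1 Y2 \<phi> \<psi> (T * s) (T * t) \<omega> -
       prob_space.expectation M (occupation_time x Y1 Y2 \<phi> \<psi> (T * s) (T * t))))"

end

theory Submission
  imports Defs
begin

text \<open>
  Given the initial configuration the particle pairs are independent, and the initial configuration
  is Poisson. A linear combination of values of the centred occupation time is therefore a centred
  Poisson integral, whose characteristic function differs from that of the Gaussian law with the same
  variance by at most the third absolute moment of a single pair, integrated over its starting point.
  Both the variance and this third moment factorize over the two types, and self-similarity of the
  stable densities shows that the rescaled covariances converge to \<open>fbs_cov\<close> while the rescaled third
  moment is of order \<open>T powr (- 1 / (2 * \<alpha>1)) * T powr (- 1 / (2 * \<alpha>2))\<close>. This gives convergence of
  the finite-dimensional laws.

  For tightness, the second moment of a rectangular increment is bounded, uniformly in \<open>T\<close>, by a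
  multiple of \<open>\<bar>s' - s\<bar> powr (2 - 1 / \<alpha>1) * \<bar>t' - t\<bar> powr (2 - 1 / \<alpha>2)\<close>. Since both exponents
  exceed 1, a two-parameter dyadic chaining argument yields a uniform modulus of continuity in
  probability.
\<close>

section \<open>Stable densities\<close>

text \<open>Two difficulties shape the argument. First, the enumeration of the Poisson points is
  arbitrary, so nothing is known about the law of a single \<open>x n\<close> beyond its domination
  by Lebesgue measure. The passage to the Poisson exponential therefore works with products over
  \<open>n < N\<close>, computed for step functions and carried over by errors that are bounded
  uniformly in \<open>N\<close> by integrals over all starting points. Likewise, motions of
  different particles are compared only through their laws at three times, which is just enough for
  iterated time integrals of order up to three. Second, \<phi> and \<psi> are merely integrable. All
  bounds use L1 norms only, which works because the increment density at lag r is at most a multiple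
  of r powr (- 1 / \<alpha>), integrable at 0 as \<alpha> > 1. Moments for a fixed starting point
  may be infinite at exceptional points, hence the many almost-everywhere statements. The variance
  of the particle sum is not computed directly but read off from the bound on characteristic
  functions as their argument tends to 0.\<close>

lemma integrable_exp_neg_abs:
  assumes "0 < t"
  shows "integrable lborel (\<lambda>y::real. exp (- (t * \<bar>y\<bar>)))"
proof -
  interpret E: prob_space "density lborel (exponential_density t)" by (rule prob_space_exponential_density[OF assms])
  have "(\<integral>\<^sup>+y. ennreal (exponential_density t y) \<partial>lborel) = 1"
    using E.emeasure_space_1 by (simp add: emeasure_density)
  then have i: "integrable lborel (exponential_density t)"
    using assms by (intro integrableI_nonneg) (auto intro!: AE_I2 simp: exponential_density_nonneg)
  \<comment> \<open>The exponential density vanishes on the negative half line; adding its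
    reflection gives a majorant on both sides.\<close>
  have i2: "integrable lborel (\<lambda>y. exponential_density t (- y))"
    using lborel_integrable_real_affine[OF i, of "-1" 0] by simp
  show ?thesis
  proof (rule Bochner_Integration.integrable_bound)
    show "integrable lborel (\<lambda>y. (exponential_density t y + exponential_density t (- y)) / t)"
      by (intro integrable_divide Bochner_Integration.integrable_add i i2)
    show "AE y in lborel. norm (exp (- (t * \<bar>y\<bar>))) \<le> norm ((exponential_density t y + exponential_density t (- y)) / t)"
      using assms by (intro AE_I2) (auto simp: exponential_density_def abs_if mult.commute divide_simps)
  qed auto
qed

text \<open>Follows from |y| - 1 \<le> |y| powr \<alpha>, which compares the stable characteristic
  function with a two-sided exponential at the cost of the factor exp t.\<close>

lemma integrable_exp_neg_powr:
  assumes "1 \<le> \<alpha>" "0 < t"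
  shows "integrable lborel (\<lambda>y::real. exp (- (t * \<bar>y\<bar> powr \<alpha>)))"
proof (rule Bochner_Integration.integrable_bound)
  show "integrable lborel (\<lambda>y. exp t * exp (- (t * \<bar>y\<bar>)))" using integrable_exp_neg_abs[OF assms(2)] by simp
  show "AE y in lborel. norm (exp (- (t * \<bar>y\<bar> powr \<alpha>))) \<le> norm (exp t * exp (- (t * \<bar>y\<bar>)))"
  proof (rule AE_I2)
    fix y :: real
    have "\<bar>y\<bar> - 1 \<le> \<bar>y\<bar> powr \<alpha>"
    proof (cases "\<bar>y\<bar> \<le> 1")
      case False
      then have "\<bar>y\<bar> powr 1 \<le> \<bar>y\<bar> powr \<alpha>" using assms by (intro powr_mono) auto
      then show ?thesis using False by simp
    next
      case True
      have "0 \<le> \<bar>y\<bar> powr \<alpha>" by simp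
      with True show ?thesis by linarith
    qed
    then have "t * (\<bar>y\<bar> - 1) \<le> t * \<bar>y\<bar> powr \<alpha>" using assms(2) by (intro mult_left_mono) auto
    then show "norm (exp (- (t * \<bar>y\<bar> powr \<alpha>))) \<le> norm (exp t * exp (- (t * \<bar>y\<bar>)))"
      by (simp add: exp_add[symmetric] algebra_simps)
  qed
qed auto

text \<open>The real part in the definition turns the Fourier kernel into a cosine; bounds,
  continuity and scaling of the density are read off this real form.\<close>

lemma stable_density_eq_cos:
  assumes "1 \<le> \<alpha>" "0 < t"
  shows "stable_density \<alpha> t x = 1 / (2 * pi) * (LBINT y. cos (x * y) * exp (- (t * \<bar>y\<bar> powr \<alpha>)))"
    and "integrable lborel (\<lambda>y. cos (x * y) * exp (- (t * \<bar>y\<bar> powr \<alpha>)))"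
proof -
  let ?f = "\<lambda>y::real. exp (- (\<i> * complex_of_real (x * y) + complex_of_real (t * \<bar>y\<bar> powr \<alpha>)))"
  have int: "integrable lborel ?f"
    by (rule Bochner_Integration.integrable_bound[OF integrable_exp_neg_powr[OF assms]]) (auto intro!: AE_I2)
  have re: "Re (?f y) = cos (x * y) * exp (- (t * \<bar>y\<bar> powr \<alpha>))" for y by (simp add: Re_exp)
  have "Re (1 / (2 * complex_of_real pi) * (CLBINT y. ?f y)) = 1 / (2 * pi) * Re (CLBINT y. ?f y)"
    by simp
  also have "Re (CLBINT y. ?f y) = (LBINT y. Re (?f y))" using int by simp
  finally show "stable_density \<alpha> t x = 1 / (2 * pi) * (LBINT y. cos (x * y) * exp (- (t * \<bar>y\<bar> powr \<alpha>)))"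
    unfolding stable_density_def re .
  show "integrable lborel (\<lambda>y. cos (x * y) * exp (- (t * \<bar>y\<bar> powr \<alpha>)))"
    using integrable_Re[OF int] unfolding re .
qed

text \<open>The cosine is bounded by 1. The absolute value is kept because the cosine formula does
  not exhibit the sign of the density away from 0.\<close>

lemma abs_stable_density_le:
  assumes "1 \<le> \<alpha>" "0 < t"
  shows "\<bar>stable_density \<alpha> t x\<bar> \<le> stable_density \<alpha> t 0"
proof -
  have "\<bar>LBINT y. cos (x * y) * exp (- (t * \<bar>y\<bar> powr \<alpha>))\<bar> \<le> (LBINT y. \<bar>cos (x * y) * exp (- (t * \<bar>y\<bar> powr \<alpha>))\<bar>)"
    by (rule integral_abs_bound)
  also have "\<dots> \<le> (LBINT y. cos (0 * y) * exp (- (t * \<bar>y\<bar> powr \<alpha>)))"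
    by (intro integral_mono integrable_abs stable_density_eq_cos(2)[OF assms]) (auto simp: abs_mult)
  finally show ?thesis unfolding stable_density_eq_cos(1)[OF assms]
    by (simp add: abs_mult divide_right_mono)
qed

lemma stable_density_0_nonneg: "1 \<le> \<alpha> \<Longrightarrow> 0 < t \<Longrightarrow> 0 \<le> stable_density \<alpha> t 0"
  using abs_stable_density_le[of \<alpha> t 0] by simp

text \<open>Self-similarity, by substituting t powr (- 1 / \<alpha>) * y for y in the cosine
  integral. The exponents of the norming originate here.\<close>

lemma stable_density_scaling:
  assumes "1 \<le> \<alpha>" "0 < t"
  shows "stable_density \<alpha> t x = t powr (- 1 / \<alpha>) * stable_density \<alpha> 1 (t powr (- 1 / \<alpha>) * x)"
proof -
  let ?c = "t powr (- 1 / \<alpha>)"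
  have c: "?c > 0" using assms by simp
  have "(LBINT y. cos (x * y) * exp (- (t * \<bar>y\<bar> powr \<alpha>))) =
     \<bar>?c\<bar> *\<^sub>R (LBINT y. cos (x * (0 + ?c * y)) * exp (- (\<lambda>y. t * \<bar>0 + ?c * y\<bar> powr \<alpha>) y))"
    using c lborel_integral_real_affine[of ?c "\<lambda>y. cos (x * y) * exp (- (t * \<bar>y\<bar> powr \<alpha>))" 0] by simp
  also have "(\<lambda>y. t * \<bar>0 + ?c * y\<bar> powr \<alpha>) = (\<lambda>y. 1 * \<bar>y\<bar> powr \<alpha>)"
  proof
    fix y
    have "t * \<bar>0 + ?c * y\<bar> powr \<alpha> = t * (t powr (- 1 / \<alpha> * \<alpha>)) * \<bar>y\<bar> powr \<alpha>"
      by (simp add: abs_mult powr_mult powr_powr)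
    also have "t powr (- 1 / \<alpha> * \<alpha>) = 1 / t" using assms by (simp add: powr_minus_divide)
    finally show "t * \<bar>0 + ?c * y\<bar> powr \<alpha> = 1 * \<bar>y\<bar> powr \<alpha>" using assms by simp
  qed
  finally show ?thesis
    using c unfolding stable_density_eq_cos(1)[OF assms] stable_density_eq_cos(1)[OF assms(1) zero_less_one]
    by (simp add: mult_ac)
qed

lemma stable_density_0_scaling:
  "1 \<le> \<alpha> \<Longrightarrow> 0 < t \<Longrightarrow> stable_density \<alpha> t 0 = t powr (- 1 / \<alpha>) * stable_density \<alpha> 1 0"
  using stable_density_scaling[of \<alpha> t 0] by simp

lemma continuous_on_stable_density:
  assumes "1 \<le> \<alpha>" "0 < t"
  shows "continuous_on UNIV (stable_density \<alpha> t)"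
proof -
  have "(\<lambda>n. stable_density \<alpha> t (X n)) \<longlonglongrightarrow> stable_density \<alpha> t a" if X: "X \<longlonglongrightarrow> a" for X a
    unfolding stable_density_eq_cos(1)[OF assms]
  proof (intro tendsto_mult_left integral_dominated_convergence[where w="\<lambda>y. exp (- (t * \<bar>y\<bar> powr \<alpha>))"])
    show "integrable lborel (\<lambda>y::real. exp (- (t * \<bar>y\<bar> powr \<alpha>)))" by (rule integrable_exp_neg_powr[OF assms])
    show "AE y in lborel. (\<lambda>n. cos (X n * y) * exp (- (t * \<bar>y\<bar> powr \<alpha>))) \<longlonglongrightarrow> cos (a * y) * exp (- (t * \<bar>y\<bar> powr \<alpha>))"
      by (intro AE_I2 tendsto_intros X)
    show "AE y in lborel. norm (cos (X n * y) * exp (- (t * \<bar>y\<bar> powr \<alpha>))) \<le> exp (- (t * \<bar>y\<bar> powr \<alpha>))" for n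
      by (intro AE_I2) (simp add: abs_mult)
  qed auto
  then have "isCont (stable_density \<alpha> t) a" for a
    unfolding continuous_at_sequentially by (auto simp: o_def)
  then show ?thesis by (simp add: continuous_at_imp_continuous_on)
qed

lemma borel_measurable_stable_density:
  assumes "1 \<le> \<alpha>"
  shows "stable_density \<alpha> 1 \<in> borel_measurable borel"
  by (intro borel_measurable_continuous_onI continuous_on_stable_density assms) auto

section \<open>A multivariate continuity theorem\<close>

text \<open>These sums form an algebra of functions for which convergence of expectations is a
  finite linear consequence of convergence of characteristic functions; constants are included
  through zero frequencies.\<close>

inductive_set trig_sums :: "nat \<Rightarrow> ((nat \<Rightarrow> real) \<Rightarrow> complex) set" for k where
  base: "(\<lambda>a. z * iexp (\<Sum>i<k. c i * a i)) \<in> trig_sums k"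
| add: "f \<in> trig_sums k \<Longrightarrow> g \<in> trig_sums k \<Longrightarrow> (\<lambda>a. f a + g a) \<in> trig_sums k"

lemma trig_sums_mult:
  assumes "f \<in> trig_sums k" "g \<in> trig_sums k"
  shows "(\<lambda>a. f a * g a) \<in> trig_sums k"
  using assms(1)
proof induction
  case (base z c)
  from assms(2) show ?case
  proof induction
    case (base z' c')
    have "(\<lambda>a. z * iexp (\<Sum>i<k. c i * a i) * (z' * iexp (\<Sum>i<k. c' i * a i))) = (\<lambda>a. (z * z') * iexp (\<Sum>i<k. (c i + c' i) * a i))"
      by (intro ext) (simp add: distrib_right sum.distrib distrib_left exp_add)
    then show ?case by (simp only: trig_sums.base)
  next
    case (add f g)
    then show ?case using trig_sums.add[OF add.IH] by (simp add: distrib_left)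
  qed
next
  case (add f g)
  then show ?case using trig_sums.add[OF add.IH] by (simp add: distrib_right)
qed

lemma trig_sums_integrable:
  assumes "f \<in> trig_sums k" and N: "prob_space N" and X: "\<And>i. i < k \<Longrightarrow> (\<lambda>w. X w i) \<in> borel_measurable N"
  shows "integrable N (\<lambda>w. f (X w))"
  using assms(1)
proof induction
  case (base z c)
  have "(\<lambda>w. \<Sum>i<k. c i * X w i) \<in> borel_measurable N" using X by (intro borel_measurable_sum borel_measurable_times) auto
  then have "(\<lambda>w. iexp (\<Sum>i<k. c i * X w i)) \<in> borel_measurable N" by measurable
  then show ?case by (intro integrable_mult_right finite_measure.integrable_const_bound[where B=1] prob_space.finite_measure[OF N]) auto
qed auto

lemma trig_sums_tendsto:
  fixes X :: "nat \<Rightarrow> 'w \<Rightarrow> nat \<Rightarrow> real"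
  assumes "f \<in> trig_sums k" and M: "prob_space M" "prob_space M'"
    and X: "\<And>n i. i < k \<Longrightarrow> (\<lambda>w. X n w i) \<in> borel_measurable M" and Y: "\<And>i. i < k \<Longrightarrow> (\<lambda>w. Y w i) \<in> borel_measurable M'"
    and char: "\<And>c. (\<lambda>n. LINT w|M. iexp (\<Sum>i<k. c i * X n w i)) \<longlonglongrightarrow> (LINT w|M'. iexp (\<Sum>i<k. c i * Y w i))"
  shows "(\<lambda>n. LINT w|M. f (X n w)) \<longlonglongrightarrow> (LINT w|M'. f (Y w))"
  using assms(1)
proof induction
  case (base z c)
  then show ?case using tendsto_mult_left[OF char[of c], of z] by simp
next
  case (add f g)
  have "integrable M (\<lambda>w. h (X n w))" "integrable M' (\<lambda>w. h (Y w))" if "h \<in> trig_sums k" for h n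
    using trig_sums_integrable[OF that M(1)] trig_sums_integrable[OF that M(2)] X Y by blast+
  then show ?case using add by (simp add: tendsto_add)
qed

text \<open>A function of the coordinates is replaced by a continuous function of their sines, which the
  trigonometric sums approximate uniformly; the error is controlled by the second moments.\<close>

lemma trig_sums_approximation:
  fixes g :: "(nat \<Rightarrow> real) \<Rightarrow> real"
  assumes cont: "continuous_on UNIV g" and dep: "\<And>a b. (\<And>i. i < k \<Longrightarrow> a i = b i) \<Longrightarrow> g a = g b"
    and B: "\<And>a. \<bar>g a\<bar> \<le> B" and K: "0 < K" and e: "0 < e"
  obtains h where "(\<lambda>a. complex_of_real (h a)) \<in> trig_sums k" "\<And>a. \<bar>g a - h a\<bar> \<le> e + 2 * B / K\<^sup>2 * (\<Sum>i<k. (a i)\<^sup>2)"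
proof -
  \<comment> \<open>Coordinates from \<open>k\<close> on are frozen at 0: the sines then range in
    the compact product \<open>S\<close>, whose points are separated by the first \<open>k\<close>
    coordinates alone.\<close>
  define u where "u a i = (if i < k then sin (a i / K) else 0)" for a :: "nat \<Rightarrow> real" and i
  define S where "S = PiE UNIV (\<lambda>i. if i < k then {- 1..1} else {0 :: real})"
  define H where "H v = g (\<lambda>i. K * arcsin (v i))" for v
  define P where "P f \<longleftrightarrow> continuous_on S f \<and> (\<lambda>a. complex_of_real (f (u a))) \<in> trig_sums k" for f :: "(nat \<Rightarrow> real) \<Rightarrow> real"
  have "compactin (product_topology (\<lambda>_. euclidean) UNIV) S" unfolding S_def compactin_PiE by auto
  then have S: "compact S" by (simp add: euclidean_product_topology)
  have coord: "- 1 \<le> v i \<and> v i \<le> 1" if "v \<in> S" for v i 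
    using PiE_mem[OF that[unfolded S_def] UNIV_I[of i]] by (auto split: if_splits)
  have zero: "v i = 0" if "v \<in> S" "\<not> i < k" for v i using PiE_mem[OF that(1)[unfolded S_def] UNIV_I[of i]] that(2) by simp
  have "continuous_on S (\<lambda>v i. K * arcsin (v i))"
    by (intro continuous_on_coordinatewise_then_product continuous_on_mult_left continuous_on_arcsin continuous_on_product_coordinates[THEN continuous_on_subset]) (auto simp: coord)
  from continuous_on_compose2[OF cont this] have HC: "continuous_on S H" unfolding H_def by simp
  have "\<exists>q. P q \<and> (\<forall>v\<in>S. \<bar>H v - q v\<bar> < e)"
  proof (rule Stone_Weierstrass_HOL[OF S _ _ _ _ _ HC e])
    show "P (\<lambda>v. c)" for c
      using trig_sums.base[where z="of_real c" and k=k and c="\<lambda>_. 0"] by (simp add: P_def)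
    show "continuous_on S f" if "P f" for f using that by (simp add: P_def)
    show "P (\<lambda>v. f v + f' v)" if "P f \<and> P f'" for f f'
      using that trig_sums.add by (auto simp: P_def intro: continuous_on_add)
    show "P (\<lambda>v. f v * f' v)" if "P f \<and> P f'" for f f'
      using that trig_sums_mult by (auto simp: P_def intro: continuous_on_mult)
    show "\<exists>f. P f \<and> f v \<noteq> f v'" if vv: "v \<in> S \<and> v' \<in> S \<and> v \<noteq> v'" for v v'
    proof -
      obtain i where i: "v i \<noteq> v' i" using vv by blast
      then have ik: "i < k" using vv zero[of v i] zero[of v' i] by fastforce
      have one: "(\<Sum>j<k. (if j = i then s else 0) * a j) = s * a i" for s and a :: "nat \<Rightarrow> real"
        using ik by (simp add: if_distrib[where f="\<lambda>x. x * _"] cong: if_cong)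
      \<comment> \<open>The separating functions are admissible because a sine is a combination of
        two exponentials with opposite frequencies.\<close>
      have sin: "complex_of_real (u a i) = - \<i> / 2 * iexp (1 / K * a i) + \<i> / 2 * iexp (- 1 / K * a i)" for a
        using ik by (simp add: u_def complex_eq_iff Re_exp Im_exp)
      have "(\<lambda>a. complex_of_real (u a i)) \<in> trig_sums k"
        unfolding sin one[symmetric] by (intro trig_sums.add trig_sums.base)
      then have "P (\<lambda>v. v i)" by (simp add: P_def continuous_on_product_coordinates[THEN continuous_on_subset])
      with i show ?thesis by blast
    qed
  qed
  then obtain q where q: "P q" "\<And>v. v \<in> S \<Longrightarrow> \<bar>H v - q v\<bar> < e" by blast
  have uS: "u a \<in> S" for a unfolding u_def S_def by auto
  show thesis
  proof (rule that[of "\<lambda>a. q (u a)"])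
    show "(\<lambda>a. complex_of_real (q (u a))) \<in> trig_sums k" using q(1) by (simp add: P_def)
    fix a
    have "\<bar>g a - H (u a)\<bar> \<le> 2 * B / K\<^sup>2 * (\<Sum>i<k. (a i)\<^sup>2)"
    proof (cases "\<forall>i<k. \<bar>a i\<bar> \<le> K")
      case True
      have "K * arcsin (u a i) = a i" if "i < k" for i
      proof -
        have "\<bar>a i / K\<bar> \<le> 1" using True that K by (simp add: abs_divide)
        then have "- (pi / 2) \<le> a i / K" "a i / K \<le> pi / 2" using pi_gt3 by linarith+
        then have "arcsin (sin (a i / K)) = a i / K" by (rule arcsin_sin)
        then show ?thesis using that K by (simp add: u_def)
      qed
      then have "H (u a) = g a" unfolding H_def by (intro dep) auto
      moreover have "0 \<le> B" using B[of a] by linarith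
      ultimately show ?thesis by (simp add: sum_nonneg)
    next
      case False
      \<comment> \<open>Outside the box \<open>arcsin\<close> no longer inverts the sine; the
        trivial bound 2 * B is absorbed there because the sum of squares exceeds the square of
        \<open>K\<close>.\<close>
      then obtain i where i: "i < k" "K < \<bar>a i\<bar>" by (auto simp: not_le)
      have "K\<^sup>2 \<le> (a i)\<^sup>2" using i K by (simp add: abs_le_square_iff[symmetric])
      also have "\<dots> \<le> (\<Sum>i<k. (a i)\<^sup>2)" using i by (intro member_le_sum) auto
      finally have "1 \<le> (\<Sum>i<k. (a i)\<^sup>2) / K\<^sup>2" using K by simp
      moreover have "\<bar>g a - H (u a)\<bar> \<le> 2 * B" "0 \<le> B" using B[of a] B[of "\<lambda>i. K * arcsin (u a i)"] unfolding H_def by linarith+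
      ultimately have "\<bar>g a - H (u a)\<bar> \<le> 2 * B * ((\<Sum>i<k. (a i)\<^sup>2) / K\<^sup>2)" using mult_left_mono[of 1 "(\<Sum>i<k. (a i)\<^sup>2) / K\<^sup>2" "2 * B"] by linarith
      then show ?thesis by simp
    qed
    with q(2)[OF uS[of a]] show "\<bar>g a - q (u a)\<bar> \<le> e + 2 * B / K\<^sup>2 * (\<Sum>i<k. (a i)\<^sup>2)" by linarith
  qed
qed

text \<open>Uniformly bounded second moments play the part of tightness: they control the error made
  by replacing \<open>g\<close> with a trigonometric sum, and for such sums convergence of
  characteristic functions is enough.\<close>

lemma multivariate_levy_continuity:
  fixes X :: "nat \<Rightarrow> 'w \<Rightarrow> nat \<Rightarrow> real" and Y :: "'v \<Rightarrow> nat \<Rightarrow> real" and g :: "(nat \<Rightarrow> real) \<Rightarrow> real"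
  assumes M: "prob_space M" "prob_space M'"
    and lip: "\<And>a b. \<bar>g a - g b\<bar> \<le> L * (\<Sum>i<k. \<bar>a i - b i\<bar>)" and B: "\<And>a. \<bar>g a\<bar> \<le> B"
    and X: "\<And>n i. i < k \<Longrightarrow> (\<lambda>w. X n w i) \<in> borel_measurable M" and Y: "\<And>i. i < k \<Longrightarrow> (\<lambda>w. Y w i) \<in> borel_measurable M'"
    and X2: "\<And>n i. i < k \<Longrightarrow> integrable M (\<lambda>w. (X n w i)\<^sup>2) \<and> (LINT w|M. (X n w i)\<^sup>2) \<le> C"
    and Y2: "\<And>i. i < k \<Longrightarrow> integrable M' (\<lambda>w. (Y w i)\<^sup>2) \<and> (LINT w|M'. (Y w i)\<^sup>2) \<le> C"
    and char: "\<And>c. (\<lambda>n. LINT w|M. iexp (\<Sum>i<k. c i * X n w i)) \<longlonglongrightarrow> (LINT w|M'. iexp (\<Sum>i<k. c i * Y w i))"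
  shows "(\<lambda>n. LINT w|M. g (X n w)) \<longlonglongrightarrow> (LINT w|M'. g (Y w))"
proof -
  have dep: "g a = g b" if "\<And>i. i < k \<Longrightarrow> a i = b i" for a b using lip[of a b] that by simp
  have B0: "0 \<le> B" using B[of undefined] by linarith
  have cont: "continuous_on UNIV g"
  proof (rule continuous_on_sequentiallyI)
    fix v a assume "v \<longlonglongrightarrow> (a :: nat \<Rightarrow> real)"
    then have "(\<lambda>n. v n i) \<longlonglongrightarrow> a i" for i
      using continuous_on_tendsto_compose[OF continuous_on_product_coordinates[of i], of v a sequentially] by simp
    then have "(\<lambda>n. L * (\<Sum>i<k. \<bar>v n i - a i\<bar>)) \<longlonglongrightarrow> L * (\<Sum>i<k. \<bar>a i - a i\<bar>)" by (intro tendsto_intros)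
    then have "(\<lambda>n. L * (\<Sum>i<k. \<bar>v n i - a i\<bar>)) \<longlonglongrightarrow> 0" by simp
    then have "(\<lambda>n. g (v n) - g a) \<longlonglongrightarrow> 0" by (rule Lim_null_comparison[rotated]) (use lip in auto)
    then show "(\<lambda>n. g (v n)) \<longlonglongrightarrow> g a" by (simp add: LIM_zero_iff)
  qed
  have approx: "\<bar>(LINT w|N. g (Z w)) - Re (LINT w|N. complex_of_real (h (Z w)))\<bar> \<le> e + 2 * B / K\<^sup>2 * (k * C)"
    if N: "prob_space N" and Z: "\<And>i. i < k \<Longrightarrow> (\<lambda>w. Z w i) \<in> borel_measurable N"
      "\<And>i. i < k \<Longrightarrow> integrable N (\<lambda>w. (Z w i)\<^sup>2) \<and> (LINT w|N. (Z w i)\<^sup>2) \<le> C"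
      and h: "(\<lambda>a. complex_of_real (h a)) \<in> trig_sums k" "\<And>a. \<bar>g a - h a\<bar> \<le> e + 2 * B / K\<^sup>2 * (\<Sum>i<k. (a i)\<^sup>2)"
    for N :: "'x measure" and Z h e K
  proof -
    interpret N: prob_space N by fact
    \<comment> \<open>Padding by zeros reduces measurability into the infinite product to the first
      \<open>k\<close> coordinates, the only ones on which \<open>g\<close> depends.\<close>
    have "(\<lambda>w i. if i < k then Z w i else 0) \<in> borel_measurable N"
    proof (rule measurable_coordinatewise_then_product)
      show "(\<lambda>w. if i < k then Z w i else 0) \<in> borel_measurable N" for i using Z(1)[of i] by (cases "i < k") auto
    qed
    from measurable_compose[OF this borel_measurable_continuous_onI[OF cont]]
    have "(\<lambda>w. g (Z w)) \<in> borel_measurable N" using dep[of "\<lambda>i. if i < k then Z w i else 0" "Z w" for w] by simp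
    then have ig: "integrable N (\<lambda>w. g (Z w))" by (intro N.integrable_const_bound[where B=B]) (use B in auto)
    have ih: "integrable N (\<lambda>w. h (Z w))"
      using trig_sums_integrable[OF h(1) N, of Z] Z(1) by (simp add: complex_of_real_integrable_eq)
    have i1: "integrable N (\<lambda>w. 2 * B / K\<^sup>2 * (\<Sum>i<k. (Z w i)\<^sup>2))"
      using Z(2) by (intro integrable_mult_right Bochner_Integration.integrable_sum) auto
    then have i2: "integrable N (\<lambda>w. e + 2 * B / K\<^sup>2 * (\<Sum>i<k. (Z w i)\<^sup>2))" by (intro Bochner_Integration.integrable_add) auto
    have "\<bar>(LINT w|N. g (Z w)) - (LINT w|N. h (Z w))\<bar> = \<bar>LINT w|N. g (Z w) - h (Z w)\<bar>" using ig ih by simp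
    also have "\<dots> \<le> (LINT w|N. \<bar>g (Z w) - h (Z w)\<bar>)" by (rule integral_abs_bound)
    also have "\<dots> \<le> (LINT w|N. e + 2 * B / K\<^sup>2 * (\<Sum>i<k. (Z w i)\<^sup>2))"
      by (intro integral_mono i2 h(2)) (use ig ih in auto)
    also have "\<dots> = e + 2 * B / K\<^sup>2 * (\<Sum>i<k. LINT w|N. (Z w i)\<^sup>2)"
      using Z(2) by (subst Bochner_Integration.integral_add[OF _ i1]) (auto simp: N.prob_space Bochner_Integration.integral_sum)
    also have "\<dots> \<le> e + 2 * B / K\<^sup>2 * (\<Sum>i<k. C)" using Z(2) B0 by (intro add_left_mono mult_left_mono sum_mono) auto
    finally show ?thesis by simp
  qed
  show ?thesis
  proof (rule LIMSEQ_I)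
    fix r :: real assume r: "0 < r"
    \<comment> \<open>The sixth part leaves room for an approximation error of at most 2 * e under
      either measure and one of e for the trigonometric sum. The 1 under the root of
      \<open>K\<close> keeps \<open>K\<close> positive even if \<open>C\<close> is 0.\<close>
    define e where "e = r / 6"
    define K where "K = sqrt (2 * B * (k * \<bar>C\<bar>) / e + 1)"
    have e: "0 < e" and K0: "0 < 2 * B * (k * \<bar>C\<bar>) / e + 1" using r B0 by (auto simp: e_def intro!: add_nonneg_pos)
    then have K: "0 < K" "K\<^sup>2 = 2 * B * (k * \<bar>C\<bar>) / e + 1" by (simp_all add: K_def)
    have "2 * B * (k * C) \<le> 2 * B * (k * \<bar>C\<bar>)" using B0 by (intro mult_left_mono) auto
    also have "\<dots> \<le> e * K\<^sup>2" using e unfolding K(2) by (simp add: field_simps)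
    finally have small: "2 * B / K\<^sup>2 * (k * C) \<le> e" using K(1) by (simp add: divide_le_eq)
    obtain h where h: "(\<lambda>a. complex_of_real (h a)) \<in> trig_sums k" "\<And>a. \<bar>g a - h a\<bar> \<le> e + 2 * B / K\<^sup>2 * (\<Sum>i<k. (a i)\<^sup>2)"
      using trig_sums_approximation[OF cont dep B K(1) e] by blast
    have "(\<lambda>n. LINT w|M. complex_of_real (h (X n w))) \<longlonglongrightarrow> (LINT w|M'. complex_of_real (h (Y w)))"
      by (rule trig_sums_tendsto[OF h(1) M X Y char])
    from LIMSEQ_D[OF tendsto_Re[OF this], of e] e obtain n0
      where n0: "\<And>n. n \<ge> n0 \<Longrightarrow> \<bar>Re (LINT w|M. complex_of_real (h (X n w))) - Re (LINT w|M'. complex_of_real (h (Y w)))\<bar> < e" by auto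
    show "\<exists>no. \<forall>n\<ge>no. norm ((LINT w|M. g (X n w)) - (LINT w|M'. g (Y w))) < r"
    proof (intro exI[of _ n0] allI impI)
      fix n assume n: "n0 \<le> n"
      have "\<bar>(LINT w|M. g (X n w)) - Re (LINT w|M. complex_of_real (h (X n w)))\<bar> \<le> e + 2 * B / K\<^sup>2 * (k * C)"
        by (rule approx[OF M(1) X X2 h])
      moreover have "\<bar>(LINT w|M'. g (Y w)) - Re (LINT w|M'. complex_of_real (h (Y w)))\<bar> \<le> e + 2 * B / K\<^sup>2 * (k * C)"
        by (rule approx[OF M(2) Y Y2 h])
      ultimately show "norm ((LINT w|M. g (X n w)) - (LINT w|M'. g (Y w))) < r"
        using n0[OF n] small unfolding e_def real_norm_def by linarith
    qed
  qed
qed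

section \<open>Weak convergence in spaces of continuous functions\<close>

abbreviation "C_set S \<equiv> mspace (C_space S)"
abbreviation "C_dist S \<equiv> mdist (C_space S)"
abbreviation "C_top S \<equiv> mtopology_of (C_space S)"

lemma mspace_C_space:
  assumes "compact S"
  shows "z \<in> C_set S \<longleftrightarrow> z \<in> extensional S \<and> continuous_on S z"
  using assms unfolding C_space_def
  by (subst compactin_mspace_cfunspace) (auto simp: compactin_subtopology)

lemma mdist_C_space_le:
  assumes "0 \<le> B" "\<And>p. p \<in> S \<Longrightarrow> \<bar>z p - w p\<bar> \<le> B"
  shows "C_dist S z w \<le> B"
  unfolding C_space_def by (rule mdist_cfunspace_le) (use assms in \<open>auto simp: dist_real_def\<close>)

lemma abs_diff_le_mdist_C_space:
  assumes "z \<in> C_set S" "w \<in> C_set S" "p \<in> S"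
  shows "\<bar>z p - w p\<bar> \<le> C_dist S z w"
  using mdist_cfunspace_imp_mdist_le[of z "top_of_set S" euclidean_metric w "C_dist S z w" p] assms
  by (auto simp: dist_real_def C_space_def)

lemma space_C_borel: "space (C_borel S) = C_set S"
  by (auto simp: C_borel_def borel_of_def space_measure_of_conv)

lemma openin_C_space_subset: "openin (C_top S) U \<Longrightarrow> U \<subseteq> C_set S"
  using openin_subset[of "C_top S" U] by simp

lemma sets_C_borel_open: "openin (C_top S) U \<Longrightarrow> U \<in> sets (C_borel S)"
  unfolding C_borel_def borel_of_def
  by (subst sets_measure_of) (use openin_C_space_subset in auto)

lemma measurable_to_C_borel:
  assumes "\<And>w. w \<in> space M \<Longrightarrow> Z w \<in> C_set S"
    and "\<And>U. openin (C_top S) U \<Longrightarrow> Z -` U \<inter> space M \<in> sets M"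
  shows "Z \<in> M \<rightarrow>\<^sub>M C_borel S"
  unfolding C_borel_def borel_of_def
proof (rule measurable_measure_of)
  show "{U. openin (C_top S) U} \<subseteq> Pow (topspace (C_top S))"
    using openin_subset by blast
qed (use assms in auto)

lemma openin_C_space_iff:
  "openin (C_top S) U \<longleftrightarrow> U \<subseteq> C_set S \<and>
     (\<forall>z\<in>U. \<exists>r>0. \<forall>w\<in>C_set S. C_dist S z w < r \<longrightarrow> w \<in> U)"
proof -
  interpret Metric_space "C_set S" "C_dist S" by simp
  show ?thesis unfolding mtopology_of_def openin_mtopology by (simp add: subset_iff in_mball) blast
qed

lemma continuous_measurable_C_borel:
  assumes "continuous_map (C_top S) euclideanreal f"
  shows "f \<in> borel_measurable (C_borel S)"
proof (rule borel_measurableI)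
  fix V :: "real set" assume "open V"
  then have "openin (C_top S) {z \<in> topspace (C_top S). f z \<in> V}"
    using assms by (auto simp: continuous_map_def)
  from sets_C_borel_open[OF this] show "f -` V \<inter> space (C_borel S) \<in> sets (C_borel S)"
    by (simp add: space_C_borel vimage_def Int_def conj_commute)
qed

text \<open>A partition of unity subordinate to a finite net of mesh \<delta>. It replaces a path by
  a continuous function of finitely many of its values, with uniform error at most the oscillation
  of the path at scale \<delta>.\<close>

definition unity_net :: "'p::metric_space set \<Rightarrow> real \<Rightarrow> nat \<Rightarrow> (nat \<Rightarrow> 'p) \<Rightarrow> (nat \<Rightarrow> 'p \<Rightarrow> real) \<Rightarrow> bool" where
  "unity_net S \<delta> k p h \<longleftrightarrow> (\<forall>i<k. p i \<in> S) \<and> (\<forall>i<k. continuous_on S (h i)) \<and>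
     (\<forall>i<k. \<forall>q\<in>S. 0 \<le> h i q) \<and> (\<forall>q\<in>S. (\<Sum>i<k. h i q) = (1::real)) \<and>
     (\<forall>i<k. \<forall>q\<in>S. h i q \<noteq> 0 \<longrightarrow> dist q (p i) < \<delta>)"

lemma ex_unity_net:
  fixes S :: "'p::metric_space set"
  assumes "compact S" "0 < \<delta>"
  shows "\<exists>k p h. unity_net S \<delta> k p h"
proof -
  have "S \<subseteq> (\<Union>x\<in>S. ball x \<delta>)" using assms(2) by auto
  then obtain P where P: "P \<subseteq> S" "finite P" "S \<subseteq> (\<Union>x\<in>P. ball x \<delta>)"
    by (rule compactE_image[OF assms(1) open_ball])
  obtain p :: "nat \<Rightarrow> 'p" where p: "bij_betw p {..<card P} P"
    using ex_bij_betw_nat_finite[OF P(2)] by (auto simp: atLeast0LessThan)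
  let ?k = "card P"
  \<comment> \<open>Tent functions around the net points; the net property makes their sum positive
    everywhere, so that it can serve as a divisor.\<close>
  define g where "g i q = max 0 (\<delta> - dist q (p i))" for i q
  define G where "G q = (\<Sum>i<?k. g i q)" for q
  have g0: "0 \<le> g i q" for i q by (auto simp: g_def)
  have Gpos: "0 < G q" if q: "q \<in> S" for q
  proof -
    obtain x where "x \<in> P" "dist x q < \<delta>" using subsetD[OF P(3) q] by auto
    then obtain i where i: "i < ?k" "dist q (p i) < \<delta>" using bij_betw_imp_surj_on[OF p] by (metis dist_commute imageE lessThan_iff)
    then have "0 < g i q" by (auto simp: g_def)
    then show ?thesis unfolding G_def using i g0 by (intro sum_pos2[of _ i]) auto
  qed
  have cg: "continuous_on S (g i)" for i unfolding g_def by (intro continuous_intros)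
  have cG: "continuous_on S G" unfolding G_def by (intro continuous_intros cg)
  show ?thesis unfolding unity_net_def
  proof (intro exI[of _ ?k] exI[of _ p] exI[of _ "\<lambda>i q. g i q / G q"] conjI allI impI ballI)
    fix i assume "i < ?k" then show "p i \<in> S" using p P by (auto simp: bij_betw_def)
    show "continuous_on S (\<lambda>q. g i q / G q)"
      using Gpos by (intro continuous_intros cg cG) (auto simp: less_le)
    fix q assume q: "q \<in> S"
    show "0 \<le> g i q / G q" using Gpos[OF q] g0 by auto
    show "dist q (p i) < \<delta>" if "g i q / G q \<noteq> 0" using that by (auto simp: g_def max_def split: if_splits)
  next
    fix q assume q: "q \<in> S"
    show "(\<Sum>i<?k. g i q / G q) = 1"
      using Gpos[OF q] by (simp add: sum_divide_distrib[symmetric]) (simp add: G_def)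
  qed
qed

definition interpolate :: "'p set \<Rightarrow> nat \<Rightarrow> (nat \<Rightarrow> 'p \<Rightarrow> real) \<Rightarrow> (nat \<Rightarrow> real) \<Rightarrow> 'p \<Rightarrow> real" where
  "interpolate S k h a = restrict (\<lambda>q. \<Sum>i<k. a i * h i q) S"

lemma interpolate_in_mspace:
  assumes "compact S" "\<And>i. i < k \<Longrightarrow> continuous_on S (h i)"
  shows "interpolate S k h a \<in> C_set S"
proof -
  have "continuous_on S (\<lambda>q. \<Sum>i<k. a i * h i q)" using assms by (intro continuous_intros) auto
  then show ?thesis by (simp add: mspace_C_space[OF assms(1)] interpolate_def)
qed

text \<open>The weights lie between 0 and 1, hence interpolation is Lipschitz for the l1 distance of
  the sampled values. This is the Lipschitz condition under which finite-dimensional convergence is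
  tested.\<close>

lemma mdist_interpolate_le:
  assumes "\<And>i q. i < k \<Longrightarrow> q \<in> S \<Longrightarrow> 0 \<le> h i q" "\<And>q. q \<in> S \<Longrightarrow> (\<Sum>i<k. h i q) = 1"
  shows "C_dist S (interpolate S k h a) (interpolate S k h b) \<le> (\<Sum>i<k. \<bar>a i - b i\<bar>)"
proof (rule mdist_C_space_le)
  fix q assume q: "q \<in> S"
  have h1: "h i q \<le> 1" if "i < k" for i
  proof -
    have "h i q \<le> (\<Sum>i<k. h i q)" using that assms(1)[OF _ q] by (intro member_le_sum) auto
    then show ?thesis using assms(2)[OF q] by simp
  qed
  have "interpolate S k h a q - interpolate S k h b q = (\<Sum>i<k. (a i - b i) * h i q)"
    using q by (simp add: interpolate_def sum_subtractf[symmetric] left_diff_distrib)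
  also have "\<bar>\<dots>\<bar> \<le> (\<Sum>i<k. \<bar>(a i - b i) * h i q\<bar>)" by (rule sum_abs)
  also have "\<dots> \<le> (\<Sum>i<k. \<bar>a i - b i\<bar>)"
    using h1 assms(1)[OF _ q] by (intro sum_mono) (auto simp: abs_mult intro!: mult_left_le)
  finally show "\<bar>interpolate S k h a q - interpolate S k h b q\<bar> \<le> (\<Sum>i<k. \<bar>a i - b i\<bar>)" .
qed (auto intro: sum_nonneg)

text \<open>A convex combination of values at points within \<delta> of q stays within \<epsilon> of
  the value at q, since points farther away carry weight 0.\<close>

lemma mdist_interpolate_sample_le:
  assumes h: "\<And>i q. i < k \<Longrightarrow> q \<in> S \<Longrightarrow> 0 \<le> h i q" "\<And>q. q \<in> S \<Longrightarrow> (\<Sum>i<k. h i q) = 1"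
    "\<And>i q. i < k \<Longrightarrow> q \<in> S \<Longrightarrow> h i q \<noteq> 0 \<Longrightarrow> dist q (p i) < \<delta>"
    and p: "\<And>i. i < k \<Longrightarrow> p i \<in> S"
    and "0 \<le> \<epsilon>" and z: "\<And>q r. q \<in> S \<Longrightarrow> r \<in> S \<Longrightarrow> dist q r < \<delta> \<Longrightarrow> \<bar>z q - z r\<bar> \<le> \<epsilon>"
  shows "C_dist S z (interpolate S k h (\<lambda>i. z (p i))) \<le> \<epsilon>"
proof (rule mdist_C_space_le[OF \<open>0 \<le> \<epsilon>\<close>])
  fix q assume q: "q \<in> S"
  have "z q = (\<Sum>i<k. z q * h i q)" using h(2)[OF q] by (simp add: sum_distrib_left[symmetric])
  then have "z q - interpolate S k h (\<lambda>i. z (p i)) q = (\<Sum>i<k. (z q - z (p i)) * h i q)"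
    using q by (simp add: interpolate_def sum_subtractf left_diff_distrib)
  also have "\<bar>\<dots>\<bar> \<le> (\<Sum>i<k. \<bar>(z q - z (p i)) * h i q\<bar>)" by (rule sum_abs)
  also have "\<dots> \<le> (\<Sum>i<k. \<epsilon> * h i q)"
  proof (rule sum_mono)
    fix i assume i: "i \<in> {..<k}"
    show "\<bar>(z q - z (p i)) * h i q\<bar> \<le> \<epsilon> * h i q"
    proof (cases "h i q = 0")
      case False
      then show ?thesis using i q z[OF q p, of i] h(1)[of i q] h(3)[of i q]
        by (auto simp: abs_mult intro!: mult_right_mono)
    qed auto
  qed
  also have "\<dots> = \<epsilon>" using h(2)[OF q] by (simp add: sum_distrib_left[symmetric])
  finally show "\<bar>z q - interpolate S k h (\<lambda>i. z (p i)) q\<bar> \<le> \<epsilon>" .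
qed

text \<open>Interpolation depends continuously on its finitely many coefficients, so preimages of
  open sets of paths are open sets of coefficients.\<close>

lemma measurable_interpolate_sample:
  assumes S: "compact S" and hc: "\<And>i. i < k \<Longrightarrow> continuous_on S (h i)"
    and h: "\<And>i q. i < k \<Longrightarrow> q \<in> S \<Longrightarrow> 0 \<le> h i q" "\<And>q. q \<in> S \<Longrightarrow> (\<Sum>i<k. h i q) = 1"
    and a: "\<And>i. i < k \<Longrightarrow> (\<lambda>w. a w i) \<in> borel_measurable M"
  shows "(\<lambda>w. interpolate S k h (a w)) \<in> M \<rightarrow>\<^sub>M C_borel S"
proof (rule measurable_to_C_borel)
  show in_space: "interpolate S k h (a w) \<in> C_set S" for w
    by (rule interpolate_in_mspace) (use S hc in auto)
  fix U assume U: "openin (C_top S) U"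
  have op: "open {b. interpolate S k h b \<in> U}"
    unfolding open_dist
  proof (safe)
    fix b assume b: "interpolate S k h b \<in> U"
    then obtain r where r: "r > 0" "\<And>w. w \<in> C_set S \<Longrightarrow> C_dist S (interpolate S k h b) w < r \<Longrightarrow> w \<in> U"
      using U unfolding openin_C_space_iff by blast
    have "open {c. (\<Sum>i<k. \<bar>b i - c i\<bar>) < r}"
      by (intro open_Collect_less continuous_intros continuous_on_product_coordinates)
    moreover have "b \<in> {c. (\<Sum>i<k. \<bar>b i - c i\<bar>) < r}" using r by simp
    ultimately obtain e where e: "e > 0" "\<And>c. dist c b < e \<Longrightarrow> (\<Sum>i<k. \<bar>b i - c i\<bar>) < r"
      unfolding open_dist by blast
    show "\<exists>e>0. \<forall>y. dist y b < e \<longrightarrow> y \<in> {b. interpolate S k h b \<in> U}"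
    proof (intro exI[of _ e] conjI allI impI)
      fix c assume "dist c b < e"
      then have "C_dist S (interpolate S k h b) (interpolate S k h c) < r"
        using e(2)[of c] mdist_interpolate_le[of k S h b c] h by auto
      then show "c \<in> {b. interpolate S k h b \<in> U}"
        using r interpolate_in_mspace[OF S hc] by auto
    qed (use e in auto)
  qed
  have m: "(\<lambda>w i. if i < k then a w i else 0) \<in> borel_measurable M"
  proof (rule measurable_coordinatewise_then_product)
    fix i show "(\<lambda>w. if i < k then a w i else 0) \<in> borel_measurable M"
      by (cases "i < k") (use a in auto)
  qed
  have "interpolate S k h (a w) = interpolate S k h (\<lambda>i. if i < k then a w i else 0)" for w
    unfolding interpolate_def by (intro restrict_ext sum.cong) auto
  then have "(\<lambda>w. interpolate S k h (a w)) -` U \<inter> space M =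
    (\<lambda>w i. if i < k then a w i else 0) -` {b. interpolate S k h b \<in> U} \<inter> space M" by auto
  also have "\<dots> \<in> sets M" using measurable_sets[OF m borel_open[OF op]] .
  finally show "(\<lambda>w. interpolate S k h (a w)) -` U \<inter> space M \<in> sets M" .
qed

lemma C_space_uniformly_equi:
  fixes S :: "'p::metric_space set"
  assumes "compact S" "z \<in> C_set S" "0 < \<epsilon>"
  shows "\<exists>\<delta>>0. \<forall>q\<in>S. \<forall>r\<in>S. dist q r < \<delta> \<longrightarrow> \<bar>z q - z r\<bar> \<le> \<epsilon>"
proof -
  have "uniformly_continuous_on S z"
    using assms by (intro compact_uniformly_continuous) (auto simp: mspace_C_space)
  then obtain d where "d > 0" "\<forall>x\<in>S. \<forall>x'\<in>S. dist x' x < d \<longrightarrow> dist (z x') (z x) < \<epsilon>"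
    unfolding uniformly_continuous_on_def using assms(3) by blast
  then show ?thesis by (intro exI[of _ d]) (force simp: dist_real_def)
qed

lemma unity_net_mdist:
  assumes "unity_net S \<delta> k p h" "0 \<le> \<epsilon>"
    "\<And>q r. q \<in> S \<Longrightarrow> r \<in> S \<Longrightarrow> dist q r < \<delta> \<Longrightarrow> \<bar>z q - z r\<bar> \<le> \<epsilon>"
  shows "C_dist S z (interpolate S k h (\<lambda>i. z (p i))) \<le> \<epsilon>"
  by (rule mdist_interpolate_sample_le[where \<delta>=\<delta>]) (use assms in \<open>auto simp: unity_net_def\<close>)

lemma unity_net_measurable:
  assumes "compact S" "unity_net S \<delta> k p h" "\<And>i. i < k \<Longrightarrow> (\<lambda>w. a w i) \<in> borel_measurable M"
  shows "(\<lambda>w. interpolate S k h (a w)) \<in> M \<rightarrow>\<^sub>M C_borel S"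
  by (rule measurable_interpolate_sample) (use assms in \<open>auto simp: unity_net_def\<close>)

lemma ex_unity_nets:
  fixes S :: "'p::metric_space set"
  assumes "compact S"
  shows "\<exists>k p h. \<forall>n. unity_net S (1 / Suc n) (k n) (p n) (h n)"
proof -
  have "\<forall>n. \<exists>a. unity_net S (1 / Suc n) (fst a) (fst (snd a)) (snd (snd a))"
  proof
    fix n :: nat
    have "0 < 1 / real (Suc n)" by simp
    from ex_unity_net[OF assms this] obtain k p h where "unity_net S (1 / Suc n) k p h" by blast
    then show "\<exists>a. unity_net S (1 / Suc n) (fst a) (fst (snd a)) (snd (snd a))"
      by (intro exI[of _ "(k, p, h)"]) simp
  qed
  then obtain a where "\<forall>n. unity_net S (1 / Suc n) (fst (a n)) (fst (snd (a n))) (snd (snd (a n)))"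
    by metis
  then show ?thesis
    by (intro exI[of _ "\<lambda>n. fst (a n)"] exI[of _ "\<lambda>n. fst (snd (a n))"] exI[of _ "\<lambda>n. snd (snd (a n))"])
qed

lemma interpolate_nets_tendsto:
  fixes S :: "'p::metric_space set"
  assumes S: "compact S" and net: "\<And>n. unity_net S (1 / Suc n) (k n) (p n) (h n)"
    and z: "z \<in> C_set S"
  shows "(\<lambda>n. C_dist S z (interpolate S (k n) (h n) (\<lambda>i. z (p n i)))) \<longlonglongrightarrow> 0"
proof (rule LIMSEQ_I)
  fix r :: real assume "0 < r"
  then obtain \<delta> where \<delta>: "\<delta> > 0" "\<forall>q\<in>S. \<forall>s\<in>S. dist q s < \<delta> \<longrightarrow> \<bar>z q - z s\<bar> \<le> r / 2"
    using C_space_uniformly_equi[OF S z, of "r/2"] by auto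
  obtain N where N: "1 / real (Suc N) < \<delta>" using nat_approx_posE[OF \<delta>(1)] by blast
  show "\<exists>no. \<forall>n\<ge>no. norm (C_dist S z (interpolate S (k n) (h n) (\<lambda>i. z (p n i))) - 0) < r"
  proof (intro exI[of _ N] allI impI)
    fix n assume "N \<le> n"
    then have "1 / real (Suc n) \<le> 1 / real (Suc N)" by (intro divide_left_mono) auto
    with N have "1 / real (Suc n) < \<delta>" by linarith
    then have "C_dist S z (interpolate S (k n) (h n) (\<lambda>i. z (p n i))) \<le> r / 2"
      using \<delta> \<open>0 < r\<close> by (intro unity_net_mdist[OF net]) force+
    then show "norm (C_dist S z (interpolate S (k n) (h n) (\<lambda>i. z (p n i))) - 0) < r"
      using \<open>0 < r\<close> by simp
  qed
qed

text \<open>The Borel sets of the path space are generated by all open sets, not by evaluations. The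
  gap is closed by writing a path as the uniform limit of interpolations of its values, each
  measurable, and by expressing membership of the limit in an open set through countably many
  conditions on them.\<close>

lemma measurable_C_borel_coordinates:
  fixes S :: "'p::metric_space set"
  assumes S: "compact S" and Z: "\<And>w. w \<in> space M \<Longrightarrow> Z w \<in> C_set S"
    and m: "\<And>p. p \<in> S \<Longrightarrow> (\<lambda>w. Z w p) \<in> borel_measurable M"
  shows "Z \<in> M \<rightarrow>\<^sub>M C_borel S"
proof (rule measurable_to_C_borel[OF Z])
  obtain k p h where net: "\<And>n. unity_net S (1 / Suc n) (k n) (p n) (h n)"
    using ex_unity_nets[OF S] by blast
  define Ip where "Ip n z = interpolate S (k n) (h n) (\<lambda>i. z (p n i))" for n and z :: "'p \<Rightarrow> real"
  have IpS: "Ip n z \<in> C_set S" for n z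
    unfolding Ip_def using net[of n] S by (intro interpolate_in_mspace) (auto simp: unity_net_def)
  have Ipm: "(\<lambda>w. Ip n (Z w)) \<in> M \<rightarrow>\<^sub>M C_borel S" for n
    unfolding Ip_def using net[of n] by (intro unity_net_measurable[OF S net]) (auto simp: unity_net_def intro!: m)
  interpret Metric_space "C_set S" "C_dist S" by simp
  fix U assume U: "openin (C_top S) U"
  \<comment> \<open>Paths with a margin inside \<open>U\<close> strictly larger than 1 / Suc j.
    Strictness makes \<open>V j\<close> open, and the fixed margin forces the limit of paths from
    \<open>V j\<close> to lie in \<open>U\<close>.\<close>
  define V where "V j = {y \<in> C_set S. \<exists>r>1 / Suc j. \<forall>w\<in>C_set S. C_dist S y w < r \<longrightarrow> w \<in> U}" for j :: nat
  have Vopen: "openin (C_top S) (V j)" for j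
    unfolding openin_C_space_iff
  proof (intro conjI ballI)
    fix y assume "y \<in> V j"
    then obtain r where r: "y \<in> C_set S" "r > 1 / Suc j" "\<And>w. w \<in> C_set S \<Longrightarrow> C_dist S y w < r \<Longrightarrow> w \<in> U"
      unfolding V_def by blast
    define e where "e = (r - 1 / Suc j) / 2"
    have half: "0 < (r - c) / 2" "c < r - (r - c) / 2" if "c < r" for c using that by (auto simp: field_simps)
    have e: "e > 0" "r - e > 1 / Suc j" unfolding e_def by (rule half[OF r(2)])+
    show "\<exists>r>0. \<forall>w\<in>C_set S. C_dist S y w < r \<longrightarrow> w \<in> V j"
    proof (intro exI[of _ e] conjI ballI impI e)
      fix w assume w: "w \<in> C_set S" "C_dist S y w < e"
      have "v \<in> U" if "v \<in> C_set S" "C_dist S w v < r - e" for v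
        using r(3)[OF that(1)] triangle[OF r(1) w(1) that(1)] w that by linarith
      then show "w \<in> V j" using e w unfolding V_def by blast
    qed
  qed (auto simp: V_def)
  have eq: "Z w \<in> U \<longleftrightarrow> (\<exists>j N. \<forall>n\<ge>N. Ip n (Z w) \<in> V j)" if w: "w \<in> space M" for w
  proof
    note lim = interpolate_nets_tendsto[OF S net Z[OF w], folded Ip_def]
    {
      assume "Z w \<in> U"
      then obtain r where r: "r > 0" "\<And>v. v \<in> C_set S \<Longrightarrow> C_dist S (Z w) v < r \<Longrightarrow> v \<in> U"
        using U unfolding openin_C_space_iff by blast
      obtain j where j: "1 / real (Suc j) < r / 2" using nat_approx_posE[of "r/2"] r by auto
      obtain N where N: "\<And>n. n \<ge> N \<Longrightarrow> C_dist S (Z w) (Ip n (Z w)) < r / 2"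
        using LIMSEQ_D[OF lim, of "r/2"] r by auto
      have "Ip n (Z w) \<in> V j" if "n \<ge> N" for n
      proof -
        have "v \<in> U" if "v \<in> C_set S" "C_dist S (Ip n (Z w)) v < r / 2" for v
          using r(2)[OF that(1)] triangle[OF Z[OF w] IpS that(1), of n "Z w"] that N[OF \<open>n \<ge> N\<close>] by linarith
        then show ?thesis using j IpS unfolding V_def by blast
      qed
      then show "\<exists>j N. \<forall>n\<ge>N. Ip n (Z w) \<in> V j" by blast
    }
    assume "\<exists>j N. \<forall>n\<ge>N. Ip n (Z w) \<in> V j"
    then obtain j N where jN: "\<And>n. n \<ge> N \<Longrightarrow> Ip n (Z w) \<in> V j" by blast
    obtain N' where N': "\<And>n. n \<ge> N' \<Longrightarrow> C_dist S (Z w) (Ip n (Z w)) < 1 / Suc j"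
      using LIMSEQ_D[OF lim, of "1 / Suc j"] by auto
    from jN[of "max N N'"] obtain r where "r > 1 / Suc j"
      "\<And>v. v \<in> C_set S \<Longrightarrow> C_dist S (Ip (max N N') (Z w)) v < r \<Longrightarrow> v \<in> U"
      unfolding V_def by auto
    from this(2)[OF Z[OF w]] this(1) N'[of "max N N'"] show "Z w \<in> U"
      by (simp add: commute)
  qed
  have "Z -` U \<inter> space M = (\<Union>j. \<Union>N. \<Inter>n\<in>{N..}. (\<lambda>w. Ip n (Z w)) -` V j \<inter> space M)" (is "_ = ?R")
  proof (rule set_eqI)
    fix w show "w \<in> Z -` U \<inter> space M \<longleftrightarrow> w \<in> ?R"
      unfolding UN_iff INT_iff using eq[of w]
      by (cases "w \<in> space M") (auto simp: atLeast_def)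
  qed
  also have "\<dots> \<in> sets M"
    using measurable_sets[OF Ipm sets_C_borel_open[OF Vopen]]
    by (intro sets.countable_UN'' sets.countable_INT' image_subsetI) auto
  finally show "Z -` U \<inter> space M \<in> sets M" .
qed

lemma continuous_map_C_space_iff:
  "continuous_map (C_top S) euclideanreal f \<longleftrightarrow>
   (\<forall>z\<in>C_set S. \<forall>e>0. \<exists>r>0. \<forall>w\<in>C_set S. C_dist S z w < r \<longrightarrow> \<bar>f z - f w\<bar> < e)"
proof -
  interpret Metric_space "C_set S" "C_dist S" by simp
  show ?thesis
    unfolding mtopology_of_def
    using metric_continuous_map[of UNIV dist f] Met_TC.Metric_space_axioms
    by (simp add: dist_real_def Ball_def imp_conjL)
qed

lemma lipschitz_imp_continuous_map_C_space:
  assumes "0 \<le> L" "\<And>z w. z \<in> C_set S \<Longrightarrow> w \<in> C_set S \<Longrightarrow> \<bar>f z - f w\<bar> \<le> L * C_dist S z w"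
  shows "continuous_map (C_top S) euclideanreal f"
  unfolding continuous_map_C_space_iff
proof (intro ballI allI impI)
  fix z and e :: real assume z: "z \<in> C_set S" "0 < e"
  show "\<exists>r>0. \<forall>w\<in>C_set S. C_dist S z w < r \<longrightarrow> \<bar>f z - f w\<bar> < e"
  proof (intro exI[of _ "e / (L + 1)"] conjI ballI impI)
    fix w assume w: "w \<in> C_set S" "C_dist S z w < e / (L + 1)"
    then have "(L + 1) * C_dist S z w < e" using assms(1) by (simp add: field_simps)
    moreover have "L * C_dist S z w \<le> (L + 1) * C_dist S z w" by (simp add: algebra_simps)
    ultimately show "\<bar>f z - f w\<bar> < e" using assms(2)[OF z(1) w(1)] by linarith
  qed (use z assms in auto)
qed

lemma measurable_C_borel_eval:
  assumes "p \<in> S"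
  shows "(\<lambda>z. z p) \<in> borel_measurable (C_borel S)"
  by (rule continuous_measurable_C_borel, rule lipschitz_imp_continuous_map_C_space[of 1])
     (use abs_diff_le_mdist_C_space[OF _ _ assms] in auto)

text \<open>Lipschitz regularization from below: the penalty of \<open>k\<close> times the distance
  makes \<open>g k\<close> Lipschitz, and \<open>g k\<close> converges back to \<open>f\<close>
  because distant paths become too expensive for a bounded function. It reduces continuous test
  functionals to Lipschitz ones.\<close>

lemma inf_convolution_C_space:
  fixes f :: "('p::metric_space \<Rightarrow> real) \<Rightarrow> real"
  assumes cont: "continuous_map (C_top S) euclideanreal f"
    and B: "\<And>z. z \<in> C_set S \<Longrightarrow> \<bar>f z\<bar> \<le> B"
  defines "g \<equiv> \<lambda>(k::nat) z. INF w\<in>C_set S. f w + real k * C_dist S z w"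
  shows "\<And>k z. z \<in> C_set S \<Longrightarrow> g k z \<le> f z"
    and "\<And>k z. z \<in> C_set S \<Longrightarrow> \<bar>g k z\<bar> \<le> B"
    and "\<And>k z w. z \<in> C_set S \<Longrightarrow> w \<in> C_set S \<Longrightarrow> \<bar>g k z - g k w\<bar> \<le> real k * C_dist S z w"
    and "\<And>z. z \<in> C_set S \<Longrightarrow> (\<lambda>k. g k z) \<longlonglongrightarrow> f z"
proof -
  interpret Metric_space "C_set S" "C_dist S" by simp
  have lb: "- B \<le> f w + real k * C_dist S z w" if "w \<in> C_set S" for k w z
    using B[OF that] mult_nonneg_nonneg[of "real k" "C_dist S z w"] by (auto simp del: mult_nonneg_nonneg zero_le_mult_iff)
  have bdd: "bdd_below ((\<lambda>w. f w + real k * C_dist S z w) ` C_set S)" for k z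
    using lb by (intro bdd_belowI[of _ "-B"]) auto
  show le: "g k z \<le> f z" if "z \<in> C_set S" for k z
    using cINF_lower[OF bdd that, of k z] that by (simp add: g_def)
  have ge: "c \<le> g k z" if "z \<in> C_set S" "\<And>w. w \<in> C_set S \<Longrightarrow> c \<le> f w + real k * C_dist S z w" for c k z
    unfolding g_def using that by (intro cINF_greatest) auto
  show "\<bar>g k z\<bar> \<le> B" if "z \<in> C_set S" for k z
    using ge[OF that lb, of k] le[OF that, of k] B[OF that] by auto
  have lip: "g k z - real k * C_dist S z w \<le> g k w" if z: "z \<in> C_set S" "w \<in> C_set S" for k z w
  proof (rule ge[OF z(2)])
    fix v assume v: "v \<in> C_set S"
    have "g k z \<le> f v + real k * C_dist S z v" unfolding g_def by (rule cINF_lower[OF bdd v])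
    also have "\<dots> \<le> f v + real k * (C_dist S z w + C_dist S w v)"
      using triangle[OF z v] by (intro add_left_mono mult_left_mono) auto
    finally show "g k z - real k * C_dist S z w \<le> f v + real k * C_dist S w v"
      by (simp add: algebra_simps)
  qed
  show "\<bar>g k z - g k w\<bar> \<le> real k * C_dist S z w" if "z \<in> C_set S" "w \<in> C_set S" for k z w
    using lip[OF that, of k] lip[OF that(2,1), of k] by (auto simp: commute)
  show "(\<lambda>k. g k z) \<longlonglongrightarrow> f z" if z: "z \<in> C_set S" for z
  proof (rule LIMSEQ_I)
    fix e :: real assume e: "0 < e"
    then obtain r where r: "r > 0" "\<And>w. w \<in> C_set S \<Longrightarrow> C_dist S z w < r \<Longrightarrow> \<bar>f z - f w\<bar> < e / 2"
      using cont z unfolding continuous_map_C_space_iff by (meson half_gt_zero)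
    \<comment> \<open>From \<open>N\<close> on, the penalty at distance r is at least 2 * B and
      outweighs anything that a function bounded by \<open>B\<close> can gain there.\<close>
    obtain N :: nat where N: "2 * B / r \<le> real N" using real_arch_simple by blast
    show "\<exists>no. \<forall>n\<ge>no. norm (g n z - f z) < e"
    proof (intro exI[of _ N] allI impI)
      fix n assume n: "N \<le> n"
      have "f z - e / 2 \<le> g n z"
      proof (rule ge[OF z])
        fix w assume w: "w \<in> C_set S"
        show "f z - e / 2 \<le> f w + real n * C_dist S z w"
        proof (cases "C_dist S z w < r")
          case True
          have "0 \<le> real n * C_dist S z w" by simp
          then show ?thesis using r(2)[OF w True] by linarith
        next
          case False
          have "2 * B \<le> real N * r" using N r by (simp add: field_simps)
          also have "\<dots> \<le> real n * C_dist S z w" using n False r by (intro mult_mono) auto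
          finally show ?thesis using B[OF z] B[OF w] e by linarith
        qed
      qed
      then show "norm (g n z - f z) < e" using le[OF z, of n] e by auto
    qed
  qed
qed

text \<open>Tightness enters only as a modulus of continuity in probability, and finite-dimensional
  convergence only for bounded Lipschitz functions of samples. Lipschitz functionals are treated by
  interpolation on a fine net; continuous ones are then approximated from below.\<close>

lemma weak_conv_on_C_space:
  fixes S :: "'p::metric_space set" and Z :: "'i \<Rightarrow> 'w \<Rightarrow> 'p \<Rightarrow> real"
  assumes S: "compact S" and M: "prob_space M" "prob_space M'"
    and Z: "\<And>T. Z T \<in> M \<rightarrow>\<^sub>M C_borel S" and V: "V \<in> M' \<rightarrow>\<^sub>M C_borel S"
    and fdd: "\<And>k p g L B. (\<And>i. i < k \<Longrightarrow> p i \<in> S) \<Longrightarrow> (\<And>a b. \<bar>g a - g b\<bar> \<le> L * (\<Sum>i<k. \<bar>a i - b i\<bar>)) \<Longrightarrow>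
       0 \<le> L \<Longrightarrow> (\<And>a. \<bar>g a\<bar> \<le> B) \<Longrightarrow>
       ((\<lambda>T. (LINT w|M. g (\<lambda>i::nat. Z T w (p i)))) \<longlongrightarrow> (LINT w|M'. g (\<lambda>i. V w (p i)))) F"
    and modulus: "\<And>\<epsilon>::real. \<epsilon> > 0 \<Longrightarrow> \<exists>\<delta>>0. \<forall>\<^sub>F T in F. \<exists>A\<in>sets M. measure M A \<le> \<epsilon> \<and>
       (\<forall>w\<in>space M - A. \<forall>q\<in>S. \<forall>r\<in>S. dist q r < \<delta> \<longrightarrow> \<bar>Z T w q - Z T w r\<bar> \<le> \<epsilon>)"
  shows "weak_conv_on (C_top S) (\<lambda>T. distr M (C_borel S) (Z T)) (distr M' (C_borel S) V) F"
proof -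
  interpret M: prob_space M by fact
  interpret M': prob_space M' by fact
  interpret Metric_space "C_set S" "C_dist S" by simp
  have ZS: "Z T w \<in> C_set S" if "w \<in> space M" for T w
    using measurable_space[OF Z that] by (simp add: space_C_borel)
  have VS: "V w \<in> C_set S" if "w \<in> space M'" for w
    using measurable_space[OF V that] by (simp add: space_C_borel)
  have bint: "integrable M (\<lambda>w. f (Y w))" if "Y \<in> M \<rightarrow>\<^sub>M C_borel S" "f \<in> borel_measurable (C_borel S)"
      "\<And>z. z \<in> C_set S \<Longrightarrow> \<bar>f z\<bar> \<le> B" for f :: "_ \<Rightarrow> real" and Y B
    using that measurable_space[OF that(1)] by (intro M.integrable_const_bound[where B=B] AE_I2) (auto simp: space_C_borel)
  have bint': "integrable M' (\<lambda>w. f (Y w))" if "Y \<in> M' \<rightarrow>\<^sub>M C_borel S" "f \<in> borel_measurable (C_borel S)"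
      "\<And>z. z \<in> C_set S \<Longrightarrow> \<bar>f z\<bar> \<le> B" for f :: "_ \<Rightarrow> real" and Y B
    using that measurable_space[OF that(1)] by (intro M'.integrable_const_bound[where B=B] AE_I2) (auto simp: space_C_borel)
  have Lip: "((\<lambda>T. (LINT w|M. f (Z T w))) \<longlongrightarrow> (LINT w|M'. f (V w))) F"
    if L: "0 \<le> L" "\<And>z w. z \<in> C_set S \<Longrightarrow> w \<in> C_set S \<Longrightarrow> \<bar>f z - f w\<bar> \<le> L * C_dist S z w"
      and B: "\<And>z. z \<in> C_set S \<Longrightarrow> \<bar>f z\<bar> \<le> B" for f L B
  proof (rule tendstoI)
    fix e :: real assume e: "0 < e"
    have fm: "f \<in> borel_measurable (C_borel S)"
      by (intro continuous_measurable_C_borel lipschitz_imp_continuous_map_C_space[OF L])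
    have "\<bar>f (restrict (\<lambda>_. 0) S)\<bar> \<le> B" by (intro B) (simp add: mspace_C_space[OF S])
    then have B0: "0 \<le> B" by linarith
    \<comment> \<open>Chosen so that the Lipschitz error off the exceptional set and the bounded
      error on it, L * \<epsilon> + 2 * B * \<epsilon> in total, stay below e / 3.\<close>
    define \<epsilon> where "\<epsilon> = e / (3 * (L + 2 * B + 1))"
    have \<epsilon>: "0 < \<epsilon>" using e L B0 by (simp add: \<epsilon>_def)
    have \<epsilon>2: "L * \<epsilon> + 2 * B * \<epsilon> < e / 3"
    proof -
      have "L * \<epsilon> + 2 * B * \<epsilon> < (L + 2 * B + 1) * \<epsilon>" using \<epsilon> by (simp add: algebra_simps)
      also have "\<dots> = e / 3" using L B0 by (simp add: \<epsilon>_def field_simps)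
      finally show ?thesis .
    qed
    obtain \<delta> where \<delta>: "\<delta> > 0" and evA: "\<forall>\<^sub>F T in F. \<exists>A\<in>sets M. measure M A \<le> \<epsilon> \<and>
       (\<forall>w\<in>space M - A. \<forall>q\<in>S. \<forall>r\<in>S. dist q r < \<delta> \<longrightarrow> \<bar>Z T w q - Z T w r\<bar> \<le> \<epsilon>)"
      using modulus[OF \<epsilon>] by blast
    obtain k p h where net: "\<And>n. unity_net S (1 / Suc n) (k n) (p n) (h n)"
      using ex_unity_nets[OF S] by blast
    define Ip where "Ip n z = interpolate S (k n) (h n) (\<lambda>i. z (p n i))" for n and z :: "'p \<Rightarrow> real"
    have int_in: "interpolate S (k n) (h n) a \<in> C_set S" for n a
      using net[of n] S by (intro interpolate_in_mspace) (auto simp: unity_net_def)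
    have IpS: "Ip n z \<in> C_set S" for n z
      unfolding Ip_def by (rule int_in)
    have Ipm: "(\<lambda>w. Ip n (Y w)) \<in> N \<rightarrow>\<^sub>M C_borel S" if "Y \<in> N \<rightarrow>\<^sub>M C_borel S" for n Y and N :: "'x measure"
      unfolding Ip_def using net[of n]
      by (intro unity_net_measurable[OF S net]) (auto simp: unity_net_def intro!: measurable_compose[OF that measurable_C_borel_eval])
    \<comment> \<open>The limit is a single random path, so dominated convergence along the nets
      replaces a modulus estimate for it.\<close>
    have "(\<lambda>n. (LINT w|M'. f (Ip n (V w)))) \<longlonglongrightarrow> (LINT w|M'. f (V w))"
    proof (rule integral_dominated_convergence[where w="\<lambda>_. B"])
      show "AE w in M'. (\<lambda>n. f (Ip n (V w))) \<longlonglongrightarrow> f (V w)"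
      proof (rule AE_I2)
        fix w assume w: "w \<in> space M'"
        have "(\<lambda>n. L * C_dist S (V w) (Ip n (V w))) \<longlonglongrightarrow> L * 0"
          unfolding Ip_def by (intro tendsto_mult_left interpolate_nets_tendsto[OF S net VS[OF w]])
        then have "(\<lambda>n. L * C_dist S (V w) (Ip n (V w))) \<longlonglongrightarrow> 0" by simp
        then have "(\<lambda>n. f (Ip n (V w)) - f (V w)) \<longlonglongrightarrow> 0"
          by (rule Lim_null_comparison[rotated]) (use L(2)[OF VS[OF w] IpS] in \<open>auto simp: abs_minus_commute\<close>)
        then show "(\<lambda>n. f (Ip n (V w))) \<longlonglongrightarrow> f (V w)" by (simp add: LIM_zero_iff)
      qed
    qed (use B IpS Ipm[OF V] V fm in \<open>auto intro!: AE_I2 measurable_compose[OF _ fm]\<close>)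
    from LIMSEQ_D[OF this, of "e/3"] e obtain N1 where N1: "\<And>n. n \<ge> N1 \<Longrightarrow> \<bar>(LINT w|M'. f (Ip n (V w))) - (LINT w|M'. f (V w))\<bar> < e / 3"
      by auto
    obtain N2 where N2: "1 / real (Suc N2) < \<delta>" using nat_approx_posE[OF \<delta>] by blast
    define n where "n = max N1 N2"
    have "1 / real (Suc n) \<le> 1 / real (Suc N2)" unfolding n_def by (intro divide_left_mono) auto
    with N2 have n\<delta>: "1 / real (Suc n) < \<delta>" by linarith
    have "((\<lambda>T. (LINT w|M. f (interpolate S (k n) (h n) (\<lambda>i. Z T w (p n i))))) \<longlongrightarrow>
       (LINT w|M'. f (interpolate S (k n) (h n) (\<lambda>i. V w (p n i))))) F"
    proof (rule fdd[where g="\<lambda>a. f (interpolate S (k n) (h n) a)" and L=L and B=B and k="k n"])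
      fix a b
      have "\<bar>f (interpolate S (k n) (h n) a) - f (interpolate S (k n) (h n) b)\<bar> \<le>
         L * C_dist S (interpolate S (k n) (h n) a) (interpolate S (k n) (h n) b)"
        by (rule L(2)[OF int_in int_in])
      also have "\<dots> \<le> L * (\<Sum>i<k n. \<bar>a i - b i\<bar>)"
        using net[of n] by (intro mult_left_mono mdist_interpolate_le L) (auto simp: unity_net_def)
      finally show "\<bar>f (interpolate S (k n) (h n) a) - f (interpolate S (k n) (h n) b)\<bar> \<le> L * (\<Sum>i<k n. \<bar>a i - b i\<bar>)" .
    qed (use net[of n] L B int_in in \<open>auto simp: unity_net_def\<close>)
    then have "\<forall>\<^sub>F T in F. dist (LINT w|M. f (Ip n (Z T w))) (LINT w|M'. f (Ip n (V w))) < e / 3"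
      unfolding Ip_def using e by (intro tendstoD) auto
    with evA show "\<forall>\<^sub>F T in F. dist (LINT w|M. f (Z T w)) (LINT w|M'. f (V w)) < e"
    proof eventually_elim
      case (elim T)
      then obtain A where A: "A \<in> sets M" "measure M A \<le> \<epsilon>"
        "\<And>w q r. w \<in> space M - A \<Longrightarrow> q \<in> S \<Longrightarrow> r \<in> S \<Longrightarrow> dist q r < \<delta> \<Longrightarrow> \<bar>Z T w q - Z T w r\<bar> \<le> \<epsilon>" by blast
      have i1: "integrable M (\<lambda>w. f (Z T w))" by (rule bint[OF Z fm B])
      have i2: "integrable M (\<lambda>w. f (Ip n (Z T w)))" by (rule bint[OF Ipm[OF Z] fm B])
      have "\<bar>(LINT w|M. f (Z T w)) - (LINT w|M. f (Ip n (Z T w)))\<bar> = \<bar>LINT w|M. f (Z T w) - f (Ip n (Z T w))\<bar>"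
        by (simp add: Bochner_Integration.integral_diff[OF i1 i2])
      also have "\<dots> \<le> (LINT w|M. \<bar>f (Z T w) - f (Ip n (Z T w))\<bar>)" by (rule integral_abs_bound)
      also have "\<dots> \<le> (LINT w|M. L * \<epsilon> + 2 * B * indicator A w)"
      proof (rule integral_mono)
        fix w assume w: "w \<in> space M"
        show "\<bar>f (Z T w) - f (Ip n (Z T w))\<bar> \<le> L * \<epsilon> + 2 * B * indicator A w"
        proof (cases "w \<in> A")
          case True
          have "0 \<le> L * \<epsilon>" using L(1) \<epsilon> by simp
          then show ?thesis using B[OF ZS[OF w], of T] B[OF IpS, of n "Z T w"] True by (simp add: abs_le_iff)
        next
          case False
          have "C_dist S (Z T w) (Ip n (Z T w)) \<le> \<epsilon>"
            unfolding Ip_def using w False A(3)[of w] n\<delta> \<epsilon>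
            by (intro unity_net_mdist[OF net]) (auto intro!: A(3)[of w])
          then have "L * C_dist S (Z T w) (Ip n (Z T w)) \<le> L * \<epsilon>" using L by (intro mult_left_mono) auto
          then show ?thesis using L(2)[OF ZS[OF w] IpS, of T n "Z T w"] False by simp
        qed
      qed (use i1 i2 A in \<open>auto intro!: Bochner_Integration.integrable_add integrable_mult_right integrable_real_indicator simp: M.emeasure_eq_measure\<close>)
      also have "\<dots> = L * \<epsilon> + 2 * B * measure M A"
        using A by (subst Bochner_Integration.integral_add) (auto simp: M.prob_space intro!: integrable_real_indicator simp: M.emeasure_eq_measure)
      also have "\<dots> \<le> L * \<epsilon> + 2 * B * \<epsilon>" using A B0 by (intro add_left_mono mult_left_mono) auto
      also have "\<dots> < e / 3" by (rule \<epsilon>2)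
      finally show ?case using elim(2) N1[of n, unfolded n_def, OF max.cobounded1, folded n_def]
        unfolding dist_real_def by linarith
    qed
  qed
  \<comment> \<open>The regularization lies below the functional and yields only a lower bound; the
    upper one comes from the same statement for the negated functional.\<close>
  have lower: "\<forall>\<^sub>F T in F. (LINT w|M. f (Z T w)) > (LINT w|M'. f (V w)) - e"
    if cont: "continuous_map (C_top S) euclideanreal f"
      and B: "\<And>z. z \<in> C_set S \<Longrightarrow> \<bar>f z\<bar> \<le> B" and e: "0 < e" for f B e
  proof -
    define g where "g k z = (INF w\<in>C_set S. f w + real k * C_dist S z w)" for k :: nat and z
    note g = inf_convolution_C_space[OF cont B, folded g_def]
    have fm: "f \<in> borel_measurable (C_borel S)" by (rule continuous_measurable_C_borel[OF cont])
    have gm: "g k \<in> borel_measurable (C_borel S)" for k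
      by (intro continuous_measurable_C_borel lipschitz_imp_continuous_map_C_space[of "real k"] g(3)) auto
    have "(\<lambda>k. (LINT w|M'. g k (V w))) \<longlonglongrightarrow> (LINT w|M'. f (V w))"
      by (rule integral_dominated_convergence[where w="\<lambda>_. B"])
         (use g V VS fm gm in \<open>auto intro!: AE_I2 measurable_compose[OF V]\<close>)
    from LIMSEQ_D[OF this, of "e/2"] e obtain k where k: "\<bar>(LINT w|M'. g k (V w)) - (LINT w|M'. f (V w))\<bar> < e / 2"
      by auto
    have "((\<lambda>T. (LINT w|M. g k (Z T w))) \<longlongrightarrow> (LINT w|M'. g k (V w))) F"
      by (rule Lip[of "real k"]) (use g in auto)
    from tendstoD[OF this, of "e/2"] e have "\<forall>\<^sub>F T in F. dist (LINT w|M. g k (Z T w)) (LINT w|M'. g k (V w)) < e / 2" by auto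
    then show ?thesis
    proof eventually_elim
      case (elim T)
      have "(LINT w|M. g k (Z T w)) \<le> (LINT w|M. f (Z T w))"
        by (intro integral_mono bint[OF Z gm g(2)] bint[OF Z fm B] g(1) ZS)
      then show ?case using elim k unfolding dist_real_def by linarith
    qed
  qed
  show ?thesis unfolding weak_conv_on_def
  proof (intro allI impI)
    fix f assume f: "continuous_map (C_top S) euclideanreal f \<and> bounded (f ` topspace (C_top S))"
    then obtain B where B: "\<And>z. z \<in> C_set S \<Longrightarrow> \<bar>f z\<bar> \<le> B"
      unfolding bounded_iff by auto
    have fm: "f \<in> borel_measurable (C_borel S)" by (rule continuous_measurable_C_borel) (use f in auto)
    have "((\<lambda>T. (LINT w|M. f (Z T w))) \<longlongrightarrow> (LINT w|M'. f (V w))) F"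
    proof (rule tendstoI)
      fix e :: real assume e: "0 < e"
      have c1: "continuous_map (C_top S) euclideanreal f" using f by auto
      have c2: "continuous_map (C_top S) euclideanreal (\<lambda>z. - f z)" using f by (simp add: continuous_map_C_space_iff abs_minus_commute)
      from lower[OF c1 B e] lower[OF c2 _ e, of B] B
      have "\<forall>\<^sub>F T in F. (LINT w|M. f (Z T w)) > (LINT w|M'. f (V w)) - e"
         "\<forall>\<^sub>F T in F. (LINT w|M. - f (Z T w)) > (LINT w|M'. - f (V w)) - e" by auto
      then show "\<forall>\<^sub>F T in F. dist (LINT w|M. f (Z T w)) (LINT w|M'. f (V w)) < e"
        by eventually_elim (auto simp: dist_real_def)
    qed
    then show "((\<lambda>T. (LINT z|(distr M (C_borel S) (Z T)). f z)) \<longlongrightarrow> (LINT z|(distr M' (C_borel S) V). f z)) F"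
      using Z V fm by (simp add: integral_distr)
  qed
qed

section \<open>Two-parameter chaining\<close>

text \<open>Suprema are taken over this countable dense subset of the unit interval so that they
  stay measurable; continuity recovers the other points.\<close>

definition dyadics :: "real set" where
  "dyadics = {real j / 2 ^ N | j N :: nat. j \<le> 2 ^ N}"

lemma countable_dyadics: "countable dyadics"
proof -
  have "dyadics \<subseteq> (\<lambda>(j::nat, N::nat). real j / 2 ^ N) ` UNIV"
  proof
    fix s assume "s \<in> dyadics"
    then obtain j N :: nat where "s = real j / 2 ^ N" unfolding dyadics_def by blast
    then show "s \<in> (\<lambda>(j::nat, N::nat). real j / 2 ^ N) ` UNIV" by (intro image_eqI[of _ _ "(j, N)"]) auto
  qed
  then show ?thesis by (rule countable_subset) simp
qed

lemma dyadicsI: "j \<le> 2 ^ N \<Longrightarrow> real j / 2 ^ N \<in> dyadics"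
  unfolding dyadics_def by blast

lemma dyadics_unit: "s \<in> dyadics \<Longrightarrow> 0 \<le> s \<and> s \<le> 1"
proof -
  assume "s \<in> dyadics"
  then obtain j N :: nat where s: "s = real j / 2 ^ N" "j \<le> 2 ^ N" unfolding dyadics_def by blast
  have "real j \<le> 2 ^ N" using s(2) by (metis of_nat_le_iff of_nat_numeral of_nat_power)
  then show ?thesis unfolding s(1) by (simp add: divide_le_eq_1)
qed

lemma zero_dyadics: "0 \<in> dyadics" using dyadicsI[of 0 0] by simp

lemma dyadics_levelE:
  assumes "s \<in> dyadics"
  obtains N0 where "\<And>N. N \<ge> N0 \<Longrightarrow> \<exists>j\<le>2 ^ N. s = real j / 2 ^ N"
proof -
  obtain j N0 :: nat where s: "s = real j / 2 ^ N0" "j \<le> 2 ^ N0" using assms unfolding dyadics_def by blast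
  have "\<exists>j\<le>2 ^ N. s = real j / 2 ^ N" if "N \<ge> N0" for N
  proof (intro exI[of _ "j * 2 ^ (N - N0)"] conjI)
    have e: "(2::nat) ^ N = 2 ^ N0 * 2 ^ (N - N0)" using that by (simp add: power_add[symmetric])
    show "j * 2 ^ (N - N0) \<le> 2 ^ N" unfolding e using s(2) by (intro mult_right_mono) auto
    have "(2::real) ^ N = 2 ^ N0 * 2 ^ (N - N0)" using that by (simp add: power_add[symmetric])
    then show "s = real (j * 2 ^ (N - N0)) / 2 ^ N" using s(1) by simp
  qed
  then show ?thesis using that by blast
qed

lemma ennreal_abs_triangle: "ennreal \<bar>a - c\<bar> \<le> ennreal \<bar>a - b\<bar> + ennreal \<bar>b - c\<bar>"
proof -
  have "ennreal \<bar>a - c\<bar> \<le> ennreal (\<bar>a - b\<bar> + \<bar>b - c\<bar>)" by (intro ennreal_leI) linarith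
  then show ?thesis by simp
qed

text \<open>Each point descends to its ancestor on level n by repeatedly halving its index, which
  uses at most one link per level; the ancestors of two points at distance at most 2 to the power -n
  are equal or adjacent. Two descents and one link give the factor 3. With values in
  \<open>ennreal\<close>, \<open>d\<close> may be a supremum whose finiteness is not yet
  known.\<close>

lemma dyadic_chaining:
  fixes d :: "real \<Rightarrow> real \<Rightarrow> ennreal"
  assumes refl: "\<And>a. d a a = 0" and sym: "\<And>a b. d a b = d b a" and tri: "\<And>a b c. d a c \<le> d a b + d b c"
    and st: "s \<in> dyadics" "t \<in> dyadics" "\<bar>s - t\<bar> \<le> 1 / 2 ^ n"
  defines "\<Delta> \<equiv> \<lambda>m::nat. SUP i\<in>{..<2 ^ m :: nat}. d (real i / 2 ^ m) (real (Suc i) / 2 ^ m)"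
  shows "d s t \<le> 3 * (\<Sum>m. \<Delta> (m + n))"
proof -
  have step: "d (real i / 2 ^ m) (real (Suc i) / 2 ^ m) \<le> \<Delta> m" if "i < 2 ^ m" for i m :: nat
    unfolding \<Delta>_def using that by (intro SUP_upper) auto
  \<comment> \<open>For even j the parent is the same point; for odd j it is the left neighbour on
    the finer level.\<close>
  have half: "d (real j / 2 ^ Suc m) (real (j div 2) / 2 ^ m) \<le> \<Delta> (Suc m)" if "j \<le> 2 ^ Suc m" for j m :: nat
  proof (cases "even j")
    case True
    then have "real (j div 2) / 2 ^ m = real j / 2 ^ Suc m" by (auto elim!: evenE)
    then show ?thesis using refl by simp
  next
    case False
    then obtain i where i: "j = Suc (2 * i)" by (auto elim!: oddE)
    then have "real (j div 2) / 2 ^ m = real (2 * i) / 2 ^ Suc m" by simp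
    then show ?thesis using step[of "2 * i" "Suc m"] i that sym by simp
  qed
  have proj: "d (real j / 2 ^ (n + l)) (real (j div 2 ^ l) / 2 ^ n) \<le> (\<Sum>m<l. \<Delta> (n + Suc m))" if "j \<le> 2 ^ (n + l)" for j l :: nat
    using that
  proof (induction l arbitrary: j)
    case 0 then show ?case using refl by simp
  next
    case (Suc l)
    have j: "j div 2 \<le> 2 ^ (n + l)" using Suc.prems by simp
    have "d (real j / 2 ^ (n + Suc l)) (real (j div 2 ^ Suc l) / 2 ^ n) \<le>
      d (real j / 2 ^ (n + Suc l)) (real (j div 2) / 2 ^ (n + l)) + d (real (j div 2) / 2 ^ (n + l)) (real (j div 2 ^ Suc l) / 2 ^ n)"
      by (rule tri)
    also have "\<dots> \<le> \<Delta> (n + Suc l) + (\<Sum>m<l. \<Delta> (n + Suc m))"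
      using half[of j "n + l"] Suc.prems Suc.IH[OF j] by (intro add_mono) (auto simp: div_mult2_eq)
    finally show ?case by (simp add: add.commute)
  qed
  define \<Sigma> where "\<Sigma> = (\<Sum>m. \<Delta> (m + n))"
  have part: "(\<Sum>m<l. \<Delta> (n + Suc m)) \<le> \<Sigma>" for l
  proof -
    have "(\<Sum>m<l. \<Delta> (n + Suc m)) = (\<Sum>m\<in>{..<l}. \<Delta> (Suc m + n))" by (simp add: add.commute)
    also have "\<dots> = (\<Sum>m\<in>Suc ` {..<l}. \<Delta> (m + n))" by (simp add: sum.reindex)
    also have "\<dots> \<le> \<Sigma>" unfolding \<Sigma>_def by (rule sum_le_suminf) auto
    finally show ?thesis .
  qed
  obtain N1 where N1: "\<And>N. N \<ge> N1 \<Longrightarrow> \<exists>j\<le>2 ^ N. s = real j / 2 ^ N" using dyadics_levelE[OF st(1)] by blast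
  obtain N2 where N2: "\<And>N. N \<ge> N2 \<Longrightarrow> \<exists>j\<le>2 ^ N. t = real j / 2 ^ N" using dyadics_levelE[OF st(2)] by blast
  \<comment> \<open>A number of levels above n large enough for both points to lie on the common
    grid n + l.\<close>
  define l where "l = N1 + N2"
  obtain j where j: "j \<le> 2 ^ (n + l)" "s = real j / 2 ^ (n + l)" using N1[of "n + l"] by (auto simp: l_def)
  obtain k where k: "k \<le> 2 ^ (n + l)" "t = real k / 2 ^ (n + l)" using N2[of "n + l"] by (auto simp: l_def)
  define a b where "a = j div 2 ^ l" and "b = k div 2 ^ l"
  have adj: "d (real a / 2 ^ n) (real b / 2 ^ n) \<le> \<Sigma>"
  proof -
    have "\<bar>real j - real k\<bar> / 2 ^ (n + l) \<le> 1 / 2 ^ n" using st(3) j k by (simp add: diff_divide_distrib[symmetric])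
    then have jk: "\<bar>real j - real k\<bar> \<le> 2 ^ l" by (simp add: field_simps power_add)
    have kj: "k \<le> j + 2 ^ l" "j \<le> k + 2 ^ l"
    proof -
      have "real k \<le> real (j + 2 ^ l)" "real j \<le> real (k + 2 ^ l)" using jk by auto
      then show "k \<le> j + 2 ^ l" "j \<le> k + 2 ^ l" by (simp_all only: of_nat_le_iff)
    qed
    have ab: "b \<le> Suc a" "a \<le> Suc b"
    proof -
      have "k div 2 ^ l \<le> (j + 2 ^ l) div 2 ^ l" "j div 2 ^ l \<le> (k + 2 ^ l) div 2 ^ l"
        using kj by (blast intro: div_le_mono)+
      then show "b \<le> Suc a" "a \<le> Suc b" by (auto simp: a_def b_def)
    qed
    have bnd: "a \<le> 2 ^ n" "b \<le> 2 ^ n"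
      using div_le_mono[OF j(1), of "2 ^ l"] div_le_mono[OF k(1), of "2 ^ l"] by (auto simp: a_def b_def power_add)
    have \<Delta>n: "\<Delta> n \<le> \<Sigma>"
      using sum_le_suminf[of "\<lambda>m. \<Delta> (m + n)" "{0}"] by (simp add: \<Sigma>_def)
    consider "a = b" | "b = Suc a" | "a = Suc b" using ab by linarith
    then show ?thesis
    proof cases
      case 1 then show ?thesis using refl by simp
    next
      case 2 then show ?thesis using step[of a n] bnd \<Delta>n by (auto intro: order_trans)
    next
      case 3 then show ?thesis using step[of b n] bnd \<Delta>n sym by (auto intro: order_trans)
    qed
  qed
  have "d s t \<le> d s (real a / 2 ^ n) + d (real a / 2 ^ n) t" by (rule tri)
  also have "\<dots> \<le> d s (real a / 2 ^ n) + (d (real a / 2 ^ n) (real b / 2 ^ n) + d (real b / 2 ^ n) t)"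
    by (intro add_left_mono tri)
  also have "\<dots> \<le> \<Sigma> + (\<Sigma> + \<Sigma>)"
    using proj[OF j(1)] proj[OF k(1)] part[of l] adj sym j(2) k(2)
    by (intro add_mono) (auto simp: a_def b_def intro: order_trans)
  also have "\<dots> = 3 * \<Sigma>" 
  proof -
    have "(3::ennreal) = 1 + (1 + 1)" by simp
    then show ?thesis by (simp only: distrib_right mult_1)
  qed
  finally show ?thesis by (simp add: \<Sigma>_def)
qed

text \<open>With U the supremum of a m / q ^ m, the sum is at most U / (1 - q), and the square of U
  is at most the sum of the weighted squares. The square is thus moved inside the series without any
  finiteness assumption.\<close>

lemma suminf_square_le_weighted:
  fixes a :: "nat \<Rightarrow> ennreal"
  assumes q: "0 < q" "q < 1"
  shows "(\<Sum>m. a m)\<^sup>2 \<le> ennreal ((1 / (1 - q))\<^sup>2) * (\<Sum>m. ennreal (1 / q ^ (2 * m)) * (a m)\<^sup>2)"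
proof -
  define f where "f m = ennreal (1 / q ^ m) * a m" for m
  define U where "U = (SUP m. f m)"
  define S where "S = (\<Sum>m. ennreal (1 / q ^ (2 * m)) * (a m)\<^sup>2)"
  have fS: "f m * f m \<le> S" for m
  proof -
    have "f m * f m = ennreal (1 / q ^ (2 * m)) * (a m)\<^sup>2"
    proof -
      have "f m * f m = (ennreal (1 / q ^ m) * ennreal (1 / q ^ m)) * (a m)\<^sup>2" by (simp add: f_def power2_eq_square mult_ac)
      also have "ennreal (1 / q ^ m) * ennreal (1 / q ^ m) = ennreal (1 / q ^ (2 * m))"
        using q by (simp add: ennreal_mult[symmetric] mult_2 power_add)
      finally show ?thesis .
    qed
    also have "\<dots> \<le> S" unfolding S_def using sum_le_suminf[of "\<lambda>m. ennreal (1 / q ^ (2 * m)) * (a m)\<^sup>2" "{m}"] by simp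
    finally show ?thesis .
  qed
  have "f m * f k \<le> S" for m k
  proof (cases "f m \<le> f k")
    case True then have "f m * f k \<le> f k * f k" by (intro mult_right_mono) auto
    then show ?thesis using fS[of k] by order
  next
    case False then have "f m * f k \<le> f m * f m" by (intro mult_left_mono) auto
    then show ?thesis using fS[of m] by order
  qed
  then have "f m * U \<le> S" for m
    unfolding U_def SUP_mult_left_ennreal by (intro SUP_least)
  then have "U * f m \<le> S" for m by (simp add: mult.commute)
  then have US: "U * U \<le> S"
    by (subst (2) U_def, unfold SUP_mult_left_ennreal) (intro SUP_least)
  have aU: "a m \<le> ennreal (q ^ m) * U" for m
  proof -
    have "a m = ennreal (q ^ m) * f m" using q by (simp add: f_def ennreal_mult[symmetric] flip: mult.assoc)
    also have "\<dots> \<le> ennreal (q ^ m) * U" unfolding U_def by (intro mult_left_mono SUP_upper) auto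
    finally show ?thesis .
  qed
  have "(\<Sum>m. a m) \<le> (\<Sum>m. ennreal (q ^ m) * U)" by (intro suminf_le aU) auto
  also have "\<dots> = (\<Sum>m. ennreal (q ^ m)) * U" by (simp add: ennreal_suminf_multc)
  also have "(\<Sum>m. ennreal (q ^ m)) = ennreal (1 / (1 - q))"
    using q by (subst suminf_ennreal2) (auto simp: suminf_geometric)
  finally have "(\<Sum>m. a m) \<le> ennreal (1 / (1 - q)) * U" .
  then have "(\<Sum>m. a m)\<^sup>2 \<le> (ennreal (1 / (1 - q)) * U)\<^sup>2" by (intro power_mono) auto
  also have "\<dots> = ennreal ((1 / (1 - q))\<^sup>2) * (U * U)"
    using q by (simp add: power_mult_distrib ennreal_power power2_eq_square mult_ac flip: ennreal_mult)
  also have "\<dots> \<le> ennreal ((1 / (1 - q))\<^sup>2) * S" by (intro mult_left_mono US) auto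
  finally show ?thesis by (simp add: S_def)
qed

text \<open>The 9 is the square of the 3 in \<open>dyadic_chaining\<close>, the squared factor 1 - q
  comes from \<open>suminf_square_le_weighted\<close>, and the last factor from the geometric series
  left after weighting the second moments.\<close>

definition chain_const :: "real \<Rightarrow> real" where
  "chain_const q = 9 / ((1 - q)\<^sup>2 * (1 - q\<^sup>2))"

lemma chain_const_nonneg: "0 < q \<Longrightarrow> q < 1 \<Longrightarrow> 0 \<le> chain_const q"
  unfolding chain_const_def by (simp add: power_le_one)

text \<open>The maximum over one level is bounded by the sum over its 2 ^ m links, for which the
  divisor 2 ^ m in the hypothesis compensates. Half of the remaining power q ^ (4 * m) pays for the
  weights, the other half makes the series converge.\<close>

lemma chaining_moment:
  fixes d :: "real \<Rightarrow> real \<Rightarrow> 'w \<Rightarrow> ennreal"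
  assumes refl: "\<And>a w. d a a w = 0" and sym: "\<And>a b w. d a b w = d b a w" and tri: "\<And>a b c w. d a c w \<le> d a b w + d b c w"
    and m[measurable]: "\<And>s t. s \<in> dyadics \<Longrightarrow> t \<in> dyadics \<Longrightarrow> d s t \<in> borel_measurable M"
    and q: "0 < q" "q < 1" and K: "0 \<le> K"
    and mom: "\<And>i m. i < 2 ^ m \<Longrightarrow>
      (\<integral>\<^sup>+w. (d (real i / 2 ^ m) (real (Suc i) / 2 ^ m) w)\<^sup>2 \<partial>M) \<le> ennreal (K * q ^ (4 * m) / 2 ^ m)"
  shows "(\<integral>\<^sup>+w. (SUP s\<in>dyadics. SUP t\<in>{t \<in> dyadics. \<bar>s - t\<bar> \<le> 1 / 2 ^ n}. d s t w)\<^sup>2 \<partial>M)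
     \<le> ennreal (chain_const q * K * q ^ (4 * n))"
proof -
  define \<Delta> where "\<Delta> m w = (SUP i\<in>{..<2 ^ m :: nat}. d (real i / 2 ^ m) (real (Suc i) / 2 ^ m) w)" for m w
  have dm: "d (real i / 2 ^ m) (real (Suc i) / 2 ^ m) \<in> borel_measurable M" if "i < 2 ^ m" for i m :: nat
    using that by (intro m dyadicsI) auto
  have \<Delta>m[measurable]: "\<Delta> m \<in> borel_measurable M" for m
    unfolding \<Delta>_def by (intro borel_measurable_SUP dm) auto
  have \<Delta>mom: "(\<integral>\<^sup>+w. (\<Delta> m w)\<^sup>2 \<partial>M) \<le> ennreal (K * q ^ (4 * m))" for m
  proof -
    have "(\<Delta> m w)\<^sup>2 \<le> (\<Sum>i<2 ^ m. (d (real i / 2 ^ m) (real (Suc i) / 2 ^ m) w)\<^sup>2)" for w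
    proof -
      \<comment> \<open>The supremum over the finitely many links of a level is attained, so its
        square is one of the summands.\<close>
      have "\<Delta> m w \<in> (\<lambda>i. d (real i / 2 ^ m) (real (Suc i) / 2 ^ m) w) ` {..<2 ^ m :: nat}"
        unfolding \<Delta>_def Max_Sup[symmetric] by (subst Max_Sup[symmetric]) (auto intro!: Max_in simp: lessThan_empty_iff)
      then obtain i where "i < 2 ^ m" "\<Delta> m w = d (real i / 2 ^ m) (real (Suc i) / 2 ^ m) w" by auto
      then show ?thesis by (auto intro!: member_le_sum)
    qed
    then have "(\<integral>\<^sup>+w. (\<Delta> m w)\<^sup>2 \<partial>M) \<le> (\<integral>\<^sup>+w. (\<Sum>i<2 ^ m. (d (real i / 2 ^ m) (real (Suc i) / 2 ^ m) w)\<^sup>2) \<partial>M)"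
      by (intro nn_integral_mono)
    also have "\<dots> = (\<Sum>i<2 ^ m. \<integral>\<^sup>+w. (d (real i / 2 ^ m) (real (Suc i) / 2 ^ m) w)\<^sup>2 \<partial>M)"
      using dm by (intro nn_integral_sum) auto
    also have "\<dots> \<le> (\<Sum>i<2 ^ m :: nat. ennreal (K * q ^ (4 * m) / 2 ^ m))" by (intro sum_mono mom) auto
    also have "\<dots> = ennreal (K * q ^ (4 * m))"
      using K q by (simp add: ennreal_of_nat_eq_real_of_nat ennreal_mult[symmetric])
    finally show ?thesis .
  qed
  have "(SUP s\<in>dyadics. SUP t\<in>{t \<in> dyadics. \<bar>s - t\<bar> \<le> 1 / 2 ^ n}. d s t w)\<^sup>2 \<le>
    ennreal (9 * (1 / (1 - q))\<^sup>2) * (\<Sum>m. ennreal (1 / q ^ (2 * m)) * (\<Delta> (m + n) w)\<^sup>2)" for w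
  proof -
    have "(SUP s\<in>dyadics. SUP t\<in>{t \<in> dyadics. \<bar>s - t\<bar> \<le> 1 / 2 ^ n}. d s t w) \<le> 3 * (\<Sum>m. \<Delta> (m + n) w)"
      unfolding \<Delta>_def by (intro SUP_least dyadic_chaining) (auto intro: refl sym tri)
    then have "(SUP s\<in>dyadics. SUP t\<in>{t \<in> dyadics. \<bar>s - t\<bar> \<le> 1 / 2 ^ n}. d s t w)\<^sup>2 \<le> (3 * (\<Sum>m. \<Delta> (m + n) w))\<^sup>2"
      by (intro power_mono) auto
    also have "\<dots> = ennreal 9 * (\<Sum>m. \<Delta> (m + n) w)\<^sup>2" by (simp add: power_mult_distrib)
    also have "\<dots> \<le> ennreal 9 * (ennreal ((1 / (1 - q))\<^sup>2) * (\<Sum>m. ennreal (1 / q ^ (2 * m)) * (\<Delta> (m + n) w)\<^sup>2))"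
      by (intro mult_left_mono suminf_square_le_weighted q) auto
    finally show ?thesis by (simp add: ennreal_mult mult.assoc)
  qed
  then have "(\<integral>\<^sup>+w. (SUP s\<in>dyadics. SUP t\<in>{t \<in> dyadics. \<bar>s - t\<bar> \<le> 1 / 2 ^ n}. d s t w)\<^sup>2 \<partial>M) \<le>
    (\<integral>\<^sup>+w. ennreal (9 * (1 / (1 - q))\<^sup>2) * (\<Sum>m. ennreal (1 / q ^ (2 * m)) * (\<Delta> (m + n) w)\<^sup>2) \<partial>M)"
    by (intro nn_integral_mono)
  also have "\<dots> = ennreal (9 * (1 / (1 - q))\<^sup>2) * (\<Sum>m. ennreal (1 / q ^ (2 * m)) * (\<integral>\<^sup>+w. (\<Delta> (m + n) w)\<^sup>2 \<partial>M))"
    by (simp add: nn_integral_cmult nn_integral_suminf)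
  also have "\<dots> \<le> ennreal (9 * (1 / (1 - q))\<^sup>2) * (\<Sum>m. ennreal (1 / q ^ (2 * m)) * ennreal (K * q ^ (4 * (m + n))))"
    by (intro mult_left_mono suminf_le \<Delta>mom) auto
  also have "(\<lambda>m. ennreal (1 / q ^ (2 * m)) * ennreal (K * q ^ (4 * (m + n)))) = (\<lambda>m. ennreal (K * q ^ (4 * n) * (q\<^sup>2) ^ m))"
  proof
    fix m
    have "1 / q ^ (2 * m) * (K * q ^ (4 * (m + n))) = K * q ^ (4 * n) * (q\<^sup>2) ^ m"
    proof -
      have "q ^ (4 * (m + n)) = q ^ (2 * m) * (q ^ (4 * n) * (q\<^sup>2) ^ m)"
        by (simp add: power_mult[symmetric] power_add[symmetric])
      then show ?thesis using q by simp
    qed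
    then show "ennreal (1 / q ^ (2 * m)) * ennreal (K * q ^ (4 * (m + n))) = ennreal (K * q ^ (4 * n) * (q\<^sup>2) ^ m)"
      using q K by (simp add: ennreal_mult[symmetric])
  qed
  also have "(\<Sum>m. ennreal (K * q ^ (4 * n) * (q\<^sup>2) ^ m)) = ennreal (K * q ^ (4 * n) * (1 / (1 - q\<^sup>2)))"
  proof -
    have q2: "norm (q\<^sup>2) < 1" using q by (simp add: power_less_one_iff)
    show ?thesis using q K q2
      by (subst suminf_ennreal2) (auto simp: suminf_mult suminf_geometric intro!: summable_mult summable_geometric)
  qed
  also have "ennreal (9 * (1 / (1 - q))\<^sup>2) * \<dots> = ennreal (chain_const q * K * q ^ (4 * n))"
    using q K by (subst ennreal_mult[symmetric]) (auto simp: chain_const_def power_divide power_le_one)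
  finally show ?thesis .
qed

lemma dyadic_floor_approx:
  assumes "0 \<le> s" "s \<le> 1"
  shows "(\<lambda>m. real (nat \<lfloor>2 ^ m * s\<rfloor>) / 2 ^ m) \<longlonglongrightarrow> s" "real (nat \<lfloor>2 ^ m * s\<rfloor>) / 2 ^ m \<in> dyadics"
proof -
  have e: "real (nat \<lfloor>2 ^ m * s\<rfloor>) = of_int \<lfloor>2 ^ m * s\<rfloor>" for m using assms by simp
  show "(\<lambda>m. real (nat \<lfloor>2 ^ m * s\<rfloor>) / 2 ^ m) \<longlonglongrightarrow> s"
  proof (rule tendsto_sandwich[of "\<lambda>m. s - (1/2) ^ m" _ _ "\<lambda>m. s"])
    have "(\<lambda>m. s - (1/2::real) ^ m) \<longlonglongrightarrow> s - 0" by (intro tendsto_intros LIMSEQ_power_zero) auto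
    then show "(\<lambda>m. s - (1/2::real) ^ m) \<longlonglongrightarrow> s" by simp
    show "\<forall>\<^sub>F m in sequentially. s - (1/2) ^ m \<le> real (nat \<lfloor>2 ^ m * s\<rfloor>) / 2 ^ m"
    proof (rule always_eventually, rule allI)
      fix m
      have "2 ^ m * s - 1 \<le> of_int \<lfloor>2 ^ m * s\<rfloor>" by linarith
      then have "(2 ^ m * s - 1) / 2 ^ m \<le> of_int \<lfloor>2 ^ m * s\<rfloor> / 2 ^ m" by (intro divide_right_mono) auto
      then show "s - (1/2) ^ m \<le> real (nat \<lfloor>2 ^ m * s\<rfloor>) / 2 ^ m" unfolding e by (simp add: diff_divide_distrib power_divide)
    qed
    show "\<forall>\<^sub>F m in sequentially. real (nat \<lfloor>2 ^ m * s\<rfloor>) / 2 ^ m \<le> s"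
    proof (rule always_eventually, rule allI)
      fix m
      have "of_int \<lfloor>2 ^ m * s\<rfloor> \<le> 2 ^ m * s" by linarith
      then show "real (nat \<lfloor>2 ^ m * s\<rfloor>) / 2 ^ m \<le> s" unfolding e by (simp add: field_simps)
    qed
  qed auto
  have "\<lfloor>2 ^ m * s\<rfloor> \<le> \<lfloor>2 ^ m :: real\<rfloor>" using assms by (intro floor_mono) auto
  then have "nat \<lfloor>2 ^ m * s\<rfloor> \<le> 2 ^ m" by (simp add: nat_le_iff)
  then show "real (nat \<lfloor>2 ^ m * s\<rfloor>) / 2 ^ m \<in> dyadics" by (rule dyadicsI)
qed

section \<open>Suprema of increments of a two-parameter field\<close>

definition increment_sup :: "(real \<Rightarrow> real \<Rightarrow> 'w \<Rightarrow> real) \<Rightarrow> nat \<Rightarrow> 'w \<Rightarrow> ennreal" where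
  "increment_sup X n w = (SUP s\<in>dyadics. SUP s'\<in>{s'\<in>dyadics. \<bar>s - s'\<bar> \<le> 1 / 2 ^ n}.
     SUP t\<in>dyadics. ennreal \<bar>X s t w - X s' t w\<bar>)"

definition rect_incr :: "(real \<Rightarrow> real \<Rightarrow> 'w \<Rightarrow> real) \<Rightarrow> real \<Rightarrow> real \<Rightarrow> real \<Rightarrow> real \<Rightarrow> 'w \<Rightarrow> real" where
  "rect_incr X s s' t t' w = X s' t' w - X s t' w - X s' t w + X s t w"

text \<open>Chaining is applied twice. For fixed s and s' it runs in the second variable, starting
  from the axis where the field vanishes, and turns rectangular moments into a moment of the
  supremum over t. That supremum is a pseudometric in s, to which chaining at scale n applies
  again.\<close>

lemma increment_sup_moment:
  fixes X :: "real \<Rightarrow> real \<Rightarrow> 'w \<Rightarrow> real"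
  assumes Xm[measurable]: "\<And>s t. s \<in> dyadics \<Longrightarrow> t \<in> dyadics \<Longrightarrow> X s t \<in> borel_measurable M"
    and zero: "\<And>s w. s \<in> dyadics \<Longrightarrow> w \<in> space M \<Longrightarrow> X s 0 w = 0"
    and K: "0 \<le> K" and ab: "0 < a" "0 < b"
    and rect: "\<And>s s' t t'. s \<in> dyadics \<Longrightarrow> s' \<in> dyadics \<Longrightarrow> t \<in> dyadics \<Longrightarrow> t' \<in> dyadics \<Longrightarrow>
      (\<integral>\<^sup>+w. ennreal ((rect_incr X s s' t t' w)\<^sup>2) \<partial>M) \<le> ennreal (K * \<bar>s' - s\<bar> powr (1 + a) * \<bar>t' - t\<bar> powr (1 + b))"
  shows "(\<integral>\<^sup>+w. (increment_sup X n w)\<^sup>2 \<partial>M) \<le>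
    ennreal (chain_const (2 powr (- a / 4)) * chain_const (2 powr (- b / 4)) * K * (2 powr (- a / 4)) ^ (4 * n))"
proof -
  \<comment> \<open>With this ratio a link length of 2 to the power -m, raised to 1 + a, equals p ^
    (4 * m) / 2 ^ m, the form demanded by \<open>chaining_moment\<close>.\<close>
  define p q :: real where "p = 2 powr (- a / 4)" and "q = 2 powr (- b / 4)"
  have pq: "0 < p" "p < 1" "0 < q" "q < 1" using ab by (auto simp: p_def q_def powr_less_one)
  have pw: "\<bar>real (Suc i) / 2 ^ m - real i / 2 ^ m\<bar> powr (1 + c) = (2 powr (- c / 4)) ^ (4 * m) / 2 ^ m" for i m :: nat and c :: real
  proof -
    have "\<bar>real (Suc i) / 2 ^ m - real i / 2 ^ m\<bar> = 2 powr (- real m)"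
      by (simp add: diff_divide_distrib[symmetric] powr_minus_divide powr_realpow)
    then have "\<bar>real (Suc i) / 2 ^ m - real i / 2 ^ m\<bar> powr (1 + c) = 2 powr (- real m * (1 + c))" by (simp add: powr_powr)
    also have "\<dots> = 2 powr (- real m) * 2 powr (- c / 4 * real (4 * m))" by (simp add: powr_add[symmetric] algebra_simps)
    also have "2 powr (- c / 4 * real (4 * m)) = (2 powr (- c / 4)) ^ (4 * m)"
      by (subst powr_powr[symmetric], subst powr_realpow) auto
    finally show ?thesis by (simp add: powr_minus_divide powr_realpow)
  qed
  define d where "d s s' w = (SUP t\<in>dyadics. ennreal \<bar>X s t w - X s' t w\<bar>)" for s s' w
  have dm: "d s s' \<in> borel_measurable M" if "s \<in> dyadics" "s' \<in> dyadics" for s s'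
    unfolding d_def using that countable_dyadics by (intro borel_measurable_SUP) auto
  have line: "(\<integral>\<^sup>+w. (d s s' w)\<^sup>2 \<partial>M) \<le> ennreal (chain_const q * (K * \<bar>s - s'\<bar> powr (1 + a)))" if s: "s \<in> dyadics" "s' \<in> dyadics" for s s'
  proof -
    define e where "e t t' w = ennreal \<bar>(X s t w - X s' t w) - (X s t' w - X s' t' w)\<bar>" for t t' w
    have "(\<integral>\<^sup>+w. (SUP t\<in>dyadics. SUP t'\<in>{t' \<in> dyadics. \<bar>t - t'\<bar> \<le> 1 / 2 ^ 0}. e t t' w)\<^sup>2 \<partial>M) \<le>
      ennreal (chain_const q * (K * \<bar>s - s'\<bar> powr (1 + a)) * q ^ (4 * 0))"
    proof (rule chaining_moment)
      show "e t t'' w \<le> e t t' w + e t' t'' w" for t t' t'' w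
        unfolding e_def by (rule ennreal_abs_triangle)
      show "e t t' \<in> borel_measurable M" if "t \<in> dyadics" "t' \<in> dyadics" for t t'
        unfolding e_def using that s by measurable
      fix i m :: nat assume i: "i < 2 ^ m"
      have "(\<integral>\<^sup>+w. (e (real i / 2 ^ m) (real (Suc i) / 2 ^ m) w)\<^sup>2 \<partial>M) =
         (\<integral>\<^sup>+w. ennreal ((rect_incr X s s' (real i / 2 ^ m) (real (Suc i) / 2 ^ m) w)\<^sup>2) \<partial>M)"
        by (intro nn_integral_cong) (simp add: e_def rect_incr_def ennreal_power power2_eq_iff algebra_simps del: of_nat_Suc)
      also have "\<dots> \<le> ennreal (K * \<bar>s' - s\<bar> powr (1 + a) * \<bar>real (Suc i) / 2 ^ m - real i / 2 ^ m\<bar> powr (1 + b))"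
        using i by (intro rect s dyadicsI) auto
      also have "\<dots> = ennreal (K * \<bar>s - s'\<bar> powr (1 + a) * q ^ (4 * m) / 2 ^ m)"
        unfolding pw q_def by (simp add: abs_minus_commute)
      finally show "(\<integral>\<^sup>+w. (e (real i / 2 ^ m) (real (Suc i) / 2 ^ m) w)\<^sup>2 \<partial>M) \<le> ennreal (K * \<bar>s - s'\<bar> powr (1 + a) * q ^ (4 * m) / 2 ^ m)" .
    qed (auto simp: e_def pq K abs_minus_commute)
    moreover have "(\<integral>\<^sup>+w. (d s s' w)\<^sup>2 \<partial>M) \<le> (\<integral>\<^sup>+w. (SUP t\<in>dyadics. SUP t'\<in>{t' \<in> dyadics. \<bar>t - t'\<bar> \<le> 1 / 2 ^ 0}. e t t' w)\<^sup>2 \<partial>M)"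
    proof (intro nn_integral_mono power_mono)
      fix w assume w: "w \<in> space M"
      show "d s s' w \<le> (SUP t\<in>dyadics. SUP t'\<in>{t' \<in> dyadics. \<bar>t - t'\<bar> \<le> 1 / 2 ^ 0}. e t t' w)"
        unfolding d_def
      proof (rule SUP_least)
        fix t assume t: "t \<in> dyadics"
        \<comment> \<open>The choice t' = 0 is admissible since at level 0 all points of the unit
          interval are within distance 1 of each other.\<close>
        have "ennreal \<bar>X s t w - X s' t w\<bar> = e t 0 w" using zero s w by (simp add: e_def)
        also have "\<dots> \<le> (SUP t'\<in>{t' \<in> dyadics. \<bar>t - t'\<bar> \<le> 1 / 2 ^ 0}. e t t' w)"
          using t dyadics_unit[OF t] zero_dyadics by (intro SUP_upper) auto
        also have "\<dots> \<le> (SUP t\<in>dyadics. SUP t'\<in>{t' \<in> dyadics. \<bar>t - t'\<bar> \<le> 1 / 2 ^ 0}. e t t' w)"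
          using t by (rule SUP_upper)
        finally show "ennreal \<bar>X s t w - X s' t w\<bar> \<le> (SUP t\<in>dyadics. SUP t'\<in>{t' \<in> dyadics. \<bar>t - t'\<bar> \<le> 1 / 2 ^ 0}. e t t' w)" .
      qed
    qed auto
    ultimately show ?thesis by simp
  qed
  have "(\<integral>\<^sup>+w. (SUP s\<in>dyadics. SUP s'\<in>{s' \<in> dyadics. \<bar>s - s'\<bar> \<le> 1 / 2 ^ n}. d s s' w)\<^sup>2 \<partial>M) \<le>
      ennreal (chain_const p * (chain_const q * K) * p ^ (4 * n))"
  proof (rule chaining_moment)
    show "d s s'' w \<le> d s s' w + d s' s'' w" for s s' s'' w
      unfolding d_def
    proof (rule SUP_least)
      fix t assume t: "t \<in> dyadics"
      have "ennreal \<bar>X s t w - X s'' t w\<bar> \<le> ennreal \<bar>X s t w - X s' t w\<bar> + ennreal \<bar>X s' t w - X s'' t w\<bar>"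
        by (rule ennreal_abs_triangle)
      also have "\<dots> \<le> (SUP t\<in>dyadics. ennreal \<bar>X s t w - X s' t w\<bar>) + (SUP t\<in>dyadics. ennreal \<bar>X s' t w - X s'' t w\<bar>)"
        using t by (intro add_mono SUP_upper)
      finally show "ennreal \<bar>X s t w - X s'' t w\<bar> \<le> (SUP t\<in>dyadics. ennreal \<bar>X s t w - X s' t w\<bar>) + (SUP t\<in>dyadics. ennreal \<bar>X s' t w - X s'' t w\<bar>)" .
    qed
    show "d s s w = 0" for s w unfolding d_def by (simp add: SUP_constant bot_ennreal)
    show "0 \<le> chain_const q * K" using chain_const_nonneg pq K by simp
    fix i m :: nat assume i: "i < 2 ^ m"
    have "(\<integral>\<^sup>+w. (d (real i / 2 ^ m) (real (Suc i) / 2 ^ m) w)\<^sup>2 \<partial>M) \<le>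
       ennreal (chain_const q * (K * \<bar>real i / 2 ^ m - real (Suc i) / 2 ^ m\<bar> powr (1 + a)))"
      using i by (intro line dyadicsI) auto
    also have "\<dots> = ennreal (chain_const q * K * p ^ (4 * m) / 2 ^ m)"
      unfolding abs_minus_commute[of "real i / 2 ^ m"] pw p_def by (simp add: mult.assoc)
    finally show "(\<integral>\<^sup>+w. (d (real i / 2 ^ m) (real (Suc i) / 2 ^ m) w)\<^sup>2 \<partial>M) \<le> ennreal (chain_const q * K * p ^ (4 * m) / 2 ^ m)" .
  qed (auto simp: pq dm, auto simp: d_def abs_minus_commute)
  then show ?thesis by (simp add: increment_sup_def d_def p_def q_def mult.assoc)
qed

lemma increment_sup_measurable:
  assumes "\<And>s t. s \<in> dyadics \<Longrightarrow> t \<in> dyadics \<Longrightarrow> X s t \<in> borel_measurable M"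
  shows "increment_sup X n \<in> borel_measurable M"
  unfolding increment_sup_def
  using countable_dyadics assms
  by (intro borel_measurable_SUP measurable_compose[OF _ measurable_ennreal] borel_measurable_abs borel_measurable_diff)
     (auto intro: countable_subset[OF _ countable_dyadics])

text \<open>Continuity extends the bound from dyadic to real arguments. The strict inequality is
  inherited by the dyadic approximations from some index on, which a weak one would not be.\<close>

lemma increment_sup_upper:
  assumes cont: "continuous_on ({0..1} \<times> {0..1}) (\<lambda>p. X (fst p) (snd p) w)"
    and s: "s \<in> {0..1}" "s' \<in> {0..1}" "t \<in> {0..1}" and lt: "\<bar>s - s'\<bar> < 1 / 2 ^ n"
  shows "ennreal \<bar>X s t w - X s' t w\<bar> \<le> increment_sup X n w"
proof -
  define f where "f s m = real (nat \<lfloor>2 ^ m * s\<rfloor>) / 2 ^ m" for s :: real and m :: nat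
  have f: "(\<lambda>m. f r m) \<longlonglongrightarrow> r" "f r m \<in> dyadics" if "r \<in> {0..1}" for r m
    using dyadic_floor_approx(1)[of r] dyadic_floor_approx(2)[of r m] that by (auto simp: f_def)
  have lim: "(\<lambda>m. X (f r m) (f t m) w) \<longlonglongrightarrow> X r t w" if "r \<in> {0..1}" for r
  proof -
    have "(\<lambda>m. (\<lambda>p. X (fst p) (snd p) w) (f r m, f t m)) \<longlonglongrightarrow> (\<lambda>p. X (fst p) (snd p) w) (r, t)"
      using s that f dyadics_unit by (intro continuous_on_tendsto_compose[OF cont] tendsto_Pair f always_eventually) force+
    then show ?thesis by simp
  qed
  have "(\<lambda>m. ennreal \<bar>X (f s m) (f t m) w - X (f s' m) (f t m) w\<bar>) \<longlonglongrightarrow> ennreal \<bar>X s t w - X s' t w\<bar>"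
    by (intro tendsto_ennrealI tendsto_rabs tendsto_diff lim s)
  moreover have "\<forall>\<^sub>F m in sequentially. ennreal \<bar>X (f s m) (f t m) w - X (f s' m) (f t m) w\<bar> \<le> increment_sup X n w"
  proof -
    have "(\<lambda>m. \<bar>f s m - f s' m\<bar>) \<longlonglongrightarrow> \<bar>s - s'\<bar>" by (intro tendsto_intros f s)
    then have "\<forall>\<^sub>F m in sequentially. \<bar>f s m - f s' m\<bar> < 1 / 2 ^ n" using lt by (rule order_tendstoD)
    then show ?thesis
    proof eventually_elim
      case (elim m)
      have "ennreal \<bar>X (f s m) (f t m) w - X (f s' m) (f t m) w\<bar> \<le> (SUP t\<in>dyadics. ennreal \<bar>X (f s m) t w - X (f s' m) t w\<bar>)"
        by (intro SUP_upper f s)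
      also have "\<dots> \<le> (SUP s'\<in>{s'\<in>dyadics. \<bar>f s m - s'\<bar> \<le> 1 / 2 ^ n}. SUP t\<in>dyadics. ennreal \<bar>X (f s m) t w - X s' t w\<bar>)"
        using elim f s by (intro SUP_upper) auto
      also have "\<dots> \<le> increment_sup X n w" unfolding increment_sup_def using f s
        by (intro SUP_upper[where f="\<lambda>s. SUP s'\<in>{s'\<in>dyadics. \<bar>s - s'\<bar> \<le> 1 / 2 ^ n}. SUP t\<in>dyadics. ennreal \<bar>X s t w - X s' t w\<bar>"]) auto
      finally show ?case .
    qed
  qed
  ultimately show ?thesis by (intro tendsto_upperbound[OF _ _ sequentially_bot])
qed

text \<open>Chebyshev's inequality; the cube makes the threshold and the probability the same number
  \<open>e\<close>.\<close>

lemma (in prob_space) sup_event_bound: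
  assumes [measurable]: "U \<in> borel_measurable M" and e: "0 < e" and U: "(\<integral>\<^sup>+w. (U w)\<^sup>2 \<partial>M) \<le> ennreal (e ^ 3)"
  shows "prob {w \<in> space M. \<not> U w \<le> ennreal e} \<le> e"
proof -
  let ?A = "{w \<in> space M. \<not> U w \<le> ennreal e}"
  have "ennreal (e\<^sup>2) * emeasure M ?A = (\<integral>\<^sup>+w. ennreal (e\<^sup>2) * indicator ?A w \<partial>M)"
    by (simp add: nn_integral_cmult)
  also have "\<dots> \<le> (\<integral>\<^sup>+w. (U w)\<^sup>2 \<partial>M)"
  proof (rule nn_integral_mono)
    fix w
    have "ennreal e ^ 2 \<le> (U w)\<^sup>2" if "w \<in> ?A" using that by (intro power_mono) auto
    then show "ennreal (e\<^sup>2) * indicator ?A w \<le> (U w)\<^sup>2" using e by (auto simp: indicator_def ennreal_power)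
  qed
  also note U
  finally have "ennreal (e\<^sup>2 * prob ?A) \<le> ennreal (e ^ 3)"
    using e by (simp add: emeasure_eq_measure ennreal_mult)
  then have "e\<^sup>2 * prob ?A \<le> e\<^sup>2 * e" using e by (simp add: ennreal_le_iff power3_eq_cube power2_eq_square mult.assoc)
  then show ?thesis using e by simp
qed

text \<open>The field is quantified after \<delta> because \<delta> depends on \<open>K\<close>,
  \<open>a\<close>, \<open>b\<close> and \<open>e\<close> alone; all rescaled fields can therefore
  share one modulus.\<close>

lemma (in prob_space) uniform_modulus_in_probability:
  assumes K: "0 \<le> K" and ab: "0 < a" "0 < b" and e: "0 < e"
  shows "\<exists>\<delta>>0. \<forall>X. (\<forall>s\<in>{0..1}. \<forall>t\<in>{0..1}. X s t \<in> borel_measurable M) \<longrightarrow>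
     (\<forall>w\<in>space M. continuous_on ({0..1} \<times> {0..1}) (\<lambda>p. X (fst p) (snd p) w)) \<longrightarrow>
     (\<forall>w\<in>space M. \<forall>s\<in>{0..1}. X s 0 w = 0 \<and> X 0 s w = 0) \<longrightarrow>
     (\<forall>s\<in>{0..1}. \<forall>s'\<in>{0..1}. \<forall>t\<in>{0..1}. \<forall>t'\<in>{0..1}.
        (\<integral>\<^sup>+w. ennreal ((rect_incr X s s' t t' w)\<^sup>2) \<partial>M) \<le> ennreal (K * \<bar>s' - s\<bar> powr (1 + a) * \<bar>t' - t\<bar> powr (1 + b))) \<longrightarrow>
     (\<exists>A\<in>sets M. prob A \<le> e \<and> (\<forall>w\<in>space M - A. \<forall>s\<in>{0..1}. \<forall>t\<in>{0..1}. \<forall>s'\<in>{0..1}. \<forall>t'\<in>{0..1}.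
        \<bar>s - s'\<bar> < \<delta> \<longrightarrow> \<bar>t - t'\<bar> < \<delta> \<longrightarrow> \<bar>X s t w - X s' t' w\<bar> \<le> e))"
proof -
  define p q :: real where "p = 2 powr (- a / 4)" and "q = 2 powr (- b / 4)"
  have pq: "0 < p" "p < 1" "0 < q" "q < 1" using ab by (auto simp: p_def q_def powr_less_one)
  define C where "C = chain_const p * chain_const q * K"
  \<comment> \<open>One half for each of the two variables, both in the oscillation and in the
    probability of the exceptional set.\<close>
  define f where "f = e / 2"
  have f: "0 < f" using e by (simp add: f_def)
  have "(\<lambda>n. C * (p ^ 4) ^ n) \<longlonglongrightarrow> C * 0" "(\<lambda>n. C * (q ^ 4) ^ n) \<longlonglongrightarrow> C * 0"
    using pq by (intro tendsto_mult_left LIMSEQ_realpow_zero; simp add: power_less_one_iff)+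
  then have "\<forall>\<^sub>F n in sequentially. C * (p ^ 4) ^ n < f ^ 3" "\<forall>\<^sub>F n in sequentially. C * (q ^ 4) ^ n < f ^ 3"
    using f by (intro order_tendstoD(2)[where y=0]; simp)+
  then have "\<forall>\<^sub>F n in sequentially. C * (p ^ 4) ^ n < f ^ 3 \<and> C * (q ^ 4) ^ n < f ^ 3" by (rule eventually_conj)
  from eventually_happens'[OF sequentially_bot this]
  obtain n where "C * (p ^ 4) ^ n < f ^ 3" "C * (q ^ 4) ^ n < f ^ 3" by blast
  then have n: "C * p ^ (4 * n) \<le> f ^ 3" "C * q ^ (4 * n) \<le> f ^ 3"
    by (simp_all add: power_mult)
  show ?thesis
  proof (intro exI[of _ "1 / 2 ^ n"] conjI allI impI)
    fix X :: "real \<Rightarrow> real \<Rightarrow> 'a \<Rightarrow> real"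
    assume m: "\<forall>s\<in>{0..1}. \<forall>t\<in>{0..1}. X s t \<in> borel_measurable M"
      and cont: "\<forall>w\<in>space M. continuous_on ({0..1} \<times> {0..1}) (\<lambda>p. X (fst p) (snd p) w)"
      and zero: "\<forall>w\<in>space M. \<forall>s\<in>{0..1}. X s 0 w = 0 \<and> X 0 s w = 0"
      and rect: "\<forall>s\<in>{0..1}. \<forall>s'\<in>{0..1}. \<forall>t\<in>{0..1}. \<forall>t'\<in>{0..1}.
        (\<integral>\<^sup>+w. ennreal ((rect_incr X s s' t t' w)\<^sup>2) \<partial>M) \<le> ennreal (K * \<bar>s' - s\<bar> powr (1 + a) * \<bar>t' - t\<bar> powr (1 + b))"
    \<comment> \<open>Exchanging the variables gives the supremum estimate in the other
      direction.\<close>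
    define X' where "X' t s w = X s t w" for t s :: real and w
    have D: "s \<in> {0..1}" if "s \<in> dyadics" for s using dyadics_unit[OF that] by auto
    have "(\<integral>\<^sup>+w. (increment_sup X n w)\<^sup>2 \<partial>M) \<le> ennreal (C * p ^ (4 * n))"
      unfolding C_def p_def q_def
      by (rule increment_sup_moment[OF _ _ K ab]) (use m zero rect D in auto)
    also have "\<dots> \<le> ennreal (f ^ 3)" using n by (intro ennreal_leI)
    finally have m1: "(\<integral>\<^sup>+w. (increment_sup X n w)\<^sup>2 \<partial>M) \<le> ennreal (f ^ 3)" .
    have rX': "rect_incr X' t t' s s' w = rect_incr X s s' t t' w" for t t' s s' w
      by (simp add: rect_incr_def X'_def)
    have "(\<integral>\<^sup>+w. (increment_sup X' n w)\<^sup>2 \<partial>M) \<le> ennreal (chain_const q * chain_const p * K * q ^ (4 * n))"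
      unfolding p_def q_def
      by (rule increment_sup_moment[OF _ _ K ab(2,1)]) (use m zero rect D in \<open>auto simp: rX' mult.assoc mult.commute[of "_ powr (1 + b)"]\<close>, auto simp: X'_def[abs_def])
    also have "\<dots> \<le> ennreal (f ^ 3)" using n by (intro ennreal_leI) (simp add: C_def mult.commute)
    finally have m2: "(\<integral>\<^sup>+w. (increment_sup X' n w)\<^sup>2 \<partial>M) \<le> ennreal (f ^ 3)" .
    have meas[measurable]: "increment_sup X n \<in> borel_measurable M" "increment_sup X' n \<in> borel_measurable M"
      by (intro increment_sup_measurable; use m D in \<open>auto simp: X'_def[abs_def]\<close>)+
    define A where "A = {w \<in> space M. \<not> increment_sup X n w \<le> ennreal f} \<union> {w \<in> space M. \<not> increment_sup X' n w \<le> ennreal f}"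
    show "\<exists>A\<in>sets M. prob A \<le> e \<and> (\<forall>w\<in>space M - A. \<forall>s\<in>{0..1}. \<forall>t\<in>{0..1}. \<forall>s'\<in>{0..1}. \<forall>t'\<in>{0..1}.
        \<bar>s - s'\<bar> < 1 / 2 ^ n \<longrightarrow> \<bar>t - t'\<bar> < 1 / 2 ^ n \<longrightarrow> \<bar>X s t w - X s' t' w\<bar> \<le> e)"
    proof (intro bexI[of _ A] conjI ballI impI)
      show As: "A \<in> sets M" unfolding A_def by measurable
      have "prob A \<le> prob {w \<in> space M. \<not> increment_sup X n w \<le> ennreal f} + prob {w \<in> space M. \<not> increment_sup X' n w \<le> ennreal f}"
        unfolding A_def by (intro measure_Un_le) measurable
      also have "\<dots> \<le> f + f" by (intro add_mono sup_event_bound f m1 m2 meas)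
      finally show "prob A \<le> e" by (simp add: f_def)
      fix w and s t s' t' :: real assume w: "w \<in> space M - A" and s: "s \<in> {0..1}" "t \<in> {0..1}" "s' \<in> {0..1}" "t' \<in> {0..1}"
        and lt: "\<bar>s - s'\<bar> < 1 / 2 ^ n" "\<bar>t - t'\<bar> < 1 / 2 ^ n"
      have c1: "continuous_on ({0..1} \<times> {0..1}) (\<lambda>p. X (fst p) (snd p) w)" using cont w by auto
      have "continuous_on ({0..1} \<times> {0..1}) (\<lambda>p. (\<lambda>p. X (fst p) (snd p) w) (snd p, fst p))"
        by (rule continuous_on_compose2[OF c1]) (auto intro!: continuous_intros)
      then have c2: "continuous_on ({0..1} \<times> {0..1}) (\<lambda>p. X' (fst p) (snd p) w)" by (simp add: X'_def)
      have "ennreal \<bar>X s t w - X s' t w\<bar> \<le> ennreal f"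
        using increment_sup_upper[of X w, OF c1 s(1,3,2) lt(1)] w by (auto simp: A_def)
      moreover have "ennreal \<bar>X' t s' w - X' t' s' w\<bar> \<le> ennreal f"
        using increment_sup_upper[of X' w, OF c2 s(2,4,3) lt(2)] w by (auto simp: A_def)
      ultimately have "\<bar>X s t w - X s' t w\<bar> \<le> f" "\<bar>X s' t w - X s' t' w\<bar> \<le> f"
        using f by (simp_all add: ennreal_le_iff X'_def)
      then show "\<bar>X s t w - X s' t' w\<bar> \<le> e" unfolding f_def by linarith
    qed
  qed auto
qed

section \<open>Poisson point processes\<close>

text \<open>The derivative of the exponential has norm at most 1 on the left half plane, which is
  convex.\<close>

lemma norm_exp_diff_le:
  fixes a b :: complex
  assumes "Re a \<le> 0" "Re b \<le> 0"
  shows "norm (exp a - exp b) \<le> norm (a - b)"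
proof -
  have "norm (exp a - exp b) \<le> 1 * norm (a - b)"
    by (rule field_differentiable_bound[where S="{z. Re z \<le> 0}" and f'=exp])
       (use assms in \<open>auto intro!: convex_halfspace_Re_le derivative_eq_intros\<close>)
  then show ?thesis by simp
qed

text \<open>The Poisson generating function. It is stated over a general field because the base is 1
  for the total mass, real for summability and complex for characteristic functionals.\<close>

lemma poisson_weights_sums:
  fixes c :: "'a :: {real_normed_field, banach}"
  shows "(\<lambda>k. c ^ k * of_real (l ^ k / fact k * exp (- l))) sums exp (of_real l * (c - 1))"
proof -
  have "(\<lambda>k. (of_real l * c) ^ k /\<^sub>R fact k) sums exp (of_real l * c)" by (rule exp_converges)
  from sums_mult2[OF this, of "of_real (exp (- l))"]
  have "(\<lambda>k. (of_real l * c) ^ k /\<^sub>R fact k * of_real (exp (- l))) sums (exp (of_real l * c) * of_real (exp (- l)))" .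
  moreover have "exp (of_real l * c) * of_real (exp (- l)) = exp (of_real l * (c - 1))"
    unfolding exp_of_real[symmetric] by (simp add: exp_add[symmetric] algebra_simps)
  moreover have "(of_real l * c) ^ k /\<^sub>R fact k * of_real (exp (- l)) = c ^ k * of_real (l ^ k / fact k * exp (- l))" for k
    by (simp add: power_mult_distrib scaleR_conv_of_real divide_inverse)
  ultimately show ?thesis by simp
qed

locale poisson_points = prob_space M + nu: sigma_finite_measure \<nu>
  for M :: "'w measure" and \<nu> :: "'e measure" +
  fixes x :: "nat \<Rightarrow> 'w \<Rightarrow> 'e"
  assumes prm: "poisson_random_measure M \<nu> x"
begin

lemma x_measurable[measurable]: "x n \<in> M \<rightarrow>\<^sub>M \<nu>"
  using prm by (auto simp: poisson_random_measure_def)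

lemma N_count_suminf: "N_count x A w = (\<Sum>n. indicator A (x n w))"
proof -
  have "N_count x A w = (\<integral>\<^sup>+n. indicator {n. x n w \<in> A} n \<partial>count_space UNIV)"
    by (simp add: N_count_def)
  also have "\<dots> = (\<Sum>n. indicator {n. x n w \<in> A} n)" by (rule nn_integral_count_space_nat)
  finally show ?thesis by (simp add: indicator_def)
qed

lemma N_count_measurable[measurable]:
  assumes [measurable]: "A \<in> sets \<nu>"
  shows "N_count x A \<in> borel_measurable M"
  unfolding N_count_suminf[abs_def] by measurable

context
  fixes A assumes A[measurable]: "A \<in> sets \<nu>" and fin: "emeasure \<nu> A < \<infinity>"
begin

lemma N_count_prob:
  "prob {w \<in> space M. N_count x A w = of_nat k} = measure \<nu> A ^ k / fact k * exp (- measure \<nu> A)"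
  using prm A fin by (auto simp: poisson_random_measure_def)

text \<open>The Poisson weights sum to 1, so the events of a finite count exhaust the
  probability.\<close>

lemma N_count_AE: "AE w in M. \<exists>k::nat. N_count x A w = of_nat k"
proof -
  let ?E = "\<lambda>k::nat. {w \<in> space M. N_count x A w = of_nat k}"
  have "(\<lambda>k. prob (?E k)) sums prob (\<Union>k. ?E k)"
    by (rule finite_measure_UNION) (auto simp: disjoint_family_on_def)
  moreover have "(\<lambda>k. prob (?E k)) sums 1"
  proof -
    have "(\<lambda>k. 1 ^ k * of_real (measure \<nu> A ^ k / fact k * exp (- measure \<nu> A)) :: real) sums exp (of_real (measure \<nu> A) * (1 - 1))"
      by (rule poisson_weights_sums)
    then show ?thesis unfolding N_count_prob by simp
  qed
  ultimately have "prob (\<Union>k. ?E k) = 1" by (rule sums_unique2)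
  then have "AE w in M. w \<in> (\<Union>k. ?E k)" by (intro AE_prob_1) 
  then show ?thesis by auto
qed

lemma N_count_mean: "(\<integral>\<^sup>+w. N_count x A w \<partial>M) = emeasure \<nu> A"
proof -
  let ?E = "\<lambda>k::nat. {w \<in> space M. N_count x A w = of_nat k}"
  let ?l = "measure \<nu> A"
  have "(\<integral>\<^sup>+w. N_count x A w \<partial>M) = (\<integral>\<^sup>+w. (\<Sum>k. of_nat k * indicator (?E k) w) \<partial>M)"
  proof (rule nn_integral_cong_AE)
    show "AE w in M. N_count x A w = (\<Sum>k. of_nat k * indicator (?E k) w)"
      using N_count_AE AE_space
    proof eventually_elim
      case (elim w)
      then obtain k :: nat where k: "N_count x A w = of_nat k" by blast
      have "(\<Sum>j. of_nat j * indicator (?E j) w :: ennreal) = (\<Sum>j. if j = k then of_nat k else 0)"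
        using k elim by (intro suminf_cong) (auto simp: indicator_def)
      also have "\<dots> = of_nat k" using sums_single[of k "\<lambda>_. of_nat k :: ennreal"] by (simp add: sums_iff)
      finally show ?case using k by simp
    qed
  qed
  also have "\<dots> = (\<Sum>k. of_nat k * emeasure M (?E k))"
    by (simp add: nn_integral_suminf nn_integral_cmult)
  also have "\<dots> = (\<Sum>k. ennreal (real k * (?l ^ k / fact k * exp (- ?l))))"
    unfolding emeasure_eq_measure N_count_prob by (simp add: ennreal_of_nat_eq_real_of_nat ennreal_mult[symmetric])
  also have "\<dots> = ennreal ?l"
  proof -
    have s: "(\<lambda>k. ?l ^ k /\<^sub>R fact k) sums exp ?l" by (rule exp_converges)
    have "(\<lambda>k. real (Suc k) * (?l ^ Suc k / fact (Suc k) * exp (- ?l))) sums ?l"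
    proof -
      have "real (Suc k) * (?l ^ Suc k / fact (Suc k) * exp (- ?l)) = ?l ^ k /\<^sub>R fact k * (?l * exp (- ?l))" for k
        by (simp add: divide_simps del: of_nat_Suc)
      moreover have "exp ?l * (?l * exp (- ?l)) = ?l" by (simp add: exp_minus field_simps)
      ultimately show ?thesis using sums_mult2[OF s, of "?l * exp (- ?l)"] by (simp only:)
    qed
    then have "(\<lambda>k. real k * (?l ^ k / fact k * exp (- ?l))) sums ?l"
      by (subst (asm) sums_Suc_iff) simp
    then show ?thesis by (subst suminf_ennreal2) (auto simp: sums_iff)
  qed
  also have "\<dots> = emeasure \<nu> A" using fin by (simp add: emeasure_eq_ennreal_measure)
  finally show ?thesis .
qed

end

text \<open>The count as an exponent of complex numbers. An infinite count, a null event on sets of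
  finite measure, is sent to 0.\<close>

definition N_nat :: "'e set \<Rightarrow> 'w \<Rightarrow> nat" where
  "N_nat A w = nat \<lfloor>enn2real (N_count x A w)\<rfloor>"

lemma N_nat_eq: "N_count x A w = of_nat k \<Longrightarrow> N_nat A w = k"
  by (simp add: N_nat_def)

lemma N_nat_eq_card:
  assumes "N_count x A w = of_nat k"
  shows "finite {n. x n w \<in> A} \<and> N_nat A w = card {n. x n w \<in> A}"
proof -
  have "emeasure (count_space UNIV) {n. x n w \<in> A} \<noteq> \<infinity>" using assms unfolding N_count_def by simp
  then have f: "finite {n. x n w \<in> A}" by (auto simp: emeasure_count_space split: if_splits)
  then have "N_count x A w = of_nat (card {n. x n w \<in> A})" by (simp add: N_count_def)
  then show ?thesis using f N_nat_eq by simp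
qed

lemma power_N_nat_expectation:
  fixes c :: complex
  assumes A: "A \<in> sets \<nu>" and fin: "emeasure \<nu> A < \<infinity>" and c: "norm c \<le> 1"
  shows "expectation (\<lambda>w. c ^ N_nat A w) = exp (of_real (measure \<nu> A) * (c - 1))"
proof -
  note [measurable] = A
  let ?E = "\<lambda>k::nat. {w \<in> space M. N_count x A w = of_nat k}"
  define f where "f k w = c ^ k * complex_of_real (indicator (?E k) w)" for k w
  have int: "integrable M (f k)" for k
    unfolding f_def by (intro integrable_mult_right integrable_const_bound[where B=1]) (auto simp: indicator_def)
  have If: "expectation (f k) = c ^ k * of_real (measure \<nu> A ^ k / fact k * exp (- measure \<nu> A))" for k
    unfolding f_def by (simp add: N_count_prob[OF A fin])
  have nIf: "expectation (\<lambda>w. norm (f k w)) = norm c ^ k * (measure \<nu> A ^ k / fact k * exp (- measure \<nu> A))" for k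
    unfolding f_def norm_mult norm_power by (simp add: N_count_prob[OF A fin])
  have sing: "f k w = (if k = N_nat A w then c ^ N_nat A w else 0)" if "N_count x A w = of_nat j" "w \<in> space M" for j k w
    using that N_nat_eq[OF that(1)] by (auto simp: f_def indicator_def)
  have ae: "AE w in M. (\<lambda>k. f k w) sums (c ^ N_nat A w)"
    using N_count_AE[OF A fin] AE_space
  proof eventually_elim
    case (elim w)
    then obtain j :: nat where "N_count x A w = of_nat j" by blast
    from sing[OF this elim(2)] show ?case using sums_single[of "N_nat A w" "\<lambda>_. c ^ N_nat A w"] by simp
  qed
  have sm: "(\<lambda>k. expectation (f k)) sums expectation (\<lambda>w. \<Sum>k. f k w)"
  proof (rule sums_integral[OF int])
    show "AE w in M. summable (\<lambda>k. norm (f k w))"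
      using N_count_AE[OF A fin] AE_space
    proof eventually_elim
      case (elim w)
      then obtain j :: nat where "N_count x A w = of_nat j" by blast
      from sing[OF this elim(2)] show ?case by (auto intro!: summable_finite[of "{N_nat A w}"] split: if_splits)
    qed
    show "summable (\<lambda>k. expectation (\<lambda>w. norm (f k w)))"
      unfolding nIf using poisson_weights_sums[of "norm c" "measure \<nu> A"] by (simp add: sums_iff)
  qed
  have "expectation (\<lambda>w. \<Sum>k. f k w) = expectation (\<lambda>w. c ^ N_nat A w)"
  proof (rule integral_cong_AE)
    show "(\<lambda>w. \<Sum>k. f k w) \<in> borel_measurable M" using int by measurable
    show "(\<lambda>w. c ^ N_nat A w) \<in> borel_measurable M" unfolding N_nat_def by measurable
    show "AE w in M. (\<Sum>k. f k w) = c ^ N_nat A w" using ae by eventually_elim (simp add: sums_iff)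
  qed
  with sm have "(\<lambda>k. expectation (f k)) sums expectation (\<lambda>w. c ^ N_nat A w)" by simp
  with poisson_weights_sums[of c "measure \<nu> A"] show ?thesis unfolding If by (rule sums_unique2[symmetric])
qed

text \<open>Written as an image of counting measure times \<open>M\<close>, Campbell's formula
  becomes a change of variables, for nonnegative and for integrable functions alike.\<close>

lemma campbell_measure:
  "distr (count_space (UNIV :: nat set) \<Otimes>\<^sub>M M) \<nu> (\<lambda>(n, w). x n w) = \<nu>"
proof -
  have m[measurable]: "(\<lambda>(n, w). x n w) \<in> count_space (UNIV :: nat set) \<Otimes>\<^sub>M M \<rightarrow>\<^sub>M \<nu>"
    by (rule measurable_pair_measure_countable1) auto
  have fin: "emeasure (distr (count_space (UNIV :: nat set) \<Otimes>\<^sub>M M) \<nu> (\<lambda>(n, w). x n w)) A = emeasure \<nu> A"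
    if A[measurable]: "A \<in> sets \<nu>" and "emeasure \<nu> A < \<infinity>" for A
  proof -
    have "emeasure (distr (count_space (UNIV :: nat set) \<Otimes>\<^sub>M M) \<nu> (\<lambda>(n, w). x n w)) A =
      (\<integral>\<^sup>+p. indicator A ((\<lambda>(n, w). x n w) p) \<partial>(count_space (UNIV :: nat set) \<Otimes>\<^sub>M M))"
      using nn_integral_distr[OF m, of "indicator A"] by simp
    also have "\<dots> = (\<integral>\<^sup>+n. \<integral>\<^sup>+w. indicator A (x n w) \<partial>M \<partial>count_space UNIV)"
      by (subst nn_integral_fst[symmetric]) auto
    also have "\<dots> = (\<Sum>n. \<integral>\<^sup>+w. indicator A (x n w) \<partial>M)" by (rule nn_integral_count_space_nat)
    also have "\<dots> = (\<integral>\<^sup>+w. N_count x A w \<partial>M)" unfolding N_count_suminf by (simp add: nn_integral_suminf)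
    also have "\<dots> = emeasure \<nu> A" by (rule N_count_mean) fact+
    finally show ?thesis .
  qed
  \<comment> \<open>The Poisson law is prescribed only on sets of finite measure; every other set is
    cut into countably many such pieces.\<close>
  obtain D :: "nat \<Rightarrow> 'e set" where D: "range D \<subseteq> sets \<nu>" "(\<Union>i. D i) = space \<nu>" "\<And>i. emeasure \<nu> (D i) \<noteq> \<infinity>" "disjoint_family D"
    using nu.sigma_finite_disjoint by blast
  show ?thesis
  proof (rule measure_eqI)
    fix A assume "A \<in> sets (distr (count_space (UNIV :: nat set) \<Otimes>\<^sub>M M) \<nu> (\<lambda>(n, w). x n w))"
    then have A: "A \<in> sets \<nu>" by simp
    have AD: "A = (\<Union>i. A \<inter> D i)" using D(2) sets.sets_into_space[OF A] by auto
    have dis: "disjoint_family (\<lambda>i. A \<inter> D i)" using D(4) by (auto simp: disjoint_family_on_def)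
    have r: "range (\<lambda>i. A \<inter> D i) \<subseteq> sets \<nu>" using D(1) A by auto
    have finD: "emeasure \<nu> (A \<inter> D i) < \<infinity>" for i
      using D(1) D(3)[of i] A emeasure_mono[of "A \<inter> D i" "D i" \<nu>] by (auto simp: less_top[symmetric] top_unique)
    have "emeasure (distr (count_space (UNIV :: nat set) \<Otimes>\<^sub>M M) \<nu> (\<lambda>(n, w). x n w)) A =
       (\<Sum>i. emeasure (distr (count_space (UNIV :: nat set) \<Otimes>\<^sub>M M) \<nu> (\<lambda>(n, w). x n w)) (A \<inter> D i))"
      by (subst AD, rule suminf_emeasure[symmetric]) (use r dis in auto)
    also have "\<dots> = (\<Sum>i. emeasure \<nu> (A \<inter> D i))" using fin finD r by (intro suminf_cong) auto
    also have "\<dots> = emeasure \<nu> A" by (subst (2) AD, rule suminf_emeasure) (use r dis in auto)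
    finally show "emeasure (distr (count_space (UNIV :: nat set) \<Otimes>\<^sub>M M) \<nu> (\<lambda>(n, w). x n w)) A = emeasure \<nu> A" .
  qed simp
qed

lemma pair_x_measurable: "(\<lambda>(n, w). x n w) \<in> count_space (UNIV :: nat set) \<Otimes>\<^sub>M M \<rightarrow>\<^sub>M \<nu>"
  by (rule measurable_pair_measure_countable1) auto

lemma campbell_nn_integral:
  assumes [measurable]: "f \<in> borel_measurable \<nu>"
  shows "(\<Sum>n. \<integral>\<^sup>+w. f (x n w) \<partial>M) = (\<integral>\<^sup>+z. f z \<partial>\<nu>)"
proof -
  note [measurable] = pair_x_measurable
  have "(\<integral>\<^sup>+z. f z \<partial>\<nu>) = (\<integral>\<^sup>+p. f ((\<lambda>(n, w). x n w) p) \<partial>(count_space (UNIV :: nat set) \<Otimes>\<^sub>M M))"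
    by (subst campbell_measure[symmetric]) (simp add: nn_integral_distr)
  also have "\<dots> = (\<integral>\<^sup>+n. \<integral>\<^sup>+w. f (x n w) \<partial>M \<partial>count_space UNIV)"
    by (subst nn_integral_fst[symmetric]) auto
  finally show ?thesis by (simp add: nn_integral_count_space_nat)
qed

lemma campbell_sum_le:
  assumes "f \<in> borel_measurable \<nu>"
  shows "(\<Sum>n<N. \<integral>\<^sup>+w. f (x n w) \<partial>M) \<le> (\<integral>\<^sup>+z. f z \<partial>\<nu>)"
  unfolding campbell_nn_integral[OF assms, symmetric] by (rule sum_le_suminf) auto

text \<open>The laws of the points sum up to \<nu>, so each of them is dominated by \<nu>.
  Properties of almost every starting point thus hold for every enumerated point almost
  surely.\<close>

lemma campbell_AE:
  assumes "AE z in \<nu>. P z"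
  shows "AE w in M. P (x n w)"
proof -
  obtain N where N: "N \<in> null_sets \<nu>" "{z \<in> space \<nu>. \<not> P z} \<subseteq> N" using assms by (auto simp: eventually_ae_filter)
  have [measurable]: "N \<in> sets \<nu>" using N by auto
  have "(\<Sum>n. \<integral>\<^sup>+w. indicator N (x n w) \<partial>M) = 0" using campbell_nn_integral[of "indicator N"] N by auto
  then have "(\<integral>\<^sup>+w. indicator N (x n w) \<partial>M) = 0" by (simp add: suminf_eq_zero_iff)
  then have "AE w in M. indicator N (x n w) = (0::ennreal)" by (subst (asm) nn_integral_0_iff_AE) auto
  then show ?thesis using AE_space
  proof eventually_elim
    case (elim w) then show ?case using N(2) measurable_space[OF x_measurable, of w n] by (auto simp: indicator_def split: if_splits)
  qed
qed

lemma campbell_integral: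
  fixes f :: "'e \<Rightarrow> 'b :: {banach, second_countable_topology}"
  assumes f: "integrable \<nu> f"
  shows "integrable M (\<lambda>w. f (x n w))" "(\<lambda>n. expectation (\<lambda>w. f (x n w))) sums (LINT z|\<nu>. f z)"
    "(\<integral>\<^sup>+w. (\<Sum>n. ennreal (norm (f (x n w)))) \<partial>M) < \<infinity>"
proof -
  note [measurable] = pair_x_measurable borel_measurable_integrable[OF f]
  interpret count: sigma_finite_measure "count_space (UNIV :: nat set)" by (rule sigma_finite_measure_count_space)
  interpret P: pair_sigma_finite "count_space (UNIV :: nat set)" M ..
  have i: "integrable (count_space (UNIV :: nat set) \<Otimes>\<^sub>M M) (\<lambda>p. f ((\<lambda>(n, w). x n w) p))"
    using f by (subst (asm) campbell_measure[symmetric], subst (asm) integrable_distr_eq) auto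
  have "(\<Sum>n. \<integral>\<^sup>+w. ennreal (norm (f (x n w))) \<partial>M) = (\<integral>\<^sup>+z. ennreal (norm (f z)) \<partial>\<nu>)"
    by (rule campbell_nn_integral) auto
  also have "\<dots> < \<infinity>" using f by (auto simp: integrable_iff_bounded)
  finally have fin: "(\<Sum>n. \<integral>\<^sup>+w. ennreal (norm (f (x n w))) \<partial>M) < \<infinity>" .
  then show "(\<integral>\<^sup>+w. (\<Sum>n. ennreal (norm (f (x n w)))) \<partial>M) < \<infinity>" by (simp add: nn_integral_suminf)
  show "integrable M (\<lambda>w. f (x n w))" for n
  proof (rule integrableI_bounded)
    have "(\<integral>\<^sup>+w. ennreal (norm (f (x n w))) \<partial>M) \<le> (\<Sum>n. \<integral>\<^sup>+w. ennreal (norm (f (x n w))) \<partial>M)"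
      using sum_le_suminf[of "\<lambda>n. \<integral>\<^sup>+w. ennreal (norm (f (x n w))) \<partial>M" "{n}"] by simp
    with fin show "(\<integral>\<^sup>+w. ennreal (norm (f (x n w))) \<partial>M) < \<infinity>" by order
  qed measurable
  have i1: "integrable (count_space UNIV) (\<lambda>n. expectation (\<lambda>w. f (x n w)))"
    using P.integrable_fst'[OF i] by simp
  have "(LINT z|\<nu>. f z) = (LINT p|(count_space (UNIV :: nat set) \<Otimes>\<^sub>M M). f ((\<lambda>(n, w). x n w) p))"
    by (subst campbell_measure[symmetric]) (simp add: integral_distr)
  also have "\<dots> = (LINT n|(count_space UNIV). expectation (\<lambda>w. f (x n w)))"
    using P.integral_fst'[OF i] by simp
  finally show "(\<lambda>n. expectation (\<lambda>w. f (x n w))) sums (LINT z|\<nu>. f z)"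
    using sums_integral_count_space_nat[OF i1] by simp
qed

section \<open>Multiplicative functionals of the Poisson process\<close>

lemma bounded_prod_integrable:
  fixes h :: "nat \<Rightarrow> 'w \<Rightarrow> complex"
  assumes "\<And>n. h n \<in> borel_measurable M" "\<And>n w. norm (h n w) \<le> 1"
  shows "integrable M (\<lambda>w. \<Prod>n<N. h n w)"
proof (rule integrable_const_bound[where B=1])
  show "AE w in M. norm (\<Prod>n<N. h n w) \<le> 1" using assms(2) by (intro AE_I2) (auto simp: prod_norm[symmetric] intro!: prod_le_1)
qed (use assms(1) in measurable)

text \<open>Products of numbers from the unit disc differ by at most the sum of the differences of
  their factors, and Campbell's formula bounds the expected sum by one integral. The bound is free
  of \<open>N\<close>, which permits approximation before the limit.\<close>

lemma prod_expectation_diff_le: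
  fixes h k :: "nat \<Rightarrow> 'e \<Rightarrow> complex"
  assumes [measurable]: "\<And>n. h n \<in> borel_measurable \<nu>" "\<And>n. k n \<in> borel_measurable \<nu>"
    and b: "\<And>n z. norm (h n z) \<le> 1" "\<And>n z. norm (k n z) \<le> 1"
    and g: "integrable \<nu> g" and le: "\<And>n. AE z in \<nu>. norm (h n z - k n z) \<le> g z"
  shows "norm (expectation (\<lambda>w. \<Prod>n<N. h n (x n w)) - expectation (\<lambda>w. \<Prod>n<N. k n (x n w))) \<le> (LINT z|\<nu>. g z)"
proof -
  note [measurable] = borel_measurable_integrable[OF g]
  have i: "integrable M (\<lambda>w. \<Prod>n<N. h n (x n w))" "integrable M (\<lambda>w. \<Prod>n<N. k n (x n w))"
    using b by (intro bounded_prod_integrable; measurable)+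
  have g0: "AE z in \<nu>. 0 \<le> g z" using le[of 0] by eventually_elim (auto intro: order_trans[OF norm_ge_zero])
  have "ennreal (norm (expectation (\<lambda>w. \<Prod>n<N. h n (x n w)) - expectation (\<lambda>w. \<Prod>n<N. k n (x n w)))) =
    ennreal (norm (expectation (\<lambda>w. (\<Prod>n<N. h n (x n w)) - (\<Prod>n<N. k n (x n w)))))"
    using i by simp
  also have "\<dots> \<le> (\<integral>\<^sup>+w. ennreal (norm ((\<Prod>n<N. h n (x n w)) - (\<Prod>n<N. k n (x n w)))) \<partial>M)"
    using i by (intro integral_norm_bound_ennreal) auto
  also have "\<dots> \<le> (\<integral>\<^sup>+w. (\<Sum>n<N. ennreal (norm (h n (x n w) - k n (x n w)))) \<partial>M)"
  proof (rule nn_integral_mono)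
    fix w
    have "norm ((\<Prod>n<N. h n (x n w)) - (\<Prod>n<N. k n (x n w))) \<le> (\<Sum>n<N. norm (h n (x n w) - k n (x n w)))"
      using b by (intro norm_prod_diff) auto
    then show "ennreal (norm ((\<Prod>n<N. h n (x n w)) - (\<Prod>n<N. k n (x n w)))) \<le> (\<Sum>n<N. ennreal (norm (h n (x n w) - k n (x n w))))"
      by (subst sum_ennreal) (auto intro: ennreal_leI)
  qed
  also have "\<dots> = (\<Sum>n<N. \<integral>\<^sup>+w. ennreal (norm (h n (x n w) - k n (x n w))) \<partial>M)"
    by (rule nn_integral_sum) auto
  also have "\<dots> \<le> (\<Sum>n<N. \<integral>\<^sup>+w. ennreal (g (x n w)) \<partial>M)"
  proof (intro sum_mono nn_integral_mono_AE)
    fix n show "AE w in M. ennreal (norm (h n (x n w) - k n (x n w))) \<le> ennreal (g (x n w))"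
      using campbell_AE[OF le[of n], of n] by (auto elim!: eventually_mono intro: ennreal_leI)
  qed
  also have "\<dots> \<le> (\<integral>\<^sup>+z. ennreal (g z) \<partial>\<nu>)" by (rule campbell_sum_le) auto
  also have "\<dots> = ennreal (LINT z|\<nu>. g z)" by (rule nn_integral_eq_integral[OF g g0])
  finally show ?thesis using integral_nonneg_AE[OF g0] by (simp add: ennreal_le_iff)
qed

text \<open>For a step function the product depends only on the counts in the sets
  \<open>A i\<close>. Almost surely finitely many points fall into them, so the partial products are
  eventually constant, equal to a product of powers with independent Poisson exponents.\<close>

lemma prod_functional_step:
  fixes c :: "nat \<Rightarrow> complex" and A :: "nat \<Rightarrow> 'e set"
  assumes A: "\<And>i. i < m \<Longrightarrow> A i \<in> sets \<nu>" "\<And>i. i < m \<Longrightarrow> emeasure \<nu> (A i) < \<infinity>"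
    and dis: "disjoint_family_on A {..<m}" and c: "\<And>i. norm (c i) \<le> 1"
  defines "h \<equiv> \<lambda>z. \<Prod>i<m. if z \<in> A i then c i else 1"
  shows "(\<lambda>N. expectation (\<lambda>w. \<Prod>n<N. h (x n w))) \<longlonglongrightarrow> exp (LINT z|\<nu>. h z - 1)" "integrable \<nu> (\<lambda>z. h z - 1)"
proof -
  have hm: "h \<in> borel_measurable \<nu>" unfolding h_def using A by (intro borel_measurable_prod measurable_If) auto
  have hsum: "h z - 1 = (\<Sum>i<m. (c i - 1) * indicator (A i) z)" for z
  proof (cases "\<exists>j<m. z \<in> A j")
    case True
    then obtain j where j: "j < m" "z \<in> A j" by blast
    have o: "z \<notin> A i" if "i < m" "i \<noteq> j" for i using dis j that by (auto simp: disjoint_family_on_def)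
    have "h z = c j * (\<Prod>i\<in>{..<m} - {j}. if z \<in> A i then c i else 1)"
      unfolding h_def using j by (subst prod.remove[of _ j]) auto
    also have "\<dots> = c j" using o by (subst prod.neutral) auto
    finally have "h z = c j" .
    moreover have "(\<Sum>i<m. (c i - 1) * indicator (A i) z) = (c j - 1) + (\<Sum>i\<in>{..<m} - {j}. (c i - 1) * indicator (A i) z)"
      using j by (subst sum.remove[of _ j]) auto
    moreover have "(\<Sum>i\<in>{..<m} - {j}. (c i - 1) * indicator (A i) z) = 0" using o by (intro sum.neutral) auto
    ultimately show ?thesis by simp
  next
    case False then show ?thesis unfolding h_def by (subst prod.neutral) auto
  qed
  have ind: "integrable \<nu> (\<lambda>z. indicator (A i) z :: complex)" "(LINT z|\<nu>. indicator (A i) z) = complex_of_real (measure \<nu> (A i))" if "i < m" for i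
  proof -
    have "integrable \<nu> (\<lambda>z. complex_of_real (indicator (A i) z))" using A that by (intro integrable_of_real integrable_real_indicator) auto
    then show "integrable \<nu> (\<lambda>z. indicator (A i) z :: complex)" by (simp add: of_real_indicator)
    show "(LINT z|\<nu>. indicator (A i) z) = complex_of_real (measure \<nu> (A i))"
      using A that sets.sets_into_space[OF A(1)[OF that]] by (subst of_real_indicator[symmetric], subst integral_complex_of_real) (simp add: Int_absorb2)
  qed
  show "integrable \<nu> (\<lambda>z. h z - 1)" unfolding hsum using ind by (intro Bochner_Integration.integrable_sum integrable_mult_right) auto
  have Ih: "(LINT z|\<nu>. h z - 1) = (\<Sum>i<m. of_real (measure \<nu> (A i)) * (c i - 1))"
    unfolding hsum using ind by (subst Bochner_Integration.integral_sum) (auto simp: mult.commute)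
  have hb: "norm (h z) \<le> 1" for z unfolding h_def using c by (auto simp: prod_norm[symmetric] intro!: prod_le_1)
  have Nm: "(\<lambda>w. c i ^ N_nat (A i) w) \<in> borel_measurable M" if "i < m" for i
    unfolding N_nat_def using A(1)[OF that] by measurable
  have "(\<lambda>N. expectation (\<lambda>w. \<Prod>n<N. h (x n w))) \<longlonglongrightarrow> expectation (\<lambda>w. \<Prod>i<m. c i ^ N_nat (A i) w)"
  proof (rule integral_dominated_convergence[where w="\<lambda>_. 1"])
    show "(\<lambda>w. \<Prod>i<m. c i ^ N_nat (A i) w) \<in> borel_measurable M" using Nm by (intro borel_measurable_prod) auto
    show "(\<lambda>w. \<Prod>n<N. h (x n w)) \<in> borel_measurable M" for N using hm by measurable
    show "AE w in M. norm (\<Prod>n<N. h (x n w)) \<le> 1" for N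
      using hb by (intro AE_I2) (auto simp: prod_norm[symmetric] intro!: prod_le_1)
    have "AE w in M. \<forall>i\<in>{..<m}. \<exists>k::nat. N_count x (A i) w = of_nat k"
      using A by (intro AE_finite_allI N_count_AE) auto
    then show "AE w in M. (\<lambda>N. \<Prod>n<N. h (x n w)) \<longlonglongrightarrow> (\<Prod>i<m. c i ^ N_nat (A i) w)"
    proof eventually_elim
      case (elim w)
      have f: "finite {n. x n w \<in> A i} \<and> N_nat (A i) w = card {n. x n w \<in> A i}" if "i < m" for i
        using elim that N_nat_eq_card by blast
      have "\<forall>i\<in>{..<m}. \<exists>N0. \<forall>n. x n w \<in> A i \<longrightarrow> n < N0"
        using f by (metis (no_types, lifting) finite_nat_set_iff_bounded lessThan_iff mem_Collect_eq)
      then obtain N0 where N0: "\<And>i n. i < m \<Longrightarrow> x n w \<in> A i \<Longrightarrow> n < N0 i" by (metis lessThan_iff)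
      \<comment> \<open>From this index on no point lies in any of the sets
        \<open>A i\<close>.\<close>
      define N1 where "N1 = (\<Sum>i<m. N0 i)"
      have N1: "n < N1" if "i < m" "x n w \<in> A i" for i n
        using N0[OF that] member_le_sum[of i "{..<m}" N0] that by (auto simp: N1_def)
      have "(\<Prod>n<N. h (x n w)) = (\<Prod>i<m. c i ^ N_nat (A i) w)" if "N \<ge> N1" for N
      proof -
        have "(\<Prod>n<N. h (x n w)) = (\<Prod>i<m. \<Prod>n<N. if x n w \<in> A i then c i else 1)" unfolding h_def by (rule prod.swap)
        also have "\<dots> = (\<Prod>i<m. c i ^ N_nat (A i) w)"
        proof (rule prod.cong[OF refl])
          fix i assume i: "i \<in> {..<m}"
          have "{n. x n w \<in> A i} = {..<N} \<inter> {n. x n w \<in> A i}" using N1[of i] i that by force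
          then show "(\<Prod>n<N. if x n w \<in> A i then c i else 1) = c i ^ N_nat (A i) w"
            using f[of i] i by (simp add: prod.If_cases)
        qed
        finally show ?thesis .
      qed
      then show ?case by (intro tendsto_eventually) (auto simp: eventually_sequentially)
    qed
  qed auto
  also have "expectation (\<lambda>w. \<Prod>i<m. c i ^ N_nat (A i) w) = (\<Prod>i<m. expectation (\<lambda>w. c i ^ N_nat (A i) w))"
  proof (rule indep_vars_lebesgue_integral)
    have "indep_vars (\<lambda>_. borel) (\<lambda>i. N_count x (A i)) {..<m}"
      using prm A dis unfolding poisson_random_measure_def by blast
    from indep_vars_compose2[OF this, of "\<lambda>i e. c i ^ nat \<lfloor>enn2real e\<rfloor>" "\<lambda>_. borel"]
    show "indep_vars (\<lambda>_. borel) (\<lambda>i w. c i ^ N_nat (A i) w) {..<m}" unfolding N_nat_def by measurable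
    show "integrable M (\<lambda>w. c i ^ N_nat (A i) w)" if "i \<in> {..<m}" for i
      using Nm that c by (intro integrable_const_bound[where B=1]) (auto simp: norm_power power_le_one)
  qed simp
  also have "\<dots> = (\<Prod>i<m. exp (of_real (measure \<nu> (A i)) * (c i - 1)))"
    using A c by (intro prod.cong refl power_N_nat_expectation) auto
  also have "\<dots> = exp (LINT z|\<nu>. h z - 1)" unfolding Ih by (simp add: exp_sum)
  finally show "(\<lambda>N. expectation (\<lambda>w. \<Prod>n<N. h (x n w))) \<longlonglongrightarrow> exp (LINT z|\<nu>. h z - 1)" .
qed

text \<open>The integrable function h - 1 is approximated by a simple function, and 1 plus this
  function is projected onto the closed unit disc. The projection is 1-Lipschitz and fixes the
  values of h, so the bound by 1 is gained without increasing the error.\<close>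

lemma ex_step_approximation:
  fixes h :: "'e \<Rightarrow> complex"
  assumes b: "\<And>z. norm (h z) \<le> 1" and int: "integrable \<nu> (\<lambda>z. h z - 1)" and e: "0 < e"
  shows "\<exists>m c A. (\<forall>i<m. A i \<in> sets \<nu>) \<and> (\<forall>i<m. emeasure \<nu> (A i) < \<infinity>) \<and> disjoint_family_on A {..<m::nat} \<and>
    (\<forall>i. norm (c i) \<le> 1) \<and> (\<integral>\<^sup>+z. ennreal (norm (h z - (\<Prod>i<m. if z \<in> A i then c i else 1))) \<partial>\<nu>) < ennreal e"
proof -
  obtain s where s: "\<And>i. Bochner_Integration.simple_bochner_integrable \<nu> (s i)"
    "(\<lambda>i. \<integral>\<^sup>+z. ennreal (norm ((h z - 1) - s i z)) \<partial>\<nu>) \<longlonglongrightarrow> 0"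
    using int by (auto elim!: integrable.cases has_bochner_integral.cases)
  have "\<forall>\<^sub>F i in sequentially. (\<integral>\<^sup>+z. ennreal (norm ((h z - 1) - s i z)) \<partial>\<nu>) < ennreal e"
    using e by (intro order_tendstoD[OF s(2)]) simp
  then obtain i0 where i0: "(\<integral>\<^sup>+z. ennreal (norm ((h z - 1) - s i0 z)) \<partial>\<nu>) < ennreal e"
    using eventually_happens'[OF sequentially_bot] by blast
  define v where "v z = closest_point (cball 0 1) (1 + s i0 z)" for z
  have simple: "simple_function \<nu> (s i0)" and supp: "emeasure \<nu> {z \<in> space \<nu>. s i0 z \<noteq> 0} \<noteq> \<infinity>"
    using s(1)[of i0] by (auto simp: Bochner_Integration.simple_bochner_integrable.simps)
  have vs: "simple_function \<nu> v" unfolding v_def using simple_function_compose[OF simple, of "\<lambda>u. closest_point (cball 0 1) (1 + u)"] by (simp add: o_def)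
  \<comment> \<open>The value 1 is the background of the product and is left out; the remaining
    level sets lie where the simple function is nonzero and hence have finite measure.\<close>
  define V where "V = v ` space \<nu> - {1}"
  have "finite V" using simple_functionD(1)[OF vs] by (simp add: V_def)
  then obtain c0 where c0: "bij_betw c0 {..<card V} V" using ex_bij_betw_nat_finite by (auto simp: atLeast0LessThan)
  define m where "m = card V"
  define c where "c i = (if i < m then c0 i else 0)" for i
  define A where "A i = {z \<in> space \<nu>. v z = c i}" for i
  have inV: "c i \<in> V" if "i < m" for i using c0 that by (auto simp: c_def m_def bij_betw_def)
  have injc: "inj_on c {..<m}" using c0 by (auto simp: c_def m_def bij_betw_def inj_on_def)
  have Vball: "norm u \<le> 1" if "u \<in> V" for u
    using that closest_point_in_set[of "cball 0 1 :: complex set"] by (auto simp: V_def v_def dist_norm)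
  have As: "A i \<in> sets \<nu>" for i
  proof -
    have "A i = v -` {c i} \<inter> space \<nu>" by (auto simp: A_def)
    then show ?thesis using simple_functionD(2)[OF vs] by simp
  qed
  have Af: "emeasure \<nu> (A i) < \<infinity>" if "i < m" for i
  proof -
    have "A i \<subseteq> {z \<in> space \<nu>. s i0 z \<noteq> 0}"
    proof
      fix z assume "z \<in> A i"
      then have "z \<in> space \<nu>" "v z \<noteq> 1" using inV[OF that] by (auto simp: A_def V_def)
      then show "z \<in> {z \<in> space \<nu>. s i0 z \<noteq> 0}" by (auto simp: v_def closest_point_self)
    qed
    moreover have "{z \<in> space \<nu>. s i0 z \<noteq> 0} = s i0 -` (- {0}) \<inter> space \<nu>" by auto
    then have "{z \<in> space \<nu>. s i0 z \<noteq> 0} \<in> sets \<nu>" using simple_functionD(2)[OF simple, of "- {0}"] by simp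
    ultimately have "emeasure \<nu> (A i) \<le> emeasure \<nu> {z \<in> space \<nu>. s i0 z \<noteq> 0}" by (rule emeasure_mono)
    with supp show ?thesis by (simp add: less_top[symmetric] top_unique) (metis top_unique)
  qed
  have dis: "disjoint_family_on A {..<m}"
    using injc by (auto simp: disjoint_family_on_def A_def inj_on_def)
  have eq: "(\<Prod>i<m. if z \<in> A i then c i else 1) = v z" if z: "z \<in> space \<nu>" for z
  proof (cases "v z = 1")
    case True
    then have "z \<notin> A i" if "i < m" for i using inV[OF that] by (auto simp: A_def V_def)
    then show ?thesis using True by (subst prod.neutral) auto
  next
    case False
    then have "v z \<in> c0 ` {..<m}" using z bij_betw_imp_surj_on[OF c0] by (auto simp: V_def m_def)
    then obtain j where j: "j < m" "v z = c j" by (auto simp: c_def)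
    have o: "z \<notin> A i" if "i < m" "i \<noteq> j" for i using injc j that by (auto simp: A_def inj_on_def)
    have "(\<Prod>i<m. if z \<in> A i then c i else 1) = c j * (\<Prod>i\<in>{..<m} - {j}. if z \<in> A i then c i else 1)"
      using j z by (subst prod.remove[of _ j]) (auto simp: A_def)
    also have "\<dots> = c j" using o by (subst prod.neutral) auto
    finally show ?thesis using j by simp
  qed
  have "(\<integral>\<^sup>+z. ennreal (norm (h z - (\<Prod>i<m. if z \<in> A i then c i else 1))) \<partial>\<nu>) \<le> (\<integral>\<^sup>+z. ennreal (norm ((h z - 1) - s i0 z)) \<partial>\<nu>)"
  proof (intro nn_integral_mono ennreal_leI)
    fix z assume z: "z \<in> space \<nu>"
    have "dist (closest_point (cball 0 1) (h z)) (closest_point (cball 0 1) (1 + s i0 z)) \<le> dist (h z) (1 + s i0 z)"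
      by (rule closest_point_lipschitz) auto
    moreover have "closest_point (cball 0 1) (h z) = h z" using b by (intro closest_point_self) (simp add: dist_norm)
    ultimately show "norm (h z - (\<Prod>i<m. if z \<in> A i then c i else 1)) \<le> norm ((h z - 1) - s i0 z)"
      unfolding eq[OF z] by (simp add: v_def dist_norm algebra_simps)
  qed
  also note i0
  finally have "(\<integral>\<^sup>+z. ennreal (norm (h z - (\<Prod>i<m. if z \<in> A i then c i else 1))) \<partial>\<nu>) < ennreal e" .
  moreover have "norm (c i) \<le> 1" for i using Vball inV[of i] by (cases "i < m") (auto simp: c_def)
  ultimately show ?thesis using As Af dis by (intro exI[of _ m] exI[of _ c] exI[of _ A]) auto
qed

lemma Re_integral_le_0:
  fixes h :: "'e \<Rightarrow> complex"
  assumes "\<And>z. norm (h z) \<le> 1" "integrable \<nu> (\<lambda>z. h z - 1)"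
  shows "Re (LINT z|\<nu>. h z - 1) \<le> 0"
proof -
  have "Re (LINT z|\<nu>. h z - 1) = (LINT z|\<nu>. Re (h z - 1))" using assms(2) by (subst integral_Re) auto
  also have "\<dots> \<le> (LINT z|\<nu>. 0)"
  proof (rule integral_mono)
    fix z show "Re (h z - 1) \<le> 0" using assms(1)[of z] abs_Re_le_cmod[of "h z"] by simp
  qed (use integrable_Re[OF assms(2)] in auto)
  finally show ?thesis by simp
qed

text \<open>The generating functional of a Poisson process, by three errors of size e / 3: replacing
  h by a step function in the products, the limit for the step function, and the comparison of the
  two exponents.\<close>

lemma prod_functional_limit:
  fixes h :: "'e \<Rightarrow> complex"
  assumes hm[measurable]: "h \<in> borel_measurable \<nu>" and b: "\<And>z. norm (h z) \<le> 1" and int: "integrable \<nu> (\<lambda>z. h z - 1)"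
  shows "(\<lambda>N. expectation (\<lambda>w. \<Prod>n<N. h (x n w))) \<longlonglongrightarrow> exp (LINT z|\<nu>. h z - 1)"
proof (rule LIMSEQ_I)
  fix e :: real assume e: "0 < e"
  obtain m c A where A: "\<And>i. i < m \<Longrightarrow> A i \<in> sets \<nu>" "\<And>i. i < m \<Longrightarrow> emeasure \<nu> (A i) < \<infinity>" "disjoint_family_on A {..<m::nat}"
    "\<And>i. norm (c i) \<le> 1" "(\<integral>\<^sup>+z. ennreal (norm (h z - (\<Prod>i<m. if z \<in> A i then c i else 1))) \<partial>\<nu>) < ennreal (e/3)"
    using ex_step_approximation[OF b int, of "e/3"] e by auto
  define k where "k z = (\<Prod>i<m. if z \<in> A i then c i else 1)" for z
  have klim: "(\<lambda>N. expectation (\<lambda>w. \<Prod>n<N. k (x n w))) \<longlonglongrightarrow> exp (LINT z|\<nu>. k z - 1)" and kint: "integrable \<nu> (\<lambda>z. k z - 1)"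
    unfolding k_def using prod_functional_step[OF A(1-4)] by auto
  have km[measurable]: "k \<in> borel_measurable \<nu>" unfolding k_def using A by (intro borel_measurable_prod measurable_If) auto
  have kb: "norm (k z) \<le> 1" for z unfolding k_def using A(4) by (auto simp: prod_norm[symmetric] intro!: prod_le_1)
  have "integrable \<nu> (\<lambda>z. (h z - 1) - (k z - 1))" by (rule Bochner_Integration.integrable_diff[OF int kint])
  then have hk: "integrable \<nu> (\<lambda>z. h z - k z)" by simp
  have "ennreal (LINT z|\<nu>. norm (h z - k z)) < ennreal (e/3)"
    using A(5) unfolding k_def[symmetric] by (subst nn_integral_eq_integral[symmetric]) (auto intro: integrable_norm hk)
  then have small: "(LINT z|\<nu>. norm (h z - k z)) < e / 3" by (subst (asm) ennreal_less_iff) auto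
  have d1: "norm (expectation (\<lambda>w. \<Prod>n<N. h (x n w)) - expectation (\<lambda>w. \<Prod>n<N. k (x n w))) \<le> (LINT z|\<nu>. norm (h z - k z))" for N
    by (rule prod_expectation_diff_le) (use b kb hk in auto)
  have "norm (exp (LINT z|\<nu>. h z - 1) - exp (LINT z|\<nu>. k z - 1)) \<le> norm ((LINT z|\<nu>. h z - 1) - (LINT z|\<nu>. k z - 1))"
    by (intro norm_exp_diff_le Re_integral_le_0 b kb int kint)
  also have "(LINT z|\<nu>. h z - 1) - (LINT z|\<nu>. k z - 1) = (LINT z|\<nu>. h z - k z)"
    using int kint by (subst Bochner_Integration.integral_diff[symmetric]) auto
  also have "norm (LINT z|\<nu>. h z - k z) \<le> (LINT z|\<nu>. norm (h z - k z))" by (rule integral_norm_bound)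
  finally have d2: "norm (exp (LINT z|\<nu>. h z - 1) - exp (LINT z|\<nu>. k z - 1)) < e / 3" using small by linarith
  obtain N0 where N0: "\<And>N. N \<ge> N0 \<Longrightarrow> norm (expectation (\<lambda>w. \<Prod>n<N. k (x n w)) - exp (LINT z|\<nu>. k z - 1)) < e / 3"
    using LIMSEQ_D[OF klim, of "e/3"] e by auto
  have tri: "norm (p - s) < e" if "norm (p - q) < e / 3" "norm (s - r) < e / 3" "norm (q - r) < e / 3" for p q r s :: complex
  proof -
    have "p - s = (p - q) + (q - r) + (r - s)" by simp
    then have "norm (p - s) \<le> norm (p - q) + norm (q - r) + norm (r - s)" by (metis norm_triangle_ineq order_trans add_right_mono)
    then show ?thesis using that by (simp add: norm_minus_commute)
  qed
  show "\<exists>no. \<forall>N\<ge>no. norm (expectation (\<lambda>w. \<Prod>n<N. h (x n w)) - exp (LINT z|\<nu>. h z - 1)) < e"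
  proof (intro exI[of _ N0] allI impI)
    fix N assume "N0 \<le> N"
    show "norm (expectation (\<lambda>w. \<Prod>n<N. h (x n w)) - exp (LINT z|\<nu>. h z - 1)) < e"
      by (rule tri[OF le_less_trans[OF d1 small] d2 N0[OF \<open>N0 \<le> N\<close>]])
  qed
qed

text \<open>The factors \<open>h n\<close> may depend on \<open>n\<close>: it suffices that they share their second-order expansion
  \<open>1 + \<i> m - q / 2\<close> up to the error \<open>g / 6\<close>.\<close>

lemma poisson_sum_char_bound:
  fixes Z :: "nat \<Rightarrow> 'w \<Rightarrow> real" and h :: "nat \<Rightarrow> 'e \<Rightarrow> complex"
  assumes Zm[measurable]: "\<And>n. Z n \<in> borel_measurable M" and Zs: "AE w in M. summable (\<lambda>n. \<bar>Z n w\<bar>)"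
    and hm[measurable]: "\<And>n. h n \<in> borel_measurable \<nu>" and hb: "\<And>n z. norm (h n z) \<le> 1"
    and decouple: "\<And>N. expectation (\<lambda>w. \<Prod>n<N. iexp (Z n w)) = expectation (\<lambda>w. \<Prod>n<N. h n (x n w))"
    and m: "integrable \<nu> m" and q: "integrable \<nu> q" and q0: "AE z in \<nu>. 0 \<le> q z" and g: "integrable \<nu> g"
    and approx: "\<And>n. AE z in \<nu>. norm (h n z - (1 + \<i> * of_real (m z) - of_real (q z) / 2)) \<le> g z / 6"
  shows "norm (expectation (\<lambda>w. iexp ((\<Sum>n. Z n w) - (LINT z|\<nu>. m z))) - of_real (exp (- (LINT z|\<nu>. q z) / 2))) \<le> (LINT z|\<nu>. g z) / 2"
proof -
  define T where "T z = \<i> * complex_of_real (m z) - of_real (q z) / 2" for z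
  have Tint: "integrable \<nu> T" unfolding T_def using m q by auto
  have IT: "(LINT z|\<nu>. T z) = \<i> * of_real (LINT z|\<nu>. m z) - of_real (LINT z|\<nu>. q z) / 2"
    unfolding T_def using m q by (subst Bochner_Integration.integral_diff) auto
  have h0int: "integrable \<nu> (\<lambda>z. h 0 z - 1)"
  proof (rule Bochner_Integration.integrable_bound)
    show "integrable \<nu> (\<lambda>z. norm (T z) + g z / 6)" using Tint g by auto
    show "AE z in \<nu>. norm (h 0 z - 1) \<le> norm (norm (T z) + g z / 6)"
      using approx[of 0]
    proof eventually_elim
      case (elim z)
      have "norm (h 0 z - 1) \<le> norm (h 0 z - (1 + \<i> * of_real (m z) - of_real (q z) / 2)) + norm (T z)"
        using norm_triangle_ineq[of "h 0 z - (1 + \<i> * of_real (m z) - of_real (q z) / 2)" "T z"] by (simp add: T_def)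
      with elim show ?case by simp
    qed
  qed simp
  have E0: "(\<lambda>N. expectation (\<lambda>w. \<Prod>n<N. h 0 (x n w))) \<longlonglongrightarrow> exp (LINT z|\<nu>. h 0 z - 1)"
    by (rule prod_functional_limit[OF hm hb h0int])
  \<comment> \<open>All \<open>h n\<close> lie within g / 6 of the same expansion, hence within g /
    3 of \<open>h 0\<close>; together with the g / 6 for replacing \<open>h 0\<close> by the
    expansion this makes the final g / 2.\<close>
  have dist0: "norm (expectation (\<lambda>w. \<Prod>n<N. h n (x n w)) - expectation (\<lambda>w. \<Prod>n<N. h 0 (x n w))) \<le> (LINT z|\<nu>. g z / 3)" for N
  proof (rule prod_expectation_diff_le)
    fix n show "AE z in \<nu>. norm (h n z - h 0 z) \<le> g z / 3"
      using approx[of n] approx[of 0]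
    proof eventually_elim
      case (elim z)
      have "norm (h n z - h 0 z) \<le> norm (h n z - (1 + \<i> * of_real (m z) - of_real (q z) / 2)) + norm (h 0 z - (1 + \<i> * of_real (m z) - of_real (q z) / 2))"
        by (metis (no_types, lifting) norm_triangle_ineq4 diff_diff_eq2 diff_add_cancel add_diff_cancel_left' diff_add_eq_diff_diff_swap)
      with elim show ?case by simp
    qed
  qed (use hb g in auto)
  have EZ: "(\<lambda>N. expectation (\<lambda>w. \<Prod>n<N. h n (x n w))) \<longlonglongrightarrow> expectation (\<lambda>w. iexp (\<Sum>n. Z n w))"
    unfolding decouple[symmetric]
  proof (rule integral_dominated_convergence[where w="\<lambda>_. 1"])
    show "AE w in M. (\<lambda>N. \<Prod>n<N. iexp (Z n w)) \<longlonglongrightarrow> iexp (\<Sum>n. Z n w)"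
      using Zs
    proof eventually_elim
      case (elim w)
      have "(\<lambda>N. \<Sum>n<N. Z n w) \<longlonglongrightarrow> (\<Sum>n. Z n w)" using summable_LIMSEQ[OF summable_rabs_cancel[OF elim]] .
      then have "(\<lambda>N. iexp (\<Sum>n<N. Z n w)) \<longlonglongrightarrow> iexp (\<Sum>n. Z n w)" by (intro tendsto_intros)
      then show ?case by (simp add: exp_sum sum_distrib_left)
    qed
    show "AE w in M. norm (\<Prod>n<N. iexp (Z n w)) \<le> 1" for N by (simp add: prod_norm[symmetric])
  qed auto
  have lim1: "norm (expectation (\<lambda>w. iexp (\<Sum>n. Z n w)) - exp (LINT z|\<nu>. h 0 z - 1)) \<le> (LINT z|\<nu>. g z / 3)"
    by (rule LIMSEQ_le_const2[OF tendsto_norm[OF tendsto_diff[OF EZ E0]]]) (use dist0 in auto)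
  have "norm (exp (LINT z|\<nu>. h 0 z - 1) - exp (LINT z|\<nu>. T z)) \<le> norm ((LINT z|\<nu>. h 0 z - 1) - (LINT z|\<nu>. T z))"
    using q0 by (intro norm_exp_diff_le Re_integral_le_0 hb h0int) (simp add: IT integral_nonneg_AE)
  also have "\<dots> = norm (LINT z|\<nu>. h 0 z - 1 - T z)"
    by (simp only: Bochner_Integration.integral_diff[OF h0int Tint])
  also have "\<dots> \<le> (LINT z|\<nu>. norm (h 0 z - 1 - T z))" by (rule integral_norm_bound)
  also have "\<dots> \<le> (LINT z|\<nu>. g z / 6)"
  proof (rule integral_mono_AE)
    show "AE z in \<nu>. norm (h 0 z - 1 - T z) \<le> g z / 6"
      using approx[of 0] by eventually_elim (simp add: T_def algebra_simps)
  qed (use h0int Tint g in auto)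
  finally have lim2: "norm (exp (LINT z|\<nu>. h 0 z - 1) - exp (LINT z|\<nu>. T z)) \<le> (LINT z|\<nu>. g z / 6)" .
  have "norm (expectation (\<lambda>w. iexp (\<Sum>n. Z n w)) - exp (LINT z|\<nu>. T z)) \<le> (LINT z|\<nu>. g z / 3) + (LINT z|\<nu>. g z / 6)"
    using norm_triangle_ineq[of "expectation (\<lambda>w. iexp (\<Sum>n. Z n w)) - exp (LINT z|\<nu>. h 0 z - 1)" "exp (LINT z|\<nu>. h 0 z - 1) - exp (LINT z|\<nu>. T z)"] lim1 lim2
    by simp
  also have "\<dots> = (LINT z|\<nu>. g z) / 2" using g by simp
  finally have main: "norm (expectation (\<lambda>w. iexp (\<Sum>n. Z n w)) - exp (LINT z|\<nu>. T z)) \<le> (LINT z|\<nu>. g z) / 2" .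
  \<comment> \<open>Centring multiplies by a number of modulus 1, which removes the imaginary part
    of the exponent and leaves the error unchanged.\<close>
  let ?e = "iexp (- (LINT z|\<nu>. m z))"
  have "expectation (\<lambda>w. iexp ((\<Sum>n. Z n w) - (LINT z|\<nu>. m z))) = ?e * expectation (\<lambda>w. iexp (\<Sum>n. Z n w))"
    by (subst integral_mult_right_zero[symmetric]) (simp add: exp_add[symmetric] algebra_simps)
  moreover have "?e * exp (LINT z|\<nu>. T z) = of_real (exp (- (LINT z|\<nu>. q z) / 2))"
    unfolding IT exp_of_real[symmetric] exp_add[symmetric] by simp
  ultimately have "expectation (\<lambda>w. iexp ((\<Sum>n. Z n w) - (LINT z|\<nu>. m z))) - of_real (exp (- (LINT z|\<nu>. q z) / 2)) =
     ?e * (expectation (\<lambda>w. iexp (\<Sum>n. Z n w)) - exp (LINT z|\<nu>. T z))"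
    by (simp add: right_diff_distrib)
  also have "norm \<dots> = norm (expectation (\<lambda>w. iexp (\<Sum>n. Z n w)) - exp (LINT z|\<nu>. T z))"
    unfolding norm_mult by simp
  finally show ?thesis using main by simp
qed

end

section \<open>Fubini identities and three-time laws of stable processes\<close>

context pair_sigma_finite
begin

lemma nn_integral_prod_of_integrals:
  assumes [measurable]: "case_prod a \<in> borel_measurable (M1 \<Otimes>\<^sub>M M2)" "case_prod c \<in> borel_measurable (M1 \<Otimes>\<^sub>M M2)"
  shows "(\<integral>\<^sup>+p. (\<integral>\<^sup>+u. a p u \<partial>M2) * (\<integral>\<^sup>+v. c p v \<partial>M2) \<partial>M1) = (\<integral>\<^sup>+u. \<integral>\<^sup>+v. \<integral>\<^sup>+p. a p u * c p v \<partial>M1 \<partial>M2 \<partial>M2)"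
proof -
  have "(\<integral>\<^sup>+p. (\<integral>\<^sup>+u. a p u \<partial>M2) * (\<integral>\<^sup>+v. c p v \<partial>M2) \<partial>M1) = (\<integral>\<^sup>+p. \<integral>\<^sup>+u. a p u * (\<integral>\<^sup>+v. c p v \<partial>M2) \<partial>M2 \<partial>M1)"
    by (intro nn_integral_cong nn_integral_multc[symmetric]) measurable
  also have "\<dots> = (\<integral>\<^sup>+u. \<integral>\<^sup>+p. a p u * (\<integral>\<^sup>+v. c p v \<partial>M2) \<partial>M1 \<partial>M2)"
    by (rule Fubini'[symmetric]) measurable
  also have "\<dots> = (\<integral>\<^sup>+u. \<integral>\<^sup>+p. \<integral>\<^sup>+v. a p u * c p v \<partial>M2 \<partial>M1 \<partial>M2)"
    by (intro nn_integral_cong nn_integral_cmult[symmetric]) measurable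
  also have "\<dots> = (\<integral>\<^sup>+u. \<integral>\<^sup>+v. \<integral>\<^sup>+p. a p u * c p v \<partial>M1 \<partial>M2 \<partial>M2)"
    by (intro nn_integral_cong Fubini'[symmetric]) measurable
  finally show ?thesis .
qed

lemma nn_integral_prod3_of_integrals:
  assumes [measurable]: "case_prod a \<in> borel_measurable (M1 \<Otimes>\<^sub>M M2)" "case_prod c \<in> borel_measurable (M1 \<Otimes>\<^sub>M M2)"
    "case_prod d \<in> borel_measurable (M1 \<Otimes>\<^sub>M M2)"
  shows "(\<integral>\<^sup>+p. (\<integral>\<^sup>+u. a p u \<partial>M2) * ((\<integral>\<^sup>+v. c p v \<partial>M2) * (\<integral>\<^sup>+t. d p t \<partial>M2)) \<partial>M1) =
     (\<integral>\<^sup>+u. \<integral>\<^sup>+v. \<integral>\<^sup>+t. \<integral>\<^sup>+p. a p u * c p v * d p t \<partial>M1 \<partial>M2 \<partial>M2 \<partial>M2)"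
proof -
  have "(\<integral>\<^sup>+p. (\<integral>\<^sup>+u. a p u \<partial>M2) * ((\<integral>\<^sup>+v. c p v \<partial>M2) * (\<integral>\<^sup>+t. d p t \<partial>M2)) \<partial>M1) =
     (\<integral>\<^sup>+p. \<integral>\<^sup>+u. a p u * ((\<integral>\<^sup>+v. c p v \<partial>M2) * (\<integral>\<^sup>+t. d p t \<partial>M2)) \<partial>M2 \<partial>M1)"
    by (intro nn_integral_cong nn_integral_multc[symmetric]) measurable
  also have "\<dots> = (\<integral>\<^sup>+u. \<integral>\<^sup>+p. a p u * ((\<integral>\<^sup>+v. c p v \<partial>M2) * (\<integral>\<^sup>+t. d p t \<partial>M2)) \<partial>M1 \<partial>M2)"
    by (rule Fubini'[symmetric]) measurable
  also have "\<dots> = (\<integral>\<^sup>+u. \<integral>\<^sup>+p. (\<integral>\<^sup>+v. a p u * c p v \<partial>M2) * (\<integral>\<^sup>+t. d p t \<partial>M2) \<partial>M1 \<partial>M2)"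
  proof (intro nn_integral_cong)
    fix u p assume "u \<in> space M2" "p \<in> space M1"
    then have [measurable]: "c p \<in> borel_measurable M2" by measurable
    show "a p u * ((\<integral>\<^sup>+v. c p v \<partial>M2) * (\<integral>\<^sup>+t. d p t \<partial>M2)) = (\<integral>\<^sup>+v. a p u * c p v \<partial>M2) * (\<integral>\<^sup>+t. d p t \<partial>M2)"
      by (subst nn_integral_cmult) (auto simp: mult.assoc)
  qed
  also have "\<dots> = (\<integral>\<^sup>+u. \<integral>\<^sup>+v. \<integral>\<^sup>+t. \<integral>\<^sup>+p. a p u * c p v * d p t \<partial>M1 \<partial>M2 \<partial>M2 \<partial>M2)"
  proof (intro nn_integral_cong)
    fix u assume [measurable]: "u \<in> space M2"
    show "(\<integral>\<^sup>+p. (\<integral>\<^sup>+v. a p u * c p v \<partial>M2) * (\<integral>\<^sup>+t. d p t \<partial>M2) \<partial>M1) = (\<integral>\<^sup>+v. \<integral>\<^sup>+t. \<integral>\<^sup>+p. a p u * c p v * d p t \<partial>M1 \<partial>M2 \<partial>M2)"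
      by (rule nn_integral_prod_of_integrals) measurable
  qed
  finally show ?thesis .
qed

text \<open>Fubini's theorem on \<open>M1\<close> times two copies of \<open>M2\<close>, with
  integrability required only through iterated absolute integrals, the form in which moment bounds
  deliver it.\<close>

lemma integral_prod_of_integrals:
  fixes f g :: "'a \<Rightarrow> 'b \<Rightarrow> real"
  assumes f[measurable]: "case_prod f \<in> borel_measurable (M1 \<Otimes>\<^sub>M M2)" and g[measurable]: "case_prod g \<in> borel_measurable (M1 \<Otimes>\<^sub>M M2)"
    and fin: "(\<integral>\<^sup>+p. (\<integral>\<^sup>+u. ennreal \<bar>f p u\<bar> \<partial>M2) * (\<integral>\<^sup>+v. ennreal \<bar>g p v\<bar> \<partial>M2) \<partial>M1) < \<infinity>"
  shows "integrable M1 (\<lambda>p. (LINT u|M2. f p u) * (LINT v|M2. g p v))"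
    "(LINT p|M1. (LINT u|M2. f p u) * (LINT v|M2. g p v)) = (LINT u|M2. (LINT v|M2. (LINT p|M1. f p u * g p v )  ))"
proof -
  interpret L: pair_sigma_finite M2 M2 ..
  have Q: "sigma_finite_measure (M2 \<Otimes>\<^sub>M M2)" by (rule L.sigma_finite_measure_axioms)
  interpret PQ: pair_sigma_finite M1 "M2 \<Otimes>\<^sub>M M2" by (intro pair_sigma_finite.intro Q M1.sigma_finite_measure_axioms)
  let ?F = "\<lambda>(p, uv). f p (fst uv) * g p (snd uv)"
  have Fm[measurable]: "?F \<in> borel_measurable (M1 \<Otimes>\<^sub>M (M2 \<Otimes>\<^sub>M M2))" by measurable
  have "(\<integral>\<^sup>+q. ennreal (norm (?F q)) \<partial>(M1 \<Otimes>\<^sub>M (M2 \<Otimes>\<^sub>M M2))) = (\<integral>\<^sup>+p. \<integral>\<^sup>+uv. ennreal (norm (?F (p, uv))) \<partial>(M2 \<Otimes>\<^sub>M M2) \<partial>M1)"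
    by (rule sigma_finite_measure.nn_integral_fst[OF Q, symmetric]) measurable
  also have "\<dots> = (\<integral>\<^sup>+p. \<integral>\<^sup>+u. \<integral>\<^sup>+v. ennreal \<bar>f p u\<bar> * ennreal \<bar>g p v\<bar> \<partial>M2 \<partial>M2 \<partial>M1)"
  proof (intro nn_integral_cong)
    fix p assume [measurable]: "p \<in> space M1"
    have "(\<lambda>uv. ennreal (norm (?F (p, uv)))) \<in> borel_measurable (M2 \<Otimes>\<^sub>M M2)" by measurable
    from M2.nn_integral_fst[OF this]
    show "(\<integral>\<^sup>+uv. ennreal (norm (?F (p, uv))) \<partial>(M2 \<Otimes>\<^sub>M M2)) = (\<integral>\<^sup>+u. \<integral>\<^sup>+v. ennreal \<bar>f p u\<bar> * ennreal \<bar>g p v\<bar> \<partial>M2 \<partial>M2)"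
      by (simp add: abs_mult ennreal_mult)
  qed
  also have "\<dots> = (\<integral>\<^sup>+p. (\<integral>\<^sup>+u. ennreal \<bar>f p u\<bar> \<partial>M2) * (\<integral>\<^sup>+v. ennreal \<bar>g p v\<bar> \<partial>M2) \<partial>M1)"
  proof (intro nn_integral_cong)
    fix p assume [measurable]: "p \<in> space M1"
    show "(\<integral>\<^sup>+u. \<integral>\<^sup>+v. ennreal \<bar>f p u\<bar> * ennreal \<bar>g p v\<bar> \<partial>M2 \<partial>M2) = (\<integral>\<^sup>+u. ennreal \<bar>f p u\<bar> \<partial>M2) * (\<integral>\<^sup>+v. ennreal \<bar>g p v\<bar> \<partial>M2)"
      by (simp add: nn_integral_cmult nn_integral_multc)
  qed
  finally have int: "integrable (M1 \<Otimes>\<^sub>M (M2 \<Otimes>\<^sub>M M2)) ?F" using fin by (intro integrableI_bounded) auto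
  have eq: "AE p in M1. (LINT uv|(M2 \<Otimes>\<^sub>M M2). ?F (p, uv)) = (LINT u|M2. f p u) * (LINT v|M2. g p v)"
    using PQ.AE_integrable_fst'[OF int]
  proof eventually_elim
    case (elim p)
    have "(LINT uv|(M2 \<Otimes>\<^sub>M M2). ?F (p, uv)) = (LINT u|M2. (LINT v|M2. f p u * g p v))"
      using L.integral_fst'[OF elim] by simp
    then show ?case by simp
  qed
  have m1: "(\<lambda>p. (LINT u|M2. f p u) * (LINT v|M2. g p v)) \<in> borel_measurable M1" by measurable
  show "integrable M1 (\<lambda>p. (LINT u|M2. f p u) * (LINT v|M2. g p v))"
    by (rule integrable_cong_AE_imp[OF PQ.integrable_fst'[OF int] m1 eq[THEN AE_mp]]) (auto intro!: AE_I2)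
  have "(LINT p|M1. (LINT u|M2. f p u) * (LINT v|M2. g p v)) = (LINT p|M1. (LINT uv|(M2 \<Otimes>\<^sub>M M2). ?F (p, uv)))"
    by (rule integral_cong_AE[OF m1]) (use eq in \<open>auto elim!: eventually_mono\<close>)
  also have "\<dots> = (LINT uv|(M2 \<Otimes>\<^sub>M M2). (LINT p|M1. ?F (p, uv)))"
    using PQ.Fubini_integral[of "\<lambda>p uv. ?F (p, uv)"] int by simp
  also have "\<dots> = (LINT u|M2. (LINT v|M2. (LINT p|M1. f p u * g p v )  ))"
  proof -
    have "integrable (M2 \<Otimes>\<^sub>M M2) (\<lambda>uv. (LINT p|M1. ?F (p, uv)))"
      using PQ.integrable_snd[of "\<lambda>p uv. ?F (p, uv)"] int by simp
    from L.integral_fst'[OF this] show ?thesis by simp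
  qed
  finally show "(LINT p|M1. (LINT u|M2. f p u) * (LINT v|M2. g p v)) = (LINT u|M2. (LINT v|M2. (LINT p|M1. f p u * g p v )  ))" .
qed

end

text \<open>Time is approximated by dyadic times, at each of which the process is measurable. Adding
  1 after rounding down keeps these times strictly to the right of the given one, where
  right-continuity applies; \<open>max 0\<close> fills in negative times.\<close>

lemma right_continuous_joint_measurable:
  fixes Y :: "real \<Rightarrow> 'w \<Rightarrow> real"
  assumes m: "\<And>t. 0 \<le> t \<Longrightarrow> Y t \<in> borel_measurable N"
    and c: "\<And>w. w \<in> space N \<Longrightarrow> cadlag_on_nonneg (\<lambda>t. Y t w)"
  shows "(\<lambda>p. Y (max 0 (fst p)) (snd p)) \<in> borel_measurable (borel \<Otimes>\<^sub>M N)"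
proof (rule borel_measurable_LIMSEQ_real)
  define r where "r k u = (real_of_int \<lfloor>2 ^ k * max 0 u\<rfloor> + 1) / 2 ^ k" for k :: nat and u :: real
  define f where "f k p = Y (r k (fst p)) (snd p)" for k and p :: "real \<times> 'w"
  have r0: "0 \<le> r k u" "max 0 u < r k u" "r k u \<le> max 0 u + 1 / 2 ^ k" for k u
  proof -
    have "2 ^ k * max 0 u < of_int \<lfloor>2 ^ k * max 0 u\<rfloor> + 1" by linarith
    then have "max 0 u * 2 ^ k < real_of_int \<lfloor>2 ^ k * max 0 u\<rfloor> + 1" by (simp only: mult.commute)
    then show "max 0 u < r k u" unfolding r_def by (subst pos_less_divide_eq) auto
    then show "0 \<le> r k u" by linarith
    have "of_int \<lfloor>2 ^ k * max 0 u\<rfloor> + 1 \<le> 2 ^ k * max 0 u + 1" by linarith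
    then have "r k u \<le> (2 ^ k * max 0 u + 1) / 2 ^ k" unfolding r_def by (rule divide_right_mono) simp
    then show "r k u \<le> max 0 u + 1 / 2 ^ k" by (simp add: add_divide_distrib)
  qed
  have rlim: "(\<lambda>k. r k u) \<longlonglongrightarrow> max 0 u" for u
  proof (rule tendsto_sandwich[of "\<lambda>_. max 0 u" _ _ "\<lambda>k. max 0 u + (1/2) ^ k"])
    have "(\<lambda>k. max 0 u + (1/2::real) ^ k) \<longlonglongrightarrow> max 0 u + 0" by (intro tendsto_intros LIMSEQ_power_zero) auto
    then show "(\<lambda>k. max 0 u + (1/2) ^ k) \<longlonglongrightarrow> max 0 u" by simp
  qed (use r0 in \<open>auto intro!: always_eventually less_imp_le simp: power_divide\<close>)
  show "(\<lambda>k. f k p) \<longlonglongrightarrow> Y (max 0 (fst p)) (snd p)" if "p \<in> space (borel \<Otimes>\<^sub>M N)" for p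
  proof -
    have "((\<lambda>t. Y t (snd p)) \<longlongrightarrow> Y (max 0 (fst p)) (snd p)) (at_right (max 0 (fst p)))"
      using c[of "snd p"] that by (auto simp: cadlag_on_nonneg_def space_pair_measure)
    moreover have "filterlim (\<lambda>k. r k (fst p)) (at_right (max 0 (fst p))) sequentially"
      unfolding filterlim_at using rlim r0(2) by (auto intro!: always_eventually simp: less_imp_neq[symmetric])
    ultimately show ?thesis unfolding f_def by (rule filterlim_compose)
  qed
  show "f k \<in> borel_measurable (borel \<Otimes>\<^sub>M N)" for k
  proof -
    have "(\<lambda>p. (\<lambda>i p. Y (max 0 ((of_int i + 1) / 2 ^ k)) (snd p)) \<lfloor>2 ^ k * max 0 (fst p :: real)\<rfloor> p) \<in> borel_measurable (borel \<Otimes>\<^sub>M N)"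
      by (rule measurable_compose_countable[where g="\<lambda>p. \<lfloor>2 ^ k * max 0 (fst p :: real)\<rfloor>"])
         (auto intro!: measurable_compose[OF measurable_snd m])
    moreover have "(\<lambda>i p. Y (max 0 ((of_int i + 1) / 2 ^ k)) (snd p)) \<lfloor>2 ^ k * max 0 (fst p)\<rfloor> p = f k p" for p :: "real \<times> 'w"
      using r0(1)[of k "fst p"] by (simp add: f_def r_def max_absorb2)
    ultimately show ?thesis by simp
  qed
qed

text \<open>Three times are what third moments of time integrals require. Independent stationary
  increments reduce the joint law to one-dimensional laws.\<close>

lemma levy_three_time_law:
  fixes Y :: "real \<Rightarrow> 'w \<Rightarrow> real"
  assumes levy: "levy_process M Y" and t: "0 \<le> a" "a \<le> b" "b \<le> c"
    and f[measurable]: "f \<in> borel_measurable (borel :: (real \<times> real \<times> real) measure)"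
  defines "\<mu> \<equiv> \<lambda>t. distr M borel (Y t)"
  shows "(\<integral>\<^sup>+w. f (Y a w, Y b w, Y c w) \<partial>M) =
    (\<integral>\<^sup>+y. \<integral>\<^sup>+z. \<integral>\<^sup>+v. f (y, y + z, y + z + v) \<partial>\<mu> (c - b) \<partial>\<mu> (b - a) \<partial>\<mu> a)"
proof -
  interpret prob_space M using levy by (simp add: levy_process_def)
  have Ym[measurable]: "\<And>t. 0 \<le> t \<Longrightarrow> Y t \<in> borel_measurable M" using levy by (auto simp: levy_process_def)
  have [measurable]: "Y a \<in> borel_measurable M" "Y b \<in> borel_measurable M" "Y c \<in> borel_measurable M" "Y 0 \<in> borel_measurable M"
    using t by auto
  \<comment> \<open>The grid starts at 0, so that \<open>Y a\<close> is itself an increment up to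
    the null event where \<open>Y 0\<close> is not 0.\<close>
  define T where "T = (\<lambda>i::nat. if i = 0 then 0 else if i = 1 then a else if i = 2 then b else c)"
  define U where "U = (\<lambda>i w. Y (T (Suc i)) w - Y (T i) w)"
  have Tm: "0 \<le> T i" for i using t by (auto simp: T_def)
  have "0 \<le> T 0 \<and> (\<forall>i<3. T i \<le> T (Suc i))" using t by (auto simp: T_def)
  then have ind: "indep_vars (\<lambda>_. borel) U {..<3}"
    using levy unfolding levy_process_def U_def by blast
  have Um[measurable]: "U i \<in> borel_measurable M" for i unfolding U_def using Tm by (intro borel_measurable_diff Ym) auto
  define \<rho> where "\<rho> i = distr M borel (U i)" for i
  have stat: "distr M borel (\<lambda>w. Y t w - Y s w) = \<mu> (t - s)" if "0 \<le> s" "s \<le> t" for s t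
    using levy that unfolding levy_process_def \<mu>_def by blast
  have \<rho>: "\<rho> 0 = \<mu> a" "\<rho> 1 = \<mu> (b - a)" "\<rho> 2 = \<mu> (c - b)"
    using stat[of 0 a] stat[of a b] stat[of b c] t by (auto simp: \<rho>_def U_def T_def)
  interpret R: product_prob_space \<rho> "{..<3}" unfolding \<rho>_def by (intro product_prob_spaceI prob_space_distr Um)
  have dist: "distr M (PiM {..<3} (\<lambda>_. borel)) (\<lambda>w. \<lambda>i\<in>{..<3}. U i w) = PiM {..<3} \<rho>"
    using ind Um unfolding \<rho>_def by (subst (asm) indep_vars_iff_distr_eq_PiM') (auto simp: lessThan_empty_iff)
  let ?g = "\<lambda>x::nat \<Rightarrow> real. f (x 0, x 0 + x 1, x 0 + x 1 + x 2)"
  have sR[simp, measurable_cong]: "sets (\<rho> i) = sets borel" for i by (simp add: \<rho>_def)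
  have setsR: "sets (PiM I \<rho>) = sets (PiM I (\<lambda>_. borel))" for I by (intro sets_PiM_cong) auto
  have gm[measurable]: "?g \<in> borel_measurable (PiM {..<3} (\<lambda>_. borel))" by measurable
  have s3: "{..<3} = insert 2 (insert 1 {0::nat})" by auto
  have Y0: "AE w in M. Y 0 w = 0" using levy by (simp add: levy_process_def)
  have "(\<integral>\<^sup>+w. f (Y a w, Y b w, Y c w) \<partial>M) = (\<integral>\<^sup>+w. ?g (\<lambda>i\<in>{..<3}. U i w) \<partial>M)"
    using Y0 by (intro nn_integral_cong_AE) (auto elim!: eventually_mono simp: U_def T_def)
  also have "\<dots> = (\<integral>\<^sup>+x. ?g x \<partial>distr M (PiM {..<3} (\<lambda>_. borel)) (\<lambda>w. \<lambda>i\<in>{..<3}. U i w))"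
    by (rule nn_integral_distr[symmetric]) measurable
  also have "\<dots> = (\<integral>\<^sup>+x. ?g x \<partial>PiM (insert 2 (insert 1 {0})) \<rho>)" unfolding dist unfolding s3 ..
  also have "\<dots> = (\<integral>\<^sup>+x. \<integral>\<^sup>+v. ?g (x(2 := v)) \<partial>\<rho> 2 \<partial>PiM (insert 1 {0}) \<rho>)"
    by (rule R.product_nn_integral_insert) (use gm in \<open>auto simp: s3 cong: measurable_cong_sets[OF setsR]\<close>)
  also have "\<dots> = (\<integral>\<^sup>+x. \<integral>\<^sup>+v. f (x 0, x 0 + x 1, x 0 + x 1 + v) \<partial>\<rho> 2 \<partial>PiM (insert 1 {0}) \<rho>)" by simp
  also have "\<dots> = (\<integral>\<^sup>+x. \<integral>\<^sup>+z. \<integral>\<^sup>+v. f ((x(1 := z)) 0, (x(1 := z)) 0 + (x(1 := z)) 1, (x(1 := z)) 0 + (x(1 := z)) 1 + v) \<partial>\<rho> 2 \<partial>\<rho> 1 \<partial>PiM {0} \<rho>)"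
  proof (rule R.product_nn_integral_insert)
    interpret R2: sigma_finite_measure "\<rho> 2" by (rule R.sigma_finite_measures)
    show "(\<lambda>x. \<integral>\<^sup>+v. f (x 0, x 0 + x 1, x 0 + x 1 + v) \<partial>\<rho> 2) \<in> borel_measurable (PiM (insert 1 {0}) \<rho>)"
      by measurable
  qed auto
  also have "\<dots> = (\<integral>\<^sup>+x. \<integral>\<^sup>+z. \<integral>\<^sup>+v. f (x 0, x 0 + z, x 0 + z + v) \<partial>\<rho> 2 \<partial>\<rho> 1 \<partial>PiM {0} \<rho>)" by simp
  also have "\<dots> = (\<integral>\<^sup>+y. \<integral>\<^sup>+z. \<integral>\<^sup>+v. f (y, y + z, y + z + v) \<partial>\<rho> 2 \<partial>\<rho> 1 \<partial>\<rho> 0)"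
  proof (rule R.product_nn_integral_singleton)
    interpret R1: sigma_finite_measure "\<rho> 1" by (rule R.sigma_finite_measures)
    interpret R2: sigma_finite_measure "\<rho> 2" by (rule R.sigma_finite_measures)
    show "(\<lambda>y. \<integral>\<^sup>+z. \<integral>\<^sup>+v. f (y, y + z, y + z + v) \<partial>\<rho> 2 \<partial>\<rho> 1) \<in> borel_measurable (\<rho> 0)" by measurable
  qed
  finally show ?thesis unfolding \<rho> .
qed

lemma stable_law_unique:
  assumes "symmetric_stable_levy M \<alpha> Y" "symmetric_stable_levy M \<alpha> Y'" "0 \<le> t"
  shows "distr M borel (Y t) = distr M borel (Y' t)"
proof (cases "t = 0")
  \<comment> \<open>Time 0 carries a point mass, outside the reach of the density
    assumption.\<close>
  case True
  have "AE w in M. Y 0 w = 0" "AE w in M. Y' 0 w = 0" "Y 0 \<in> borel_measurable M" "Y' 0 \<in> borel_measurable M"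
    using assms by (auto simp: symmetric_stable_levy_def levy_process_def)
  then show ?thesis unfolding True by (intro distr_cong_AE) auto
next
  case False
  then have "distributed M lborel (Y t) (\<lambda>x. ennreal (stable_density \<alpha> t x))" "distributed M lborel (Y' t) (\<lambda>x. ennreal (stable_density \<alpha> t x))"
    using assms by (auto simp: symmetric_stable_levy_def)
  then have "distr M lborel (Y t) = distr M lborel (Y' t)" by (simp add: distributed_def)
  moreover have "distr M lborel (Z t) = distr M borel (Z t)" for Z :: "real \<Rightarrow> 'a \<Rightarrow> real" by (rule distr_cong) auto
  ultimately show ?thesis by simp
qed

text \<open>The formula of \<open>levy_three_time_law\<close> for sorted times involves
  one-dimensional laws only; the six orderings reduce to it by permuting the arguments of the test
  function.\<close>

lemma stable_three_time_unique:
  assumes Y: "symmetric_stable_levy M \<alpha> Y" "symmetric_stable_levy M \<alpha> Y'" and t: "0 \<le> a" "0 \<le> b" "0 \<le> c"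
  shows "distr M borel (\<lambda>w. (Y a w, Y b w, Y c w)) = distr M borel (\<lambda>w. (Y' a w, Y' b w, Y' c w))"
proof -
  have L: "levy_process M Y" "levy_process M Y'" using Y by (auto simp: symmetric_stable_levy_def)
  have [measurable]: "Y r \<in> borel_measurable M" "Y' r \<in> borel_measurable M" if "0 \<le> r" for r
    using L that by (auto simp: levy_process_def)
  have sorted: "(\<integral>\<^sup>+w. f (Y a w, Y b w, Y c w) \<partial>M) = (\<integral>\<^sup>+w. f (Y' a w, Y' b w, Y' c w) \<partial>M)"
    if "0 \<le> a" "a \<le> b" "b \<le> c" "f \<in> borel_measurable (borel :: (real \<times> real \<times> real) measure)" for a b c f
    using that stable_law_unique[OF Y, of a] stable_law_unique[OF Y, of "b - a"] stable_law_unique[OF Y, of "c - b"]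
    by (simp add: levy_three_time_law[OF L(1)] levy_three_time_law[OF L(2)])
  have all: "(\<integral>\<^sup>+w. f (Y a w, Y b w, Y c w) \<partial>M) = (\<integral>\<^sup>+w. f (Y' a w, Y' b w, Y' c w) \<partial>M)"
    if f[measurable]: "f \<in> borel_measurable (borel :: (real \<times> real \<times> real) measure)" for f
  proof -
    have perm: "(\<lambda>x. f (h x)) \<in> borel_measurable borel" if "continuous_on UNIV h" for h :: "real \<times> real \<times> real \<Rightarrow> real \<times> real \<times> real"
      using measurable_compose[OF borel_measurable_continuous_onI[OF that] f] .
    consider "a \<le> b" "b \<le> c" | "a \<le> c" "c \<le> b" | "b \<le> a" "a \<le> c" | "b \<le> c" "c \<le> a" | "c \<le> a" "a \<le> b" | "c \<le> b" "b \<le> a"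
      by linarith
    then show ?thesis
    proof cases
      case 1 then show ?thesis using sorted[of a b c f] t f by simp
    next
      case 2
      have "continuous_on UNIV (\<lambda>x :: real \<times> real \<times> real. (fst x, snd (snd x), fst (snd x)))" by (intro continuous_intros)
      from sorted[OF _ _ _ perm[OF this], of a c b] 2 t show ?thesis by simp
    next
      case 3
      have "continuous_on UNIV (\<lambda>x :: real \<times> real \<times> real. (fst (snd x), fst x, snd (snd x)))" by (intro continuous_intros)
      from sorted[OF _ _ _ perm[OF this], of b a c] 3 t show ?thesis by simp
    next
      case 4
      have "continuous_on UNIV (\<lambda>x :: real \<times> real \<times> real. (snd (snd x), fst x, fst (snd x)))" by (intro continuous_intros)
      from sorted[OF _ _ _ perm[OF this], of b c a] 4 t show ?thesis by simp
    next
      case 5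
      have "continuous_on UNIV (\<lambda>x :: real \<times> real \<times> real. (fst (snd x), snd (snd x), fst x))" by (intro continuous_intros)
      from sorted[OF _ _ _ perm[OF this], of c a b] 5 t show ?thesis by simp
    next
      case 6
      have "continuous_on UNIV (\<lambda>x :: real \<times> real \<times> real. (snd (snd x), fst (snd x), fst x))" by (intro continuous_intros)
      from sorted[OF _ _ _ perm[OF this], of c b a] 6 t show ?thesis by simp
    qed
  qed
  show ?thesis
  proof (rule measure_eqI)
    fix A assume "A \<in> sets (distr M borel (\<lambda>w. (Y a w, Y b w, Y c w)))"
    then have [measurable]: "A \<in> sets borel" by simp
    have e: "emeasure (distr M borel Z) A = (\<integral>\<^sup>+w. indicator A (Z w) \<partial>M)" if "Z \<in> M \<rightarrow>\<^sub>M borel" for Z :: "'a \<Rightarrow> real \<times> real \<times> real"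
      using nn_integral_distr[OF that, of "indicator A"] by simp
    show "emeasure (distr M borel (\<lambda>w. (Y a w, Y b w, Y c w))) A = emeasure (distr M borel (\<lambda>w. (Y' a w, Y' b w, Y' c w))) A"
    proof -
      have "(\<lambda>w. (Y a w, Y b w, Y c w)) \<in> M \<rightarrow>\<^sub>M borel" "(\<lambda>w. (Y' a w, Y' b w, Y' c w)) \<in> M \<rightarrow>\<^sub>M borel"
        using t by measurable
      then show ?thesis using all[of "indicator A"] by (simp add: e)
    qed
  qed simp
qed

section \<open>Occupation times of a stable motion\<close>

text \<open>\<open>max 0\<close> makes the field jointly measurable over all real times, so that
  Fubini's theorem can be used on the whole line; indicators in the integrals discard the negative
  times.\<close>

definition path_field :: "(real \<Rightarrow> real) \<Rightarrow> (real \<Rightarrow> 'w \<Rightarrow> real) \<Rightarrow> real \<times> 'w \<Rightarrow> real \<Rightarrow> real" where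
  "path_field \<phi> Y p u = \<phi> (fst p + Y (max 0 u) (snd p))"

definition occ :: "(real \<Rightarrow> real) \<Rightarrow> (real \<Rightarrow> 'w \<Rightarrow> real) \<Rightarrow> real \<times> 'w \<Rightarrow> real \<Rightarrow> real" where
  "occ \<phi> Y p s = (LBINT u. path_field \<phi> Y p u * indicator {0..s} u)"

text \<open>Valued in \<open>ennreal\<close>, it makes sense without integrability and dominates
  \<open>occ\<close> even where the latter is 0 by the convention for divergent integrals.\<close>

definition abs_occ :: "(real \<Rightarrow> real) \<Rightarrow> (real \<Rightarrow> 'w \<Rightarrow> real) \<Rightarrow> real \<times> 'w \<Rightarrow> real \<Rightarrow> real \<Rightarrow> ennreal" where
  "abs_occ \<phi> Y p l r = (\<integral>\<^sup>+u. ennreal \<bar>path_field \<phi> Y p u * indicator {l..r} u\<bar> \<partial>lborel)"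

lemma path_field_measurable:
  assumes "\<And>t. 0 \<le> t \<Longrightarrow> Y t \<in> borel_measurable N" "\<And>w. w \<in> space N \<Longrightarrow> cadlag_on_nonneg (\<lambda>t. Y t w)"
    and [measurable]: "\<phi> \<in> borel_measurable borel"
  shows "(\<lambda>q. path_field \<phi> Y (fst q) (snd q)) \<in> borel_measurable ((borel \<Otimes>\<^sub>M N) \<Otimes>\<^sub>M borel)"
proof -
  have "(\<lambda>q. (\<lambda>p. Y (max 0 (fst p)) (snd p)) (snd q, snd (fst q))) \<in> borel_measurable ((borel \<Otimes>\<^sub>M N) \<Otimes>\<^sub>M borel)"
    by (rule measurable_compose[OF _ right_continuous_joint_measurable[OF assms(1,2)]]) auto
  then have [measurable]: "(\<lambda>q. Y (max 0 (snd q)) (snd (fst q))) \<in> borel_measurable ((borel \<Otimes>\<^sub>M N) \<Otimes>\<^sub>M borel)" by simp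
  show ?thesis unfolding path_field_def by measurable
qed

lemma sets_lborel_pair: "sets ((lborel \<Otimes>\<^sub>M N) \<Otimes>\<^sub>M lborel) = sets ((borel \<Otimes>\<^sub>M N) \<Otimes>\<^sub>M borel)"
  by (intro sets_pair_measure_cong) auto

lemma occ_measurable:
  assumes Y: "\<And>t. 0 \<le> t \<Longrightarrow> Y t \<in> borel_measurable N" "\<And>w. w \<in> space N \<Longrightarrow> cadlag_on_nonneg (\<lambda>t. Y t w)"
    and \<phi>: "\<phi> \<in> borel_measurable borel"
  shows "(\<lambda>p. occ \<phi> Y p s) \<in> borel_measurable (borel \<Otimes>\<^sub>M N)"
    and "(\<lambda>p. abs_occ \<phi> Y p l r) \<in> borel_measurable (borel \<Otimes>\<^sub>M N)"
proof -
  have [measurable]: "(\<lambda>q. path_field \<phi> Y (fst q) (snd q)) \<in> borel_measurable ((borel \<Otimes>\<^sub>M N) \<Otimes>\<^sub>M lborel)"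
    using path_field_measurable[OF Y \<phi>] by (subst measurable_cong_sets[OF sets_pair_measure_cong refl]) auto
  have "(\<lambda>p. (LBINT u. (\<lambda>q. path_field \<phi> Y (fst q) (snd q) * indicator {0..s} (snd q)) (p, u))) \<in> borel_measurable (borel \<Otimes>\<^sub>M N)"
    by (rule lborel.borel_measurable_lebesgue_integral) measurable
  then show "(\<lambda>p. occ \<phi> Y p s) \<in> borel_measurable (borel \<Otimes>\<^sub>M N)" by (simp add: occ_def)
  have "(\<lambda>p. \<integral>\<^sup>+u. (\<lambda>q. ennreal \<bar>path_field \<phi> Y (fst q) (snd q) * indicator {l..r} (snd q)\<bar>) (p, u) \<partial>lborel) \<in> borel_measurable (borel \<Otimes>\<^sub>M N)"
    by (rule lborel.borel_measurable_nn_integral) measurable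
  then show "(\<lambda>p. abs_occ \<phi> Y p l r) \<in> borel_measurable (borel \<Otimes>\<^sub>M N)" by (simp add: abs_occ_def)
qed

lemma abs_occ_mono: "l' \<le> l \<Longrightarrow> r \<le> r' \<Longrightarrow> abs_occ \<phi> Y p l r \<le> abs_occ \<phi> Y p l' r'"
  unfolding abs_occ_def by (intro nn_integral_mono ennreal_leI) (auto simp: indicator_def)

lemma abs_occ_le:
  assumes "0 \<le> s"
  shows "ennreal \<bar>occ \<phi> Y p s\<bar> \<le> abs_occ \<phi> Y p 0 s"
proof (cases "integrable lborel (\<lambda>u. path_field \<phi> Y p u * indicator {0..s} u)")
  case True
  then show ?thesis unfolding occ_def abs_occ_def using integral_norm_bound_ennreal[OF True] by simp
qed (simp add: occ_def not_integrable_integral_eq)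

lemma occ_diff:
  assumes m: "(\<lambda>u. path_field \<phi> Y p u) \<in> borel_measurable borel" and fin: "abs_occ \<phi> Y p 0 r < \<infinity>" and lr: "0 \<le> l" "l \<le> r"
  shows "ennreal \<bar>occ \<phi> Y p r - occ \<phi> Y p l\<bar> \<le> abs_occ \<phi> Y p l r"
proof -
  have ir: "integrable lborel (\<lambda>u. path_field \<phi> Y p u * indicator {0..s} u)" if "s \<le> r" for s
  proof (rule integrableI_bounded)
    show "(\<lambda>u. path_field \<phi> Y p u * indicator {0..s} u) \<in> borel_measurable lborel" using m by simp
    have "abs_occ \<phi> Y p 0 s \<le> abs_occ \<phi> Y p 0 r" using that by (intro abs_occ_mono) auto
    with fin show "(\<integral>\<^sup>+u. ennreal (norm (path_field \<phi> Y p u * indicator {0..s} u)) \<partial>lborel) < \<infinity>"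
      by (simp add: abs_occ_def)
  qed
  have eq: "occ \<phi> Y p r - occ \<phi> Y p l = (LBINT u. path_field \<phi> Y p u * indicator {0..r} u - path_field \<phi> Y p u * indicator {0..l} u)"
    unfolding occ_def using ir[of r] ir[of l] lr by simp
  have "ennreal \<bar>occ \<phi> Y p r - occ \<phi> Y p l\<bar> \<le> (\<integral>\<^sup>+u. ennreal (norm (path_field \<phi> Y p u * indicator {0..r} u - path_field \<phi> Y p u * indicator {0..l} u)) \<partial>lborel)"
    unfolding eq using integral_norm_bound_ennreal[OF Bochner_Integration.integrable_diff[OF ir[of r] ir[of l]]] lr by simp
  also have "\<dots> \<le> abs_occ \<phi> Y p l r"
    unfolding abs_occ_def using lr by (intro nn_integral_mono ennreal_leI) (auto simp: indicator_def)
  finally show ?thesis .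
qed

lemma nn_integral_lborel_shift:
  fixes f :: "real \<Rightarrow> ennreal"
  assumes "f \<in> borel_measurable borel"
  shows "(\<integral>\<^sup>+x. f (x + c) \<partial>lborel) = (\<integral>\<^sup>+x. f x \<partial>lborel)"
  using nn_integral_real_affine[OF assms, of 1 c] by (simp add: add.commute)

lemma integral_lborel_shift: "(LBINT x. f (x + c)) = (LBINT x. f x)"
  for f :: "real \<Rightarrow> real"
  using lborel_integral_real_affine[of 1 f c] by (simp add: add.commute)

text \<open>The singularity at v = u is integrable because b > 0: the antiderivatives are continuous
  up to u, so the fundamental theorem applies on either side. With b = 1 - 1 / \<alpha> the
  integrand is the decay of the stable density at 0 in the time lag.\<close>

lemma has_integral_powr_abs:
  fixes b :: real assumes b: "0 < b" and u: "l \<le> u" "u \<le> r"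
  shows "((\<lambda>v. \<bar>u - v\<bar> powr (b - 1)) has_integral ((u - l) powr b + (r - u) powr b) / b) {l..r}"
proof -
  have 1: "((\<lambda>v. \<bar>u - v\<bar> powr (b - 1)) has_integral (- ((u - u) powr b / b)) - (- ((u - l) powr b / b))) {l..u}"
  proof (rule fundamental_theorem_of_calculus_interior)
    show "continuous_on {l..u} (\<lambda>v. - ((u - v) powr b / b))"
      using b by (intro continuous_on_minus continuous_on_divide continuous_on_powr' continuous_on_diff continuous_on_const continuous_on_id) auto
    fix v assume "v \<in> {l<..<u}"
    then have "u - v > 0" by auto
    then have "((\<lambda>v. (u - v) powr b) has_real_derivative (b * (u - v) powr (b - 1)) * (0 - 1)) (at v)"
      by (rule DERIV_chain2[OF has_real_derivative_powr DERIV_diff[OF DERIV_const DERIV_ident]])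
    from DERIV_minus[OF DERIV_cdivide[OF this, of b]] b \<open>u - v > 0\<close>
    show "((\<lambda>v. - ((u - v) powr b / b)) has_vector_derivative \<bar>u - v\<bar> powr (b - 1)) (at v)"
      by (simp add: has_real_derivative_iff_has_vector_derivative[symmetric])
  qed (use u in auto)
  have 2: "((\<lambda>v. \<bar>u - v\<bar> powr (b - 1)) has_integral ((r - u) powr b / b) - ((u - u) powr b / b)) {u..r}"
  proof (rule fundamental_theorem_of_calculus_interior)
    show "continuous_on {u..r} (\<lambda>v. (v - u) powr b / b)"
      using b by (intro continuous_on_minus continuous_on_divide continuous_on_powr' continuous_on_diff continuous_on_const continuous_on_id) auto
    fix v assume "v \<in> {u<..<r}"
    then have v: "v - u > 0" by auto
    then have "((\<lambda>v. (v - u) powr b) has_real_derivative (b * (v - u) powr (b - 1)) * (1 - 0)) (at v)"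
      by (rule DERIV_chain2[OF has_real_derivative_powr DERIV_diff[OF DERIV_ident DERIV_const]])
    from DERIV_cdivide[OF this, of b] b v
    show "((\<lambda>v. (v - u) powr b / b) has_vector_derivative \<bar>u - v\<bar> powr (b - 1)) (at v)"
      by (simp add: has_real_derivative_iff_has_vector_derivative[symmetric] abs_minus_commute[of u])
  qed (use u in auto)
  from has_integral_combine[OF u 1 2] show ?thesis by (simp add: add_divide_distrib)
qed

lemma nn_integral_powr_abs:
  fixes b :: real assumes "0 < b" "l \<le> u" "u \<le> r"
  shows "(\<integral>\<^sup>+v. ennreal (\<bar>u - v\<bar> powr (b - 1)) * indicator {l..r} v \<partial>lborel) = ennreal (((u - l) powr b + (r - u) powr b) / b)"
proof -
  show ?thesis by (rule nn_integral_has_integral_lebesgue'[OF _ has_integral_powr_abs[OF assms]]) simp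
qed

lemma nn_integral_powr_abs_le:
  fixes b :: real assumes "0 < b" "l \<le> u" "u \<le> r"
  shows "(\<integral>\<^sup>+v. ennreal (\<bar>u - v\<bar> powr (b - 1)) * indicator {l..r} v \<partial>lborel) \<le> ennreal (2 * (r - l) powr b / b)"
proof -
  have "(u - l) powr b \<le> (r - l) powr b" "(r - u) powr b \<le> (r - l) powr b" using assms by (auto intro!: powr_mono2)
  then show ?thesis unfolding nn_integral_powr_abs[OF assms] using assms(1) by (intro ennreal_leI divide_right_mono) auto
qed

section \<open>One stable motion with starting point distributed by Lebesgue measure\<close>

locale stable_motion = prob_space M for M :: "'w measure" +
  fixes \<alpha> :: real and Y :: "real \<Rightarrow> 'w \<Rightarrow> real" and \<phi> :: "real \<Rightarrow> real"
  assumes \<alpha>: "1 < \<alpha>" and stable: "symmetric_stable_levy M \<alpha> Y" and \<phi>: "integrable lborel \<phi>"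
begin

abbreviation "b \<equiv> 1 - 1 / \<alpha>"
abbreviation "pf \<equiv> path_field \<phi> Y"
text \<open>Starting point and sample point together: an infinite measure under which the position
  keeps Lebesgue distribution at all times, so that moments depend on time differences only.\<close>

abbreviation "LM \<equiv> (lborel :: real measure) \<Otimes>\<^sub>M M"

lemma b_pos: "0 < b" using \<alpha> by simp

lemma levy: "levy_process M Y" using stable by (simp add: symmetric_stable_levy_def)

lemma Y_measurable: "0 \<le> t \<Longrightarrow> Y t \<in> borel_measurable M" using levy by (simp add: levy_process_def)

lemma Y_cadlag: "w \<in> space M \<Longrightarrow> cadlag_on_nonneg (\<lambda>t. Y t w)" using levy by (simp add: levy_process_def)

lemma \<phi>_measurable[measurable]: "\<phi> \<in> borel_measurable borel"
  using borel_measurable_integrable[OF \<phi>] by simp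

lemma field_measurable[measurable]:
  "(\<lambda>q. pf (fst q) (snd q)) \<in> borel_measurable (LM \<Otimes>\<^sub>M lborel)"
  using path_field_measurable[OF Y_measurable Y_cadlag \<phi>_measurable]
  by (simp add: measurable_cong_sets[OF sets_lborel_pair refl])

lemma field_measurable_u: "w \<in> space M \<Longrightarrow> pf (x, w) \<in> borel_measurable borel"
proof -
  assume "w \<in> space M"
  then have "(\<lambda>u. (\<lambda>q. pf (fst q) (snd q)) ((x, w), u)) \<in> borel_measurable lborel"
    by (intro measurable_compose[OF measurable_Pair1' field_measurable]) (simp add: space_pair_measure)
  then show ?thesis by simp
qed

lemma field_measurable_w: "(\<lambda>q. pf (x, fst q) (snd q)) \<in> borel_measurable (M \<Otimes>\<^sub>M lborel)"
proof -
  have "(\<lambda>q. (\<lambda>q. pf (fst q) (snd q)) ((x, fst q), snd q)) \<in> borel_measurable (M \<Otimes>\<^sub>M lborel)"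
    by (rule measurable_compose[OF _ field_measurable]) measurable
  then show ?thesis by simp
qed

lemma increment_nn_integral:
  assumes "0 \<le> u" "u < v" and [measurable]: "f \<in> borel_measurable borel"
  shows "(\<integral>\<^sup>+w. f (Y v w - Y u w) \<partial>M) = (\<integral>\<^sup>+z. ennreal (stable_density \<alpha> (v - u) z) * f z \<partial>lborel)"
proof -
  have d: "distributed M lborel (Y (v - u)) (\<lambda>x. ennreal (stable_density \<alpha> (v - u) x))"
    using stable assms by (simp add: symmetric_stable_levy_def)
  have [measurable]: "Y u \<in> borel_measurable M" "Y v \<in> borel_measurable M" "Y (v - u) \<in> borel_measurable M" using assms by (auto intro: Y_measurable)
  have st: "distr M borel (\<lambda>w. Y v w - Y u w) = distr M borel (Y (v - u))"
    using levy assms unfolding levy_process_def by auto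
  have "(\<integral>\<^sup>+w. f (Y v w - Y u w) \<partial>M) = (\<integral>\<^sup>+z. f z \<partial>distr M borel (\<lambda>w. Y v w - Y u w))" by (simp add: nn_integral_distr)
  also have "\<dots> = (\<integral>\<^sup>+w. f (Y (v - u) w) \<partial>M)" unfolding st by (simp add: nn_integral_distr)
  also have "\<dots> = (\<integral>\<^sup>+z. ennreal (stable_density \<alpha> (v - u) z) * f z \<partial>lborel)"
    using distributed_nn_integral[OF d, of f] by simp
  finally show ?thesis .
qed

abbreviation "p1 \<equiv> stable_density \<alpha> 1 0"

lemma p1_nonneg: "0 \<le> p1" using stable_density_0_nonneg \<alpha> by simp

lemma density_le: "0 < r \<Longrightarrow> \<bar>stable_density \<alpha> r z\<bar> \<le> p1 * r powr (b - 1)"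
  using abs_stable_density_le[of \<alpha> r z] stable_density_0_scaling[of \<alpha> r] \<alpha> by (simp add: mult.commute)

text \<open>The density of \<open>Y r\<close> is bounded by a constant, and translation invariance
  of Lebesgue measure removes the shift.\<close>

lemma law_shift_le:
  assumes "0 < r" and [measurable]: "h \<in> borel_measurable borel"
  shows "(\<integral>\<^sup>+z. h (c + z) \<partial>distr M borel (Y r)) \<le> ennreal (p1 * r powr (b - 1)) * (\<integral>\<^sup>+z. h z \<partial>lborel)"
proof -
  have [measurable]: "Y r \<in> borel_measurable M" using assms by (auto intro: Y_measurable)
  have "(\<integral>\<^sup>+z. h (c + z) \<partial>distr M borel (Y r)) = (\<integral>\<^sup>+w. h (c + Y r w) \<partial>M)" by (simp add: nn_integral_distr)
  also have "\<dots> = (\<integral>\<^sup>+z. ennreal (stable_density \<alpha> r z) * h (c + z) \<partial>lborel)"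
    using stable assms(1) by (subst distributed_nn_integral[of M lborel "Y r" "\<lambda>x. ennreal (stable_density \<alpha> r x)" "\<lambda>z. h (c + z)", symmetric])
      (auto simp: symmetric_stable_levy_def)
  also have "\<dots> \<le> (\<integral>\<^sup>+z. ennreal (p1 * r powr (b - 1)) * h (c + z) \<partial>lborel)"
    using density_le[OF assms(1)] by (intro nn_integral_mono mult_right_mono ennreal_leI) (auto intro: order_trans[OF abs_ge_self])
  also have "\<dots> = ennreal (p1 * r powr (b - 1)) * (\<integral>\<^sup>+z. h z \<partial>lborel)"
    using nn_integral_lborel_shift[of h c] by (simp add: nn_integral_cmult add.commute)
  finally show ?thesis .
qed

sublocale P: pair_sigma_finite lborel M ..

sublocale PL: pair_sigma_finite "LM" lborel
  by (intro pair_sigma_finite.intro P.sigma_finite_measure_axioms lborel.sigma_finite_measure_axioms)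

text \<open>A bound for the density of an increment over the time lag r. By the convention for
  \<open>powr\<close> it vanishes at r = 0, so the estimates using it exclude coinciding times,
  which form a null set.\<close>

abbreviation "kern r \<equiv> ennreal (p1 * \<bar>r\<bar> powr (b - 1))"

text \<open>Increments are integrated from the last to the first, each costing one kernel and one
  integral of a test function; the integral over the start then costs only the integral of
  f.\<close>

lemma triple_bound_sorted:
  assumes t: "0 \<le> u" "u < v" "v < r"
    and f[measurable]: "f \<in> borel_measurable borel" and g[measurable]: "g \<in> borel_measurable borel" and h[measurable]: "h \<in> borel_measurable borel"
  shows "(\<integral>\<^sup>+q. f (fst q + Y u (snd q)) * g (fst q + Y v (snd q)) * h (fst q + Y r (snd q)) \<partial>LM) \<le>
     kern (u - v) * kern (v - r) * ((\<integral>\<^sup>+z. f z \<partial>lborel) * (\<integral>\<^sup>+z. g z \<partial>lborel) * (\<integral>\<^sup>+z. h z \<partial>lborel))"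
proof -
  define \<mu> where "\<mu> t = distr M borel (Y t)" for t
  have [measurable]: "Y u \<in> borel_measurable M" "Y v \<in> borel_measurable M" "Y r \<in> borel_measurable M" using t by (auto intro: Y_measurable)
  have [measurable_cong, simp]: "sets (\<mu> t) = sets borel" for t by (simp add: \<mu>_def)
  interpret \<mu>u: prob_space "\<mu> u" unfolding \<mu>_def by (intro prob_space_distr) measurable
  interpret \<mu>P: pair_sigma_finite lborel "\<mu> u" ..
  have [measurable]: "sigma_finite_measure (\<mu> (v - u))"
    unfolding \<mu>_def using t by (intro prob_space_imp_sigma_finite prob_space_distr Y_measurable) auto
  define ig ih where "ig = (\<integral>\<^sup>+z. g z \<partial>lborel)" and "ih = (\<integral>\<^sup>+z. h z \<partial>lborel)"
  define K1 K2 where "K1 = kern (u - v)" and "K2 = kern (v - r)"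
  have b1: "(\<integral>\<^sup>+z. g (c + z) \<partial>\<mu> (v - u)) \<le> K1 * ig" for c
    using law_shift_le[of "v - u" g c] t by (simp add: \<mu>_def K1_def ig_def abs_minus_commute)
  have b2: "(\<integral>\<^sup>+z. h (c + z) \<partial>\<mu> (r - v)) \<le> K2 * ih" for c
    using law_shift_le[of "r - v" h c] t by (simp add: \<mu>_def K2_def ih_def abs_minus_commute)
  have "(\<integral>\<^sup>+q. f (fst q + Y u (snd q)) * g (fst q + Y v (snd q)) * h (fst q + Y r (snd q)) \<partial>LM) =
    (\<integral>\<^sup>+x. \<integral>\<^sup>+w. f (x + Y u w) * g (x + Y v w) * h (x + Y r w) \<partial>M \<partial>lborel)"
    by (subst nn_integral_fst[symmetric]) auto
  also have "\<dots> = (\<integral>\<^sup>+x. \<integral>\<^sup>+y. \<integral>\<^sup>+z. \<integral>\<^sup>+s. f (x + y) * g (x + y + z) * h (x + y + z + s) \<partial>\<mu> (r - v) \<partial>\<mu> (v - u) \<partial>\<mu> u \<partial>lborel)"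
  proof (rule nn_integral_cong)
    fix x :: real
    have "(\<lambda>y :: real \<times> real \<times> real. f (x + fst y) * g (x + fst (snd y)) * h (x + snd (snd y))) \<in> borel_measurable borel"
      by (simp add: borel_prod[symmetric])
    from levy_three_time_law[OF levy t(1) _ _ this, of v r] t
    show "(\<integral>\<^sup>+w. f (x + Y u w) * g (x + Y v w) * h (x + Y r w) \<partial>M) =
      (\<integral>\<^sup>+y. \<integral>\<^sup>+z. \<integral>\<^sup>+s. f (x + y) * g (x + y + z) * h (x + y + z + s) \<partial>\<mu> (r - v) \<partial>\<mu> (v - u) \<partial>\<mu> u)"
      by (simp add: \<mu>_def add.assoc)
  qed
  also have "\<dots> \<le> (\<integral>\<^sup>+x. \<integral>\<^sup>+y. \<integral>\<^sup>+z. f (x + y) * g (x + y + z) * (K2 * ih) \<partial>\<mu> (v - u) \<partial>\<mu> u \<partial>lborel)"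
  proof (intro nn_integral_mono)
    fix x y z
    have "(\<integral>\<^sup>+s. f (x + y) * g (x + y + z) * h (x + y + z + s) \<partial>\<mu> (r - v)) = f (x + y) * g (x + y + z) * (\<integral>\<^sup>+s. h (x + y + z + s) \<partial>\<mu> (r - v))"
      by (rule nn_integral_cmult) measurable
    also have "\<dots> \<le> f (x + y) * g (x + y + z) * (K2 * ih)" by (intro mult_left_mono b2) auto
    finally show "(\<integral>\<^sup>+s. f (x + y) * g (x + y + z) * h (x + y + z + s) \<partial>\<mu> (r - v)) \<le> f (x + y) * g (x + y + z) * (K2 * ih)" .
  qed
  also have "\<dots> \<le> (\<integral>\<^sup>+x. \<integral>\<^sup>+y. f (x + y) * (K2 * ih * (K1 * ig)) \<partial>\<mu> u \<partial>lborel)"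
  proof (intro nn_integral_mono)
    fix x y
    have "(\<integral>\<^sup>+z. f (x + y) * g (x + y + z) * (K2 * ih) \<partial>\<mu> (v - u)) = (\<integral>\<^sup>+z. f (x + y) * (K2 * ih) * g (x + y + z) \<partial>\<mu> (v - u))"
      by (simp add: mult_ac)
    also have "\<dots> = f (x + y) * (K2 * ih) * (\<integral>\<^sup>+z. g (x + y + z) \<partial>\<mu> (v - u))" by (rule nn_integral_cmult) measurable
    also have "\<dots> \<le> f (x + y) * (K2 * ih) * (K1 * ig)" by (intro mult_left_mono b1) auto
    finally show "(\<integral>\<^sup>+z. f (x + y) * g (x + y + z) * (K2 * ih) \<partial>\<mu> (v - u)) \<le> f (x + y) * (K2 * ih * (K1 * ig))" by (simp add: mult.assoc)
  qed
  also have "\<dots> = (\<integral>\<^sup>+y. \<integral>\<^sup>+x. f (x + y) * (K2 * ih * (K1 * ig)) \<partial>lborel \<partial>\<mu> u)"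
    by (rule \<mu>P.Fubini'[symmetric]) measurable
  also have "\<dots> = (\<integral>\<^sup>+y. (\<integral>\<^sup>+x. f x \<partial>lborel) * (K2 * ih * (K1 * ig)) \<partial>\<mu> u)"
    by (simp add: nn_integral_multc nn_integral_lborel_shift)
  also have "\<dots> = K1 * K2 * ((\<integral>\<^sup>+z. f z \<partial>lborel) * ig * ih)" by (simp add: \<mu>u.emeasure_space_1 mult_ac)
  finally show ?thesis by (simp add: K1_def K2_def ig_def ih_def)
qed

text \<open>Once the start is shifted by the displacement up to time u, only the increment from u to
  v remains random.\<close>

lemma pair_bound_sorted:
  assumes t: "0 \<le> u" "u < v" and f[measurable]: "f \<in> borel_measurable borel" and g[measurable]: "g \<in> borel_measurable borel"
  shows "(\<integral>\<^sup>+q. f (fst q + Y u (snd q)) * g (fst q + Y v (snd q)) \<partial>LM) \<le>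
     kern (u - v) * ((\<integral>\<^sup>+z. f z \<partial>lborel) * (\<integral>\<^sup>+z. g z \<partial>lborel))"
proof -
  have [measurable]: "Y u \<in> borel_measurable M" "Y v \<in> borel_measurable M" using t by (auto intro: Y_measurable)
  have "(\<integral>\<^sup>+q. f (fst q + Y u (snd q)) * g (fst q + Y v (snd q)) \<partial>LM) =
    (\<integral>\<^sup>+w. \<integral>\<^sup>+x. f (x + Y u w) * g (x + Y v w) \<partial>lborel \<partial>M)"
    by (subst P.nn_integral_snd[symmetric]) auto
  also have "\<dots> = (\<integral>\<^sup>+w. \<integral>\<^sup>+x. f x * g (x + (Y v w - Y u w)) \<partial>lborel \<partial>M)"
  proof (rule nn_integral_cong)
    fix w
    have "(\<integral>\<^sup>+x. (\<lambda>x. f x * g (x + (Y v w - Y u w))) (x + Y u w) \<partial>lborel) = (\<integral>\<^sup>+x. f x * g (x + (Y v w - Y u w)) \<partial>lborel)"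
      by (rule nn_integral_lborel_shift) measurable
    then show "(\<integral>\<^sup>+x. f (x + Y u w) * g (x + Y v w) \<partial>lborel) = (\<integral>\<^sup>+x. f x * g (x + (Y v w - Y u w)) \<partial>lborel)"
      by (simp add: add.assoc)
  qed
  also have "\<dots> = (\<integral>\<^sup>+x. \<integral>\<^sup>+w. f x * g (x + (Y v w - Y u w)) \<partial>M \<partial>lborel)"
    by (rule P.Fubini') measurable
  also have "\<dots> \<le> (\<integral>\<^sup>+x. f x * (kern (u - v) * (\<integral>\<^sup>+z. g z \<partial>lborel)) \<partial>lborel)"
  proof (intro nn_integral_mono)
    fix x
    have "(\<integral>\<^sup>+w. f x * g (x + (Y v w - Y u w)) \<partial>M) = f x * (\<integral>\<^sup>+w. g (x + (Y v w - Y u w)) \<partial>M)" by (rule nn_integral_cmult) measurable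
    also have "(\<integral>\<^sup>+w. g (x + (Y v w - Y u w)) \<partial>M) = (\<integral>\<^sup>+z. ennreal (stable_density \<alpha> (v - u) z) * g (x + z) \<partial>lborel)"
      using increment_nn_integral[OF t, of "\<lambda>z. g (x + z)"] by simp
    also have "\<dots> \<le> (\<integral>\<^sup>+z. kern (u - v) * g (x + z) \<partial>lborel)"
      using density_le[of "v - u"] t by (intro nn_integral_mono mult_right_mono ennreal_leI) (auto simp: abs_minus_commute intro: order_trans[OF abs_ge_self])
    also have "\<dots> = kern (u - v) * (\<integral>\<^sup>+z. g z \<partial>lborel)"
      using nn_integral_lborel_shift[of g x] by (simp add: nn_integral_cmult add.commute)
    finally show "(\<integral>\<^sup>+w. f x * g (x + (Y v w - Y u w)) \<partial>M) \<le> f x * (kern (u - v) * (\<integral>\<^sup>+z. g z \<partial>lborel))"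
      by (simp add: mult_left_mono)
  qed
  also have "\<dots> = kern (u - v) * ((\<integral>\<^sup>+z. f z \<partial>lborel) * (\<integral>\<^sup>+z. g z \<partial>lborel))" by (simp add: nn_integral_multc mult_ac)
  finally show ?thesis .
qed

abbreviation "absf u q \<equiv> ennreal \<bar>pf q u\<bar>"

abbreviation "L1 \<equiv> \<integral>x. \<bar>\<phi> x\<bar> \<partial>lborel"

lemma L1_nn: "(\<integral>\<^sup>+x. ennreal \<bar>\<phi> x\<bar> \<partial>lborel) = ennreal L1"
  by (rule nn_integral_eq_integral) (use \<phi> in auto)

lemma pair_bound:
  assumes "0 \<le> u" "0 \<le> v" "u \<noteq> v"
  shows "(\<integral>\<^sup>+q. absf u q * absf v q \<partial>LM) \<le> kern (u - v) * ennreal (L1\<^sup>2)"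
proof -
  have L: "ennreal (L1\<^sup>2) = ennreal L1 * ennreal L1" by (simp add: power2_eq_square ennreal_mult)
  show ?thesis
  proof (cases "u < v")
    case True
    show ?thesis
      using pair_bound_sorted[OF assms(1) True, of "\<lambda>x. ennreal \<bar>\<phi> x\<bar>" "\<lambda>x. ennreal \<bar>\<phi> x\<bar>"] assms
      by (simp add: path_field_def L1_nn L)
  next
    case False
    then show ?thesis
      using pair_bound_sorted[of v u "\<lambda>x. ennreal \<bar>\<phi> x\<bar>" "\<lambda>x. ennreal \<bar>\<phi> x\<bar>"] assms
      by (simp add: path_field_def L1_nn L mult.commute abs_minus_commute)
  qed
qed

text \<open>One of the three times lies between the others and is joined to both by a kernel; the
  three summands are the three choices of this middle time.\<close>

lemma triple_bound:
  assumes t: "0 \<le> u" "0 \<le> v" "0 \<le> r" and d: "u \<noteq> v" "v \<noteq> r" "u \<noteq> r"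
  shows "(\<integral>\<^sup>+q. absf u q * absf v q * absf r q \<partial>LM) \<le>
    (kern (u - v) * kern (v - r) + kern (u - v) * kern (u - r) + kern (u - r) * kern (v - r)) * ennreal (L1 ^ 3)"
proof -
  have L: "ennreal (L1 ^ 3) = ennreal L1 * ennreal L1 * ennreal L1" by (simp add: power3_eq_cube ennreal_mult)
  have s: "(\<integral>\<^sup>+q. absf u q * absf v q * absf r q \<partial>LM) \<le> kern (u - v) * kern (v - r) * ennreal (L1 ^ 3)"
    if "0 \<le> u" "u < v" "v < r" for u v r
    using triple_bound_sorted[OF that, of "\<lambda>x. ennreal \<bar>\<phi> x\<bar>" "\<lambda>x. ennreal \<bar>\<phi> x\<bar>" "\<lambda>x. ennreal \<bar>\<phi> x\<bar>"] that
    by (simp add: path_field_def L1_nn L)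
  have c: "kern (r - u) = kern (u - r)" "kern (v - u) = kern (u - v)" "kern (r - v) = kern (v - r)" by (simp_all add: abs_minus_commute)
  consider "u < v \<and> v < r \<or> r < v \<and> v < u" | "v < u \<and> u < r \<or> r < u \<and> u < v" | "u < r \<and> r < v \<or> v < r \<and> r < u"
    using d by linarith
  then show ?thesis
  proof cases
    case 1
    then have "(\<integral>\<^sup>+q. absf u q * absf v q * absf r q \<partial>LM) \<le> kern (u - v) * kern (v - r) * ennreal (L1 ^ 3)"
      using s[of u v r] s[of r v u] t c by (auto simp: mult_ac)
    also have "\<dots> \<le> (kern (u - v) * kern (v - r) + kern (u - v) * kern (u - r) + kern (u - r) * kern (v - r)) * ennreal (L1 ^ 3)"
      by (intro mult_right_mono) (auto simp: add.assoc)
    finally show ?thesis .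
  next
    case 2
    then have "(\<integral>\<^sup>+q. absf u q * absf v q * absf r q \<partial>LM) \<le> kern (u - v) * kern (u - r) * ennreal (L1 ^ 3)"
      using s[of v u r] s[of r u v] t c by (auto simp: mult_ac)
    also have "\<dots> \<le> (kern (u - v) * kern (v - r) + kern (u - v) * kern (u - r) + kern (u - r) * kern (v - r)) * ennreal (L1 ^ 3)"
      by (intro mult_right_mono) (auto simp: add.assoc add_increasing add_increasing2)
    finally show ?thesis .
  next
    case 3
    then have "(\<integral>\<^sup>+q. absf u q * absf v q * absf r q \<partial>LM) \<le> kern (u - r) * kern (v - r) * ennreal (L1 ^ 3)"
      using s[of u r v] s[of v r u] t c by (auto simp: mult_ac)
    also have "\<dots> \<le> (kern (u - v) * kern (v - r) + kern (u - v) * kern (u - r) + kern (u - r) * kern (v - r)) * ennreal (L1 ^ 3)"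
      by (intro mult_right_mono) (auto simp: add_increasing)
    finally show ?thesis .
  qed
qed

end

context stable_motion
begin

lemma field_prod_measurable[measurable]:
  "(\<lambda>(q, u). pf q u) \<in> borel_measurable (LM \<Otimes>\<^sub>M lborel)"
  using field_measurable by (simp add: split_beta')

lemma field_section_measurable:
  "(\<lambda>q. pf q u) \<in> borel_measurable LM"
proof -
  have "(\<lambda>q. (\<lambda>(q, u). pf q u) (q, u)) \<in> borel_measurable LM"
    by (rule measurable_compose[OF _ field_prod_measurable]) measurable
  then show ?thesis by simp
qed

section \<open>Moments of the absolute occupation time\<close>

lemma kern_integral_le:
  assumes "l \<le> u" "u \<le> r"
  shows "(\<integral>\<^sup>+v. kern (u - v) * indicator {l..r} v \<partial>lborel) \<le> ennreal (p1 * (2 * (r - l) powr b / b))"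
proof -
  have "(\<integral>\<^sup>+v. kern (u - v) * indicator {l..r} v \<partial>lborel) = (\<integral>\<^sup>+v. ennreal p1 * (ennreal (\<bar>u - v\<bar> powr (b - 1)) * indicator {l..r} v) \<partial>lborel)"
    using p1_nonneg by (intro nn_integral_cong) (simp add: ennreal_mult mult.assoc)
  also have "\<dots> = ennreal p1 * (\<integral>\<^sup>+v. ennreal (\<bar>u - v\<bar> powr (b - 1)) * indicator {l..r} v \<partial>lborel)"
    by (rule nn_integral_cmult) measurable
  also have "\<dots> \<le> ennreal p1 * ennreal (2 * (r - l) powr b / b)"
    by (intro mult_left_mono nn_integral_powr_abs_le b_pos assms) auto
  also have "\<dots> = ennreal (p1 * (2 * (r - l) powr b / b))"
    by (rule ennreal_mult'[OF p1_nonneg, symmetric])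
  finally show ?thesis .
qed

text \<open>Integrating the kernel over one time gives the power b of the interval length, and the
  other time adds one more. The resulting exponent exceeds 1, as chaining requires.\<close>

lemma abs_occ_second_moment:
  assumes lr: "0 \<le> l" "l \<le> r"
  shows "(\<integral>\<^sup>+q. (abs_occ \<phi> Y q l r)\<^sup>2 \<partial>LM) \<le> ennreal (L1\<^sup>2 * p1 * (2 / b) * (r - l) powr (1 + b))"
proof -
  let ?i = "indicator {l..r} :: real \<Rightarrow> ennreal"
  let ?a = "\<lambda>q u. ennreal \<bar>pf q u * indicator {l..r} u\<bar>"
  have a: "?a q u = absf u q * ?i u" for q u by (auto simp: indicator_def)
  have am: "(\<lambda>(q, u). ?a q u) \<in> borel_measurable (LM \<Otimes>\<^sub>M lborel)" by measurable
  have "(\<integral>\<^sup>+q. (abs_occ \<phi> Y q l r)\<^sup>2 \<partial>LM) = (\<integral>\<^sup>+u. \<integral>\<^sup>+v. \<integral>\<^sup>+q. ?a q u * ?a q v \<partial>LM \<partial>lborel \<partial>lborel)"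
    unfolding abs_occ_def power2_eq_square by (rule PL.nn_integral_prod_of_integrals[OF am am])
  also have "\<dots> \<le> (\<integral>\<^sup>+u. ?i u * ennreal (L1\<^sup>2) * ennreal (p1 * (2 * (r - l) powr b / b)) \<partial>lborel)"
  proof (rule nn_integral_mono)
    fix u :: real
    have "(\<integral>\<^sup>+v. \<integral>\<^sup>+q. ?a q u * ?a q v \<partial>LM \<partial>lborel) \<le> (\<integral>\<^sup>+v. ?i u * ennreal (L1\<^sup>2) * (kern (u - v) * ?i v) \<partial>lborel)"
    proof (rule nn_integral_mono_AE)
      show "AE v in lborel. (\<integral>\<^sup>+q. ?a q u * ?a q v \<partial>LM) \<le> ?i u * ennreal (L1\<^sup>2) * (kern (u - v) * ?i v)"
        using AE_lborel_singleton[of u]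
      proof eventually_elim
        case (elim v)
        show ?case
        proof (cases "u \<in> {l..r} \<and> v \<in> {l..r}")
          case True
          then show ?thesis using pair_bound[of u v] elim lr by (simp add: a mult.commute)
        next
          case False then show ?thesis by (auto simp: a indicator_def)
        qed
      qed
    qed
    also have "\<dots> = ?i u * ennreal (L1\<^sup>2) * (\<integral>\<^sup>+v. kern (u - v) * ?i v \<partial>lborel)"
      by (rule nn_integral_cmult) measurable
    also have "\<dots> \<le> ?i u * ennreal (L1\<^sup>2) * ennreal (p1 * (2 * (r - l) powr b / b))"
      using kern_integral_le[of l u r] by (cases "u \<in> {l..r}") (auto intro: mult_left_mono)
    finally show "(\<integral>\<^sup>+v. \<integral>\<^sup>+q. ?a q u * ?a q v \<partial>LM \<partial>lborel) \<le> ?i u * ennreal (L1\<^sup>2) * ennreal (p1 * (2 * (r - l) powr b / b))" .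
  qed
  also have "\<dots> = ennreal (r - l) * ennreal (L1\<^sup>2) * ennreal (p1 * (2 * (r - l) powr b / b))"
    using lr by (simp add: nn_integral_multc)
  also have "\<dots> = ennreal (L1\<^sup>2 * p1 * (2 / b) * (r - l) powr (1 + b))"
  proof -
    have "(r - l) powr (1 + b) = (r - l) * (r - l) powr b"
      by (subst powr_add) (use lr in simp)
    then have "(r - l) * L1\<^sup>2 * (p1 * (2 * (r - l) powr b / b)) = L1\<^sup>2 * p1 * (2 / b) * (r - l) powr (1 + b)" by simp
    moreover have "0 \<le> p1 * (2 * (r - l) powr b / b)" using p1_nonneg b_pos by simp
    ultimately show ?thesis using lr by (simp only: ennreal_mult[symmetric] diff_ge_0_iff_ge mult_nonneg_nonneg zero_le_power2)
  qed
  finally show ?thesis .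
qed

text \<open>Each of the three kernel products integrates to at most R times the square of 2 * p1 * R
  powr b / b, and three times 4 is 12. The order R powr (1 + 2 * b) is smaller than the 3/2 power of
  the second moment bound because b < 1; this Lyapunov-type gap drives the Gaussian limit.\<close>

lemma abs_occ_third_moment:
  assumes R: "0 \<le> R"
  shows "(\<integral>\<^sup>+q. (abs_occ \<phi> Y q 0 R) ^ 3 \<partial>LM) \<le> ennreal (L1 ^ 3 * (12 * p1\<^sup>2 / b\<^sup>2) * (R * R powr b * R powr b))"
proof -
  let ?i = "indicator {0..R} :: real \<Rightarrow> ennreal"
  let ?a = "\<lambda>q u. ennreal \<bar>pf q u * indicator {0..R} u\<bar>"
  define C where "C = ennreal (p1 * (2 * (R - 0) powr b / b))"
  have C: "(\<integral>\<^sup>+v. kern (u - v) * ?i v \<partial>lborel) \<le> C" if "u \<in> {0..R}" for u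
    using kern_integral_le[of 0 u R] that by (simp add: C_def)
  have C': "(\<integral>\<^sup>+v. kern (v - u) * ?i v \<partial>lborel) \<le> C" if "u \<in> {0..R}" for u
    using C[OF that] by (simp add: abs_minus_commute)
  have a: "?a q u = absf u q * ?i u" for q u by (auto simp: indicator_def)
  have am: "(\<lambda>(q, u). ?a q u) \<in> borel_measurable (LM \<Otimes>\<^sub>M lborel)" by measurable
  let ?K = "\<lambda>u v t. kern (u - v) * kern (v - t) + kern (u - v) * kern (u - t) + kern (u - t) * kern (v - t)"
  have "(\<integral>\<^sup>+q. (abs_occ \<phi> Y q 0 R) ^ 3 \<partial>LM) = (\<integral>\<^sup>+u. \<integral>\<^sup>+v. \<integral>\<^sup>+t. \<integral>\<^sup>+q. ?a q u * ?a q v * ?a q t \<partial>LM \<partial>lborel \<partial>lborel \<partial>lborel)"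
    unfolding abs_occ_def power3_eq_cube mult.assoc[symmetric]
    using PL.nn_integral_prod3_of_integrals[OF am am am] by (simp add: mult.assoc)
  also have "\<dots> \<le> (\<integral>\<^sup>+u. \<integral>\<^sup>+v. \<integral>\<^sup>+t. ennreal (L1 ^ 3) * (?i u * ?i v * ?i t * ?K u v t) \<partial>lborel \<partial>lborel \<partial>lborel)"
  proof (rule nn_integral_mono)
    fix u :: real
    show "(\<integral>\<^sup>+v. \<integral>\<^sup>+t. \<integral>\<^sup>+q. ?a q u * ?a q v * ?a q t \<partial>LM \<partial>lborel \<partial>lborel) \<le> (\<integral>\<^sup>+v. \<integral>\<^sup>+t. ennreal (L1 ^ 3) * (?i u * ?i v * ?i t * ?K u v t) \<partial>lborel \<partial>lborel)"
    proof (rule nn_integral_mono_AE)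
      show "AE v in lborel. (\<integral>\<^sup>+t. \<integral>\<^sup>+q. ?a q u * ?a q v * ?a q t \<partial>LM \<partial>lborel) \<le> (\<integral>\<^sup>+t. ennreal (L1 ^ 3) * (?i u * ?i v * ?i t * ?K u v t) \<partial>lborel)"
        using AE_lborel_singleton[of u]
      proof eventually_elim
        case (elim v)
        show ?case
        proof (rule nn_integral_mono_AE)
          show "AE t in lborel. (\<integral>\<^sup>+q. ?a q u * ?a q v * ?a q t \<partial>LM) \<le> ennreal (L1 ^ 3) * (?i u * ?i v * ?i t * ?K u v t)"
            using AE_lborel_singleton[of u] AE_lborel_singleton[of v]
          proof eventually_elim
            case (elim t)
            show ?case
            proof (cases "u \<in> {0..R} \<and> v \<in> {0..R} \<and> t \<in> {0..R}")
              case True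
              then show ?thesis using triple_bound[of u v t] elim \<open>v \<noteq> u\<close> by (simp add: a mult.commute)
            next
              case False then show ?thesis by (auto simp: a indicator_def)
            qed
          qed
        qed
      qed
    qed
  qed
  also have "\<dots> = ennreal (L1 ^ 3) * (\<integral>\<^sup>+u. \<integral>\<^sup>+v. \<integral>\<^sup>+t. ?i u * ?i v * ?i t * ?K u v t \<partial>lborel \<partial>lborel \<partial>lborel)"
    by (simp add: nn_integral_cmult)
  also have "(\<integral>\<^sup>+u. \<integral>\<^sup>+v. \<integral>\<^sup>+t. ?i u * ?i v * ?i t * ?K u v t \<partial>lborel \<partial>lborel \<partial>lborel) \<le> (\<integral>\<^sup>+u. ?i u * (3 * C * C) \<partial>lborel)"
  proof (rule nn_integral_mono)
    fix u :: real
    have split: "?i u * ?i v * ?i t * ?K u v t = ?i u * (?i v * kern (u - v) * (kern (v - t) * ?i t)) + ?i u * (?i v * kern (u - v) * (kern (u - t) * ?i t)) + ?i u * (?i t * kern (u - t) * (kern (v - t) * ?i v))" for v t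
      by (simp add: distrib_left distrib_right mult_ac)
    have 1: "(\<integral>\<^sup>+v. \<integral>\<^sup>+t. ?i v * kern (u - v) * (kern (v - t) * ?i t) \<partial>lborel \<partial>lborel) \<le> C * C" if u: "u \<in> {0..R}"
    proof -
      have "(\<integral>\<^sup>+v. \<integral>\<^sup>+t. ?i v * kern (u - v) * (kern (v - t) * ?i t) \<partial>lborel \<partial>lborel) = (\<integral>\<^sup>+v. ?i v * kern (u - v) * (\<integral>\<^sup>+t. kern (v - t) * ?i t \<partial>lborel) \<partial>lborel)"
        by (intro nn_integral_cong nn_integral_cmult) measurable
      also have "\<dots> \<le> (\<integral>\<^sup>+v. kern (u - v) * ?i v * C \<partial>lborel)"
      proof (rule nn_integral_mono)
        fix v show "?i v * kern (u - v) * (\<integral>\<^sup>+t. kern (v - t) * ?i t \<partial>lborel) \<le> kern (u - v) * ?i v * C"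
          using C[of v] by (cases "v \<in> {0..R}") (auto intro: mult_left_mono)
      qed
      also have "\<dots> = (\<integral>\<^sup>+v. kern (u - v) * ?i v \<partial>lborel) * C" by (rule nn_integral_multc) measurable
      also have "\<dots> \<le> C * C" by (intro mult_right_mono C u) auto
      finally show ?thesis .
    qed
    have 2: "(\<integral>\<^sup>+v. \<integral>\<^sup>+t. ?i v * kern (u - v) * (kern (u - t) * ?i t) \<partial>lborel \<partial>lborel) \<le> C * C" if u: "u \<in> {0..R}"
    proof -
      have "(\<integral>\<^sup>+v. \<integral>\<^sup>+t. ?i v * kern (u - v) * (kern (u - t) * ?i t) \<partial>lborel \<partial>lborel) = (\<integral>\<^sup>+v. ?i v * kern (u - v) * (\<integral>\<^sup>+t. kern (u - t) * ?i t \<partial>lborel) \<partial>lborel)"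
        by (intro nn_integral_cong nn_integral_cmult) measurable
      also have "\<dots> = (\<integral>\<^sup>+v. kern (u - v) * ?i v \<partial>lborel) * (\<integral>\<^sup>+t. kern (u - t) * ?i t \<partial>lborel)"
        by (simp add: nn_integral_multc mult.commute[of "?i _"])
      also have "\<dots> \<le> C * C" by (intro mult_mono C u) auto
      finally show ?thesis .
    qed
    \<comment> \<open>Here t is the time shared by both kernels, so the integration over v is
      carried out first.\<close>
    have 3: "(\<integral>\<^sup>+v. \<integral>\<^sup>+t. ?i t * kern (u - t) * (kern (v - t) * ?i v) \<partial>lborel \<partial>lborel) \<le> C * C" if u: "u \<in> {0..R}"
    proof -
          have "(\<integral>\<^sup>+v. \<integral>\<^sup>+t. ?i t * kern (u - t) * (kern (v - t) * ?i v) \<partial>lborel \<partial>lborel) = (\<integral>\<^sup>+t. \<integral>\<^sup>+v. ?i t * kern (u - t) * (kern (v - t) * ?i v) \<partial>lborel \<partial>lborel)"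
        by (rule lborel_pair.Fubini') measurable
      also have "\<dots> = (\<integral>\<^sup>+t. ?i t * kern (u - t) * (\<integral>\<^sup>+v. kern (v - t) * ?i v \<partial>lborel) \<partial>lborel)"
        by (intro nn_integral_cong nn_integral_cmult) measurable
      also have "\<dots> \<le> (\<integral>\<^sup>+t. kern (u - t) * ?i t * C \<partial>lborel)"
      proof (rule nn_integral_mono)
        fix t show "?i t * kern (u - t) * (\<integral>\<^sup>+v. kern (v - t) * ?i v \<partial>lborel) \<le> kern (u - t) * ?i t * C"
          using C'[of t] by (cases "t \<in> {0..R}") (auto intro: mult_left_mono)
      qed
      also have "\<dots> = (\<integral>\<^sup>+v. kern (u - v) * ?i v \<partial>lborel) * C" by (rule nn_integral_multc) measurable
      also have "\<dots> \<le> C * C" by (intro mult_right_mono C u) auto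
      finally show ?thesis .
    qed
    have "(\<integral>\<^sup>+v. \<integral>\<^sup>+t. ?i u * ?i v * ?i t * ?K u v t \<partial>lborel \<partial>lborel) =
      ?i u * (\<integral>\<^sup>+v. \<integral>\<^sup>+t. ?i v * kern (u - v) * (kern (v - t) * ?i t) \<partial>lborel \<partial>lborel) +
      ?i u * (\<integral>\<^sup>+v. \<integral>\<^sup>+t. ?i v * kern (u - v) * (kern (u - t) * ?i t) \<partial>lborel \<partial>lborel) +
      ?i u * (\<integral>\<^sup>+v. \<integral>\<^sup>+t. ?i t * kern (u - t) * (kern (v - t) * ?i v) \<partial>lborel \<partial>lborel)"
      unfolding split by (simp add: nn_integral_add nn_integral_cmult)
    also have "\<dots> \<le> ?i u * (3 * C * C)"
    proof (cases "u \<in> {0..R}")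
      case True
      have "C * C + C * C + C * C = (1 + 1 + 1) * (C * C)" by (simp only: distrib_right mult_1)
      also have "\<dots> = 3 * C * C" by (simp add: mult.assoc)
      finally have "C * C + C * C + C * C = 3 * C * C" .
      then show ?thesis using add_mono[OF add_mono[OF 1[OF True] 2[OF True]] 3[OF True]] True by simp
    qed simp
    finally show "(\<integral>\<^sup>+v. \<integral>\<^sup>+t. ?i u * ?i v * ?i t * ?K u v t \<partial>lborel \<partial>lborel) \<le> ?i u * (3 * C * C)" .
  qed
  also have "(\<integral>\<^sup>+u. ?i u * (3 * C * C) \<partial>lborel) = ennreal R * (3 * C * C)" using R by (simp add: nn_integral_multc)
  also have "ennreal (L1 ^ 3) * (ennreal R * (3 * C * C)) = ennreal (L1 ^ 3 * (12 * p1\<^sup>2 / b\<^sup>2) * (R * R powr b * R powr b))"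
  proof -
    have c0: "0 \<le> p1 * (2 * R powr b / b)" using p1_nonneg b_pos by simp
    have "3 * C * C = ennreal (3 * (p1 * (2 * R powr b / b)) * (p1 * (2 * R powr b / b)))"
    proof -
      have "3 * ennreal c * ennreal c = ennreal (3 * c * c)" if "0 \<le> c" for c using that by (simp add: ennreal_mult')
      from this[OF c0] show ?thesis by (simp add: C_def)
    qed
    moreover have "L1 ^ 3 * (R * (3 * (p1 * (2 * R powr b / b)) * (p1 * (2 * R powr b / b)))) = L1 ^ 3 * (12 * p1\<^sup>2 / b\<^sup>2) * (R * R powr b * R powr b)"
      by (simp add: power2_eq_square)
    moreover have "0 \<le> L1 ^ 3" by simp
    ultimately show ?thesis using R c0 by (simp only: ennreal_mult[symmetric] mult_nonneg_nonneg zero_le_numeral)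
  qed
  finally show ?thesis by (simp add: mult_left_mono)
qed

text \<open>An equality rather than a bound, since the position at every time is again distributed
  by Lebesgue measure.\<close>

lemma abs_occ_first_moment:
  assumes R: "0 \<le> R"
  shows "(\<integral>\<^sup>+q. abs_occ \<phi> Y q 0 R \<partial>LM) = ennreal (L1 * R)"
proof -
  have "(\<integral>\<^sup>+q. abs_occ \<phi> Y q 0 R \<partial>LM) = (\<integral>\<^sup>+u. \<integral>\<^sup>+q. ennreal \<bar>pf q u * indicator {0..R} u\<bar> \<partial>LM \<partial>lborel)"
    unfolding abs_occ_def by (rule PL.Fubini'[symmetric]) measurable
  also have "\<dots> = (\<integral>\<^sup>+u. ennreal L1 * indicator {0..R} u \<partial>lborel)"
  proof (rule nn_integral_cong)
    fix u :: real
    show "(\<integral>\<^sup>+q. ennreal \<bar>pf q u * indicator {0..R} u\<bar> \<partial>LM) = ennreal L1 * indicator {0..R} u"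
    proof (cases "u \<in> {0..R}")
      case True
      have [measurable]: "Y (max 0 u) \<in> borel_measurable M" by (rule Y_measurable) simp
      have "(\<integral>\<^sup>+q. ennreal \<bar>pf q u\<bar> \<partial>LM) = (\<integral>\<^sup>+w. \<integral>\<^sup>+x. ennreal \<bar>\<phi> (x + Y (max 0 u) w)\<bar> \<partial>lborel \<partial>M)"
        unfolding path_field_def by (subst P.nn_integral_snd[symmetric]) auto
      also have "\<dots> = ennreal L1"
        using nn_integral_lborel_shift[of "\<lambda>x. ennreal \<bar>\<phi> x\<bar>"] by (simp add: L1_nn emeasure_space_1)
      finally show ?thesis using True by simp
    qed simp
  qed
  also have "\<dots> = ennreal (L1 * R)" using R by (simp add: nn_integral_cmult ennreal_mult)
  finally show ?thesis .
qed

section \<open>Covariance of the occupation time and its scaling limit\<close>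

definition "self_conv z = (LBINT x. \<phi> x * \<phi> (x + z))"

text \<open>\<open>self_conv\<close> is the autocorrelation of \<phi>, given by a convergent
  integral for almost every shift. Its total mass is the squared integral that ends up in the square
  of \<open>D\<close>.\<close>

lemma self_conv_integrable: "integrable lborel self_conv" "(LBINT z. self_conv z) = (LBINT x. \<phi> x)\<^sup>2"
proof -
  have m: "(\<lambda>(x, z). \<phi> x * \<phi> (x + z)) \<in> borel_measurable (lborel \<Otimes>\<^sub>M lborel)" by measurable
  have "(\<integral>\<^sup>+q. ennreal (norm ((\<lambda>(x, z). \<phi> x * \<phi> (x + z)) q)) \<partial>(lborel \<Otimes>\<^sub>M lborel)) = (\<integral>\<^sup>+x. \<integral>\<^sup>+z. ennreal \<bar>\<phi> x\<bar> * ennreal \<bar>\<phi> (x + z)\<bar> \<partial>lborel \<partial>lborel)"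
    using m by (subst lborel.nn_integral_fst[symmetric]) (auto simp: abs_mult ennreal_mult)
  also have "\<dots> = (\<integral>\<^sup>+x. ennreal \<bar>\<phi> x\<bar> * ennreal L1 \<partial>lborel)"
    using nn_integral_lborel_shift[of "\<lambda>x. ennreal \<bar>\<phi> x\<bar>"]
    by (intro nn_integral_cong) (simp add: nn_integral_cmult L1_nn add.commute)
  also have "\<dots> = ennreal L1 * ennreal L1" by (simp add: nn_integral_multc L1_nn)
  finally have int: "integrable (lborel \<Otimes>\<^sub>M lborel) (\<lambda>(x, z). \<phi> x * \<phi> (x + z))"
    using m by (intro integrableI_bounded) (auto simp: ennreal_mult_less_top)
  show "integrable lborel self_conv" unfolding self_conv_def using lborel_pair.integrable_snd[OF int] by simp
  have "(LBINT z. self_conv z) = (LBINT x. (LBINT z. \<phi> x * \<phi> (x + z)))"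
    unfolding self_conv_def using lborel_pair.Fubini_integral[OF int] by simp
  also have "\<dots> = (LBINT x. \<phi> x * (LBINT z. \<phi> z))"
    using integral_lborel_shift[of \<phi>] by (simp add: add.commute)
  finally show "(LBINT z. self_conv z) = (LBINT x. \<phi> x)\<^sup>2" by (simp add: power2_eq_square)
qed

text \<open>The covariance density at time lag r. The density at time r is written through the one
  at time 1, which makes measurability in r immediate and the scaling visible; \<open>max 0\<close>
  matches the truncation by \<open>ennreal\<close> in \<open>symmetric_stable_levy\<close>.\<close>

definition "kap r = (LBINT z. max 0 (r powr (- 1 / \<alpha>) * stable_density \<alpha> 1 (r powr (- 1 / \<alpha>) * z)) * self_conv z)"

lemma self_conv_measurable[measurable]: "self_conv \<in> borel_measurable borel"
  using borel_measurable_integrable[OF self_conv_integrable(1)] by simp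

lemma density1_measurable[measurable]: "stable_density \<alpha> 1 \<in> borel_measurable borel"
  using borel_measurable_stable_density \<alpha> by simp

lemma kap_measurable[measurable]: "kap \<in> borel_measurable borel"
  unfolding kap_def by measurable

lemma field_pair_integral:
  assumes "0 \<le> u" "0 \<le> v" "u \<noteq> v"
  shows "(LINT q|LM. pf q u * pf q v) = kap \<bar>u - v\<bar>"
proof -
  have sorted: "(LINT q|LM. pf q u * pf q v) = kap (v - u)" if uv: "0 \<le> u" "u < v" for u v
  proof -
    have [measurable]: "Y u \<in> borel_measurable M" "Y v \<in> borel_measurable M" "Y (v - u) \<in> borel_measurable M" using uv by (auto intro: Y_measurable)
    have "(\<integral>\<^sup>+q. ennreal (norm (pf q u * pf q v)) \<partial>LM) \<le> kern (u - v) * ennreal (L1\<^sup>2)"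
      using pair_bound[of u v] uv by (simp add: abs_mult ennreal_mult)
    also have "\<dots> < \<infinity>" by (simp add: ennreal_mult_less_top)
    finally have int: "integrable LM (\<lambda>q. pf q u * pf q v)"
      by (intro integrableI_bounded borel_measurable_times field_section_measurable)
    have "(LINT q|LM. pf q u * pf q v) = (LINT w|M. (LBINT x. \<phi> (x + Y u w) * \<phi> (x + Y v w)))"
      using P.integral_snd[of "\<lambda>x w. pf (x, w) u * pf (x, w) v"] int uv by (simp add: path_field_def max_absorb2 split_beta')
    also have "\<dots> = (LINT w|M. self_conv (Y v w - Y u w))"
    proof (rule Bochner_Integration.integral_cong[OF refl])
      fix w
      show "(LBINT x. \<phi> (x + Y u w) * \<phi> (x + Y v w)) = self_conv (Y v w - Y u w)"
        unfolding self_conv_def using integral_lborel_shift[of "\<lambda>x. \<phi> x * \<phi> (x + (Y v w - Y u w))" "Y u w"] by (simp add: add.assoc)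
    qed
    also have "\<dots> = (LINT z|(distr M borel (\<lambda>w. Y v w - Y u w)). self_conv z)" by (simp add: integral_distr)
    also have "distr M borel (\<lambda>w. Y v w - Y u w) = distr M borel (Y (v - u))"
      using levy uv unfolding levy_process_def by auto
    also have "(LINT z|(distr M borel (Y (v - u))). self_conv z) = (LINT w|M. self_conv (Y (v - u) w))" by (simp add: integral_distr)
    also have "\<dots> = (LBINT z. max 0 (stable_density \<alpha> (v - u) z) * self_conv z)"
    proof (rule distributed_integral[symmetric])
      have "(\<lambda>z. ennreal (max 0 (stable_density \<alpha> (v - u) z))) = (\<lambda>z. ennreal (stable_density \<alpha> (v - u) z))"
        by (auto simp: max_def ennreal_neg)
      then show "distributed M lborel (Y (v - u)) (\<lambda>z. ennreal (max 0 (stable_density \<alpha> (v - u) z)))"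
        using stable uv by (simp add: symmetric_stable_levy_def)
    qed auto
    also have "\<dots> = kap (v - u)" unfolding kap_def using stable_density_scaling[of \<alpha> "v - u"] \<alpha> uv by simp
    finally show ?thesis .
  qed
  show ?thesis
  proof (cases "u < v")
    case True then show ?thesis using sorted[of u v] assms by simp
  next
    case False then show ?thesis using sorted[of v u] assms by (simp add: mult.commute)
  qed
qed

definition "occ_cov s s' = (LINT q|LM. occ \<phi> Y q s * occ \<phi> Y q s')"

text \<open>The time integrals are exchanged with the integral over start and path, the finiteness
  coming from the second moment of \<open>abs_occ\<close>. On the diagonal, where \<phi> would have
  to be square integrable, nothing is claimed; it is a null set.\<close>

lemma occ_cov_eq:
  assumes "0 \<le> s" "0 \<le> s'"
  shows "integrable LM (\<lambda>q. occ \<phi> Y q s * occ \<phi> Y q s')"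
    "occ_cov s s' = (LBINT u. (LBINT v. kap \<bar>u - v\<bar> * indicator {0..s} u * indicator {0..s'} v))"
proof -
  define R where "R = max s s'"
  have R: "0 \<le> R" "s \<le> R" "s' \<le> R" using assms by (auto simp: R_def)
  let ?f = "\<lambda>q u. pf q u * indicator {0..s} u" and ?g = "\<lambda>q u. pf q u * indicator {0..s'} u"
  have fm: "(\<lambda>(q, u). ?f q u) \<in> borel_measurable (LM \<Otimes>\<^sub>M lborel)" and gm: "(\<lambda>(q, u). ?g q u) \<in> borel_measurable (LM \<Otimes>\<^sub>M lborel)"
    by measurable
  have "(\<integral>\<^sup>+q. (\<integral>\<^sup>+u. ennreal \<bar>?f q u\<bar> \<partial>lborel) * (\<integral>\<^sup>+v. ennreal \<bar>?g q v\<bar> \<partial>lborel) \<partial>LM) \<le>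
     (\<integral>\<^sup>+q. (abs_occ \<phi> Y q 0 R)\<^sup>2 \<partial>LM)"
    using abs_occ_mono[of 0 0 s R \<phi> Y] abs_occ_mono[of 0 0 s' R \<phi> Y] R
    by (intro nn_integral_mono) (auto simp: abs_occ_def[symmetric] power2_eq_square intro!: mult_mono)
  also have "\<dots> < \<infinity>" using abs_occ_second_moment[of 0 R] R by (auto simp: less_top[symmetric] top_unique)
  finally have fin: "(\<integral>\<^sup>+q. (\<integral>\<^sup>+u. ennreal \<bar>?f q u\<bar> \<partial>lborel) * (\<integral>\<^sup>+v. ennreal \<bar>?g q v\<bar> \<partial>lborel) \<partial>LM) < \<infinity>" .
  note I = PL.integral_prod_of_integrals[OF fm gm fin]
  show "integrable LM (\<lambda>q. occ \<phi> Y q s * occ \<phi> Y q s')" using I(1) by (simp add: occ_def)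
  have "occ_cov s s' = (LBINT u. (LBINT v. (LINT q|LM. ?f q u * ?g q v )  ))"
    using I(2) by (simp add: occ_def occ_cov_def)
  also have "\<dots> = (LBINT u. (LBINT v. kap \<bar>u - v\<bar> * indicator {0..s} u * indicator {0..s'} v))"
  proof (rule Bochner_Integration.integral_cong[OF refl])
    fix u :: real
    show "(LBINT v. (LINT q|LM. ?f q u * ?g q v)) = (LBINT v. kap \<bar>u - v\<bar> * indicator {0..s} u * indicator {0..s'} v)"
    proof (rule integral_cong_AE)
      show "(\<lambda>v. (LINT q|LM. ?f q u * ?g q v)) \<in> borel_measurable lborel"
      proof (rule P.borel_measurable_lebesgue_integral)
        have "(\<lambda>p. (\<lambda>(q, u). ?f q u) (snd p, u) * (\<lambda>(q, u). ?g q u) (snd p, fst p)) \<in> borel_measurable (lborel \<Otimes>\<^sub>M LM)"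
          by (intro borel_measurable_times measurable_compose[OF _ fm] measurable_compose[OF _ gm]) measurable
        then show "(\<lambda>(v, q). ?f q u * ?g q v) \<in> borel_measurable (lborel \<Otimes>\<^sub>M LM)"
          by (simp add: split_beta')
      qed
      show "AE v in lborel. (LINT q|LM. ?f q u * ?g q v) = kap \<bar>u - v\<bar> * indicator {0..s} u * indicator {0..s'} v"
        using AE_lborel_singleton[of u]
      proof eventually_elim
        case (elim v)
        show ?case
        proof (cases "u \<in> {0..s} \<and> v \<in> {0..s'}")
          case True
          then show ?thesis using field_pair_integral[of u v] elim by simp
        qed (auto simp: indicator_def)
      qed
    qed measurable
  qed
  finally show "occ_cov s s' = (LBINT u. (LBINT v. kap \<bar>u - v\<bar> * indicator {0..s} u * indicator {0..s'} v))" .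
qed

lemma density1_conv_bound: "\<bar>max 0 (stable_density \<alpha> 1 y) * self_conv z\<bar> \<le> p1 * \<bar>self_conv z\<bar>"
  using density_le[of 1 y] p1_nonneg by (auto simp: abs_mult intro!: mult_right_mono)

text \<open>The identity shows the limit, since the argument of the density tends to 0 as T grows;
  the inequality is a majorant independent of T and integrable at lag 0, for use in dominated
  convergence.\<close>

lemma kap_scaled:
  assumes T: "0 < T" and r: "0 < r"
  shows "T powr (1 / \<alpha>) * kap (T * r) = r powr (b - 1) * (LBINT z. max 0 (stable_density \<alpha> 1 ((T * r) powr (- 1 / \<alpha>) * z)) * self_conv z)"
    and "\<bar>T powr (1 / \<alpha>) * kap (T * r)\<bar> \<le> r powr (b - 1) * (p1 * (LBINT z. \<bar>self_conv z\<bar>))"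
proof -
  have c: "T powr (1 / \<alpha>) * (T * r) powr (- 1 / \<alpha>) = r powr (b - 1)"
    using T r by (simp add: powr_mult powr_add[symmetric] flip: mult.assoc)
  have "kap (T * r) = (T * r) powr (- 1 / \<alpha>) * (LBINT z. max 0 (stable_density \<alpha> 1 ((T * r) powr (- 1 / \<alpha>) * z)) * self_conv z)"
  proof -
    have "max 0 ((T * r) powr (- 1 / \<alpha>) * s) = (T * r) powr (- 1 / \<alpha>) * max 0 s" for s
    proof (cases "0 \<le> s")
      case False
      then have "(T * r) powr (- 1 / \<alpha>) * s \<le> 0" by (intro mult_nonneg_nonpos) auto
      with False show ?thesis by (simp add: max_absorb1)
    qed (simp add: max_absorb2)
    then show ?thesis unfolding kap_def by (simp add: mult.assoc)
  qed
  then show eq: "T powr (1 / \<alpha>) * kap (T * r) = r powr (b - 1) * (LBINT z. max 0 (stable_density \<alpha> 1 ((T * r) powr (- 1 / \<alpha>) * z)) * self_conv z)"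
    using c by (simp flip: mult.assoc)
  note bd = density1_conv_bound
  have "\<bar>LBINT z. max 0 (stable_density \<alpha> 1 ((T * r) powr (- 1 / \<alpha>) * z)) * self_conv z\<bar> \<le> (LBINT z. p1 * \<bar>self_conv z\<bar>)"
  proof (rule order_trans[OF integral_abs_bound], rule integral_mono)
    show "integrable lborel (\<lambda>z. p1 * \<bar>self_conv z\<bar>)" using self_conv_integrable(1) by auto
    then show "integrable lborel (\<lambda>z. \<bar>max 0 (stable_density \<alpha> 1 ((T * r) powr (- 1 / \<alpha>) * z)) * self_conv z\<bar>)"
      by (rule Bochner_Integration.integrable_bound) (use bd p1_nonneg in \<open>auto intro!: AE_I2 simp: abs_mult\<close>)
  qed (rule bd)
  then show "\<bar>T powr (1 / \<alpha>) * kap (T * r)\<bar> \<le> r powr (b - 1) * (p1 * (LBINT z. \<bar>self_conv z\<bar>))"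
    unfolding eq by (simp add: abs_mult mult_left_mono)
qed

text \<open>The density is evaluated ever closer to 0, where it equals \<open>p1\<close>, and the
  autocorrelation contributes only its total mass. This is why \<phi> survives in the limit only
  through its integral.\<close>

lemma kap_scaled_limit:
  assumes T: "filterlim T at_top sequentially" and r: "0 < r"
  shows "(\<lambda>n. T n powr (1 / \<alpha>) * kap (T n * r)) \<longlonglongrightarrow> r powr (b - 1) * (p1 * (LBINT x. \<phi> x)\<^sup>2)"
proof -
  have ev: "\<forall>\<^sub>F n in sequentially. 0 < T n" using T by (simp add: filterlim_at_top_dense)
  have c0: "(\<lambda>n. (T n * r) powr (- 1 / \<alpha>)) \<longlonglongrightarrow> 0"
  proof (rule tendsto_neg_powr)
    show "filterlim (\<lambda>n. T n * r) at_top sequentially" using filterlim_tendsto_pos_mult_at_top[OF tendsto_const r T] by (simp add: mult.commute)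
  qed (use \<alpha> in auto)
  have "(\<lambda>n. (LBINT z. max 0 (stable_density \<alpha> 1 ((T n * r) powr (- 1 / \<alpha>) * z)) * self_conv z)) \<longlonglongrightarrow> (LBINT z. max 0 p1 * self_conv z)"
  proof (rule integral_dominated_convergence[where w="\<lambda>z. p1 * \<bar>self_conv z\<bar>"])
    show "integrable lborel (\<lambda>z. p1 * \<bar>self_conv z\<bar>)" using self_conv_integrable(1) by auto
    have cont: "isCont (stable_density \<alpha> 1) 0"
      using continuous_on_stable_density[of \<alpha> 1] \<alpha> by (simp add: continuous_on_eq_continuous_at)
    show "AE z in lborel. (\<lambda>n. max 0 (stable_density \<alpha> 1 ((T n * r) powr (- 1 / \<alpha>) * z)) * self_conv z) \<longlonglongrightarrow> max 0 p1 * self_conv z"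
    proof (rule AE_I2)
      fix z
      have "(\<lambda>n. (T n * r) powr (- 1 / \<alpha>) * z) \<longlonglongrightarrow> 0 * z" by (intro tendsto_mult_right c0)
      then have "(\<lambda>n. stable_density \<alpha> 1 ((T n * r) powr (- 1 / \<alpha>) * z)) \<longlonglongrightarrow> p1"
        using isCont_tendsto_compose[OF cont, of "\<lambda>n. (T n * r) powr (- 1 / \<alpha>) * z"] by simp
      then show "(\<lambda>n. max 0 (stable_density \<alpha> 1 ((T n * r) powr (- 1 / \<alpha>) * z)) * self_conv z) \<longlonglongrightarrow> max 0 p1 * self_conv z"
        by (intro tendsto_mult_right tendsto_max tendsto_const)
    qed
    show "AE z in lborel. norm (max 0 (stable_density \<alpha> 1 ((T n * r) powr (- 1 / \<alpha>) * z)) * self_conv z) \<le> p1 * \<bar>self_conv z\<bar>" for n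
      using density1_conv_bound by (intro AE_I2) simp
  qed auto
  then have "(\<lambda>n. r powr (b - 1) * (LBINT z. max 0 (stable_density \<alpha> 1 ((T n * r) powr (- 1 / \<alpha>) * z)) * self_conv z)) \<longlonglongrightarrow> r powr (b - 1) * (p1 * (LBINT x. \<phi> x)\<^sup>2)"
    using p1_nonneg by (intro tendsto_mult_left) (simp add: self_conv_integrable(2) max_absorb2)
  then show ?thesis
    by (rule Lim_transform_eventually) (use ev in \<open>auto elim!: eventually_mono simp: kap_scaled(1)[OF _ r]\<close>)
qed

end

lemma fbs_cov_sym: "fbs_cov \<alpha> u v = fbs_cov \<alpha> v u"
  unfolding fbs_cov_def by (simp add: min.commute add.commute)

lemma integral_powr_abs:
  fixes b :: real assumes "0 < b" "l \<le> u" "u \<le> r"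
  shows "integrable lborel (\<lambda>v. \<bar>u - v\<bar> powr (b - 1) * indicator {l..r} v)"
    "(LBINT v. \<bar>u - v\<bar> powr (b - 1) * indicator {l..r} v) = ((u - l) powr b + (r - u) powr b) / b"
proof -
  have nn: "(\<integral>\<^sup>+v. ennreal (\<bar>u - v\<bar> powr (b - 1) * indicator {l..r} v) \<partial>lborel) = ennreal (((u - l) powr b + (r - u) powr b) / b)"
    using nn_integral_powr_abs[OF assms] by (simp add: ennreal_mult ennreal_indicator)
  have "has_bochner_integral lborel (\<lambda>v. \<bar>u - v\<bar> powr (b - 1) * indicator {l..r} v) (((u - l) powr b + (r - u) powr b) / b)"
    by (rule has_bochner_integral_nn_integral[OF _ _ _ nn]) (use assms in auto)
  then show "integrable lborel (\<lambda>v. \<bar>u - v\<bar> powr (b - 1) * indicator {l..r} v)"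
    "(LBINT v. \<bar>u - v\<bar> powr (b - 1) * indicator {l..r} v) = ((u - l) powr b + (r - u) powr b) / b"
    by (auto simp: has_bochner_integral_iff)
qed

context stable_motion
begin

lemma occ_cov_sym: "occ_cov s s' = occ_cov s' s"
  unfolding occ_cov_def by (simp add: mult.commute)

text \<open>Both time variables are multiplied by T; the Jacobian T * T divided by T powr (1 + b)
  leaves T powr (1 / \<alpha>).\<close>

lemma occ_cov_scale:
  assumes T: "0 < T" and s: "0 \<le> s" "0 \<le> s'"
  shows "occ_cov (T * s) (T * s') / T powr (1 + b) =
    (LBINT u. (LBINT v. T powr (1 / \<alpha>) * kap (T * \<bar>u - v\<bar>) * indicator {0..s'} v) * indicator {0..s} u)"
proof -
  have ind: "indicator {0..T * r} (T * x) = (indicator {0..r} x :: real)" for r x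
    using T by (auto simp: indicator_def zero_le_mult_iff)
  have "occ_cov (T * s) (T * s') = (LBINT u. (LBINT v. kap \<bar>u - v\<bar> * indicator {0..T * s} u * indicator {0..T * s'} v))"
    using occ_cov_eq(2)[of "T * s" "T * s'"] T s by simp
  also have "\<dots> = T * (LBINT u. (LBINT v. kap \<bar>T * u - v\<bar> * indicator {0..T * s} (T * u) * indicator {0..T * s'} v))"
    using lborel_integral_real_affine[of T "\<lambda>u. (LBINT v. kap \<bar>u - v\<bar> * indicator {0..T * s} u * indicator {0..T * s'} v)" 0] T by simp
  also have "(\<lambda>u. (LBINT v. kap \<bar>T * u - v\<bar> * indicator {0..T * s} (T * u) * indicator {0..T * s'} v)) =
    (\<lambda>u. T * (LBINT v. kap (T * \<bar>u - v\<bar>) * indicator {0..s} u * indicator {0..s'} v))"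
  proof
    fix u
    have "\<bar>T * u - T * v\<bar> = T * \<bar>u - v\<bar>" for v using T by (simp add: right_diff_distrib[symmetric] abs_mult)
    then show "(LBINT v. kap \<bar>T * u - v\<bar> * indicator {0..T * s} (T * u) * indicator {0..T * s'} v) =
      T * (LBINT v. kap (T * \<bar>u - v\<bar>) * indicator {0..s} u * indicator {0..s'} v)"
      using lborel_integral_real_affine[of T "\<lambda>v. kap \<bar>T * u - v\<bar> * indicator {0..T * s} (T * u) * indicator {0..T * s'} v" 0] T
      by (simp add: ind)
  qed
  finally have e: "occ_cov (T * s) (T * s') = T * T * (LBINT u. (LBINT v. kap (T * \<bar>u - v\<bar>) * indicator {0..s} u * indicator {0..s'} v))"
    by simp
  have "T * T / T powr (1 + b) = T powr 2 / T powr (1 + b)" using T by (simp add: power2_eq_square)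
  also have "\<dots> = T powr (1 / \<alpha>)" by (simp add: powr_diff[symmetric])
  finally have p: "T * T / T powr (1 + b) = T powr (1 / \<alpha>)" .
  have "occ_cov (T * s) (T * s') / T powr (1 + b) = T powr (1 / \<alpha>) * (LBINT u. (LBINT v. kap (T * \<bar>u - v\<bar>) * indicator {0..s} u * indicator {0..s'} v))"
    unfolding e p[symmetric] by simp
  also have "\<dots> = (LBINT u. (LBINT v. T powr (1 / \<alpha>) * kap (T * \<bar>u - v\<bar>) * indicator {0..s'} v) * indicator {0..s} u)"
    unfolding integral_mult_right_zero[symmetric] integral_mult_left_zero[symmetric]
    by (intro Bochner_Integration.integral_cong refl) (simp add: mult_ac)
  finally show ?thesis .
qed

text \<open>Dominated convergence in v and then in u. If s is at most s', every u in {0..s} lies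
  within the range of v, so that the inner limit has one closed form; symmetry covers the other
  case.\<close>

lemma occ_cov_limit:
  assumes T: "filterlim T at_top sequentially" and s: "0 \<le> s" "0 \<le> s'"
  shows "(\<lambda>n. occ_cov (T n * s) (T n * s') / T n powr (1 + b)) \<longlonglongrightarrow> p1 / b * (LBINT x. \<phi> x)\<^sup>2 * fbs_cov \<alpha> s s'"
proof -
  define c where "c = p1 * (LBINT x. \<phi> x)\<^sup>2"
  define D where "D = p1 * (LBINT z. \<bar>self_conv z\<bar>)"
  have D0: "0 \<le> D" using p1_nonneg by (simp add: D_def)
  have ev: "\<forall>\<^sub>F n in sequentially. 0 < T n" using T by (simp add: filterlim_at_top_dense)
  have main: "(\<lambda>n. occ_cov (T n * s) (T n * s') / T n powr (1 + b)) \<longlonglongrightarrow> p1 / b * (LBINT x. \<phi> x)\<^sup>2 * fbs_cov \<alpha> s s'"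
    if s: "0 \<le> s" "s \<le> s'" for s s'
  proof -
    have fm: "(\<lambda>v. T n powr (1 / \<alpha>) * kap (T n * \<bar>u - v\<bar>) * indicator {0..s'} v) \<in> borel_measurable lborel" for n u by measurable
    have bd: "\<bar>t powr (1 / \<alpha>) * kap (t * \<bar>u - v\<bar>) * indicator {0..s'} v\<bar> \<le> D * (\<bar>u - v\<bar> powr (b - 1) * indicator {0..s'} v)" if "0 < t" "v \<noteq> u" for t u v
      using kap_scaled(2)[OF that(1), of "\<bar>u - v\<bar>"] that by (auto simp: indicator_def D_def abs_mult mult.commute)
    \<comment> \<open>The finitely many nonpositive values are replaced by 1, so that the bounds
      hold for every index.\<close>
    define t where "t n = (if 0 < T n then T n else 1)" for n
    have t: "0 < t n" for n by (simp add: t_def)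
    have evt: "\<forall>\<^sub>F n in sequentially. t n = T n" using ev by eventually_elim (simp add: t_def)
    have tlim: "filterlim t at_top sequentially" using T evt by (rule filterlim_cong[THEN iffD2, OF refl refl, rotated])
    have inner: "(\<lambda>n. (LBINT v. t n powr (1 / \<alpha>) * kap (t n * \<bar>u - v\<bar>) * indicator {0..s'} v)) \<longlonglongrightarrow> c * ((u powr b + (s' - u) powr b) / b)" if u: "u \<in> {0..s}" for u
    proof -
      have i: "integrable lborel (\<lambda>v. \<bar>u - v\<bar> powr (b - 1) * indicator {0..s'} v)"
        "(LBINT v. \<bar>u - v\<bar> powr (b - 1) * indicator {0..s'} v) = (u powr b + (s' - u) powr b) / b"
        using integral_powr_abs[OF b_pos, of 0 u s'] u s by auto
      have "(\<lambda>n. (LBINT v. t n powr (1 / \<alpha>) * kap (t n * \<bar>u - v\<bar>) * indicator {0..s'} v)) \<longlonglongrightarrow> (LBINT v. c * (\<bar>u - v\<bar> powr (b - 1) * indicator {0..s'} v))"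
      proof (rule integral_dominated_convergence[where w="\<lambda>v. D * (\<bar>u - v\<bar> powr (b - 1) * indicator {0..s'} v)"])
        show "AE v in lborel. norm (t n powr (1 / \<alpha>) * kap (t n * \<bar>u - v\<bar>) * indicator {0..s'} v) \<le> D * (\<bar>u - v\<bar> powr (b - 1) * indicator {0..s'} v)" for n
          using AE_lborel_singleton[of u] by eventually_elim (use bd[OF t] in simp)
        show "AE v in lborel. (\<lambda>n. t n powr (1 / \<alpha>) * kap (t n * \<bar>u - v\<bar>) * indicator {0..s'} v) \<longlonglongrightarrow> c * (\<bar>u - v\<bar> powr (b - 1) * indicator {0..s'} v)"
          using AE_lborel_singleton[of u]
        proof eventually_elim
          case (elim v)
          have "(\<lambda>n. t n powr (1 / \<alpha>) * kap (t n * \<bar>u - v\<bar>)) \<longlonglongrightarrow> \<bar>u - v\<bar> powr (b - 1) * c"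
            unfolding c_def using elim by (intro kap_scaled_limit[OF tlim]) auto
          from tendsto_mult_right[OF this, of "indicator {0..s'} v"] show ?case by (simp add: mult_ac)
        qed
      qed (use i in auto)
      then show ?thesis using i(2) by simp
    qed
    have "(\<lambda>n. (LBINT u. (LBINT v. t n powr (1 / \<alpha>) * kap (t n * \<bar>u - v\<bar>) * indicator {0..s'} v) * indicator {0..s} u)) \<longlonglongrightarrow>
       (LBINT u. c * ((u powr b + (s' - u) powr b) / b) * indicator {0..s} u)"
    proof (rule integral_dominated_convergence[where w="\<lambda>u. D * (2 * s' powr b / b) * indicator {0..s} u"])
      show "integrable lborel (\<lambda>u. D * (2 * s' powr b / b) * indicator {0..s} u)"
        using s by (intro integrable_mult_right integrable_real_indicator) (auto simp: emeasure_lborel_Icc)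
      show "AE u in lborel. (\<lambda>n. (LBINT v. t n powr (1 / \<alpha>) * kap (t n * \<bar>u - v\<bar>) * indicator {0..s'} v) * indicator {0..s} u) \<longlonglongrightarrow> c * ((u powr b + (s' - u) powr b) / b) * indicator {0..s} u"
        using inner by (intro AE_I2) (auto simp: indicator_def)
      show "AE u in lborel. norm ((LBINT v. t n powr (1 / \<alpha>) * kap (t n * \<bar>u - v\<bar>) * indicator {0..s'} v) * indicator {0..s} u) \<le> D * (2 * s' powr b / b) * indicator {0..s} u" for n
      proof (rule AE_I2)
        fix u
        show "norm ((LBINT v. t n powr (1 / \<alpha>) * kap (t n * \<bar>u - v\<bar>) * indicator {0..s'} v) * indicator {0..s} u) \<le> D * (2 * s' powr b / b) * indicator {0..s} u"
        proof (cases "u \<in> {0..s}")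
          case True
          have i: "integrable lborel (\<lambda>v. \<bar>u - v\<bar> powr (b - 1) * indicator {0..s'} v)"
            "(LBINT v. \<bar>u - v\<bar> powr (b - 1) * indicator {0..s'} v) = (u powr b + (s' - u) powr b) / b"
            using integral_powr_abs[OF b_pos, of 0 u s'] True s by auto
          have ae: "AE v in lborel. \<bar>t n powr (1 / \<alpha>) * kap (t n * \<bar>u - v\<bar>) * indicator {0..s'} v\<bar> \<le> D * (\<bar>u - v\<bar> powr (b - 1) * indicator {0..s'} v)"
            using AE_lborel_singleton[of u] by eventually_elim (use bd[OF t] in simp)
          have "\<bar>LBINT v. t n powr (1 / \<alpha>) * kap (t n * \<bar>u - v\<bar>) * indicator {0..s'} v\<bar> \<le> (LBINT v. D * (\<bar>u - v\<bar> powr (b - 1) * indicator {0..s'} v))"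
          proof (rule order_trans[OF integral_abs_bound], rule integral_mono_AE[OF _ _ ae])
            show i2: "integrable lborel (\<lambda>v. D * (\<bar>u - v\<bar> powr (b - 1) * indicator {0..s'} v))" using i(1) by simp
            show "integrable lborel (\<lambda>v. \<bar>t n powr (1 / \<alpha>) * kap (t n * \<bar>u - v\<bar>) * indicator {0..s'} v\<bar>)"
              by (rule Bochner_Integration.integrable_bound[OF i2]) (use ae in \<open>auto elim!: eventually_mono intro: order_trans\<close>)
          qed
          also have "\<dots> = D * ((u powr b + (s' - u) powr b) / b)" using i(2) by simp
          also have "\<dots> \<le> D * (2 * s' powr b / b)"
          proof (intro mult_left_mono divide_right_mono D0)
            have "u powr b \<le> s' powr b" "(s' - u) powr b \<le> s' powr b" using True s b_pos by (auto intro!: powr_mono2)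
            then show "u powr b + (s' - u) powr b \<le> 2 * s' powr b" by simp
          qed (use b_pos in auto)
          finally show ?thesis using True by simp
        qed simp
      qed
    qed measurable
    \<comment> \<open>Integration over v has produced the divisor b, which is the factor 1 / (1 - 1
      / \<alpha>) in \<open>D\<close>; the remaining integral over u is
      \<open>fbs_cov\<close>.\<close>
    moreover have "(LBINT u. c * ((u powr b + (s' - u) powr b) / b) * indicator {0..s} u) = p1 / b * (LBINT x. \<phi> x)\<^sup>2 * fbs_cov \<alpha> s s'"
    proof -
      have b1: "0 < 1 + b" using b_pos by simp
      have i1: "integrable lborel (\<lambda>u. u powr b * indicator {0..s} u)" "(LBINT u. u powr b * indicator {0..s} u) = s powr (1 + b) / (1 + b)"
      proof -
        have e: "(\<lambda>u. \<bar>0 - u\<bar> powr (1 + b - 1) * indicator {0..s} u) = (\<lambda>u. u powr b * indicator {0..s} u :: real)"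
          by (auto simp: indicator_def)
        show "integrable lborel (\<lambda>u. u powr b * indicator {0..s} u)" "(LBINT u. u powr b * indicator {0..s} u) = s powr (1 + b) / (1 + b)"
          using integral_powr_abs[OF b1, of 0 0 s, unfolded e] s by auto
      qed
      have i2: "integrable lborel (\<lambda>u. (s' - u) powr b * indicator {0..s} u)"
        "(LBINT u. (s' - u) powr b * indicator {0..s} u) = (s' powr (1 + b) - (s' - s) powr (1 + b)) / (1 + b)"
        using set_integral_powr_reflect[OF b_pos s] by (auto simp: set_integrable_def set_lebesgue_integral_def mult.commute)
      have "(LBINT u. c * ((u powr b + (s' - u) powr b) / b) * indicator {0..s} u) =
        (LBINT u. c / b * (u powr b * indicator {0..s} u + (s' - u) powr b * indicator {0..s} u))"
        by (intro Bochner_Integration.integral_cong refl) (simp add: field_simps)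
      also have "\<dots> = c / b * (s powr (1 + b) / (1 + b) + (s' powr (1 + b) - (s' - s) powr (1 + b)) / (1 + b))"
        using i1 i2 by simp
      also have "s powr (1 + b) / (1 + b) + (s' powr (1 + b) - (s' - s) powr (1 + b)) / (1 + b) = fbs_cov \<alpha> s s'"
        unfolding fbs_cov_eq[OF \<alpha> s(1) order_trans[OF s]] using s by (simp add: abs_minus_commute[of s] add_divide_distrib diff_divide_distrib)
      finally show ?thesis by (simp add: c_def)
    qed
    ultimately have "(\<lambda>n. occ_cov (t n * s) (t n * s') / t n powr (1 + b)) \<longlonglongrightarrow> p1 / b * (LBINT x. \<phi> x)\<^sup>2 * fbs_cov \<alpha> s s'"
      by (simp only: occ_cov_scale[OF t s(1) order_trans[OF s]])
    then show ?thesis by (rule Lim_transform_eventually) (use evt in \<open>auto elim!: eventually_mono\<close>)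
  qed
  show ?thesis
  proof (cases "s \<le> s'")
    case True then show ?thesis using main s by simp
  next
    case False
    then have "(\<lambda>n. occ_cov (T n * s') (T n * s) / T n powr (1 + b)) \<longlonglongrightarrow> p1 / b * (LBINT x. \<phi> x)\<^sup>2 * fbs_cov \<alpha> s' s"
      using main s by simp
    then show ?thesis by (simp add: occ_cov_sym[of "_ * s'"] fbs_cov_sym[of \<alpha> s'])
  qed
qed

lemma occ_measurable': "(\<lambda>q. occ \<phi> Y q s) \<in> borel_measurable LM"
  "(\<lambda>q. abs_occ \<phi> Y q l r) \<in> borel_measurable LM"
  using occ_measurable[OF Y_measurable Y_cadlag \<phi>_measurable]
  by (simp_all add: measurable_cong_sets[OF sets_pair_measure_cong[OF sets_lborel refl] refl])

lemma abs_occ_finite_AE: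
  assumes "0 \<le> R"
  shows "AE q in LM. abs_occ \<phi> Y q 0 R < \<infinity>"
proof -
  have "(\<integral>\<^sup>+q. abs_occ \<phi> Y q 0 R \<partial>LM) \<noteq> \<infinity>" using abs_occ_first_moment[OF assms] by simp
  from nn_integral_PInf_AE[OF occ_measurable'(2) this] show ?thesis by (auto elim!: eventually_mono simp: less_top)
qed

text \<open>The combination of covariances is the second moment of an increment of
  \<open>occ\<close>, which is dominated by the second moment of \<open>abs_occ\<close> over the
  interval in between.\<close>

lemma occ_incr_bound:
  assumes lr: "0 \<le> l" "0 \<le> r"
  shows "occ_cov r r - 2 * occ_cov r l + occ_cov l l \<le> L1\<^sup>2 * p1 * (2 / b) * \<bar>r - l\<bar> powr (1 + b)"
proof -
  have ord: "occ_cov r r - 2 * occ_cov r l + occ_cov l l \<le> L1\<^sup>2 * p1 * (2 / b) * \<bar>r - l\<bar> powr (1 + b)" if lr: "0 \<le> l" "l \<le> r" for l r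
  proof -
    have r: "0 \<le> r" using lr by simp
    note i = occ_cov_eq(1)[OF r r] occ_cov_eq(1)[OF r lr(1)] occ_cov_eq(1)[OF lr(1) lr(1)]
    have int: "integrable LM (\<lambda>q. (occ \<phi> Y q r - occ \<phi> Y q l)\<^sup>2)"
    proof -
      have "integrable LM (\<lambda>q. occ \<phi> Y q r * occ \<phi> Y q r - 2 * (occ \<phi> Y q r * occ \<phi> Y q l) + occ \<phi> Y q l * occ \<phi> Y q l)"
        using i by auto
      then show ?thesis by (simp add: power2_eq_square algebra_simps)
    qed
    have "occ_cov r r - 2 * occ_cov r l + occ_cov l l = (LINT q|LM. (occ \<phi> Y q r - occ \<phi> Y q l)\<^sup>2)"
    proof -
      have "(LINT q|LM. (occ \<phi> Y q r - occ \<phi> Y q l)\<^sup>2) =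
        (LINT q|LM. occ \<phi> Y q r * occ \<phi> Y q r - 2 * (occ \<phi> Y q r * occ \<phi> Y q l) + occ \<phi> Y q l * occ \<phi> Y q l)"
        by (intro Bochner_Integration.integral_cong refl) (simp add: power2_eq_square algebra_simps)
      also have "\<dots> = occ_cov r r - 2 * occ_cov r l + occ_cov l l" unfolding occ_cov_def using i by simp
      finally show ?thesis by simp
    qed
    also have "\<dots> \<le> L1\<^sup>2 * p1 * (2 / b) * \<bar>r - l\<bar> powr (1 + b)"
    proof -
      have "ennreal (LINT q|LM. (occ \<phi> Y q r - occ \<phi> Y q l)\<^sup>2) = (\<integral>\<^sup>+q. ennreal ((occ \<phi> Y q r - occ \<phi> Y q l)\<^sup>2) \<partial>LM)"
        using int by (intro nn_integral_eq_integral[symmetric]) auto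
      also have "\<dots> \<le> (\<integral>\<^sup>+q. (abs_occ \<phi> Y q l r)\<^sup>2 \<partial>LM)"
      proof (rule nn_integral_mono_AE)
        show "AE q in LM. ennreal ((occ \<phi> Y q r - occ \<phi> Y q l)\<^sup>2) \<le> (abs_occ \<phi> Y q l r)\<^sup>2"
          using abs_occ_finite_AE[OF r] AE_space
        proof eventually_elim
          case (elim q)
          have "pf q \<in> borel_measurable borel"
            using field_measurable_u[of "snd q" "fst q"] elim(2) by (auto simp: space_pair_measure)
          from occ_diff[OF this elim(1) lr] have "ennreal \<bar>occ \<phi> Y q r - occ \<phi> Y q l\<bar> ^ 2 \<le> (abs_occ \<phi> Y q l r)\<^sup>2"
            by (intro power_mono) auto
          then show ?case by (simp add: ennreal_power)
        qed
      qed
      also have "\<dots> \<le> ennreal (L1\<^sup>2 * p1 * (2 / b) * (r - l) powr (1 + b))" by (rule abs_occ_second_moment[OF lr])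
      finally show ?thesis using lr p1_nonneg b_pos by (subst (asm) ennreal_le_iff) auto
    qed
    finally show ?thesis .
  qed
  show ?thesis
  proof (cases "l \<le> r")
    case True then show ?thesis using ord lr by simp
  next
    case False
    then have "occ_cov l l - 2 * occ_cov l r + occ_cov r r \<le> L1\<^sup>2 * p1 * (2 / b) * \<bar>l - r\<bar> powr (1 + b)" using ord[of r l] lr by simp
    then show ?thesis by (simp add: occ_cov_sym[of l r] abs_minus_commute[of l])
  qed
qed

section \<open>Moments for a fixed starting point\<close>

definition "mean1 x s = (LINT w|M. occ \<phi> Y (x, w) s)"
definition "mean2 x s s' = (LINT w|M. occ \<phi> Y (x, w) s * occ \<phi> Y (x, w) s')"
definition "abs_mean1 x R = (\<integral>\<^sup>+w. abs_occ \<phi> Y (x, w) 0 R \<partial>M)"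
text \<open>It may be infinite at exceptional starting points, \<phi> being merely integrable. Its
  finiteness controls the lower moments as well and is therefore the one condition under which
  formulas for a fixed start are stated.\<close>

definition "abs_mean3 x R = (\<integral>\<^sup>+w. (abs_occ \<phi> Y (x, w) 0 R) ^ 3 \<partial>M)"

lemma abs_mean_measurable[measurable]:
  "(\<lambda>x. abs_mean1 x R) \<in> borel_measurable lborel" "(\<lambda>x. abs_mean3 x R) \<in> borel_measurable lborel"
proof -
  note [measurable] = occ_measurable'
  have "(\<lambda>x. \<integral>\<^sup>+w. (\<lambda>q. abs_occ \<phi> Y q 0 R) (x, w) \<partial>M) \<in> borel_measurable lborel" by measurable
  then show "(\<lambda>x. abs_mean1 x R) \<in> borel_measurable lborel" by (simp add: abs_mean1_def)
  have "(\<lambda>x. \<integral>\<^sup>+w. (\<lambda>q. abs_occ \<phi> Y q 0 R ^ 3) (x, w) \<partial>M) \<in> borel_measurable lborel" by measurable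
  then show "(\<lambda>x. abs_mean3 x R) \<in> borel_measurable lborel" by (simp add: abs_mean3_def)
qed

lemma abs_mean1_integral: "0 \<le> R \<Longrightarrow> (\<integral>\<^sup>+x. abs_mean1 x R \<partial>lborel) = ennreal (L1 * R)"
  unfolding abs_mean1_def using abs_occ_first_moment[of R] nn_integral_fst[OF occ_measurable'(2)[of 0 R]] by simp

lemma abs_mean3_integral: "0 \<le> R \<Longrightarrow> (\<integral>\<^sup>+x. abs_mean3 x R \<partial>lborel) \<le> ennreal (L1 ^ 3 * (12 * p1\<^sup>2 / b\<^sup>2) * (R * R powr b * R powr b))"
  unfolding abs_mean3_def using abs_occ_third_moment[of R]
    nn_integral_fst[of "\<lambda>q. abs_occ \<phi> Y q 0 R ^ 3" lborel] occ_measurable'(2)[of 0 R] by simp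

lemma abs_mean3_finite_AE: "0 \<le> R \<Longrightarrow> AE x in lborel. abs_mean3 x R < \<infinity>"
proof -
  assume "0 \<le> R"
  then have "(\<integral>\<^sup>+x. abs_mean3 x R \<partial>lborel) \<noteq> \<infinity>" using abs_mean3_integral[of R] by (auto simp: top_unique)
  from nn_integral_PInf_AE[OF abs_mean_measurable(2) this] show ?thesis by (auto elim!: eventually_mono simp: less_top)
qed

lemma mean1_integrable: "0 \<le> s \<Longrightarrow> integrable lborel (\<lambda>x. mean1 x s)"
proof -
  assume s: "0 \<le> s"
  have "(\<integral>\<^sup>+q. ennreal (norm (occ \<phi> Y q s)) \<partial>LM) \<le> (\<integral>\<^sup>+q. abs_occ \<phi> Y q 0 s \<partial>LM)"
    using abs_occ_le[OF s] by (intro nn_integral_mono) simp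
  also have "\<dots> < \<infinity>" by (simp add: abs_occ_first_moment[OF s])
  finally have "integrable LM (\<lambda>q. occ \<phi> Y q s)" by (intro integrableI_bounded occ_measurable')
  from P.integrable_fst'[OF this] show ?thesis by (simp add: mean1_def)
qed

lemma mean2_integrable: "0 \<le> s \<Longrightarrow> 0 \<le> s' \<Longrightarrow> integrable lborel (\<lambda>x. mean2 x s s')"
  "0 \<le> s \<Longrightarrow> 0 \<le> s' \<Longrightarrow> (LBINT x. mean2 x s s') = occ_cov s s'"
  unfolding mean2_def occ_cov_def using P.integrable_fst'[OF occ_cov_eq(1)[of s s']] P.integral_fst'[OF occ_cov_eq(1)[of s s']] by auto

lemma section_measurable:
  "(\<lambda>w. occ \<phi> Y (x, w) s) \<in> borel_measurable M" "(\<lambda>w. abs_occ \<phi> Y (x, w) l r) \<in> borel_measurable M"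
proof -
  have p: "(\<lambda>w. (x, w)) \<in> M \<rightarrow>\<^sub>M LM" by measurable
  show "(\<lambda>w. occ \<phi> Y (x, w) s) \<in> borel_measurable M" using measurable_compose[OF p occ_measurable'(1)] by simp
  show "(\<lambda>w. abs_occ \<phi> Y (x, w) l r) \<in> borel_measurable M" using measurable_compose[OF p occ_measurable'(2)] by simp
qed

sublocale MT: pair_sigma_finite M lborel
  by (intro pair_sigma_finite.intro sigma_finite_measure_axioms lborel.sigma_finite_measure_axioms)

lemma field_w_prod_measurable: "(\<lambda>(w, u). pf (x, w) u) \<in> borel_measurable (M \<Otimes>\<^sub>M lborel)"
  using field_measurable_w by (simp add: split_beta')

lemma ennreal_le_1_power3: "(a::ennreal) \<le> 1 + a ^ 3" "(a::ennreal) ^ 2 \<le> 1 + a ^ 3"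
proof -
  have "a \<le> 1 + a ^ 3 \<and> a ^ 2 \<le> 1 + a ^ 3"
  proof (cases "a \<le> 1")
    case True
    then have "a ^ 2 \<le> 1" by (intro power_le_one) auto
    then show ?thesis using True by (auto intro: add_increasing2)
  next
    case False
    then have "a ^ 1 \<le> a ^ 3" "a ^ 2 \<le> a ^ 3" by (intro power_increasing; simp)+
    then show ?thesis by (auto intro: add_increasing)
  qed
  then show "(a::ennreal) \<le> 1 + a ^ 3" "(a::ennreal) ^ 2 \<le> 1 + a ^ 3" by auto
qed

lemma abs_mean2_finite:
  assumes "abs_mean3 x R < \<infinity>"
  shows "(\<integral>\<^sup>+w. (abs_occ \<phi> Y (x, w) 0 R)\<^sup>2 \<partial>M) < \<infinity>" "abs_mean1 x R < \<infinity>"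
proof -
  note [measurable] = section_measurable
  have e: "(\<integral>\<^sup>+w. 1 + (abs_occ \<phi> Y (x, w) 0 R) ^ 3 \<partial>M) = 1 + abs_mean3 x R"
    unfolding abs_mean3_def by (subst nn_integral_add) (auto simp: emeasure_space_1)
  have "(\<integral>\<^sup>+w. (abs_occ \<phi> Y (x, w) 0 R)\<^sup>2 \<partial>M) \<le> 1 + abs_mean3 x R" "abs_mean1 x R \<le> 1 + abs_mean3 x R"
    unfolding e[symmetric] abs_mean1_def by (intro nn_integral_mono ennreal_le_1_power3)+
  with assms show "(\<integral>\<^sup>+w. (abs_occ \<phi> Y (x, w) 0 R)\<^sup>2 \<partial>M) < \<infinity>" "abs_mean1 x R < \<infinity>"
    by (auto intro: le_less_trans)
qed

text \<open>The right-hand sides involve the path only through expectations at one or two times,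
  hence only through finite-dimensional laws. In the first moment a dummy integral over {0..1},
  equal to 1, allows the same Fubini lemma to be used.\<close>

lemma mean_formulas:
  assumes fin: "abs_mean3 x R < \<infinity>" and s: "0 \<le> s" "s \<le> R" "0 \<le> s'" "s' \<le> R"
  shows "mean2 x s s' = (LBINT u. (LBINT v. (LINT w|M. pf (x, w) u * pf (x, w) v) * indicator {0..s} u * indicator {0..s'} v))"
    and "mean1 x s = (LBINT u. (LBINT v. (LINT w|M. pf (x, w) u) * indicator {0..s} u * indicator {0..1::real} v))"
    and "integrable M (\<lambda>w. occ \<phi> Y (x, w) s * occ \<phi> Y (x, w) s')" "integrable M (\<lambda>w. occ \<phi> Y (x, w) s)"
proof -
  note [measurable] = field_w_prod_measurable section_measurable
  have le: "abs_occ \<phi> Y p 0 s \<le> abs_occ \<phi> Y p 0 R" "abs_occ \<phi> Y p 0 s' \<le> abs_occ \<phi> Y p 0 R" for p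
    using s by (auto intro!: abs_occ_mono)
  let ?f = "\<lambda>w u. pf (x, w) u * indicator {0..s} u" and ?g = "\<lambda>w u. pf (x, w) u * indicator {0..s'} u"
  have fm: "(\<lambda>(w, u). ?f w u) \<in> borel_measurable (M \<Otimes>\<^sub>M lborel)" and gm: "(\<lambda>(w, u). ?g w u) \<in> borel_measurable (M \<Otimes>\<^sub>M lborel)"
    and im: "(\<lambda>(w, u :: real). indicator {0..1} u :: real) \<in> borel_measurable (M \<Otimes>\<^sub>M lborel)" by measurable
  have "(\<integral>\<^sup>+w. (\<integral>\<^sup>+u. ennreal \<bar>?f w u\<bar> \<partial>lborel) * (\<integral>\<^sup>+v. ennreal \<bar>?g w v\<bar> \<partial>lborel) \<partial>M) \<le> (\<integral>\<^sup>+w. (abs_occ \<phi> Y (x, w) 0 R)\<^sup>2 \<partial>M)"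
    unfolding abs_occ_def[symmetric] power2_eq_square by (intro nn_integral_mono mult_mono le) auto
  also have "\<dots> < \<infinity>" by (rule abs_mean2_finite[OF fin])
  finally have fin2: "(\<integral>\<^sup>+w. (\<integral>\<^sup>+u. ennreal \<bar>?f w u\<bar> \<partial>lborel) * (\<integral>\<^sup>+v. ennreal \<bar>?g w v\<bar> \<partial>lborel) \<partial>M) < \<infinity>" .
  note I2 = MT.integral_prod_of_integrals[OF fm gm fin2]
  show "integrable M (\<lambda>w. occ \<phi> Y (x, w) s * occ \<phi> Y (x, w) s')" using I2(1) by (simp add: occ_def)
  show "mean2 x s s' = (LBINT u. (LBINT v. (LINT w|M. pf (x, w) u * pf (x, w) v) * indicator {0..s} u * indicator {0..s'} v))"
  proof -
    have "(LINT w|M. ?f w u * ?g w v) = (LINT w|M. pf (x, w) u * pf (x, w) v) * indicator {0..s} u * indicator {0..s'} v" for u v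
    proof -
      have "(LINT w|M. ?f w u * ?g w v) = (LINT w|M. (pf (x, w) u * pf (x, w) v) * (indicator {0..s} u * indicator {0..s'} v))"
        by (intro Bochner_Integration.integral_cong refl) (simp only: mult_ac)
      then show ?thesis by simp
    qed
    then show ?thesis using I2(2) unfolding mean2_def occ_def by simp
  qed
  have "(\<integral>\<^sup>+w. (\<integral>\<^sup>+u. ennreal \<bar>?f w u\<bar> \<partial>lborel) * (\<integral>\<^sup>+v. ennreal \<bar>indicator {0..1::real} v\<bar> \<partial>lborel) \<partial>M) = (\<integral>\<^sup>+w. abs_occ \<phi> Y (x, w) 0 s \<partial>M)"
    unfolding abs_occ_def[symmetric] by (simp add: ennreal_indicator)
  also have "\<dots> \<le> abs_mean1 x R" unfolding abs_mean1_def by (intro nn_integral_mono le)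
  also have "\<dots> < \<infinity>" by (rule abs_mean2_finite[OF fin])
  finally have fin1: "(\<integral>\<^sup>+w. (\<integral>\<^sup>+u. ennreal \<bar>?f w u\<bar> \<partial>lborel) * (\<integral>\<^sup>+v. ennreal \<bar>indicator {0..1::real} v\<bar> \<partial>lborel) \<partial>M) < \<infinity>" .
  note I1 = MT.integral_prod_of_integrals[OF fm im fin1]
  show "integrable M (\<lambda>w. occ \<phi> Y (x, w) s)" using I1(1) by (simp add: occ_def)
  show "mean1 x s = (LBINT u. (LBINT v. (LINT w|M. pf (x, w) u) * indicator {0..s} u * indicator {0..1::real} v))"
    using I1(2) unfolding mean1_def occ_def by simp
qed

end

text \<open>All these moments are iterated time integrals of expectations at up to three times, so
  agreement of the three-time laws suffices and laws on path space need not be compared.\<close>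

lemma stable_motion_means_unique:
  assumes Y: "stable_motion M \<alpha> Y \<phi>" and Y': "stable_motion M \<alpha> Y' \<phi>"
  shows "stable_motion.abs_mean3 M Y \<phi> x R = stable_motion.abs_mean3 M Y' \<phi> x R"
    and "stable_motion.abs_mean1 M Y \<phi> x R = stable_motion.abs_mean1 M Y' \<phi> x R"
    and "stable_motion.abs_mean3 M Y \<phi> x R < \<infinity> \<Longrightarrow> 0 \<le> s \<Longrightarrow> s \<le> R \<Longrightarrow> stable_motion.mean1 M Y \<phi> x s = stable_motion.mean1 M Y' \<phi> x s"
    and "stable_motion.abs_mean3 M Y \<phi> x R < \<infinity> \<Longrightarrow> 0 \<le> s \<Longrightarrow> s \<le> R \<Longrightarrow> 0 \<le> s' \<Longrightarrow> s' \<le> R \<Longrightarrow>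
      stable_motion.mean2 M Y \<phi> x s s' = stable_motion.mean2 M Y' \<phi> x s s'"
proof -
  interpret A: stable_motion M \<alpha> Y \<phi> by fact
  interpret B: stable_motion M \<alpha> Y' \<phi> by fact
  note law = stable_three_time_unique[OF A.stable B.stable]
  have mA: "(\<lambda>w. (Y a w, Y b w, Y c w)) \<in> M \<rightarrow>\<^sub>M borel" and mB: "(\<lambda>w. (Y' a w, Y' b w, Y' c w)) \<in> M \<rightarrow>\<^sub>M borel"
    if "0 \<le> a" "0 \<le> b" "0 \<le> c" for a b c
    using that A.Y_measurable B.Y_measurable by (auto intro!: borel_measurable_Pair)
  have nn: "(\<integral>\<^sup>+w. f (Y a w, Y b w, Y c w) \<partial>M) = (\<integral>\<^sup>+w. f (Y' a w, Y' b w, Y' c w) \<partial>M)"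
    if "f \<in> borel_measurable borel" "0 \<le> a" "0 \<le> b" "0 \<le> c" for f a b c
    using nn_integral_distr[OF mA[OF that(2-4)], of f] nn_integral_distr[OF mB[OF that(2-4)], of f]
      law[OF that(2-4)] that(1) by simp
  have re: "(LINT w|M. f (Y a w, Y b w, Y c w)) = (LINT w|M. f (Y' a w, Y' b w, Y' c w))"
    if "f \<in> borel_measurable borel" "0 \<le> a" "0 \<le> b" "0 \<le> c" for f :: "_ \<Rightarrow> real" and a b c
    using integral_distr[OF mA[OF that(2-4)] that(1)] integral_distr[OF mB[OF that(2-4)] that(1)]
      law[OF that(2-4)] by simp
  note [measurable] = A.field_w_prod_measurable B.field_w_prod_measurable
  let ?a = "\<lambda>Y w u. ennreal \<bar>path_field \<phi> Y (x, w) u * indicator {0..R} u\<bar>"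
  have am: "(\<lambda>(w, u). ?a Y w u) \<in> borel_measurable (M \<Otimes>\<^sub>M lborel)" "(\<lambda>(w, u). ?a Y' w u) \<in> borel_measurable (M \<Otimes>\<^sub>M lborel)" by measurable
  have [measurable]: "\<phi> \<in> borel_measurable borel" by (rule A.\<phi>_measurable)
  have "(\<integral>\<^sup>+w. ?a Y w u * ?a Y w v * ?a Y w t \<partial>M) = (\<integral>\<^sup>+w. ?a Y' w u * ?a Y' w v * ?a Y' w t \<partial>M)" for u v t
  proof -
    have "(\<lambda>y. ennreal \<bar>\<phi> (x + fst y) * indicator {0..R} u\<bar> * ennreal \<bar>\<phi> (x + fst (snd y)) * indicator {0..R} v\<bar> * ennreal \<bar>\<phi> (x + snd (snd y)) * indicator {0..R} t\<bar>)
       \<in> borel_measurable (borel :: (real \<times> real \<times> real) measure)" by (simp add: borel_prod[symmetric])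
    from nn[OF this, of "max 0 u" "max 0 v" "max 0 t"] show ?thesis by (simp add: path_field_def)
  qed
  then show "A.abs_mean3 x R = B.abs_mean3 x R"
    unfolding A.abs_mean3_def B.abs_mean3_def abs_occ_def power3_eq_cube mult.assoc
      A.MT.nn_integral_prod3_of_integrals[OF am(1) am(1) am(1)] A.MT.nn_integral_prod3_of_integrals[OF am(2) am(2) am(2)]
    by (simp add: mult.assoc)
  have "(\<integral>\<^sup>+w. ?a Y w u \<partial>M) = (\<integral>\<^sup>+w. ?a Y' w u \<partial>M)" for u
  proof -
    have "(\<lambda>y. ennreal \<bar>\<phi> (x + fst y) * indicator {0..R} u\<bar>) \<in> borel_measurable (borel :: (real \<times> real \<times> real) measure)" by (simp add: borel_prod[symmetric])
    from nn[OF this, of "max 0 u" "max 0 u" "max 0 u"] show ?thesis by (simp add: path_field_def)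
  qed
  then show "A.abs_mean1 x R = B.abs_mean1 x R"
    unfolding A.abs_mean1_def B.abs_mean1_def abs_occ_def
    using A.MT.Fubini'[OF am(1)] A.MT.Fubini'[OF am(2)] by simp
  assume fin: "A.abs_mean3 x R < \<infinity>" and s: "0 \<le> s" "s \<le> R"
  have finB: "B.abs_mean3 x R < \<infinity>" using fin \<open>A.abs_mean3 x R = B.abs_mean3 x R\<close> by simp
  have e1: "(LINT w|M. path_field \<phi> Y (x, w) u) = (LINT w|M. path_field \<phi> Y' (x, w) u)" for u
  proof -
    have "(\<lambda>y. \<phi> (x + fst y)) \<in> borel_measurable (borel :: (real \<times> real \<times> real) measure)" by (simp add: borel_prod[symmetric])
    from re[OF this, of "max 0 u" "max 0 u" "max 0 u"] show ?thesis by (simp add: path_field_def)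
  qed
  show "A.mean1 x s = B.mean1 x s"
    unfolding A.mean_formulas(2)[OF fin s s] B.mean_formulas(2)[OF finB s s] e1 ..
  assume s': "0 \<le> s'" "s' \<le> R"
  have e2: "(LINT w|M. path_field \<phi> Y (x, w) u * path_field \<phi> Y (x, w) v) = (LINT w|M. path_field \<phi> Y' (x, w) u * path_field \<phi> Y' (x, w) v)" for u v
  proof -
    have "(\<lambda>y. \<phi> (x + fst y) * \<phi> (x + fst (snd y))) \<in> borel_measurable (borel :: (real \<times> real \<times> real) measure)" by (simp add: borel_prod[symmetric])
    from re[OF this, of "max 0 u" "max 0 v" "max 0 v"] show ?thesis by (simp add: path_field_def)
  qed
  show "A.mean2 x s s' = B.mean2 x s s'"
    unfolding A.mean_formulas(1)[OF fin s s'] B.mean_formulas(1)[OF finB s s'] e2 ..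
qed

section \<open>The particle system\<close>

lemma generated_events_Pow: "generated_events M I Z \<subseteq> Pow (space M)"
proof
  fix A assume "A \<in> generated_events M I Z"
  then have "A \<subseteq> space M" unfolding generated_events_def by (rule sigma_sets_into_sp[rotated]) auto
  then show "A \<in> Pow (space M)" by simp
qed

lemma generated_events_sets:
  assumes "\<And>i. i \<in> I \<Longrightarrow> Z i \<in> borel_measurable M"
  shows "generated_events M I Z \<subseteq> sets M"
  unfolding generated_events_def using assms by (intro sets.sigma_sets_subset) (auto intro: measurable_sets)

lemma Int_stable_generated_events: "Int_stable (generated_events M I Z)"
proof -
  interpret sigma_algebra "space M" "generated_events M I Z"
    unfolding generated_events_def by (rule sigma_algebra_sigma_sets) auto
  show ?thesis by (rule Int_stable)
qed

locale particle_system =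
  fixes M :: "'w measure" and \<alpha>1 \<alpha>2 :: real and x :: "nat \<Rightarrow> 'w \<Rightarrow> real \<times> real"
    and Y1 Y2 :: "nat \<Rightarrow> real \<Rightarrow> 'w \<Rightarrow> real" and \<phi> \<psi> :: "real \<Rightarrow> real"
  assumes \<alpha>: "1 < \<alpha>1" "1 < \<alpha>2" and \<phi>: "integrable lborel \<phi>" and \<psi>: "integrable lborel \<psi>"
    and sys: "two_type_particle_system M \<alpha>1 \<alpha>2 x Y1 Y2"
begin

sublocale prob_space M using sys by (simp add: two_type_particle_system_def)

sublocale points: poisson_points M "lborel :: (real \<times> real) measure" x
  by (intro poisson_points.intro poisson_points_axioms.intro prob_space_axioms lborel.sigma_finite_measure_axioms)
     (use sys in \<open>simp add: two_type_particle_system_def\<close>)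

lemma stable1: "stable_motion M \<alpha>1 (Y1 n) \<phi>"
  using sys \<alpha> \<phi> by (auto intro!: stable_motion.intro prob_space_axioms stable_motion_axioms.intro simp: two_type_particle_system_def)

lemma stable2: "stable_motion M \<alpha>2 (Y2 n) \<psi>"
  using sys \<alpha> \<psi> by (auto intro!: stable_motion.intro prob_space_axioms stable_motion_axioms.intro simp: two_type_particle_system_def)

sublocale m1: stable_motion M \<alpha>1 "Y1 n" \<phi> for n by (rule stable1)

sublocale m2: stable_motion M \<alpha>2 "Y2 n" \<psi> for n by (rule stable2)

text \<open>The randomness contained in a set of sources, as a measurable space on the original sample
  space: the identity map then plays the role of the random element generated by these sources.\<close>

definition sub_alg :: "source set \<Rightarrow> 'w measure" where
  "sub_alg S = sigma (space M) (\<Union>i\<in>S. source_events M x Y1 Y2 i)"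

lemma source_events_Pow: "source_events M x Y1 Y2 i \<subseteq> Pow (space M)"
  by (cases i) (simp_all add: generated_events_Pow)

lemma source_events_sets: "source_events M x Y1 Y2 i \<subseteq> sets M"
proof -
  have "x n \<in> borel_measurable M" for n using points.x_measurable[of n] by simp
  then have "generated_events M UNIV x \<subseteq> sets M" by (intro generated_events_sets)
  moreover have "generated_events M {0..} (Y1 n) \<subseteq> sets M" "generated_events M {0..} (Y2 n) \<subseteq> sets M" for n
    by (rule generated_events_sets; simp add: m1.Y_measurable m2.Y_measurable)+
  ultimately show ?thesis by (cases i) simp_all
qed

lemma space_sub_alg[simp]: "space (sub_alg S) = space M"
  unfolding sub_alg_def by (rule space_measure_of_conv)

lemma sets_sub_alg: "sets (sub_alg S) = sigma_sets (space M) (\<Union>i\<in>S. source_events M x Y1 Y2 i)"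
  unfolding sub_alg_def by (rule sets_measure_of) (use source_events_Pow in auto)

lemma sets_sub_alg_subset: "sets (sub_alg S) \<subseteq> sets M"
  unfolding sets_sub_alg by (rule sets.sigma_sets_subset) (use source_events_sets in auto)

lemma id_measurable: "(\<lambda>w. w) \<in> M \<rightarrow>\<^sub>M sub_alg S"
  using sets_sub_alg_subset[of S] sets.sets_into_space by (auto simp: measurable_def Int_absorb2 subset_iff)

lemma sub_alg_mono: "S \<subseteq> S' \<Longrightarrow> f \<in> sub_alg S \<rightarrow>\<^sub>M N \<Longrightarrow> f \<in> sub_alg S' \<rightarrow>\<^sub>M N"
proof -
  assume "S \<subseteq> S'" and f: "f \<in> sub_alg S \<rightarrow>\<^sub>M N"
  then have "sets (sub_alg S) \<subseteq> sets (sub_alg S')" unfolding sets_sub_alg by (intro sigma_sets_mono') auto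
  then show ?thesis using f by (auto simp: measurable_def)
qed

lemma sub_alg_measurable_M: "f \<in> sub_alg S \<rightarrow>\<^sub>M N \<Longrightarrow> f \<in> M \<rightarrow>\<^sub>M N"
  using measurable_compose[OF id_measurable] by blast

lemma generated_measurable:
  assumes "i \<in> I" "generated_events M I Z \<subseteq> sets (sub_alg S)"
  shows "Z i \<in> borel_measurable (sub_alg S)"
proof (rule measurableI)
  fix A assume "A \<in> sets (borel :: 'b measure)"
  then have "Z i -` A \<inter> space M \<in> generated_events M I Z" unfolding generated_events_def using assms by (intro sigma_sets.Basic) auto
  then show "Z i -` A \<inter> space (sub_alg S) \<in> sets (sub_alg S)" using assms by auto
qed simp

lemma source_events_sub_alg: "i \<in> S \<Longrightarrow> source_events M x Y1 Y2 i \<subseteq> sets (sub_alg S)"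
  unfolding sets_sub_alg by (auto intro: sigma_sets.Basic)

lemma x_sub_alg: "Start \<in> S \<Longrightarrow> x n \<in> borel_measurable (sub_alg S)"
  using generated_measurable[of n UNIV x S] source_events_sub_alg[of Start S] by simp

lemma Y1_sub_alg: "Motion1 n \<in> S \<Longrightarrow> 0 \<le> t \<Longrightarrow> Y1 n t \<in> borel_measurable (sub_alg S)"
  using generated_measurable[of t "{0..}" "Y1 n" S] source_events_sub_alg[of "Motion1 n" S] by simp

lemma Y2_sub_alg: "Motion2 n \<in> S \<Longrightarrow> 0 \<le> t \<Longrightarrow> Y2 n t \<in> borel_measurable (sub_alg S)"
  using generated_measurable[of t "{0..}" "Y2 n" S] source_events_sub_alg[of "Motion2 n" S] by simp

lemma occ_sub_alg:
  "Motion1 n \<in> S \<Longrightarrow> (\<lambda>q. occ \<phi> (Y1 n) q s) \<in> borel_measurable (borel \<Otimes>\<^sub>M sub_alg S)"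
  "Motion2 n \<in> S \<Longrightarrow> (\<lambda>q. occ \<psi> (Y2 n) q s) \<in> borel_measurable (borel \<Otimes>\<^sub>M sub_alg S)"
  "Motion1 n \<in> S \<Longrightarrow> (\<lambda>q. abs_occ \<phi> (Y1 n) q l r) \<in> borel_measurable (borel \<Otimes>\<^sub>M sub_alg S)"
  "Motion2 n \<in> S \<Longrightarrow> (\<lambda>q. abs_occ \<psi> (Y2 n) q l r) \<in> borel_measurable (borel \<Otimes>\<^sub>M sub_alg S)"
  by (intro occ_measurable; simp add: Y1_sub_alg Y2_sub_alg m1.Y_cadlag m2.Y_cadlag m1.\<phi>_measurable m2.\<phi>_measurable)+

text \<open>The event family of each source is stable under intersections, so independence of the
  sources passes to what disjoint groups of them generate.\<close>

lemma indep_sub_algs: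
  assumes "disjoint_family_on S J"
  shows "indep_vars (\<lambda>j. sub_alg (S j)) (\<lambda>j w. w) J"
proof -
  have ind: "indep_sets (source_events M x Y1 Y2) UNIV" using sys by (simp add: two_type_particle_system_def)
  have Int: "Int_stable (source_events M x Y1 Y2 i)" for i
    by (cases i) (simp_all add: Int_stable_generated_events)
  have "indep_sets (\<lambda>j. sigma_sets (space M) (\<Union>i\<in>S j. source_events M x Y1 Y2 i)) J"
    by (rule indep_sets_collect_sigma) (use ind Int assms in \<open>auto intro: indep_sets_mono_index\<close>)
  then have "indep_sets (\<lambda>j. sets (sub_alg (S j))) J" by (simp add: sets_sub_alg)
  moreover have "{(\<lambda>w. w) -` A \<inter> space M |A. A \<in> sets (sub_alg T)} = sets (sub_alg T)" for T
  proof -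
    have "{(\<lambda>w. w) -` A \<inter> space M |A. A \<in> sets (sub_alg T)} = (\<lambda>A. A \<inter> space M) ` sets (sub_alg T)" by auto
    also have "\<dots> = (\<lambda>A. A) ` sets (sub_alg T)"
      using sets.sets_into_space[of _ "sub_alg T"] by (intro image_cong refl) (simp add: Int_absorb2)
    finally show ?thesis by simp
  qed
  ultimately show ?thesis unfolding indep_vars_def2 using id_measurable by simp
qed

section \<open>Decoupling of independent groups of sources\<close>

lemma indep_pair:
  assumes "S \<inter> S' = {}"
  shows "indep_var (sub_alg S) (\<lambda>w. w) (sub_alg S') (\<lambda>w. w)"
proof -
  have "disjoint_family_on (case_bool S S') UNIV" using assms by (auto simp: disjoint_family_on_def split: bool.split)
  note ind = indep_sub_algs[OF this]
  show ?thesis unfolding indep_var_def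
    by (rule indep_vars_cong[THEN iffD1, OF refl _ _ ind]) (auto split: bool.split)
qed

lemma diagonal_distr:
  assumes "S \<inter> S' = {}"
  shows "distr M (sub_alg S \<Otimes>\<^sub>M sub_alg S') (\<lambda>w. (w, w)) = distr M (sub_alg S) (\<lambda>w. w) \<Otimes>\<^sub>M distr M (sub_alg S') (\<lambda>w. w)"
  using indep_pair[OF assms] by (simp add: indep_var_distribution_eq)

text \<open>Seen through two disjoint groups of sources, the pair (w, w) has a product law, so one
  sample point may be replaced by two independent ones. This takes the place of
  conditioning.\<close>

lemma decouple_nn_integral:
  assumes d: "S \<inter> S' = {}" and f: "f \<in> borel_measurable (sub_alg S \<Otimes>\<^sub>M sub_alg S')"
  shows "(\<integral>\<^sup>+w. f (w, w) \<partial>M) = (\<integral>\<^sup>+w. \<integral>\<^sup>+w'. f (w, w') \<partial>M \<partial>M)"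
proof -
  have i: "(\<lambda>w. w) \<in> M \<rightarrow>\<^sub>M sub_alg T" for T by (rule id_measurable)
  interpret D: prob_space "distr M (sub_alg S) (\<lambda>w. w)" by (rule prob_space_distr[OF i])
  interpret D': prob_space "distr M (sub_alg S') (\<lambda>w. w)" by (rule prob_space_distr[OF i])
  have f': "f \<in> borel_measurable (distr M (sub_alg S) (\<lambda>w. w) \<Otimes>\<^sub>M distr M (sub_alg S') (\<lambda>w. w))"
    using f by (simp cong: measurable_cong_sets sets_pair_measure_cong add: measurable_cong_sets[OF sets_pair_measure_cong[OF sets_distr sets_distr] refl])
  have sec: "(\<lambda>w'. f (w, w')) \<in> borel_measurable (sub_alg S')" if "w \<in> space M" for w
    using measurable_Pair2[OF f] that by simp
  have "(\<integral>\<^sup>+w. f (w, w) \<partial>M) = (\<integral>\<^sup>+q. f q \<partial>distr M (sub_alg S \<Otimes>\<^sub>M sub_alg S') (\<lambda>w. (w, w)))"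
    by (rule nn_integral_distr[symmetric]) (use f i in auto)
  also have "\<dots> = (\<integral>\<^sup>+w. \<integral>\<^sup>+w'. f (w, w') \<partial>distr M (sub_alg S') (\<lambda>w. w) \<partial>distr M (sub_alg S) (\<lambda>w. w))"
    unfolding diagonal_distr[OF d] using f' by (rule D'.nn_integral_fst[symmetric])
  also have "\<dots> = (\<integral>\<^sup>+w. \<integral>\<^sup>+w'. f (w, w') \<partial>distr M (sub_alg S') (\<lambda>w. w) \<partial>M)"
    by (rule nn_integral_distr[OF i]) (use D'.borel_measurable_nn_integral_fst[OF f'] in simp)
  also have "\<dots> = (\<integral>\<^sup>+w. \<integral>\<^sup>+w'. f (w, w') \<partial>M \<partial>M)"
    by (intro nn_integral_cong nn_integral_distr[OF i]) (use sec in simp)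
  finally show ?thesis .
qed

lemma decouple_integral:
  fixes f :: "'w \<times> 'w \<Rightarrow> 'b :: {banach, second_countable_topology}"
  assumes d: "S \<inter> S' = {}" and f: "f \<in> borel_measurable (sub_alg S \<Otimes>\<^sub>M sub_alg S')" and fi: "integrable M (\<lambda>w. f (w, w))"
  shows "(LINT w|M. f (w, w)) = (LINT w|M. (LINT w'|M. f (w, w')))"
proof -
  have i: "(\<lambda>w. w) \<in> M \<rightarrow>\<^sub>M sub_alg T" for T by (rule id_measurable)
  interpret D: prob_space "distr M (sub_alg S) (\<lambda>w. w)" by (rule prob_space_distr[OF i])
  interpret D': prob_space "distr M (sub_alg S') (\<lambda>w. w)" by (rule prob_space_distr[OF i])
  interpret DD: pair_prob_space "distr M (sub_alg S) (\<lambda>w. w)" "distr M (sub_alg S') (\<lambda>w. w)" ..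
  have f': "f \<in> borel_measurable (distr M (sub_alg S) (\<lambda>w. w) \<Otimes>\<^sub>M distr M (sub_alg S') (\<lambda>w. w))"
    using f by (simp add: measurable_cong_sets[OF sets_pair_measure_cong[OF sets_distr sets_distr] refl])
  have int: "integrable (distr M (sub_alg S) (\<lambda>w. w) \<Otimes>\<^sub>M distr M (sub_alg S') (\<lambda>w. w)) f"
    unfolding diagonal_distr[OF d, symmetric] by (rule integrable_distr_eq[THEN iffD2]) (use fi f i in auto)
  have sec: "(\<lambda>w'. f (w, w')) \<in> borel_measurable (sub_alg S')" if "w \<in> space M" for w
    using measurable_Pair2[OF f] that by simp
  have "(LINT w|M. f (w, w)) = (LINT q|(distr M (sub_alg S \<Otimes>\<^sub>M sub_alg S') (\<lambda>w. (w, w))). f q)"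
    by (rule integral_distr[symmetric]) (use f i in auto)
  also have "\<dots> = (LINT w|(distr M (sub_alg S) (\<lambda>w. w)). (LINT w'|(distr M (sub_alg S') (\<lambda>w. w)). f (w, w')))"
    unfolding diagonal_distr[OF d] using DD.integral_fst'[OF int] by simp
  also have "\<dots> = (LINT w|M. (LINT w'|(distr M (sub_alg S') (\<lambda>w. w)). f (w, w')))"
  proof (rule integral_distr[OF i])
    have "(\<lambda>w. (LINT w'|(distr M (sub_alg S') (\<lambda>w. w)). f (w, w'))) \<in> borel_measurable (distr M (sub_alg S) (\<lambda>w. w))"
      by (rule D'.borel_measurable_lebesgue_integral) (use f' in \<open>simp add: split_beta'\<close>)
    then show "(\<lambda>w. (LINT w'|(distr M (sub_alg S') (\<lambda>w. w)). f (w, w'))) \<in> borel_measurable (sub_alg S)" by simp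
  qed
  also have "\<dots> = (LINT w|M. (LINT w'|M. f (w, w')))"
    by (intro Bochner_Integration.integral_cong refl integral_distr[OF i]) (use sec in simp)
  finally show ?thesis .
qed

abbreviation "motions n \<equiv> {Motion1 n, Motion2 n}"

text \<open>The starts are separated from all motions at once. With the starts frozen, the factors
  are functions of disjoint groups of motions and hence independent: conditional independence of the
  pairs given the initial configuration.\<close>

lemma decouple_prod:
  fixes e :: "nat \<Rightarrow> (real \<times> real) \<times> 'w \<Rightarrow> complex"
  assumes e: "\<And>n. e n \<in> borel_measurable (borel \<Otimes>\<^sub>M sub_alg (motions n))" and b: "\<And>n q. norm (e n q) \<le> 1"
  shows "expectation (\<lambda>w. \<Prod>n<N. e n (x n w, w)) = expectation (\<lambda>w. \<Prod>n<N. expectation (\<lambda>w'. e n (x n w, w')))"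
proof -
  define S' where "S' = (\<Union>n. motions n)"
  have d: "{Start} \<inter> S' = {}" by (auto simp: S'_def)
  let ?F = "\<lambda>q. \<Prod>n<N. e n (x n (fst q), snd q)"
  have em: "e n \<in> borel_measurable (borel \<Otimes>\<^sub>M sub_alg S')" for n
  proof -
    have "(\<lambda>w. w) \<in> sub_alg S' \<rightarrow>\<^sub>M sub_alg (motions n)"
      by (rule sub_alg_mono[of "motions n"]) (auto simp: S'_def)
    then have "(\<lambda>q. (fst q, snd q)) \<in> borel \<Otimes>\<^sub>M sub_alg S' \<rightarrow>\<^sub>M borel \<Otimes>\<^sub>M sub_alg (motions n)"
      by (intro measurable_Pair measurable_fst measurable_compose[OF measurable_snd])
    from measurable_compose[OF this e] show ?thesis by simp
  qed
  have Fm: "?F \<in> borel_measurable (sub_alg {Start} \<Otimes>\<^sub>M sub_alg S')"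
  proof (rule borel_measurable_prod)
    fix n
    have "(\<lambda>q. (x n (fst q), snd q)) \<in> sub_alg {Start} \<Otimes>\<^sub>M sub_alg S' \<rightarrow>\<^sub>M borel \<Otimes>\<^sub>M sub_alg S'"
      by (intro measurable_Pair measurable_compose[OF measurable_fst x_sub_alg] measurable_snd) simp
    from measurable_compose[OF this em] show "(\<lambda>q. e n (x n (fst q), snd q)) \<in> borel_measurable (sub_alg {Start} \<Otimes>\<^sub>M sub_alg S')" .
  qed
  have "expectation (\<lambda>w. \<Prod>n<N. e n (x n w, w)) = expectation (\<lambda>w. ?F (w, w))" by simp
  also have "\<dots> = expectation (\<lambda>w. expectation (\<lambda>w'. ?F (w, w')))"
  proof (rule decouple_integral[OF d Fm])
    have "norm (?F q) \<le> 1" for q unfolding prod_norm[symmetric] by (intro prod_le_1 conjI norm_ge_zero b)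
    moreover have "(\<lambda>w. ?F (w, w)) \<in> borel_measurable M"
      by (rule measurable_compose[OF _ Fm]) (intro measurable_Pair id_measurable)
    ultimately show "integrable M (\<lambda>w. ?F (w, w))" by (intro integrable_const_bound[where B=1] AE_I2)
  qed
  also have "\<dots> = expectation (\<lambda>w. \<Prod>n<N. expectation (\<lambda>w'. e n (x n w, w')))"
  proof (rule Bochner_Integration.integral_cong[OF refl])
    fix w
    have sec: "(\<lambda>w'. e n (x n w, w')) \<in> borel_measurable (sub_alg (motions n))" for n
      using measurable_Pair2[OF e[of n], of "x n w"] by simp
    have "disjoint_family_on motions {..<N}" by (auto simp: disjoint_family_on_def)
    from indep_vars_compose2[OF indep_sub_algs[OF this], of "\<lambda>n w'. e n (x n w, w')" "\<lambda>_. borel"]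
    have ind: "indep_vars (\<lambda>_. borel) (\<lambda>n w'. e n (x n w, w')) {..<N}" using sec by simp
    have "integrable M (\<lambda>w'. e n (x n w, w'))" for n
      using sub_alg_measurable_M[OF sec] b by (intro integrable_const_bound[where B=1]) auto
    then show "expectation (\<lambda>w'. ?F (w, w')) = (\<Prod>n<N. expectation (\<lambda>w'. e n (x n w, w')))"
      using indep_vars_lebesgue_integral[OF _ ind] by simp
  qed
  finally show ?thesis .
qed

lemma decouple_start_nn:
  assumes f: "f \<in> borel_measurable (borel \<Otimes>\<^sub>M sub_alg (motions n))"
  shows "(\<integral>\<^sup>+w. f (x n w, w) \<partial>M) = (\<integral>\<^sup>+w. \<integral>\<^sup>+w'. f (x n w, w') \<partial>M \<partial>M)"
proof -
  have "(\<lambda>q. (x n (fst q), snd q)) \<in> sub_alg {Start} \<Otimes>\<^sub>M sub_alg (motions n) \<rightarrow>\<^sub>M borel \<Otimes>\<^sub>M sub_alg (motions n)"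
    by (intro measurable_Pair measurable_compose[OF measurable_fst x_sub_alg] measurable_snd) simp
  from decouple_nn_integral[OF _ measurable_compose[OF this f]] show ?thesis by simp
qed

lemma decouple_start:
  fixes f :: "(real \<times> real) \<times> 'w \<Rightarrow> real"
  assumes f: "f \<in> borel_measurable (borel \<Otimes>\<^sub>M sub_alg (motions n))" and fi: "integrable M (\<lambda>w. f (x n w, w))"
  shows "(LINT w|M. f (x n w, w)) = (LINT w|M. (LINT w'|M. f (x n w, w')))"
proof -
  have "(\<lambda>q. (x n (fst q), snd q)) \<in> sub_alg {Start} \<Otimes>\<^sub>M sub_alg (motions n) \<rightarrow>\<^sub>M borel \<Otimes>\<^sub>M sub_alg (motions n)"
    by (intro measurable_Pair measurable_compose[OF measurable_fst x_sub_alg] measurable_snd) simp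
  from decouple_integral[OF _ measurable_compose[OF this f]] fi show ?thesis by simp
qed

lemma decouple_motions_nn:
  assumes f: "f \<in> borel_measurable (sub_alg {Motion1 n})" and g: "g \<in> borel_measurable (sub_alg {Motion2 n})"
  shows "(\<integral>\<^sup>+w. f w * g w \<partial>M) = (\<integral>\<^sup>+w. f w \<partial>M) * (\<integral>\<^sup>+w. g w \<partial>M)"
proof -
  have "(\<lambda>q. f (fst q) * g (snd q)) \<in> borel_measurable (sub_alg {Motion1 n} \<Otimes>\<^sub>M sub_alg {Motion2 n})"
    using measurable_compose[OF measurable_fst f] measurable_compose[OF measurable_snd g] by measurable
  from decouple_nn_integral[OF _ this]
  have "(\<integral>\<^sup>+w. f w * g w \<partial>M) = (\<integral>\<^sup>+w. \<integral>\<^sup>+w'. f w * g w' \<partial>M \<partial>M)" by simp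
  also have "\<dots> = (\<integral>\<^sup>+w. f w * (\<integral>\<^sup>+w'. g w' \<partial>M) \<partial>M)"
    by (intro nn_integral_cong nn_integral_cmult sub_alg_measurable_M[OF g])
  also have "\<dots> = (\<integral>\<^sup>+w. f w \<partial>M) * (\<integral>\<^sup>+w. g w \<partial>M)"
    by (intro nn_integral_multc sub_alg_measurable_M[OF f])
  finally show ?thesis .
qed

lemma decouple_motions:
  fixes f g :: "'w \<Rightarrow> real"
  assumes f: "f \<in> borel_measurable (sub_alg {Motion1 n})" "integrable M f" and g: "g \<in> borel_measurable (sub_alg {Motion2 n})" "integrable M g"
  shows "integrable M (\<lambda>w. f w * g w)" "(LINT w|M. f w * g w) = (LINT w|M. f w) * (LINT w|M. g w)"
proof -
  have "indep_var borel (f \<circ> (\<lambda>w. w)) borel (g \<circ> (\<lambda>w. w))"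
    by (rule indep_var_compose[OF indep_pair]) (use f g in auto)
  then have "indep_var borel f borel g" by (simp add: o_def)
  then show "integrable M (\<lambda>w. f w * g w)" "(LINT w|M. f w * g w) = (LINT w|M. f w) * (LINT w|M. g w)"
    using indep_var_integrable indep_var_lebesgue_integral f g by auto
qed

end

section \<open>Product integrals over the starting points\<close>

lemma nn_integral_lborel_prod:
  assumes [measurable]: "f \<in> borel_measurable borel" "g \<in> borel_measurable borel"
  shows "(\<integral>\<^sup>+z. f (fst z) * g (snd z) \<partial>(lborel :: (real \<times> real) measure)) = (\<integral>\<^sup>+x. f x \<partial>lborel) * (\<integral>\<^sup>+y. g y \<partial>lborel)"
proof -
  have "(\<integral>\<^sup>+z. f (fst z) * g (snd z) \<partial>(lborel \<Otimes>\<^sub>M lborel)) = (\<integral>\<^sup>+x. \<integral>\<^sup>+y. f x * g y \<partial>lborel \<partial>lborel)"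
    by (subst lborel.nn_integral_fst[symmetric]) auto
  then show ?thesis by (simp add: lborel_prod nn_integral_cmult nn_integral_multc)
qed

lemma integral_lborel_prod:
  fixes f g :: "real \<Rightarrow> real"
  assumes f: "integrable lborel f" and g: "integrable lborel g"
  shows "integrable lborel (\<lambda>z :: real \<times> real. f (fst z) * g (snd z))"
    "(LINT z|(lborel :: (real \<times> real) measure). f (fst z) * g (snd z)) = (LBINT x. f x) * (LBINT y. g y)"
proof -
  have [measurable]: "f \<in> borel_measurable borel" "g \<in> borel_measurable borel"
    using borel_measurable_integrable[OF f] borel_measurable_integrable[OF g] by auto
  have "(\<integral>\<^sup>+z. ennreal (norm (f (fst z) * g (snd z))) \<partial>(lborel :: (real \<times> real) measure)) = (\<integral>\<^sup>+x. ennreal \<bar>f x\<bar> \<partial>lborel) * (\<integral>\<^sup>+y. ennreal \<bar>g y\<bar> \<partial>lborel)"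
    using nn_integral_lborel_prod[of "\<lambda>x. ennreal \<bar>f x\<bar>" "\<lambda>x. ennreal \<bar>g x\<bar>"] by (simp add: abs_mult ennreal_mult)
  also have "\<dots> < \<infinity>" using f g by (auto simp: integrable_iff_bounded ennreal_mult_less_top)
  finally have i: "integrable (lborel \<Otimes>\<^sub>M lborel) (\<lambda>z. f (fst z) * g (snd z))"
    unfolding lborel_prod by (intro integrableI_bounded) (auto simp: lborel_prod[symmetric])
  then show "integrable lborel (\<lambda>z :: real \<times> real. f (fst z) * g (snd z))" by (simp add: lborel_prod)
  show "(LINT z|(lborel :: (real \<times> real) measure). f (fst z) * g (snd z)) = (LBINT x. f x) * (LBINT y. g y)"
    using lborel_pair.integral_fst'[OF i] by (simp add: lborel_prod)
qed

lemma AE_lborel_fst_snd: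
  assumes P: "AE x in lborel. P x" and Q: "AE y in lborel. Q y"
  shows "AE z in (lborel :: (real \<times> real) measure). P (fst z) \<and> Q (snd z)"
proof -
  obtain A where A: "A \<in> null_sets lborel" "{x. \<not> P x} \<subseteq> A" using P by (auto simp: eventually_ae_filter)
  obtain B where B: "B \<in> null_sets lborel" "{x. \<not> Q x} \<subseteq> B" using Q by (auto simp: eventually_ae_filter)
  have "A \<times> UNIV \<in> null_sets (lborel \<Otimes>\<^sub>M (lborel :: real measure))" "UNIV \<times> B \<in> null_sets ((lborel :: real measure) \<Otimes>\<^sub>M lborel)"
    using A B by (auto simp: null_sets_def lborel.emeasure_pair_measure_Times)
  then have "A \<times> UNIV \<union> UNIV \<times> B \<in> null_sets (lborel :: (real \<times> real) measure)" by (simp add: lborel_prod null_sets.Un)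
  moreover have "{z \<in> space lborel. \<not> (P (fst z) \<and> Q (snd z))} \<subseteq> A \<times> UNIV \<union> UNIV \<times> B" using A B by auto
  ultimately show ?thesis by (rule AE_I')
qed

lemma iexp_taylor2: "norm (iexp y - (1 + \<i> * of_real y - of_real (y\<^sup>2) / 2)) \<le> \<bar>y\<bar> ^ 3 / 6"
proof -
  have e: "(\<Sum>k\<le>2. (\<i> * complex_of_real y) ^ k / fact k) = 1 + \<i> * of_real y - of_real (y\<^sup>2) / 2"
    by (simp add: numeral_2_eq_2 power2_eq_square algebra_simps)
  have f: "\<bar>y\<bar> ^ Suc 2 / fact (Suc 2) = \<bar>y\<bar> ^ 3 / 6" by (simp add: eval_nat_numeral)
  show ?thesis using iexp_approx1[of y 2] unfolding e f .
qed

context particle_system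
begin

section \<open>Contributions of single particle pairs\<close>

lemma fst_sub: "(\<lambda>q. (fst (fst q), snd q)) \<in> (borel :: (real \<times> real) measure) \<Otimes>\<^sub>M N \<rightarrow>\<^sub>M borel \<Otimes>\<^sub>M N"
  and snd_sub: "(\<lambda>q. (snd (fst q), snd q)) \<in> (borel :: (real \<times> real) measure) \<Otimes>\<^sub>M N \<rightarrow>\<^sub>M borel \<Otimes>\<^sub>M N"
proof -
  have c: "(fst :: real \<times> real \<Rightarrow> real) \<in> borel_measurable borel" "(snd :: real \<times> real \<Rightarrow> real) \<in> borel_measurable borel"
    by (intro borel_measurable_continuous_onI continuous_intros)+
  show "(\<lambda>q. (fst (fst q), snd q)) \<in> (borel :: (real \<times> real) measure) \<Otimes>\<^sub>M N \<rightarrow>\<^sub>M borel \<Otimes>\<^sub>M N"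
    "(\<lambda>q. (snd (fst q), snd q)) \<in> (borel :: (real \<times> real) measure) \<Otimes>\<^sub>M N \<rightarrow>\<^sub>M borel \<Otimes>\<^sub>M N"
    by (intro measurable_Pair measurable_snd measurable_compose[OF measurable_fst] c)+
qed

text \<open>One majorant for the contribution of a pair at all times up to \<open>R\<close>; for a
  fixed start its moments factorize by independence of the two motions.\<close>

definition pair_bar :: "nat \<Rightarrow> real \<Rightarrow> real \<times> real \<Rightarrow> 'w \<Rightarrow> ennreal" where
  "pair_bar n R z w = abs_occ \<phi> (Y1 n) (fst z, w) 0 R * abs_occ \<psi> (Y2 n) (snd z, w) 0 R"

lemma pair_bar_measurable: "(\<lambda>q. pair_bar n R (fst q) (snd q)) \<in> borel_measurable (borel \<Otimes>\<^sub>M sub_alg (motions n))"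
proof -
  have [measurable]: "(\<lambda>q. abs_occ \<phi> (Y1 n) (fst (fst q), snd q) 0 R) \<in> borel_measurable ((borel :: (real \<times> real) measure) \<Otimes>\<^sub>M sub_alg (motions n))"
    "(\<lambda>q. abs_occ \<psi> (Y2 n) (snd (fst q), snd q) 0 R) \<in> borel_measurable ((borel :: (real \<times> real) measure) \<Otimes>\<^sub>M sub_alg (motions n))"
    by (rule measurable_compose[OF fst_sub occ_sub_alg(3)] measurable_compose[OF snd_sub occ_sub_alg(4)]; simp)+
  show ?thesis unfolding pair_bar_def by measurable
qed

lemma section_sub_alg:
  "(\<lambda>w. occ \<phi> (Y1 n) (a, w) s) \<in> borel_measurable (sub_alg {Motion1 n})"
  "(\<lambda>w. occ \<psi> (Y2 n) (a, w) s) \<in> borel_measurable (sub_alg {Motion2 n})"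
  "(\<lambda>w. abs_occ \<phi> (Y1 n) (a, w) l r) \<in> borel_measurable (sub_alg {Motion1 n})"
  "(\<lambda>w. abs_occ \<psi> (Y2 n) (a, w) l r) \<in> borel_measurable (sub_alg {Motion2 n})"
  using measurable_Pair2[OF occ_sub_alg(1)[of n "{Motion1 n}"], of a] measurable_Pair2[OF occ_sub_alg(2)[of n "{Motion2 n}"], of a]
    measurable_Pair2[OF occ_sub_alg(3)[of n "{Motion1 n}"], of a] measurable_Pair2[OF occ_sub_alg(4)[of n "{Motion2 n}"], of a] by auto

lemma means_indep_of_particle:
  "m1.abs_mean3 n a R = m1.abs_mean3 0 a R" "m2.abs_mean3 n a R = m2.abs_mean3 0 a R"
  "m1.abs_mean1 n a R = m1.abs_mean1 0 a R" "m2.abs_mean1 n a R = m2.abs_mean1 0 a R"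
  "m1.abs_mean3 0 a R < \<infinity> \<Longrightarrow> 0 \<le> s \<Longrightarrow> s \<le> R \<Longrightarrow> m1.mean1 n a s = m1.mean1 0 a s"
  "m2.abs_mean3 0 a R < \<infinity> \<Longrightarrow> 0 \<le> s \<Longrightarrow> s \<le> R \<Longrightarrow> m2.mean1 n a s = m2.mean1 0 a s"
  "m1.abs_mean3 0 a R < \<infinity> \<Longrightarrow> 0 \<le> s \<Longrightarrow> s \<le> R \<Longrightarrow> 0 \<le> s' \<Longrightarrow> s' \<le> R \<Longrightarrow> m1.mean2 n a s s' = m1.mean2 0 a s s'"
  "m2.abs_mean3 0 a R < \<infinity> \<Longrightarrow> 0 \<le> s \<Longrightarrow> s \<le> R \<Longrightarrow> 0 \<le> s' \<Longrightarrow> s' \<le> R \<Longrightarrow> m2.mean2 n a s s' = m2.mean2 0 a s s'"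
  using stable_motion_means_unique[OF stable1[of 0] stable1[of n]] stable_motion_means_unique[OF stable2[of 0] stable2[of n]] by auto

lemma pair_bar_moments:
  "(\<integral>\<^sup>+w. pair_bar n R z w \<partial>M) = m1.abs_mean1 0 (fst z) R * m2.abs_mean1 0 (snd z) R"
  "(\<integral>\<^sup>+w. pair_bar n R z w ^ 3 \<partial>M) = m1.abs_mean3 0 (fst z) R * m2.abs_mean3 0 (snd z) R"
proof -
  show "(\<integral>\<^sup>+w. pair_bar n R z w \<partial>M) = m1.abs_mean1 0 (fst z) R * m2.abs_mean1 0 (snd z) R"
    unfolding pair_bar_def means_indep_of_particle(3)[of n, symmetric] means_indep_of_particle(4)[of n, symmetric]
    unfolding m1.abs_mean1_def m2.abs_mean1_def by (rule decouple_motions_nn[OF section_sub_alg(3,4)])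
  show "(\<integral>\<^sup>+w. pair_bar n R z w ^ 3 \<partial>M) = m1.abs_mean3 0 (fst z) R * m2.abs_mean3 0 (snd z) R"
    unfolding pair_bar_def power_mult_distrib means_indep_of_particle(1)[of n, symmetric] means_indep_of_particle(2)[of n, symmetric]
    unfolding m1.abs_mean3_def m2.abs_mean3_def
    by (rule decouple_motions_nn[OF measurable_compose[OF section_sub_alg(3) borel_measurable_power_ennreal[OF measurable_ident]] measurable_compose[OF section_sub_alg(4) borel_measurable_power_ennreal[OF measurable_ident]], unfolded id_apply])
qed

lemma abs_mean_borel[measurable]:
  "(\<lambda>a. m1.abs_mean1 n a R) \<in> borel_measurable borel" "(\<lambda>a. m2.abs_mean1 n a R) \<in> borel_measurable borel"
  "(\<lambda>a. m1.abs_mean3 n a R) \<in> borel_measurable borel" "(\<lambda>a. m2.abs_mean3 n a R) \<in> borel_measurable borel"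
  using m1.abs_mean_measurable[of n R] m2.abs_mean_measurable[of n R] by auto

text \<open>Campbell's formula combined with the exact first moments. Finiteness of this expectation
  gives almost sure absolute convergence of the particle sum, uniformly over times up to
  \<open>R\<close>.\<close>

lemma pair_bar_sum:
  assumes R: "0 \<le> R"
  shows "(\<integral>\<^sup>+w. (\<Sum>n. pair_bar n R (x n w) w) \<partial>M) = ennreal (m1.L1 * R) * ennreal (m2.L1 * R)"
proof -
  have m: "(\<lambda>w. pair_bar n R (x n w) w) \<in> borel_measurable M" for n
  proof -
    have "(\<lambda>w. (x n w, w)) \<in> M \<rightarrow>\<^sub>M borel \<Otimes>\<^sub>M sub_alg (motions n)"
      using points.x_measurable[of n] by (intro measurable_Pair id_measurable) simp
    from measurable_compose[OF this pair_bar_measurable] show ?thesis by simp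
  qed
  have "(\<integral>\<^sup>+w. (\<Sum>n. pair_bar n R (x n w) w) \<partial>M) = (\<Sum>n. \<integral>\<^sup>+w. pair_bar n R (x n w) w \<partial>M)"
    by (rule nn_integral_suminf[OF m])
  also have "\<dots> = (\<Sum>n. \<integral>\<^sup>+w. m1.abs_mean1 0 (fst (x n w)) R * m2.abs_mean1 0 (snd (x n w)) R \<partial>M)"
    using decouple_start_nn[OF pair_bar_measurable] by (simp add: pair_bar_moments)
  also have "\<dots> = (\<integral>\<^sup>+z. m1.abs_mean1 0 (fst z) R * m2.abs_mean1 0 (snd z) R \<partial>lborel)"
    by (rule points.campbell_nn_integral) (simp add: lborel_prod[symmetric])
  also have "\<dots> = ennreal (m1.L1 * R) * ennreal (m2.L1 * R)"
    using R m1.abs_mean1_integral[of R 0] m2.abs_mean1_integral[of R 0] nn_integral_lborel_prod[OF abs_mean_borel(1)[of 0 R] abs_mean_borel(2)[of 0 R]] by simp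
  finally show ?thesis .
qed

lemma pair_bar_sum_finite: "0 \<le> R \<Longrightarrow> AE w in M. (\<Sum>n. pair_bar n R (x n w) w) < \<infinity>"
proof -
  assume R: "0 \<le> R"
  have m: "(\<lambda>w. pair_bar n R (x n w) w) \<in> borel_measurable M" for n
  proof -
    have "(\<lambda>w. (x n w, w)) \<in> M \<rightarrow>\<^sub>M borel \<Otimes>\<^sub>M sub_alg (motions n)"
      using points.x_measurable[of n] by (intro measurable_Pair id_measurable) simp
    from measurable_compose[OF this pair_bar_measurable] show ?thesis by simp
  qed
  have "(\<integral>\<^sup>+w. (\<Sum>n. pair_bar n R (x n w) w) \<partial>M) \<noteq> \<infinity>" unfolding pair_bar_sum[OF R] by (simp add: ennreal_mult_eq_top_iff)
  from nn_integral_PInf_AE[OF _ this] m show ?thesis by (auto elim!: eventually_mono simp: less_top)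
qed

text \<open>The starting points at which the second-order expansion of the characteristic function
  is available.\<close>

definition good :: "real \<Rightarrow> real \<times> real \<Rightarrow> bool" where
  "good R z \<longleftrightarrow> m1.abs_mean3 0 (fst z) R < \<infinity> \<and> m2.abs_mean3 0 (snd z) R < \<infinity>"

lemma good_AE: "0 \<le> R \<Longrightarrow> AE z in lborel. good R z"
  unfolding good_def by (intro AE_lborel_fst_snd m1.abs_mean3_finite_AE m2.abs_mean3_finite_AE)

definition pair_comb :: "nat \<Rightarrow> (nat \<Rightarrow> real) \<Rightarrow> (nat \<Rightarrow> real) \<Rightarrow> (nat \<Rightarrow> real) \<Rightarrow> nat \<Rightarrow> real \<times> real \<Rightarrow> 'w \<Rightarrow> real" where
  "pair_comb k c s t n z w = (\<Sum>j<k. c j * (occ \<phi> (Y1 n) (fst z, w) (s j) * occ \<psi> (Y2 n) (snd z, w) (t j)))"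

lemma pair_comb_measurable: "(\<lambda>q. pair_comb k c s t n (fst q) (snd q)) \<in> borel_measurable (borel \<Otimes>\<^sub>M sub_alg (motions n))"
proof -
  have [measurable]: "(\<lambda>q. occ \<phi> (Y1 n) (fst (fst q), snd q) a) \<in> borel_measurable ((borel :: (real \<times> real) measure) \<Otimes>\<^sub>M sub_alg (motions n))"
    "(\<lambda>q. occ \<psi> (Y2 n) (snd (fst q), snd q) a) \<in> borel_measurable ((borel :: (real \<times> real) measure) \<Otimes>\<^sub>M sub_alg (motions n))" for a
    by (rule measurable_compose[OF fst_sub occ_sub_alg(1)] measurable_compose[OF snd_sub occ_sub_alg(2)]; simp)+
  show ?thesis unfolding pair_comb_def by measurable
qed

lemma pair_comb_M: "(\<lambda>q. pair_comb k c s t n (fst q) (snd q)) \<in> borel_measurable (borel \<Otimes>\<^sub>M M)"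
proof -
  have "(\<lambda>q. (fst q, snd q)) \<in> borel \<Otimes>\<^sub>M M \<rightarrow>\<^sub>M borel \<Otimes>\<^sub>M sub_alg (motions n)"
    by (intro measurable_Pair measurable_fst measurable_compose[OF measurable_snd id_measurable])
  from measurable_compose[OF this pair_comb_measurable] show ?thesis by simp
qed

lemma pair_comb_section: "pair_comb k c s t n z \<in> borel_measurable M"
  using measurable_Pair2[OF pair_comb_M, of z] by simp

definition comb_sum :: "nat \<Rightarrow> (nat \<Rightarrow> real) \<Rightarrow> (nat \<Rightarrow> real) \<Rightarrow> (nat \<Rightarrow> real) \<Rightarrow> 'w \<Rightarrow> real" where
  "comb_sum k c s t w = (\<Sum>n. pair_comb k c s t n (x n w) w)"

text \<open>Here and in the next definitions particle 0 stands for all particles, which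
  \<open>means_indep_of_particle\<close> justifies at good starting points.\<close>

definition comb_mean :: "nat \<Rightarrow> (nat \<Rightarrow> real) \<Rightarrow> (nat \<Rightarrow> real) \<Rightarrow> (nat \<Rightarrow> real) \<Rightarrow> real \<times> real \<Rightarrow> real" where
  "comb_mean k c s t z = (\<Sum>j<k. c j * (m1.mean1 0 (fst z) (s j) * m2.mean1 0 (snd z) (t j)))"

definition comb_sq :: "nat \<Rightarrow> (nat \<Rightarrow> real) \<Rightarrow> (nat \<Rightarrow> real) \<Rightarrow> (nat \<Rightarrow> real) \<Rightarrow> real \<times> real \<Rightarrow> real" where
  "comb_sq k c s t z = (\<Sum>j<k. \<Sum>l<k. c j * c l * (m1.mean2 0 (fst z) (s j) (s l) * m2.mean2 0 (snd z) (t j) (t l)))"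

definition comb_cube :: "nat \<Rightarrow> (nat \<Rightarrow> real) \<Rightarrow> real \<Rightarrow> real \<times> real \<Rightarrow> real" where
  "comb_cube k c R z = (\<Sum>j<k. \<bar>c j\<bar>) ^ 3 * (enn2real (m1.abs_mean3 0 (fst z) R) * enn2real (m2.abs_mean3 0 (snd z) R))"

definition comb_var :: "nat \<Rightarrow> (nat \<Rightarrow> real) \<Rightarrow> (nat \<Rightarrow> real) \<Rightarrow> (nat \<Rightarrow> real) \<Rightarrow> real" where
  "comb_var k c s t = (\<Sum>j<k. \<Sum>l<k. c j * c l * (m1.occ_cov 0 (s j) (s l) * m2.occ_cov 0 (t j) (t l)))"

abbreviation "third1 R \<equiv> m1.L1 ^ 3 * (12 * m1.p1\<^sup>2 / m1.b\<^sup>2) * (R * R powr m1.b * R powr m1.b)"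
abbreviation "third2 R \<equiv> m2.L1 ^ 3 * (12 * m2.p1\<^sup>2 / m2.b\<^sup>2) * (R * R powr m2.b * R powr m2.b)"

context
  fixes k :: nat and c s t :: "nat \<Rightarrow> real" and R :: real
  assumes R: "0 \<le> R" and st: "\<And>j. j < k \<Longrightarrow> 0 \<le> s j \<and> s j \<le> R \<and> 0 \<le> t j \<and> t j \<le> R"
begin

lemma abs_pair_comb_le: "ennreal \<bar>pair_comb k c s t n z w\<bar> \<le> ennreal (\<Sum>j<k. \<bar>c j\<bar>) * pair_bar n R z w"
proof -
  let ?A = "abs_occ \<phi> (Y1 n) (fst z, w) 0 R" and ?B = "abs_occ \<psi> (Y2 n) (snd z, w) 0 R"
  have "\<bar>pair_comb k c s t n z w\<bar> \<le> (\<Sum>j<k. \<bar>c j\<bar> * (\<bar>occ \<phi> (Y1 n) (fst z, w) (s j)\<bar> * \<bar>occ \<psi> (Y2 n) (snd z, w) (t j)\<bar>))"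
    unfolding pair_comb_def by (rule order_trans[OF sum_abs]) (simp add: abs_mult)
  then have "ennreal \<bar>pair_comb k c s t n z w\<bar> \<le> (\<Sum>j<k. ennreal (\<bar>c j\<bar> * (\<bar>occ \<phi> (Y1 n) (fst z, w) (s j)\<bar> * \<bar>occ \<psi> (Y2 n) (snd z, w) (t j)\<bar>)))"
    by (subst sum_ennreal) (auto intro: ennreal_leI)
  also have "\<dots> \<le> (\<Sum>j<k. ennreal \<bar>c j\<bar> * (?A * ?B))"
  proof (rule sum_mono)
    fix j assume "j \<in> {..<k}"
    then have s: "0 \<le> s j" "s j \<le> R" "0 \<le> t j" "t j \<le> R" using st by auto
    have "ennreal \<bar>occ \<phi> (Y1 n) (fst z, w) (s j)\<bar> \<le> ?A" "ennreal \<bar>occ \<psi> (Y2 n) (snd z, w) (t j)\<bar> \<le> ?B"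
      using abs_occ_le[OF s(1)] abs_occ_mono[OF order_refl s(2)] abs_occ_le[OF s(3)] abs_occ_mono[OF order_refl s(4)] by (blast intro: order_trans)+
    then show "ennreal (\<bar>c j\<bar> * (\<bar>occ \<phi> (Y1 n) (fst z, w) (s j)\<bar> * \<bar>occ \<psi> (Y2 n) (snd z, w) (t j)\<bar>)) \<le> ennreal \<bar>c j\<bar> * (?A * ?B)"
      by (simp add: ennreal_mult mult_mono mult_left_mono)
  qed
  also have "\<dots> = ennreal (\<Sum>j<k. \<bar>c j\<bar>) * (?A * ?B)" by (simp add: sum_distrib_right[symmetric] sum_ennreal)
  finally show ?thesis by (simp add: pair_bar_def)
qed

text \<open>With the start fixed the two motions are independent, so mixed first and second moments
  split into one factor per type; the absolute third moment is bounded through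
  \<open>pair_bar\<close>, which factorizes as well.\<close>

lemma single_moments:
  assumes g: "good R z"
  shows "integrable M (pair_comb k c s t n z)" "(LINT w|M. pair_comb k c s t n z w) = comb_mean k c s t z"
    "integrable M (\<lambda>w. (pair_comb k c s t n z w)\<^sup>2)" "(LINT w|M. (pair_comb k c s t n z w)\<^sup>2) = comb_sq k c s t z"
    "(\<integral>\<^sup>+w. ennreal (\<bar>pair_comb k c s t n z w\<bar> ^ 3) \<partial>M) \<le> ennreal (comb_cube k c R z)"
proof -
  have f1: "m1.abs_mean3 n (fst z) R < \<infinity>" and f2: "m2.abs_mean3 n (snd z) R < \<infinity>"
    using g means_indep_of_particle(1,2)[of n] by (auto simp: good_def)
  let ?a = "\<lambda>j w. occ \<phi> (Y1 n) (fst z, w) (s j)" and ?b = "\<lambda>j w. occ \<psi> (Y2 n) (snd z, w) (t j)"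
  have am: "?a j \<in> borel_measurable (sub_alg {Motion1 n})" and bm: "?b j \<in> borel_measurable (sub_alg {Motion2 n})" for j
    by (rule section_sub_alg)+
  have one: "integrable M (\<lambda>w. ?a j w * ?b j w)" "(LINT w|M. ?a j w * ?b j w) = m1.mean1 0 (fst z) (s j) * m2.mean1 0 (snd z) (t j)" if "j < k" for j
  proof -
    have i: "integrable M (?a j)" "integrable M (?b j)"
      using m1.mean_formulas(4)[OF f1] m2.mean_formulas(4)[OF f2] st[OF that] by auto
    show "integrable M (\<lambda>w. ?a j w * ?b j w)" by (rule decouple_motions(1)[OF am i(1) bm i(2)])
    have "(LINT w|M. ?a j w * ?b j w) = m1.mean1 n (fst z) (s j) * m2.mean1 n (snd z) (t j)"
      using decouple_motions(2)[OF am i(1) bm i(2)] by (simp add: m1.mean1_def m2.mean1_def)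
    then show "(LINT w|M. ?a j w * ?b j w) = m1.mean1 0 (fst z) (s j) * m2.mean1 0 (snd z) (t j)"
      using g st[OF that] means_indep_of_particle(5)[of "fst z" R "s j" n] means_indep_of_particle(6)[of "snd z" R "t j" n] by (simp add: good_def)
  qed
  have two: "integrable M (\<lambda>w. (?a j w * ?a l w) * (?b j w * ?b l w))"
    "(LINT w|M. (?a j w * ?a l w) * (?b j w * ?b l w)) = m1.mean2 0 (fst z) (s j) (s l) * m2.mean2 0 (snd z) (t j) (t l)" if "j < k" "l < k" for j l
  proof -
    have i: "integrable M (\<lambda>w. ?a j w * ?a l w)" "integrable M (\<lambda>w. ?b j w * ?b l w)"
      using m1.mean_formulas(3)[OF f1] m2.mean_formulas(3)[OF f2] st[OF that(1)] st[OF that(2)] by auto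
    have m: "(\<lambda>w. ?a j w * ?a l w) \<in> borel_measurable (sub_alg {Motion1 n})" "(\<lambda>w. ?b j w * ?b l w) \<in> borel_measurable (sub_alg {Motion2 n})"
      using am bm by (auto intro: borel_measurable_times)
    show "integrable M (\<lambda>w. (?a j w * ?a l w) * (?b j w * ?b l w))" by (rule decouple_motions(1)[OF m(1) i(1) m(2) i(2)])
    have "(LINT w|M. (?a j w * ?a l w) * (?b j w * ?b l w)) = m1.mean2 n (fst z) (s j) (s l) * m2.mean2 n (snd z) (t j) (t l)"
      using decouple_motions(2)[OF m(1) i(1) m(2) i(2)] by (simp add: m1.mean2_def m2.mean2_def)
    then show "(LINT w|M. (?a j w * ?a l w) * (?b j w * ?b l w)) = m1.mean2 0 (fst z) (s j) (s l) * m2.mean2 0 (snd z) (t j) (t l)"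
      using g st[OF that(1)] st[OF that(2)] means_indep_of_particle(7)[of "fst z" R "s j" "s l" n] means_indep_of_particle(8)[of "snd z" R "t j" "t l" n]
      by (simp add: good_def)
  qed
  show "integrable M (pair_comb k c s t n z)"
    unfolding pair_comb_def[abs_def] using one by (intro Bochner_Integration.integrable_sum integrable_mult_right) auto
  show "(LINT w|M. pair_comb k c s t n z w) = comb_mean k c s t z"
    unfolding pair_comb_def comb_mean_def using one by (subst Bochner_Integration.integral_sum) auto
  have sq: "(pair_comb k c s t n z w)\<^sup>2 = (\<Sum>j<k. \<Sum>l<k. c j * c l * ((?a j w * ?a l w) * (?b j w * ?b l w)))" for w
    unfolding pair_comb_def power2_eq_square sum_product by (intro sum.cong refl) (simp add: mult_ac)
  show "integrable M (\<lambda>w. (pair_comb k c s t n z w)\<^sup>2)"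
    unfolding sq using two by (intro Bochner_Integration.integrable_sum integrable_mult_right) auto
  show "(LINT w|M. (pair_comb k c s t n z w)\<^sup>2) = comb_sq k c s t z"
    unfolding sq comb_sq_def using two
    by (subst Bochner_Integration.integral_sum, force, intro sum.cong refl, subst Bochner_Integration.integral_sum) auto
  have "(\<integral>\<^sup>+w. ennreal (\<bar>pair_comb k c s t n z w\<bar> ^ 3) \<partial>M) \<le> (\<integral>\<^sup>+w. ennreal ((\<Sum>j<k. \<bar>c j\<bar>) ^ 3) * pair_bar n R z w ^ 3 \<partial>M)"
  proof (rule nn_integral_mono)
    fix w
    have "ennreal \<bar>pair_comb k c s t n z w\<bar> ^ 3 \<le> (ennreal (\<Sum>j<k. \<bar>c j\<bar>) * pair_bar n R z w) ^ 3"
      by (intro power_mono abs_pair_comb_le) auto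
    then show "ennreal (\<bar>pair_comb k c s t n z w\<bar> ^ 3) \<le> ennreal ((\<Sum>j<k. \<bar>c j\<bar>) ^ 3) * pair_bar n R z w ^ 3"
      by (simp add: ennreal_power power_mult_distrib sum_nonneg)
  qed
  also have "\<dots> = ennreal ((\<Sum>j<k. \<bar>c j\<bar>) ^ 3) * (m1.abs_mean3 0 (fst z) R * m2.abs_mean3 0 (snd z) R)"
  proof -
    have "(\<lambda>w. pair_bar n R z w) \<in> borel_measurable M"
      using sub_alg_measurable_M[OF measurable_Pair2[OF pair_bar_measurable, of z]] by simp
    then show ?thesis by (subst nn_integral_cmult) (auto simp: pair_bar_moments)
  qed
  also have "\<dots> = ennreal (comb_cube k c R z)"
    using g by (simp add: comb_cube_def good_def ennreal_mult sum_nonneg)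
  finally show "(\<integral>\<^sup>+w. ennreal (\<bar>pair_comb k c s t n z w\<bar> ^ 3) \<partial>M) \<le> ennreal (comb_cube k c R z)" .
qed

text \<open>Taylor's expansion of the exponential, integrated over the motions. The left-hand
  characteristic function may depend on n, the expansion and its error do not.\<close>

lemma single_expansion:
  assumes g: "good R z"
  shows "norm ((LINT w|M. iexp (pair_comb k c s t n z w)) - (1 + \<i> * of_real (comb_mean k c s t z) - of_real (comb_sq k c s t z) / 2)) \<le> comb_cube k c R z / 6"
proof -
  note mom = single_moments[OF g, of n]
  let ?F = "pair_comb k c s t n z"
  note [measurable] = pair_comb_section[of k c s t n z]
  have i1: "integrable M (\<lambda>w. iexp (?F w))" by (rule integrable_const_bound[where B=1]) auto
  have i2: "integrable M (\<lambda>w. 1 + \<i> * complex_of_real (?F w) - of_real ((?F w)\<^sup>2) / 2)"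
  proof -
    have "integrable M (\<lambda>w. complex_of_real (?F w))" "integrable M (\<lambda>w. complex_of_real ((?F w)\<^sup>2))"
      using mom(1,3) by (intro integrable_of_real; simp)+
    then show ?thesis by (auto simp del: of_real_power)
  qed
  have e: "(LINT w|M. 1 + \<i> * complex_of_real (?F w) - of_real ((?F w)\<^sup>2) / 2) = 1 + \<i> * of_real (comb_mean k c s t z) - of_real (comb_sq k c s t z) / 2"
  proof -
    have "integrable M (\<lambda>w. complex_of_real (?F w))" "integrable M (\<lambda>w. complex_of_real ((?F w)\<^sup>2))"
      using mom(1,3) by (intro integrable_of_real; simp)+
    then show ?thesis using mom(2,4) by (simp add: prob_space del: of_real_power flip: mom(2,4))
  qed
  have "ennreal (norm ((LINT w|M. iexp (?F w)) - (1 + \<i> * of_real (comb_mean k c s t z) - of_real (comb_sq k c s t z) / 2))) =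
    ennreal (norm (LINT w|M. iexp (?F w) - (1 + \<i> * complex_of_real (?F w) - of_real ((?F w)\<^sup>2) / 2)))"
    unfolding e[symmetric] Bochner_Integration.integral_diff[OF i1 i2] ..
  also have "\<dots> \<le> (\<integral>\<^sup>+w. ennreal (norm (iexp (?F w) - (1 + \<i> * complex_of_real (?F w) - of_real ((?F w)\<^sup>2) / 2))) \<partial>M)"
    by (rule integral_norm_bound_ennreal[OF Bochner_Integration.integrable_diff[OF i1 i2]])
  also have "\<dots> \<le> (\<integral>\<^sup>+w. ennreal (1 / 6) * ennreal (\<bar>?F w\<bar> ^ 3) \<partial>M)"
  proof (rule nn_integral_mono)
    fix w
    have "norm (iexp (?F w) - (1 + \<i> * complex_of_real (?F w) - of_real ((?F w)\<^sup>2) / 2)) \<le> 1 / 6 * \<bar>?F w\<bar> ^ 3"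
      using iexp_taylor2[of "?F w"] by simp
    then show "ennreal (norm (iexp (?F w) - (1 + \<i> * complex_of_real (?F w) - of_real ((?F w)\<^sup>2) / 2))) \<le> ennreal (1 / 6) * ennreal (\<bar>?F w\<bar> ^ 3)"
      by (subst ennreal_mult[symmetric]) (auto intro: ennreal_leI)
  qed
  also have "\<dots> = ennreal (1 / 6) * (\<integral>\<^sup>+w. ennreal (\<bar>?F w\<bar> ^ 3) \<partial>M)" by (rule nn_integral_cmult) measurable
  also have "\<dots> \<le> ennreal (1 / 6) * ennreal (comb_cube k c R z)" by (intro mult_left_mono mom) auto
  also have "\<dots> = ennreal (comb_cube k c R z / 6)" by (subst ennreal_mult'[symmetric]) auto
  finally show ?thesis by (subst (asm) ennreal_le_iff) (auto simp: comb_cube_def sum_nonneg)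
qed

lemma comb_mean_integrable: "integrable lborel (comb_mean k c s t)"
  unfolding comb_mean_def[abs_def]
  by (intro Bochner_Integration.integrable_sum integrable_mult_right integral_lborel_prod(1) m1.mean1_integrable m2.mean1_integrable) (use st in auto)

lemma comb_sq_integrable: "integrable lborel (comb_sq k c s t)" "(LBINT z. comb_sq k c s t z) = comb_var k c s t"
proof -
  have i: "integrable lborel (\<lambda>z. m1.mean2 0 (fst z) (s j) (s l) * m2.mean2 0 (snd z) (t j) (t l))"
    "(LBINT z. m1.mean2 0 (fst z) (s j) (s l) * m2.mean2 0 (snd z) (t j) (t l)) = m1.occ_cov 0 (s j) (s l) * m2.occ_cov 0 (t j) (t l)"
    if "j < k" "l < k" for j l
    using integral_lborel_prod[OF m1.mean2_integrable(1)[of "s j" "s l" 0] m2.mean2_integrable(1)[of "t j" "t l" 0]]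
      m1.mean2_integrable(2)[of "s j" "s l" 0] m2.mean2_integrable(2)[of "t j" "t l" 0] st[OF that(1)] st[OF that(2)] by auto
  show "integrable lborel (comb_sq k c s t)" unfolding comb_sq_def[abs_def]
    using i by (intro Bochner_Integration.integrable_sum integrable_mult_right) auto
  show "(LBINT z. comb_sq k c s t z) = comb_var k c s t" unfolding comb_sq_def comb_var_def using i
    by (subst Bochner_Integration.integral_sum, force, intro sum.cong refl, subst Bochner_Integration.integral_sum) auto
qed

lemma comb_sq_nonneg: "AE z in lborel. 0 \<le> comb_sq k c s t z"
  using good_AE[OF R]
proof eventually_elim
  case (elim z)
  show ?case unfolding single_moments(4)[OF elim, of 0, symmetric] by (rule integral_nonneg_AE) auto
qed

lemma comb_cube_integrable: "integrable lborel (comb_cube k c R)" "(LBINT z. comb_cube k c R z) \<le> (\<Sum>j<k. \<bar>c j\<bar>) ^ 3 * (third1 R * third2 R)"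
proof -
  have e: "integrable lborel (\<lambda>a. enn2real (f a)) \<and> (LBINT a. enn2real (f a)) \<le> B"
    if [measurable]: "f \<in> borel_measurable borel" and f: "(\<integral>\<^sup>+a. f a \<partial>lborel) \<le> ennreal B" "0 \<le> B" for f :: "real \<Rightarrow> ennreal" and B
  proof -
    have "(\<integral>\<^sup>+a. f a \<partial>lborel) \<noteq> \<infinity>" using f by (auto simp: top_unique)
    from nn_integral_PInf_AE[OF _ this] have ae: "AE a in lborel. ennreal (enn2real (f a)) = f a" by (auto elim!: eventually_mono simp: less_top)
    then have nn: "(\<integral>\<^sup>+a. ennreal (enn2real (f a)) \<partial>lborel) = (\<integral>\<^sup>+a. f a \<partial>lborel)" by (rule nn_integral_cong_AE)
    have i: "integrable lborel (\<lambda>a. enn2real (f a))" using nn f by (intro integrableI_nonneg) (auto simp: le_less_trans)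
    have "ennreal (LBINT a. enn2real (f a)) \<le> ennreal B"
      using nn_integral_eq_integral[OF i] nn f by simp
    then show ?thesis using i f(2) by (simp add: ennreal_le_iff)
  qed
  have t1: "0 \<le> third1 R" "0 \<le> third2 R" using R by auto
  note e1 = e[OF abs_mean_borel(3)[of 0 R] m1.abs_mean3_integral[OF R, of 0] t1(1)] and e2 = e[OF abs_mean_borel(4)[of 0 R] m2.abs_mean3_integral[OF R, of 0] t1(2)]
  note p = integral_lborel_prod[OF conjunct1[OF e1] conjunct1[OF e2]]
  show "integrable lborel (comb_cube k c R)" unfolding comb_cube_def[abs_def] using p(1) by simp
  have "(LBINT z. comb_cube k c R z) = (\<Sum>j<k. \<bar>c j\<bar>) ^ 3 * ((LBINT a. enn2real (m1.abs_mean3 0 a R)) * (LBINT a. enn2real (m2.abs_mean3 0 a R)))"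
    unfolding comb_cube_def using p(2) by simp
  also have "\<dots> \<le> (\<Sum>j<k. \<bar>c j\<bar>) ^ 3 * (third1 R * third2 R)"
    using conjunct2[OF e1] conjunct2[OF e2] t1 by (intro mult_left_mono mult_mono) (auto simp: sum_nonneg)
  finally show "(LBINT z. comb_cube k c R z) \<le> (\<Sum>j<k. \<bar>c j\<bar>) ^ 3 * (third1 R * third2 R)" .
qed

lemma particle_term_measurable: "(\<lambda>w. pair_comb k c s t n (x n w) w) \<in> borel_measurable M"
proof -
  have "(\<lambda>w. (x n w, w)) \<in> M \<rightarrow>\<^sub>M borel \<Otimes>\<^sub>M M" using points.x_measurable[of n] by (intro measurable_Pair) auto
  from measurable_compose[OF this pair_comb_M] show ?thesis by simp
qed

lemma abs_terms_finite: "(\<integral>\<^sup>+w. (\<Sum>n. ennreal \<bar>pair_comb k c s t n (x n w) w\<bar>) \<partial>M) < \<infinity>"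
proof -
  have "(\<integral>\<^sup>+w. (\<Sum>n. ennreal \<bar>pair_comb k c s t n (x n w) w\<bar>) \<partial>M) \<le> (\<integral>\<^sup>+w. ennreal (\<Sum>j<k. \<bar>c j\<bar>) * (\<Sum>n. pair_bar n R (x n w) w) \<partial>M)"
    unfolding ennreal_suminf_cmult[symmetric] by (intro nn_integral_mono suminf_le abs_pair_comb_le) auto
  also have "\<dots> = ennreal (\<Sum>j<k. \<bar>c j\<bar>) * (\<integral>\<^sup>+w. (\<Sum>n. pair_bar n R (x n w) w) \<partial>M)"
  proof (rule nn_integral_cmult)
    have "(\<lambda>w. (x n w, w)) \<in> M \<rightarrow>\<^sub>M borel \<Otimes>\<^sub>M sub_alg (motions n)" for n
      using points.x_measurable[of n] by (intro measurable_Pair id_measurable) simp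
    from measurable_compose[OF this pair_bar_measurable] have "(\<lambda>w. pair_bar n R (x n w) w) \<in> borel_measurable M" for n by simp
    then show "(\<lambda>w. \<Sum>n. pair_bar n R (x n w) w) \<in> borel_measurable M" by measurable
  qed
  also have "\<dots> < \<infinity>" unfolding pair_bar_sum[OF R] by (simp add: ennreal_mult_less_top)
  finally show ?thesis .
qed

lemma terms_summable: "AE w in M. summable (\<lambda>n. \<bar>pair_comb k c s t n (x n w) w\<bar>)"
proof -
  have m: "(\<lambda>w. \<Sum>n. ennreal \<bar>pair_comb k c s t n (x n w) w\<bar>) \<in> borel_measurable M" using particle_term_measurable by measurable
  have "AE w in M. (\<Sum>n. ennreal \<bar>pair_comb k c s t n (x n w) w\<bar>) \<noteq> \<infinity>"
    by (rule nn_integral_PInf_AE[OF m]) (use abs_terms_finite in auto)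
  then show ?thesis by eventually_elim (auto intro!: summable_suminf_not_top)
qed

text \<open>Sum and expectation are exchanged by absolute convergence; decoupling the start turns
  every term into a function of \<open>x n\<close> alone, and Campbell's formula adds these
  up.\<close>

lemma comb_sum_mean: "integrable M (comb_sum k c s t)" "expectation (comb_sum k c s t) = (LBINT z. comb_mean k c s t z)"
proof -
  note [measurable] = particle_term_measurable
  have nn: "(\<Sum>n. \<integral>\<^sup>+w. ennreal \<bar>pair_comb k c s t n (x n w) w\<bar> \<partial>M) < \<infinity>"
    using abs_terms_finite by (simp add: nn_integral_suminf)
  have int: "integrable M (\<lambda>w. pair_comb k c s t n (x n w) w)" for n
  proof (rule integrableI_bounded)
    have "(\<integral>\<^sup>+w. ennreal \<bar>pair_comb k c s t n (x n w) w\<bar> \<partial>M) \<le> (\<Sum>n. \<integral>\<^sup>+w. ennreal \<bar>pair_comb k c s t n (x n w) w\<bar> \<partial>M)"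
      using sum_le_suminf[of "\<lambda>n. \<integral>\<^sup>+w. ennreal \<bar>pair_comb k c s t n (x n w) w\<bar> \<partial>M" "{n}"] by simp
    with nn show "(\<integral>\<^sup>+w. ennreal (norm (pair_comb k c s t n (x n w) w)) \<partial>M) < \<infinity>" by (simp add: le_less_trans)
  qed measurable
  have summ: "summable (\<lambda>n. (LINT w|M. norm (pair_comb k c s t n (x n w) w)))"
  proof (rule summable_suminf_not_top)
    show "(\<Sum>n. ennreal (LINT w|M. norm (pair_comb k c s t n (x n w) w))) \<noteq> \<top>"
      using nn nn_integral_eq_integral[OF integrable_norm[OF int]] by (simp add: less_top)
  qed auto
  have E: "(LINT w|M. pair_comb k c s t n (x n w) w) = (LINT w|M. comb_mean k c s t (x n w))" for n
  proof -
    have "(LINT w|M. pair_comb k c s t n (x n w) w) = (LINT w|M. (LINT w'|M. pair_comb k c s t n (x n w) w' ))"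
      using decouple_start[OF pair_comb_measurable, of k c s t n] int by simp
    also have "\<dots> = (LINT w|M. comb_mean k c s t (x n w))"
    proof (rule integral_cong_AE)
      have "(\<lambda>q. pair_comb k c s t n (x n (fst q)) (snd q)) \<in> borel_measurable (M \<Otimes>\<^sub>M M)"
      proof -
        have "(\<lambda>q. (x n (fst q), snd q)) \<in> M \<Otimes>\<^sub>M M \<rightarrow>\<^sub>M borel \<Otimes>\<^sub>M M" using points.x_measurable[of n] by simp
        from measurable_compose[OF this pair_comb_M] show ?thesis by simp
      qed
      then show "(\<lambda>w. (LINT w'|M. pair_comb k c s t n (x n w) w')) \<in> borel_measurable M"
        by (intro borel_measurable_lebesgue_integral) (simp add: split_beta')
      show "(\<lambda>w. comb_mean k c s t (x n w)) \<in> borel_measurable M"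
        using measurable_compose[OF points.x_measurable borel_measurable_integrable[OF comb_mean_integrable]] by simp
      show "AE w in M. (LINT w'|M. pair_comb k c s t n (x n w) w') = comb_mean k c s t (x n w)"
        using points.campbell_AE[OF good_AE[OF R], of n] by (auto elim!: eventually_mono simp: single_moments(2))
    qed
    finally show ?thesis .
  qed
  show "integrable M (comb_sum k c s t)" unfolding comb_sum_def[abs_def]
    by (rule integrable_suminf[OF int _ summ]) (use terms_summable in auto)
  have "(\<lambda>n. (LINT w|M. pair_comb k c s t n (x n w) w)) sums expectation (comb_sum k c s t)"
    unfolding comb_sum_def by (rule sums_integral[OF int _ summ]) (use terms_summable in auto)
  moreover have "(\<lambda>n. (LINT w|M. pair_comb k c s t n (x n w) w)) sums (LBINT z. comb_mean k c s t z)"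
    unfolding E by (rule points.campbell_integral(2)[OF comb_mean_integrable])
  ultimately show "expectation (comb_sum k c s t) = (LBINT z. comb_mean k c s t z)" by (rule sums_unique2)
qed

text \<open>After decoupling, the factors are the characteristic functions of single pairs as
  functions of the start. They share one expansion at almost every start, so
  \<open>poisson_sum_char_bound\<close> applies with \<open>comb_var\<close> as variance and the
  third moment as error.\<close>

lemma comb_sum_char_bound:
  "norm (expectation (\<lambda>w. iexp (comb_sum k c s t w - expectation (comb_sum k c s t))) - of_real (exp (- comb_var k c s t / 2)))
     \<le> (\<Sum>j<k. \<bar>c j\<bar>) ^ 3 * (third1 R * third2 R) / 2"
proof -
  define h where "h n z = (LINT w|M. iexp (pair_comb k c s t n z w))" for n z
  have em: "(\<lambda>q. iexp (pair_comb k c s t n (fst q) (snd q))) \<in> borel_measurable (borel \<Otimes>\<^sub>M sub_alg (motions n))" for n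
    using pair_comb_measurable by measurable
  have hm: "h n \<in> borel_measurable lborel" for n
  proof -
    have "(\<lambda>q. iexp (pair_comb k c s t n (fst q) (snd q))) \<in> borel_measurable (borel \<Otimes>\<^sub>M M)"
      using pair_comb_M by measurable
    then have "h n \<in> borel_measurable borel" unfolding h_def by (intro borel_measurable_lebesgue_integral) (simp add: split_beta')
    then show ?thesis by simp
  qed
  have hb: "norm (h n z) \<le> 1" for n z
  proof -
    have "norm (h n z) \<le> (LINT w|M. norm (iexp (pair_comb k c s t n z w)))" unfolding h_def by (rule integral_norm_bound)
    then show ?thesis by (simp add: prob_space)
  qed
  have "norm (expectation (\<lambda>w. iexp ((\<Sum>n. pair_comb k c s t n (x n w) w) - (LBINT z. comb_mean k c s t z))) - of_real (exp (- (LBINT z. comb_sq k c s t z) / 2)))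
     \<le> (LBINT z. comb_cube k c R z) / 2"
  proof (rule points.poisson_sum_char_bound[where h=h])
    show "expectation (\<lambda>w. \<Prod>n<N. iexp (pair_comb k c s t n (x n w) w)) = expectation (\<lambda>w. \<Prod>n<N. h n (x n w))" for N
      unfolding h_def using decouple_prod[OF em] by simp
    show "AE z in lborel. norm (h n z - (1 + \<i> * of_real (comb_mean k c s t z) - of_real (comb_sq k c s t z) / 2)) \<le> comb_cube k c R z / 6" for n
      unfolding h_def using single_expansion by (rule eventually_mono[OF good_AE[OF R]])
  qed (rule particle_term_measurable terms_summable hm hb comb_mean_integrable comb_sq_integrable(1) comb_sq_nonneg comb_cube_integrable(1))+
  also have "\<dots> \<le> (\<Sum>j<k. \<bar>c j\<bar>) ^ 3 * (third1 R * third2 R) / 2" using comb_cube_integrable(2) by (rule divide_right_mono) simp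
  finally show ?thesis unfolding comb_sum_mean(2) comb_sq_integrable(2) unfolding comb_sum_def .
qed

end

end

section \<open>Paths of the occupation time\<close>

text \<open>By the half-angle formula the quotient is four times the square of sin (\<theta> * y /
  2) / \<theta>, a difference quotient of the sine at 0. It recovers a square from a characteristic
  function.\<close>

lemma versine_quotient_limit:
  fixes y :: real
  shows "(\<lambda>m. 2 * (1 - cos (inverse (real (Suc m)) * y)) / (inverse (real (Suc m)))\<^sup>2) \<longlonglongrightarrow> y\<^sup>2"
proof -
  let ?\<theta> = "\<lambda>m. inverse (real (Suc m))"
  have "((\<lambda>h. sin (h * (y / 2))) has_real_derivative cos (0 * (y / 2)) * (y / 2)) (at 0)"
    by (rule DERIV_fun_sin, rule DERIV_cong[OF DERIV_mult[OF DERIV_ident DERIV_const]]) simp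
  then have "(\<lambda>h. sin (h * (y / 2)) / h) \<midarrow>0\<rightarrow> y / 2" by (simp add: DERIV_def)
  moreover have "filterlim ?\<theta> (at 0) sequentially" by (intro filterlim_atI LIMSEQ_inverse_real_of_nat) simp
  ultimately have "(\<lambda>m. sin (?\<theta> m * (y / 2)) / ?\<theta> m) \<longlonglongrightarrow> y / 2"
    by (rule filterlim_compose)
  then have "(\<lambda>m. 4 * (sin (?\<theta> m * (y / 2)) / ?\<theta> m)\<^sup>2) \<longlonglongrightarrow> 4 * (y / 2)\<^sup>2" by (intro tendsto_mult_left tendsto_power)
  moreover have "4 * (sin (?\<theta> m * (y / 2)) / ?\<theta> m)\<^sup>2 = 2 * (1 - cos (?\<theta> m * y)) / (?\<theta> m)\<^sup>2" for m
    using cos_double_sin[of "?\<theta> m * (y / 2)"] by (simp add: power_divide)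
  ultimately show ?thesis by (simp add: power_divide)
qed

text \<open>An infinite sum of reals over \<open>UNIV\<close> is 0 unless it converges absolutely;
  the explicit form supplies measurability and the link to ordinary series.\<close>

lemma infsum_nat_real: "(\<Sum>\<^sub>\<infinity>n\<in>UNIV. a n) = (if (\<Sum>n. ennreal \<bar>a n\<bar>) < \<infinity> then \<Sum>n. a n else 0)"
  for a :: "nat \<Rightarrow> real"
proof (cases "(\<Sum>n. ennreal \<bar>a n\<bar>) < \<infinity>")
  case True
  then have "summable (\<lambda>n. norm (a n))" by (auto intro!: summable_suminf_not_top simp: less_top)
  then have "infsum a UNIV = (\<Sum>n. a n)" by (metis norm_summable_imp_has_sum infsumI summable_norm_cancel summable_sums)
  with True show ?thesis by simp
next
  case False
  have "\<not> a summable_on UNIV"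
  proof
    assume "a summable_on UNIV"
    then have "(\<lambda>n. norm (a n)) summable_on UNIV" by (rule summable_on_iff_abs_summable_on_real[THEN iffD1])
    then have "summable (\<lambda>n. norm (a n))" by (simp add: summable_on_UNIV_nonneg_real_iff)
    then have "(\<Sum>n. ennreal \<bar>a n\<bar>) < \<infinity>" by (simp add: suminf_ennreal2)
    with False show False by simp
  qed
  with False show ?thesis by (simp add: infsum_not_exists)
qed

lemma borel_measurable_infsum_nat[measurable (raw)]:
  fixes a :: "nat \<Rightarrow> 'a \<Rightarrow> real"
  assumes [measurable]: "\<And>n. a n \<in> borel_measurable N"
  shows "(\<lambda>q. \<Sum>\<^sub>\<infinity>n\<in>UNIV. a n q) \<in> borel_measurable N"
  unfolding infsum_nat_real by measurable

text \<open>Absolute convergence of the products of integrals carries both integrations inside the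
  sum. The times at which the sum diverges, where \<open>infsum\<close> falls back to 0, are null
  sets.\<close>

lemma iterated_integral_infsum:
  fixes F G :: "nat \<Rightarrow> real \<Rightarrow> real"
  assumes F: "\<And>n. integrable lborel (F n)" and G: "\<And>n. integrable lborel (G n)"
    and fin: "(\<Sum>n. (\<integral>\<^sup>+u. ennreal \<bar>F n u\<bar> \<partial>lborel) * (\<integral>\<^sup>+v. ennreal \<bar>G n v\<bar> \<partial>lborel)) < \<infinity>"
  shows "(LBINT u. (LBINT v. (\<Sum>\<^sub>\<infinity>n\<in>UNIV. F n u * G n v))) = (\<Sum>n. (LBINT u. F n u) * (LBINT v. G n v))"
proof -
  have [measurable]: "F n \<in> borel_measurable borel" "G n \<in> borel_measurable borel" for n
    using borel_measurable_integrable[OF F] borel_measurable_integrable[OF G] by auto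
  have Gf: "(\<integral>\<^sup>+v. ennreal \<bar>G n v\<bar> \<partial>lborel) = ennreal (LBINT v. \<bar>G n v\<bar>)" for n
    by (rule nn_integral_eq_integral) (use G in auto)
  have Ff: "(\<integral>\<^sup>+v. ennreal \<bar>F n v\<bar> \<partial>lborel) = ennreal (LBINT v. \<bar>F n v\<bar>)" for n
    by (rule nn_integral_eq_integral) (use F in auto)
  have "(\<integral>\<^sup>+u. (\<Sum>n. ennreal \<bar>F n u\<bar> * (\<integral>\<^sup>+v. ennreal \<bar>G n v\<bar> \<partial>lborel)) \<partial>lborel) \<noteq> \<infinity>"
    using fin by (simp add: nn_integral_suminf nn_integral_multc)
  then have "AE u in lborel. (\<Sum>n. ennreal \<bar>F n u\<bar> * (\<integral>\<^sup>+v. ennreal \<bar>G n v\<bar> \<partial>lborel)) \<noteq> \<infinity>" by (intro nn_integral_PInf_AE) measurable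
  then have ae: "AE u in lborel. (\<Sum>n. ennreal \<bar>F n u\<bar> * (\<integral>\<^sup>+v. ennreal \<bar>G n v\<bar> \<partial>lborel)) < \<infinity>" by (simp add: less_top)
  have inner: "(LBINT v. (\<Sum>\<^sub>\<infinity>n\<in>UNIV. F n u * G n v)) = (\<Sum>n. F n u * (LBINT v. G n v))"
    and sm: "summable (\<lambda>n. norm (F n u * (LBINT v. G n v)))"
    if u: "(\<Sum>n. ennreal \<bar>F n u\<bar> * (\<integral>\<^sup>+v. ennreal \<bar>G n v\<bar> \<partial>lborel)) < \<infinity>" for u
  proof -
    have "(\<integral>\<^sup>+v. (\<Sum>n. ennreal \<bar>F n u * G n v\<bar>) \<partial>lborel) \<noteq> \<infinity>"
      using u by (simp add: nn_integral_suminf nn_integral_cmult abs_mult ennreal_mult)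
    then have "AE v in lborel. (\<Sum>n. ennreal \<bar>F n u * G n v\<bar>) \<noteq> \<infinity>" by (intro nn_integral_PInf_AE) measurable
    then have av: "AE v in lborel. (\<Sum>n. ennreal \<bar>F n u * G n v\<bar>) < \<infinity>" by (simp add: less_top)
    have s1: "summable (\<lambda>n. \<bar>F n u\<bar> * (LBINT v. \<bar>G n v\<bar>))"
      by (rule summable_suminf_not_top) (use u in \<open>auto simp: Gf ennreal_mult\<close>)
    have "(LBINT v. (\<Sum>\<^sub>\<infinity>n\<in>UNIV. F n u * G n v)) = (LBINT v. (\<Sum>n. F n u * G n v))"
      by (rule integral_cong_AE) (use av in \<open>auto simp: infsum_nat_real elim!: eventually_mono\<close>)
    also have "\<dots> = (\<Sum>n. (LBINT v. F n u * G n v))"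
    proof (rule integral_suminf)
      show "AE v in lborel. summable (\<lambda>n. norm (F n u * G n v))"
        using av by (rule eventually_mono) (auto intro!: summable_suminf_not_top simp: less_top)
      show "summable (\<lambda>n. (LBINT v. norm (F n u * G n v)))" using s1 by (simp add: abs_mult)
    qed (use G in auto)
    finally show "(LBINT v. (\<Sum>\<^sub>\<infinity>n\<in>UNIV. F n u * G n v)) = (\<Sum>n. F n u * (LBINT v. G n v))" by simp
    show "summable (\<lambda>n. norm (F n u * (LBINT v. G n v)))"
      by (rule summable_comparison_test'[OF s1, of 0]) (auto simp: abs_mult intro!: mult_left_mono integral_abs_bound)
  qed
  have "(LBINT u. (LBINT v. (\<Sum>\<^sub>\<infinity>n\<in>UNIV. F n u * G n v))) = (LBINT u. (\<Sum>n. F n u * (LBINT v. G n v)))"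
    by (rule integral_cong_AE) (use ae inner in \<open>auto elim!: eventually_mono\<close>)
  also have "\<dots> = (\<Sum>n. (LBINT u. F n u * (LBINT v. G n v)))"
  proof (rule integral_suminf)
    show "AE u in lborel. summable (\<lambda>n. norm (F n u * (LBINT v. G n v)))" using ae sm by (auto elim!: eventually_mono)
    have s2: "summable (\<lambda>n. (LBINT u. \<bar>F n u\<bar>) * (LBINT v. \<bar>G n v\<bar>))"
      by (rule summable_suminf_not_top) (use fin in \<open>auto simp: Gf Ff ennreal_mult\<close>)
    show "summable (\<lambda>n. (LBINT u. norm (F n u * (LBINT v. G n v))))"
      by (rule summable_comparison_test'[OF s2, of 0]) (auto simp: abs_mult intro!: mult_left_mono integral_abs_bound)
  qed (use F in auto)
  finally show ?thesis by simp
qed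

lemma occ_continuous:
  assumes m: "path_field \<phi> Y p \<in> borel_measurable borel" and fin: "abs_occ \<phi> Y p 0 R < \<infinity>"
  shows "integrable lborel (\<lambda>u. path_field \<phi> Y p u * indicator {0..R} u)" "continuous_on {0..R} (occ \<phi> Y p)"
proof -
  show i: "integrable lborel (\<lambda>u. path_field \<phi> Y p u * indicator {0..R} u)"
    using m fin by (intro integrableI_bounded) (auto simp: abs_occ_def)
  then have si: "set_integrable lborel {0..R} (path_field \<phi> Y p)" by (simp add: set_integrable_def mult.commute)
  have "occ \<phi> Y p s = integral {0..s} (path_field \<phi> Y p)" if "s \<in> {0..R}" for s
  proof -
    have "set_integrable lborel {0..s} (path_field \<phi> Y p)" by (rule set_integrable_subset[OF si]) (use that in auto)
    from set_borel_integral_eq_integral(2)[OF this] show ?thesis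
      by (simp add: occ_def set_lebesgue_integral_def mult.commute)
  qed
  moreover have "continuous_on {0..R} (\<lambda>s. integral {0..s} (path_field \<phi> Y p))"
    by (rule indefinite_integral_continuous_1) (rule set_borel_integral_eq_integral(1)[OF si])
  ultimately show "continuous_on {0..R} (occ \<phi> Y p)" by (metis (mono_tags, lifting) continuous_on_cong)
qed

lemma occ_0: "occ \<phi> Y p 0 = 0"
proof -
  have "occ \<phi> Y p 0 = (LINT u|(lborel :: real measure). 0)"
    unfolding occ_def
  proof (rule integral_cong_AE)
    show ae: "AE u in lborel. path_field \<phi> Y p u * indicator {0..0} u = 0"
      using AE_lborel_singleton[of "0::real"] by eventually_elim auto
    \<comment> \<open>No measurability of the path is assumed here; only its value at time 0
      enters.\<close>
    have "(\<lambda>u. path_field \<phi> Y p u * indicator {0..0} u) = (\<lambda>u. path_field \<phi> Y p 0 * indicator {0} u)"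
      by (auto simp: indicator_def)
    then show "(\<lambda>u. path_field \<phi> Y p u * indicator {0..0} u) \<in> borel_measurable lborel" by simp
  qed simp
  then show ?thesis by simp
qed

context particle_system
begin

context
  fixes k :: nat and c s t :: "nat \<Rightarrow> real" and R :: real
  assumes R: "0 \<le> R" and st: "\<And>j. j < k \<Longrightarrow> 0 \<le> s j \<and> s j \<le> R \<and> 0 \<le> t j \<and> t j \<le> R"
begin

lemma comb_var_nonneg: "0 \<le> comb_var k c s t"
proof -
  have "AE z in lborel. 0 \<le> comb_sq k c s t z" by (rule comb_sq_nonneg[OF R], rule st)
  moreover have "(LBINT z. comb_sq k c s t z) = comb_var k c s t" by (rule comb_sq_integrable(2)[OF R], rule st)
  ultimately show ?thesis by (metis integral_nonneg_AE)
qed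

text \<open>Extracted from \<open>comb_sum_char_bound\<close> with coefficients \<theta> * c. The
  quotient 2 * (1 - cos (\<theta> * X)) / \<theta>^2 tends to the square of X, its expectation is at
  most the variance plus an error of order \<theta>, and Fatou's lemma gives the one-sided bound
  that tightness needs.\<close>

lemma comb_sum_variance:
  "(\<integral>\<^sup>+w. ennreal ((comb_sum k c s t w - expectation (comb_sum k c s t))\<^sup>2) \<partial>M) \<le> ennreal (comb_var k c s t)"
proof -
  let ?\<theta> = "\<lambda>m. inverse (real (Suc m))"
  define X where "X w = comb_sum k c s t w - expectation (comb_sum k c s t)" for w
  define V where "V = comb_var k c s t"
  define K where "K = (\<Sum>j<k. \<bar>c j\<bar>) ^ 3 * (third1 R * third2 R) / 2"
  have V0: "0 \<le> V" unfolding V_def by (rule comb_var_nonneg)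
  have mean: "integrable M (comb_sum k c s t)" "expectation (comb_sum k c s t) = (LBINT z. comb_mean k c s t z)" for c
    by ((rule comb_sum_mean(1)[OF R], erule st), (rule comb_sum_mean(2)[OF R], erule st))
  have char_bound: "norm (expectation (\<lambda>w. iexp (comb_sum k c s t w - expectation (comb_sum k c s t))) - of_real (exp (- comb_var k c s t / 2)))
     \<le> (\<Sum>j<k. \<bar>c j\<bar>) ^ 3 * (third1 R * third2 R) / 2" for c
    by (rule comb_sum_char_bound[OF R], rule st)
  have [measurable]: "X \<in> borel_measurable M" unfolding X_def[abs_def]
    using borel_measurable_integrable[OF mean(1)[of c]] by measurable
  have bound: "(\<integral>\<^sup>+w. ennreal (2 * (1 - cos (?\<theta> m * X w)) / (?\<theta> m)\<^sup>2) \<partial>M) \<le> ennreal (V + 2 * ?\<theta> m * K)" for m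
  proof -
    define \<theta> where "\<theta> = ?\<theta> m"
    have \<theta>: "0 < \<theta>" unfolding \<theta>_def by simp
    have 1: "pair_comb k (\<lambda>j. \<theta> * c j) s t n z w = \<theta> * pair_comb k c s t n z w" for n z w
      by (simp add: pair_comb_def sum_distrib_left mult.assoc)
    have 2: "comb_mean k (\<lambda>j. \<theta> * c j) s t z = \<theta> * comb_mean k c s t z" for z
      by (simp add: comb_mean_def sum_distrib_left mult.assoc)
    have 3: "comb_var k (\<lambda>j. \<theta> * c j) s t = \<theta>\<^sup>2 * V"
      by (simp add: V_def comb_var_def sum_distrib_left power2_eq_square mult_ac)
    have 4: "(\<Sum>j<k. \<bar>\<theta> * c j\<bar>) = \<theta> * (\<Sum>j<k. \<bar>c j\<bar>)" using \<theta> by (simp add: abs_mult sum_distrib_left)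
    have E: "expectation (comb_sum k (\<lambda>j. \<theta> * c j) s t) = \<theta> * expectation (comb_sum k c s t)"
      using mean(2)[of c] mean(2)[of "\<lambda>j. \<theta> * c j"] by (simp add: 2)
    have ae: "AE w in M. comb_sum k (\<lambda>j. \<theta> * c j) s t w - expectation (comb_sum k (\<lambda>j. \<theta> * c j) s t) = \<theta> * X w"
    proof -
      have "AE w in M. summable (\<lambda>n. \<bar>pair_comb k c s t n (x n w) w\<bar>)" by (rule terms_summable[OF R], rule st)
      then show ?thesis
    proof eventually_elim
      case (elim w)
      then have "summable (\<lambda>n. pair_comb k c s t n (x n w) w)" by (rule summable_rabs_cancel)
      then show ?case unfolding E X_def comb_sum_def 1 by (subst suminf_mult) (auto simp: right_diff_distrib)
    qed
    qed
    have cm: "comb_sum k (\<lambda>j. \<theta> * c j) s t \<in> borel_measurable M"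
      using borel_measurable_integrable[OF mean(1)[of "\<lambda>j. \<theta> * c j"]] .
    have "expectation (\<lambda>w. iexp (comb_sum k (\<lambda>j. \<theta> * c j) s t w - expectation (comb_sum k (\<lambda>j. \<theta> * c j) s t))) = expectation (\<lambda>w. iexp (\<theta> * X w))"
    proof (rule integral_cong_AE)
      show "AE w in M. iexp (comb_sum k (\<lambda>j. \<theta> * c j) s t w - expectation (comb_sum k (\<lambda>j. \<theta> * c j) s t)) = iexp (\<theta> * X w)"
        using ae by eventually_elim simp
    qed (use cm in measurable)
    then have "norm (expectation (\<lambda>w. iexp (\<theta> * X w)) - of_real (exp (- (\<theta>\<^sup>2 * V) / 2))) \<le> \<theta> ^ 3 * K"
      using char_bound[of "\<lambda>j. \<theta> * c j"] unfolding 3 4 K_def power_mult_distrib mult.assoc times_divide_eq_right by simp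
    moreover have "\<bar>Re (expectation (\<lambda>w. iexp (\<theta> * X w)) - of_real (exp (- (\<theta>\<^sup>2 * V) / 2)))\<bar> \<le> norm (expectation (\<lambda>w. iexp (\<theta> * X w)) - of_real (exp (- (\<theta>\<^sup>2 * V) / 2)))"
      by (rule abs_Re_le_cmod)
    moreover have "Re (expectation (\<lambda>w. iexp (\<theta> * X w))) = expectation (\<lambda>w. cos (\<theta> * X w))"
    proof -
      have "complex_integrable M (\<lambda>w. iexp (\<theta> * X w))" by (rule integrable_const_bound[where B=1]) auto
      from integral_Re[OF this] show ?thesis by (simp add: Re_exp)
    qed
    ultimately have "\<bar>expectation (\<lambda>w. cos (\<theta> * X w)) - exp (- (\<theta>\<^sup>2 * V) / 2)\<bar> \<le> \<theta> ^ 3 * K" by simp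
    moreover have "1 - \<theta>\<^sup>2 * V / 2 \<le> exp (- (\<theta>\<^sup>2 * V) / 2)" using exp_ge_add_one_self[of "- (\<theta>\<^sup>2 * V) / 2"] by simp
    ultimately have le: "1 - expectation (\<lambda>w. cos (\<theta> * X w)) \<le> \<theta>\<^sup>2 * V / 2 + \<theta> ^ 3 * K" by linarith
    have ic: "integrable M (\<lambda>w. cos (\<theta> * X w))" by (rule integrable_const_bound[where B=1]) auto
    then have i: "integrable M (\<lambda>w. 2 * (1 - cos (\<theta> * X w)) / \<theta>\<^sup>2)" by simp
    have "(\<integral>\<^sup>+w. ennreal (2 * (1 - cos (\<theta> * X w)) / \<theta>\<^sup>2) \<partial>M) = ennreal (LINT w|M. 2 * (1 - cos (\<theta> * X w)) / \<theta>\<^sup>2)"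
      by (rule nn_integral_eq_integral[OF i]) auto
    also have "(LINT w|M. 2 * (1 - cos (\<theta> * X w)) / \<theta>\<^sup>2) = 2 * (1 - expectation (\<lambda>w. cos (\<theta> * X w))) / \<theta>\<^sup>2"
      using ic by (simp add: prob_space)
    also have "ennreal \<dots> \<le> ennreal (V + 2 * \<theta> * K)"
    proof (rule ennreal_leI)
      have "2 * (1 - expectation (\<lambda>w. cos (\<theta> * X w))) / \<theta>\<^sup>2 \<le> 2 * (\<theta>\<^sup>2 * V / 2 + \<theta> ^ 3 * K) / \<theta>\<^sup>2"
        using le by (intro divide_right_mono mult_left_mono) auto
      also have "\<dots> = V + 2 * \<theta> * K" using \<theta> by (simp add: field_simps power2_eq_square power3_eq_cube)
      finally show "2 * (1 - expectation (\<lambda>w. cos (\<theta> * X w))) / \<theta>\<^sup>2 \<le> V + 2 * \<theta> * K" .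
    qed
    finally show ?thesis unfolding \<theta>_def .
  qed
  have "(\<integral>\<^sup>+w. ennreal ((X w)\<^sup>2) \<partial>M) = (\<integral>\<^sup>+w. liminf (\<lambda>m. ennreal (2 * (1 - cos (?\<theta> m * X w)) / (?\<theta> m)\<^sup>2)) \<partial>M)"
  proof (rule nn_integral_cong)
    fix w
    have "(\<lambda>m. ennreal (2 * (1 - cos (?\<theta> m * X w)) / (?\<theta> m)\<^sup>2)) \<longlonglongrightarrow> ennreal ((X w)\<^sup>2)"
      by (intro tendsto_ennrealI versine_quotient_limit)
    from lim_imp_Liminf[OF _ this] show "ennreal ((X w)\<^sup>2) = liminf (\<lambda>m. ennreal (2 * (1 - cos (?\<theta> m * X w)) / (?\<theta> m)\<^sup>2))" by simp
  qed
  also have "\<dots> \<le> liminf (\<lambda>m. \<integral>\<^sup>+w. ennreal (2 * (1 - cos (?\<theta> m * X w)) / (?\<theta> m)\<^sup>2) \<partial>M)"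
    by (rule nn_integral_liminf) measurable
  also have "\<dots> \<le> liminf (\<lambda>m. ennreal (V + 2 * ?\<theta> m * K))"
    by (rule Liminf_mono) (use bound in simp)
  also have "\<dots> = ennreal V"
  proof -
    have "(\<lambda>m. V + 2 * ?\<theta> m * K) \<longlonglongrightarrow> V + 2 * 0 * K"
      by (intro tendsto_intros LIMSEQ_inverse_real_of_nat)
    then have "(\<lambda>m. ennreal (V + 2 * ?\<theta> m * K)) \<longlonglongrightarrow> ennreal V" by (intro tendsto_ennrealI) simp
    from lim_imp_Liminf[OF _ this] show ?thesis by simp
  qed
  finally show ?thesis unfolding X_def V_def .
qed

end

section \<open>The occupation time as an almost surely convergent series\<close>

definition field :: "real \<Rightarrow> real \<Rightarrow> 'w \<Rightarrow> real" where
  "field s t w = (\<Sum>n. occ \<phi> (Y1 n) (fst (x n w), w) s * occ \<psi> (Y2 n) (snd (x n w), w) t)"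

text \<open>Integer horizons keep the conditions countable, hence the set measurable. Finiteness of
  both factors is listed separately because in \<open>ennreal\<close> a vanishing factor hides an
  infinite one in \<open>pair_bar\<close>.\<close>

definition good_paths :: "'w set" where
  "good_paths = {w \<in> space M. \<forall>N::nat. (\<Sum>n. pair_bar n (real N) (x n w) w) < \<infinity> \<and>
     (\<forall>n. abs_occ \<phi> (Y1 n) (fst (x n w), w) 0 (real N) < \<infinity> \<and> abs_occ \<psi> (Y2 n) (snd (x n w), w) 0 (real N) < \<infinity>)}"

lemma start_measurable: "(\<lambda>w. (fst (x n w), w)) \<in> M \<rightarrow>\<^sub>M borel \<Otimes>\<^sub>M M" "(\<lambda>w. (snd (x n w), w)) \<in> M \<rightarrow>\<^sub>M borel \<Otimes>\<^sub>M M"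
proof -
  have "(\<lambda>w. (x n w, w)) \<in> M \<rightarrow>\<^sub>M borel \<Otimes>\<^sub>M M" using points.x_measurable[of n] by (intro measurable_Pair) auto
  from measurable_compose[OF this fst_sub] measurable_compose[OF this snd_sub]
  show "(\<lambda>w. (fst (x n w), w)) \<in> M \<rightarrow>\<^sub>M borel \<Otimes>\<^sub>M M" "(\<lambda>w. (snd (x n w), w)) \<in> M \<rightarrow>\<^sub>M borel \<Otimes>\<^sub>M M" by simp_all
qed

lemma start_occ_measurable[measurable]:
  "(\<lambda>w. occ \<phi> (Y1 n) (fst (x n w), w) s) \<in> borel_measurable M" "(\<lambda>w. occ \<psi> (Y2 n) (snd (x n w), w) s) \<in> borel_measurable M"
  "(\<lambda>w. abs_occ \<phi> (Y1 n) (fst (x n w), w) l r) \<in> borel_measurable M" "(\<lambda>w. abs_occ \<psi> (Y2 n) (snd (x n w), w) l r) \<in> borel_measurable M"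
  by (rule measurable_compose[OF start_measurable(1)] measurable_compose[OF start_measurable(2)],
      rule occ_measurable; simp add: m1.Y_measurable m2.Y_measurable m1.Y_cadlag m2.Y_cadlag m1.\<phi>_measurable m2.\<phi>_measurable)+

lemma field_measurable[measurable]: "field s t \<in> borel_measurable M"
  unfolding field_def[abs_def] by measurable

lemma good_paths_sets[measurable]: "good_paths \<in> sets M"
  unfolding good_paths_def pair_bar_def by measurable

lemma good_paths_AE: "AE w in M. w \<in> good_paths"
proof -
  have f: "AE w in M. abs_occ \<phi> (Y1 n) (fst (x n w), w) 0 (real N) < \<infinity> \<and> abs_occ \<psi> (Y2 n) (snd (x n w), w) 0 (real N) < \<infinity>" for n and N :: nat
  proof -
    \<comment> \<open>The indicator of an infinite value turns the almost sure claim into a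
      vanishing integral, to which decoupling from the start applies.\<close>
    let ?f = "\<lambda>q :: (real \<times> real) \<times> 'w. (indicator {\<infinity>} (abs_occ \<phi> (Y1 n) (fst (fst q), snd q) 0 (real N)) + indicator {\<infinity>} (abs_occ \<psi> (Y2 n) (snd (fst q), snd q) 0 (real N))) :: ennreal"
    have [measurable]: "(\<lambda>q. abs_occ \<phi> (Y1 n) (fst (fst q), snd q) 0 (real N)) \<in> borel_measurable ((borel :: (real \<times> real) measure) \<Otimes>\<^sub>M sub_alg (motions n))"
      "(\<lambda>q. abs_occ \<psi> (Y2 n) (snd (fst q), snd q) 0 (real N)) \<in> borel_measurable ((borel :: (real \<times> real) measure) \<Otimes>\<^sub>M sub_alg (motions n))"
      by (rule measurable_compose[OF fst_sub occ_sub_alg(3)] measurable_compose[OF snd_sub occ_sub_alg(4)]; simp)+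
    have fm: "?f \<in> borel_measurable (borel \<Otimes>\<^sub>M sub_alg (motions n))" by measurable
    have "(\<integral>\<^sup>+w. ?f (x n w, w) \<partial>M) = (\<integral>\<^sup>+w. \<integral>\<^sup>+w'. ?f (x n w, w') \<partial>M \<partial>M)" by (rule decouple_start_nn[OF fm])
    also have "\<dots> = (\<integral>\<^sup>+w. 0 \<partial>M)"
    proof (rule nn_integral_cong_AE)
      have "AE w in M. good (real N) (x n w)" by (rule points.campbell_AE[OF good_AE]) simp
      then show "AE w in M. (\<integral>\<^sup>+w'. ?f (x n w, w') \<partial>M) = 0"
      proof eventually_elim
        case (elim w)
        have "AE w' in M. abs_occ \<phi> (Y1 n) (fst (x n w), w') 0 (real N) ^ 3 \<noteq> \<infinity>"
          by (rule nn_integral_PInf_AE)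
             (use elim means_indep_of_particle(1)[of n] m1.section_measurable in \<open>auto simp: good_def m1.abs_mean3_def[symmetric]\<close>)
        moreover have "AE w' in M. abs_occ \<psi> (Y2 n) (snd (x n w), w') 0 (real N) ^ 3 \<noteq> \<infinity>"
          by (rule nn_integral_PInf_AE)
             (use elim means_indep_of_particle(2)[of n] m2.section_measurable in \<open>auto simp: good_def m2.abs_mean3_def[symmetric]\<close>)
        ultimately have "AE w' in M. ?f (x n w, w') = 0" by eventually_elim (auto simp: indicator_def)
        then have "(\<integral>\<^sup>+w'. ?f (x n w, w') \<partial>M) = (\<integral>\<^sup>+w'. 0 \<partial>M)" by (rule nn_integral_cong_AE)
        then show ?case by simp
      qed
    qed
    finally have "(\<integral>\<^sup>+w. ?f (x n w, w) \<partial>M) = 0" by simp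
    moreover have "(\<lambda>w. ?f (x n w, w)) \<in> borel_measurable M"
      by (rule measurable_compose[OF _ fm]) (use points.x_measurable[of n] in \<open>auto intro!: measurable_Pair id_measurable\<close>)
    ultimately have "AE w in M. ?f (x n w, w) = 0" by (simp add: nn_integral_0_iff_AE)
    then show ?thesis by eventually_elim (auto simp: indicator_def less_top split: if_splits)
  qed
  have "AE w in M. \<forall>N::nat. (\<Sum>n. pair_bar n (real N) (x n w) w) < \<infinity>"
    unfolding AE_all_countable by (intro allI pair_bar_sum_finite) simp
  moreover have "AE w in M. \<forall>N::nat. \<forall>n. abs_occ \<phi> (Y1 n) (fst (x n w), w) 0 (real N) < \<infinity> \<and> abs_occ \<psi> (Y2 n) (snd (x n w), w) 0 (real N) < \<infinity>"
    unfolding AE_all_countable using f by blast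
  ultimately show ?thesis by (rule AE_mp[OF AE_space AE_mp[OF _ AE_mp]]) (auto simp: good_paths_def)
qed

context
  fixes w assumes w: "w \<in> good_paths"
begin

lemma good_path_finite:
  "(\<Sum>n. pair_bar n R (x n w) w) < \<infinity>" "abs_occ \<phi> (Y1 n) (fst (x n w), w) 0 R < \<infinity>" "abs_occ \<psi> (Y2 n) (snd (x n w), w) 0 R < \<infinity>"
proof -
  obtain N :: nat where N: "R \<le> real N" using real_arch_simple by blast
  have le: "abs_occ \<phi> (Y1 n) (fst (x n w), w) 0 R \<le> abs_occ \<phi> (Y1 n) (fst (x n w), w) 0 N"
    "abs_occ \<psi> (Y2 n) (snd (x n w), w) 0 R \<le> abs_occ \<psi> (Y2 n) (snd (x n w), w) 0 N" for n
    using N by (auto intro: abs_occ_mono)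
  then have "pair_bar n R (x n w) w \<le> pair_bar n N (x n w) w" for n unfolding pair_bar_def by (intro mult_mono) auto
  then have "(\<Sum>n. pair_bar n R (x n w) w) \<le> (\<Sum>n. pair_bar n N (x n w) w)" by (intro suminf_le) auto
  then show "(\<Sum>n. pair_bar n R (x n w) w) < \<infinity>" "abs_occ \<phi> (Y1 n) (fst (x n w), w) 0 R < \<infinity>" "abs_occ \<psi> (Y2 n) (snd (x n w), w) 0 R < \<infinity>"
    using w le[of n] by (auto simp: good_paths_def intro: le_less_trans)
qed

lemma good_path_space: "w \<in> space M" using w by (simp add: good_paths_def)

lemma abs_term_le:
  assumes "0 \<le> s" "s \<le> R" "0 \<le> t" "t \<le> R"
  shows "\<bar>occ \<phi> (Y1 n) (fst (x n w), w) s * occ \<psi> (Y2 n) (snd (x n w), w) t\<bar> \<le> enn2real (pair_bar n R (x n w) w)"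
proof -
  have "ennreal \<bar>occ \<phi> (Y1 n) (fst (x n w), w) s\<bar> \<le> abs_occ \<phi> (Y1 n) (fst (x n w), w) 0 R"
    "ennreal \<bar>occ \<psi> (Y2 n) (snd (x n w), w) t\<bar> \<le> abs_occ \<psi> (Y2 n) (snd (x n w), w) 0 R"
    using assms by (blast intro: order_trans[OF abs_occ_le abs_occ_mono] order_refl)+
  then have "ennreal \<bar>occ \<phi> (Y1 n) (fst (x n w), w) s * occ \<psi> (Y2 n) (snd (x n w), w) t\<bar> \<le> pair_bar n R (x n w) w"
    unfolding pair_bar_def abs_mult by (subst ennreal_mult) (auto intro: mult_mono)
  moreover have "pair_bar n R (x n w) w < \<infinity>" using good_path_finite(2,3)[of n R] by (simp add: pair_bar_def ennreal_mult_less_top)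
  ultimately show ?thesis by (metis abs_ge_zero enn2real_ennreal enn2real_mono infinity_ennreal_def)
qed

lemma pair_bar_summable: "summable (\<lambda>n. enn2real (pair_bar n R (x n w) w))"
proof (rule summable_suminf_not_top)
  have "pair_bar n R (x n w) w < \<infinity>" for n using good_path_finite(2,3)[of n R] by (simp add: pair_bar_def ennreal_mult_less_top)
  then show "(\<Sum>n. ennreal (enn2real (pair_bar n R (x n w) w))) \<noteq> \<top>" using good_path_finite(1)[of R] by (simp add: less_top)
qed simp

lemma good_term_summable:
  assumes "0 \<le> s" "0 \<le> t"
  shows "summable (\<lambda>n. occ \<phi> (Y1 n) (fst (x n w), w) s * occ \<psi> (Y2 n) (snd (x n w), w) t)"
  by (rule summable_comparison_test'[OF pair_bar_summable[of "max s t"], of 0])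
     (use assms in \<open>auto intro!: abs_term_le simp del: abs_mult\<close>)

lemma comb_sum_field:
  assumes "\<And>j. j < k \<Longrightarrow> 0 \<le> s j \<and> 0 \<le> t j"
  shows "comb_sum k c s t w = (\<Sum>j<k. c j * field (s j) (t j) w)"
proof -
  have "comb_sum k c s t w = (\<Sum>j<k. \<Sum>n. c j * (occ \<phi> (Y1 n) (fst (x n w), w) (s j) * occ \<psi> (Y2 n) (snd (x n w), w) (t j)))"
    unfolding comb_sum_def pair_comb_def by (rule suminf_sum) (use assms in \<open>auto intro!: summable_mult good_term_summable\<close>)
  also have "\<dots> = (\<Sum>j<k. c j * field (s j) (t j) w)"
    unfolding field_def by (intro sum.cong refl suminf_mult) (use assms in \<open>auto intro!: good_term_summable\<close>)
  finally show ?thesis .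
qed

lemma field_bound: "0 \<le> s \<Longrightarrow> s \<le> R \<Longrightarrow> 0 \<le> t \<Longrightarrow> t \<le> R \<Longrightarrow> ennreal \<bar>field s t w\<bar> \<le> (\<Sum>n. pair_bar n R (x n w) w)"
proof -
  assume st: "0 \<le> s" "s \<le> R" "0 \<le> t" "t \<le> R"
  have sm: "summable (\<lambda>n. \<bar>occ \<phi> (Y1 n) (fst (x n w), w) s * occ \<psi> (Y2 n) (snd (x n w), w) t\<bar>)"
    by (rule summable_comparison_test'[OF pair_bar_summable[of R], of 0]) (use st abs_term_le in simp)
  have "\<bar>field s t w\<bar> \<le> (\<Sum>n. \<bar>occ \<phi> (Y1 n) (fst (x n w), w) s * occ \<psi> (Y2 n) (snd (x n w), w) t\<bar>)"
    unfolding field_def by (rule summable_rabs[OF sm])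
  also have "\<dots> \<le> (\<Sum>n. enn2real (pair_bar n R (x n w) w))"
    by (rule suminf_le[OF _ sm pair_bar_summable]) (rule abs_term_le[OF st])
  finally have "ennreal \<bar>field s t w\<bar> \<le> ennreal (\<Sum>n. enn2real (pair_bar n R (x n w) w))" by (rule ennreal_leI)
  also have "\<dots> = (\<Sum>n. ennreal (enn2real (pair_bar n R (x n w) w)))" by (rule suminf_ennreal2[symmetric]) (auto intro: pair_bar_summable)
  also have "\<dots> = (\<Sum>n. pair_bar n R (x n w) w)"
    using good_path_finite(2,3)[of _ R] by (intro suminf_cong) (simp add: pair_bar_def ennreal_mult_less_top)
  finally show ?thesis .
qed

lemma good_occ_continuous:
  "continuous_on {0..R} (occ \<phi> (Y1 n) (fst (x n w), w))" "continuous_on {0..R} (occ \<psi> (Y2 n) (snd (x n w), w))"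
  "integrable lborel (\<lambda>u. path_field \<phi> (Y1 n) (fst (x n w), w) u * indicator {0..R} u)"
  "integrable lborel (\<lambda>u. path_field \<psi> (Y2 n) (snd (x n w), w) u * indicator {0..R} u)"
  using occ_continuous[OF m1.field_measurable_u[OF good_path_space] good_path_finite(2)]
    occ_continuous[OF m2.field_measurable_u[OF good_path_space] good_path_finite(3)] by auto

text \<open>Weierstrass's criterion: the majorants \<open>pair_bar\<close> are summable and do not
  depend on the times up to \<open>R\<close>.\<close>

lemma field_continuous: "continuous_on ({0..R} \<times> {0..R}) (\<lambda>p. field (fst p) (snd p) w)"
proof -
  have u: "uniform_limit ({0..R} \<times> {0..R}) (\<lambda>n p. \<Sum>i<n. occ \<phi> (Y1 i) (fst (x i w), w) (fst p) * occ \<psi> (Y2 i) (snd (x i w), w) (snd p)) (\<lambda>p. field (fst p) (snd p) w) sequentially"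
    unfolding field_def by (rule Weierstrass_m_test[OF _ pair_bar_summable[of R]]) (auto intro!: abs_term_le simp del: abs_mult)
  have c: "continuous_on ({0..R} \<times> {0..R}) (\<lambda>p. \<Sum>i<n. occ \<phi> (Y1 i) (fst (x i w), w) (fst p) * occ \<psi> (Y2 i) (snd (x i w), w) (snd p))" for n
    by (intro continuous_on_sum continuous_on_mult continuous_on_compose2[OF good_occ_continuous(1)[of R]] continuous_on_compose2[OF good_occ_continuous(2)[of R]] continuous_on_fst continuous_on_snd continuous_on_id) auto
  show ?thesis by (rule uniform_limit_theorem[OF _ u]) (use c in auto)
qed

end

lemma occupation_time_path_field:
  "occupation_time x Y1 Y2 \<phi> \<psi> s t w = (LBINT u. (LBINT v. (\<Sum>\<^sub>\<infinity>n\<in>UNIV. (path_field \<phi> (Y1 n) (fst (x n w), w) u * indicator {0..s} u) * (path_field \<psi> (Y2 n) (snd (x n w), w) v * indicator {0..t} v))))"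
proof -
  have "(indicator {0..t} v *\<^sub>R N_pairing x Y1 Y2 \<phi> \<psi> u v w) * indicator {0..s} u = (\<Sum>\<^sub>\<infinity>n\<in>UNIV. (path_field \<phi> (Y1 n) (fst (x n w), w) u * indicator {0..s} u) * (path_field \<psi> (Y2 n) (snd (x n w), w) v * indicator {0..t} v))" for u v :: real
    unfolding N_pairing_def path_field_def by (auto simp: indicator_def)
  then have "indicator {0..s} u * (LBINT v. indicator {0..t} v *\<^sub>R N_pairing x Y1 Y2 \<phi> \<psi> u v w) = (LBINT v. (\<Sum>\<^sub>\<infinity>n\<in>UNIV. (path_field \<phi> (Y1 n) (fst (x n w), w) u * indicator {0..s} u) * (path_field \<psi> (Y2 n) (snd (x n w), w) v * indicator {0..t} v)))" for u :: real
    by (subst mult.commute) (simp only: flip: integral_mult_left_zero)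
  then show ?thesis unfolding occupation_time_def set_lebesgue_integral_def by simp
qed

lemma occupation_time_field:
  assumes w: "w \<in> good_paths" and "0 \<le> s" "0 \<le> t"
  shows "occupation_time x Y1 Y2 \<phi> \<psi> s t w = field s t w"
  unfolding occupation_time_path_field field_def
proof (subst iterated_integral_infsum)
  let ?R = "max s t"
  have "(\<Sum>n. abs_occ \<phi> (Y1 n) (fst (x n w), w) 0 s * abs_occ \<psi> (Y2 n) (snd (x n w), w) 0 t) \<le> (\<Sum>n. pair_bar n ?R (x n w) w)"
    unfolding pair_bar_def by (intro suminf_le mult_mono abs_occ_mono) auto
  also have "\<dots> < \<infinity>" by (rule good_path_finite(1)[OF w])
  finally show "(\<Sum>n. (\<integral>\<^sup>+u. ennreal \<bar>path_field \<phi> (Y1 n) (fst (x n w), w) u * indicator {0..s} u\<bar> \<partial>lborel) * (\<integral>\<^sup>+v. ennreal \<bar>path_field \<psi> (Y2 n) (snd (x n w), w) v * indicator {0..t} v\<bar> \<partial>lborel)) < \<infinity>"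
    unfolding abs_occ_def .
qed (use good_occ_continuous(3,4)[OF w] in \<open>auto simp: occ_def\<close>)

text \<open>The occupation time is defined on the whole sample space, not only on
  \<open>good_paths\<close>; its measurability is needed to transfer the almost sure identity with
  \<open>field\<close> to expectations.\<close>

lemma occupation_time_measurable: "occupation_time x Y1 Y2 \<phi> \<psi> s t \<in> borel_measurable M"
proof -
  have "(\<lambda>q. (\<lambda>p. path_field \<phi> (Y1 n) (fst p) (snd p)) ((fst (x n (fst (fst q))), fst (fst q)), snd (fst q))) \<in> borel_measurable ((M \<Otimes>\<^sub>M lborel) \<Otimes>\<^sub>M (lborel :: real measure))" for n
  proof (rule measurable_compose[OF _ path_field_measurable[where N=M]])
    have a: "(\<lambda>q. (fst (x n (fst (fst q))), fst (fst q))) \<in> (M \<Otimes>\<^sub>M (lborel :: real measure)) \<Otimes>\<^sub>M (lborel :: real measure) \<rightarrow>\<^sub>M borel \<Otimes>\<^sub>M M"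
      by (rule measurable_compose[OF _ start_measurable(1)]) measurable
    show "(\<lambda>q. ((fst (x n (fst (fst q))), fst (fst q)), snd (fst q))) \<in> (M \<Otimes>\<^sub>M (lborel :: real measure)) \<Otimes>\<^sub>M (lborel :: real measure) \<rightarrow>\<^sub>M (borel \<Otimes>\<^sub>M M) \<Otimes>\<^sub>M borel"
      by (rule measurable_Pair[OF a]) simp
  qed (simp_all add: m1.Y_measurable m1.Y_cadlag m1.\<phi>_measurable)
  then have f1: "(\<lambda>q. path_field \<phi> (Y1 n) (fst (x n (fst (fst q))), fst (fst q)) (snd (fst q))) \<in> borel_measurable ((M \<Otimes>\<^sub>M lborel) \<Otimes>\<^sub>M (lborel :: real measure))" for n by simp
  have "(\<lambda>q. (\<lambda>p. path_field \<psi> (Y2 n) (fst p) (snd p)) ((snd (x n (fst (fst q))), fst (fst q)), snd q)) \<in> borel_measurable ((M \<Otimes>\<^sub>M (lborel :: real measure)) \<Otimes>\<^sub>M lborel)" for n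
  proof (rule measurable_compose[OF _ path_field_measurable[where N=M]])
    have a: "(\<lambda>q. (snd (x n (fst (fst q))), fst (fst q))) \<in> (M \<Otimes>\<^sub>M (lborel :: real measure)) \<Otimes>\<^sub>M (lborel :: real measure) \<rightarrow>\<^sub>M borel \<Otimes>\<^sub>M M"
      by (rule measurable_compose[OF _ start_measurable(2)]) measurable
    show "(\<lambda>q. ((snd (x n (fst (fst q))), fst (fst q)), snd q)) \<in> (M \<Otimes>\<^sub>M (lborel :: real measure)) \<Otimes>\<^sub>M (lborel :: real measure) \<rightarrow>\<^sub>M (borel \<Otimes>\<^sub>M M) \<Otimes>\<^sub>M borel"
      by (rule measurable_Pair[OF a]) simp
  qed (simp_all add: m2.Y_measurable m2.Y_cadlag m2.\<phi>_measurable)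
  then have f2: "(\<lambda>q. path_field \<psi> (Y2 n) (snd (x n (fst (fst q))), fst (fst q)) (snd q)) \<in> borel_measurable ((M \<Otimes>\<^sub>M (lborel :: real measure)) \<Otimes>\<^sub>M lborel)" for n by simp
  have i: "(\<lambda>q. indicator {0..s} (snd (fst q)) :: real) \<in> borel_measurable ((M \<Otimes>\<^sub>M lborel) \<Otimes>\<^sub>M (lborel :: real measure))"
    "(\<lambda>q. indicator {0..t} (snd q) :: real) \<in> borel_measurable ((M \<Otimes>\<^sub>M (lborel :: real measure)) \<Otimes>\<^sub>M lborel)" by measurable
  let ?f = "\<lambda>q. (\<Sum>\<^sub>\<infinity>n\<in>UNIV. (path_field \<phi> (Y1 n) (fst (x n (fst (fst q))), fst (fst q)) (snd (fst q)) * indicator {0..s} (snd (fst q))) * (path_field \<psi> (Y2 n) (snd (x n (fst (fst q))), fst (fst q)) (snd q) * indicator {0..t} (snd q)))"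
  have "?f \<in> borel_measurable ((M \<Otimes>\<^sub>M lborel) \<Otimes>\<^sub>M lborel)"
    by (rule borel_measurable_infsum_nat) (intro borel_measurable_times f1 f2 i)
  then have "(\<lambda>p. (LBINT v. ?f (p, v))) \<in> borel_measurable (M \<Otimes>\<^sub>M lborel)"
    by (intro lborel.borel_measurable_lebesgue_integral) (simp add: split_beta')
  then have "(\<lambda>w. (LBINT u. (\<lambda>p. (LBINT v. ?f (p, v))) (w, u))) \<in> borel_measurable M"
    by (intro lborel.borel_measurable_lebesgue_integral) (simp add: split_beta')
  then show ?thesis unfolding occupation_time_path_field[abs_def] by simp
qed

lemma expectation_occupation_time:
  assumes "0 \<le> s" "0 \<le> t"
  shows "expectation (occupation_time x Y1 Y2 \<phi> \<psi> s t) = expectation (field s t)"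
proof (rule integral_cong_AE[OF occupation_time_measurable field_measurable])
  show "AE w in M. occupation_time x Y1 Y2 \<phi> \<psi> s t w = field s t w"
    by (rule eventually_mono[OF good_paths_AE occupation_time_field[OF _ assms]])
qed

end

section \<open>Gaussian limits\<close>

text \<open>A second moment of an increment; its sign is required when the increment bounds of the
  two types are multiplied.\<close>

lemma (in stable_motion) occ_incr_nonneg:
  assumes "0 \<le> l" "0 \<le> r"
  shows "0 \<le> occ_cov r r - 2 * occ_cov r l + occ_cov l l"
proof -
  let ?P = "lborel \<Otimes>\<^sub>M M"
  have i: "integrable ?P (\<lambda>q. occ \<phi> Y q r * occ \<phi> Y q r)" "integrable ?P (\<lambda>q. occ \<phi> Y q r * occ \<phi> Y q l)" "integrable ?P (\<lambda>q. occ \<phi> Y q l * occ \<phi> Y q l)"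
    using occ_cov_eq(1) assms by blast+
  have "0 \<le> (LINT q|?P. (occ \<phi> Y q r - occ \<phi> Y q l)\<^sup>2)" by simp
  also have "\<dots> = (LINT q|?P. (occ \<phi> Y q r * occ \<phi> Y q r - 2 * (occ \<phi> Y q r * occ \<phi> Y q l)) + occ \<phi> Y q l * occ \<phi> Y q l)"
    by (intro Bochner_Integration.integral_cong refl) (simp add: power2_eq_square algebra_simps)
  also have "\<dots> = occ_cov r r - 2 * occ_cov r l + occ_cov l l" using i by (simp add: occ_cov_def)
  finally show ?thesis .
qed

lemma (in prob_space) gaussian_second_moment:
  assumes X: "gaussian_rv M X"
  shows "integrable M (\<lambda>w. (X w)\<^sup>2)" "integrable M X"
    "expectation X = 0 \<Longrightarrow> expectation (\<lambda>w. iexp (X w)) = of_real (exp (- expectation (\<lambda>w. (X w)\<^sup>2) / 2))"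
proof -
  have [measurable]: "X \<in> borel_measurable M" using X by (simp add: gaussian_rv_def)
  have "integrable M (\<lambda>w. (X w)\<^sup>2) \<and> (expectation X = 0 \<longrightarrow> expectation (\<lambda>w. iexp (X w)) = of_real (exp (- expectation (\<lambda>w. (X w)\<^sup>2) / 2)))"
  proof (cases "\<exists>m \<sigma>. \<sigma> > 0 \<and> distributed M lborel X (\<lambda>x. ennreal (normal_density m \<sigma> x))")
    case True
    then obtain m \<sigma> where \<sigma>: "0 < \<sigma>" and d: "distributed M lborel X (\<lambda>x. ennreal (normal_density m \<sigma> x))" by blast
    have "integrable lborel (\<lambda>x. normal_density m \<sigma> x * (x - m) ^ 2)" "integrable lborel (\<lambda>x. normal_density m \<sigma> x * x)" "integrable lborel (normal_density m \<sigma>)"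
      using integrable_normal_moment[OF \<sigma>, of m 2] integrable_normal_moment_nz_1[OF \<sigma>] integrable_normal_moment[OF \<sigma>, of m 0] by simp_all
    then have "integrable lborel (\<lambda>x. (normal_density m \<sigma> x * (x - m) ^ 2 + 2 * m * (normal_density m \<sigma> x * x)) - m\<^sup>2 * normal_density m \<sigma> x)"
      by (intro Bochner_Integration.integrable_diff Bochner_Integration.integrable_add integrable_mult_right)
    moreover have "(normal_density m \<sigma> x * (x - m) ^ 2 + 2 * m * (normal_density m \<sigma> x * x)) - m\<^sup>2 * normal_density m \<sigma> x = normal_density m \<sigma> x * x\<^sup>2" for x
      by (simp add: power2_eq_square algebra_simps)
    ultimately have "integrable lborel (\<lambda>x. normal_density m \<sigma> x * x\<^sup>2)" by simp
    then have i: "integrable M (\<lambda>w. (X w)\<^sup>2)" using distributed_integrable[OF d, of "\<lambda>x. x\<^sup>2"] by simp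
    have "expectation (\<lambda>w. iexp (X w)) = of_real (exp (- expectation (\<lambda>w. (X w)\<^sup>2) / 2))" if E: "expectation X = 0"
    proof -
      have m: "m = 0" using normal_distributed_expectation[OF \<sigma> d] E by simp
      have v: "expectation (\<lambda>w. (X w)\<^sup>2) = \<sigma>\<^sup>2" using normal_distributed_variance[OF \<sigma> d] E by simp
      have s: "distributed M lborel (\<lambda>w. X w / \<sigma>) (\<lambda>x. ennreal (std_normal_density x))"
        using d normal_standard_normal_convert[OF \<sigma>, of X m] m by simp
      have "expectation (\<lambda>w. iexp (X w)) = expectation (\<lambda>w. iexp (\<sigma> * (X w / \<sigma>)))" using \<sigma> by simp
      also have "\<dots> = (LINT y|(distr M lborel (\<lambda>w. X w / \<sigma>)). iexp (\<sigma> * y))" by (subst integral_distr) auto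
      also have "\<dots> = char std_normal_distribution \<sigma>"
        unfolding distributed_distr_eq_density[OF s] char_def by simp
      also have "\<dots> = of_real (exp (- expectation (\<lambda>w. (X w)\<^sup>2) / 2))" by (simp add: char_std_normal_distribution v)
      finally show ?thesis .
    qed
    with i show ?thesis by blast
  next
    case False
    then obtain m where m: "AE w in M. X w = m" using X unfolding gaussian_rv_def by blast
    have i: "integrable M (\<lambda>w. (X w)\<^sup>2)" by (rule integrable_const_bound[where B="m\<^sup>2"]) (use m in auto)
    have e: "expectation X = m"
      using integral_cong_AE[of X M "\<lambda>_. m"] m by (simp add: prob_space)
    have "AE w in M. iexp (X w) = iexp m" "AE w in M. (X w)\<^sup>2 = m\<^sup>2" using m by (eventually_elim, simp)+
    then have "expectation (\<lambda>w. iexp (X w)) = iexp m" "expectation (\<lambda>w. (X w)\<^sup>2) = m\<^sup>2"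
      using integral_cong_AE[of "\<lambda>w. iexp (X w)" M "\<lambda>_. iexp m"] integral_cong_AE[of "\<lambda>w. (X w)\<^sup>2" M "\<lambda>_. m\<^sup>2"] by (simp_all add: prob_space)
    with i e show ?thesis by auto
  qed
  then show i: "integrable M (\<lambda>w. (X w)\<^sup>2)" and "expectation X = 0 \<Longrightarrow> expectation (\<lambda>w. iexp (X w)) = of_real (exp (- expectation (\<lambda>w. (X w)\<^sup>2) / 2))" by auto
  show "integrable M X" by (rule square_integrable_imp_integrable[OF _ i]) simp
qed

lemma sheet_combination_char:
  fixes k :: nat
  assumes W: "fractional_brownian_sheet M' \<alpha>1 \<alpha>2 W" and p: "\<And>i. i < k \<Longrightarrow> p i \<in> {0..} \<times> {0..}"
  shows "(LINT w|M'. iexp (\<Sum>i<k. c i * W (p i) w)) =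
    of_real (exp (- (\<Sum>i<k. \<Sum>j<k. c i * c j * (fbs_cov \<alpha>1 (fst (p i)) (fst (p j)) * fbs_cov \<alpha>2 (snd (p i)) (snd (p j)))) / 2))"
proof -
  interpret prob_space M' using W by (simp add: fractional_brownian_sheet_def)
  have G: "centered_gaussian_field M' ({0..} \<times> {0..}) W" using W by (simp add: fractional_brownian_sheet_def)
  let ?X = "\<lambda>w. \<Sum>i<k. c i * W (p i) w"
  \<comment> \<open>The points \<open>p i\<close> may coincide, whereas
    \<open>centered_gaussian_field\<close> speaks of finite sets of points, so the coefficients of
    equal points are added up.\<close>
  define d where "d q = (\<Sum>i | i < k \<and> p i = q. c i)" for q
  have X: "?X = (\<lambda>w. \<Sum>q\<in>p ` {..<k}. d q * W q w)"
  proof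
    fix w
    have "?X w = (\<Sum>q\<in>p ` {..<k}. \<Sum>i | i \<in> {..<k} \<and> p i = q. c i * W (p i) w)" by (rule sum.image_gen) simp
    also have "\<dots> = (\<Sum>q\<in>p ` {..<k}. d q * W q w)" unfolding d_def sum_distrib_right by (intro sum.cong) auto
    finally show "?X w = (\<Sum>q\<in>p ` {..<k}. d q * W q w)" .
  qed
  have G1: "gaussian_rv M' (\<lambda>w. \<Sum>q\<in>J. d q * W q w)" if "finite J" "J \<subseteq> {0..} \<times> {0..}" for J d
    using G that by (simp add: centered_gaussian_field_def)
  have "p ` {..<k} \<subseteq> {0..} \<times> {0..}" using p by blast
  then have gX: "gaussian_rv M' ?X" unfolding X by (intro G1 finite_imageI finite_lessThan)
  have gW: "gaussian_rv M' (W q)" if "q \<in> {0..} \<times> {0..}" for q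
    using G1[of "{q}" "\<lambda>_. 1"] that by simp
  have [measurable]: "W (p i) \<in> borel_measurable M'" if "i < k" for i using gW[OF p[OF that]] by (simp add: gaussian_rv_def)
  have EX: "expectation ?X = 0"
  proof -
    have "integrable M' (W (p i))" if "i < k" for i by (rule gaussian_second_moment(2)[OF gW[OF p[OF that]]])
    then have e: "expectation ?X = (\<Sum>i<k. c i * expectation (W (p i)))"
      by (subst Bochner_Integration.integral_sum) auto
    have "expectation (W (p i)) = 0" if "i < k" for i
      by (rule bspec[OF conjunct2[OF G[unfolded centered_gaussian_field_def]] p[OF that]])
    then show ?thesis unfolding e by simp
  qed
  have ii: "integrable M' (\<lambda>w. W (p i) w * W (p j) w)" if "i < k" "j < k" for i j
  proof (rule Bochner_Integration.integrable_bound)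
    show "integrable M' (\<lambda>w. (W (p i) w)\<^sup>2 + (W (p j) w)\<^sup>2)"
      using gaussian_second_moment(1)[OF gW[OF p[OF that(1)]]] gaussian_second_moment(1)[OF gW[OF p[OF that(2)]]] by simp
    have "\<bar>a * b\<bar> \<le> a\<^sup>2 + b\<^sup>2" for a b :: real
    proof -
      have "0 \<le> (\<bar>a\<bar> - \<bar>b\<bar>)\<^sup>2" by simp
      then have "2 * (\<bar>a\<bar> * \<bar>b\<bar>) \<le> a\<^sup>2 + b\<^sup>2" by (simp add: power2_diff)
      moreover have "0 \<le> \<bar>a\<bar> * \<bar>b\<bar>" by simp
      ultimately show ?thesis unfolding abs_mult by linarith
    qed
    then show "AE w in M'. norm (W (p i) w * W (p j) w) \<le> norm ((W (p i) w)\<^sup>2 + (W (p j) w)\<^sup>2)"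
      by (intro AE_I2) (simp add: abs_of_nonneg)
  qed (use that in measurable)
  have "(\<lambda>w. (?X w)\<^sup>2) = (\<lambda>w. \<Sum>i<k. \<Sum>j<k. c i * c j * (W (p i) w * W (p j) w))"
    unfolding power2_eq_square sum_product by (intro ext sum.cong refl) (simp add: mult_ac)
  then have "expectation (\<lambda>w. (?X w)\<^sup>2) = expectation (\<lambda>w. \<Sum>i<k. \<Sum>j<k. c i * c j * (W (p i) w * W (p j) w))" by simp
  also have "\<dots> = (\<Sum>i<k. \<Sum>j<k. c i * c j * expectation (\<lambda>w. W (p i) w * W (p j) w))"
    using ii by (subst Bochner_Integration.integral_sum, force, intro sum.cong refl, subst Bochner_Integration.integral_sum) auto
  also have "\<dots> = (\<Sum>i<k. \<Sum>j<k. c i * c j * (fbs_cov \<alpha>1 (fst (p i)) (fst (p j)) * fbs_cov \<alpha>2 (snd (p i)) (snd (p j))))"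
  proof (intro sum.cong refl)
    fix i j assume "i \<in> {..<k}" "j \<in> {..<k}"
    then have pp: "p i \<in> {0..} \<times> {0..}" "p j \<in> {0..} \<times> {0..}" using p by auto
    have cov: "expectation (\<lambda>w. W (s, t) w * W (s', t') w) = fbs_cov \<alpha>1 s s' * fbs_cov \<alpha>2 t t'"
      if "0 \<le> s" "0 \<le> t" "0 \<le> s'" "0 \<le> t'" for s t s' t'
      using W that unfolding fractional_brownian_sheet_def by blast
    from cov[of "fst (p i)" "snd (p i)" "fst (p j)" "snd (p j)"] pp show "c i * c j * expectation (\<lambda>w. W (p i) w * W (p j) w) = c i * c j * (fbs_cov \<alpha>1 (fst (p i)) (fst (p j)) * fbs_cov \<alpha>2 (snd (p i)) (snd (p j)))" by (simp add: mem_Times_iff)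
  qed
  finally show ?thesis using gaussian_second_moment(3)[OF gX EX] by simp
qed

context particle_system
begin

text \<open>Setting the centred field to 0 off the almost sure event \<open>good_paths\<close> makes
  every path continuous, as a random element of the path space requires.\<close>

definition cfield :: "real \<Rightarrow> real \<Rightarrow> 'w \<Rightarrow> real" where
  "cfield s t w = (if w \<in> good_paths then field s t w - expectation (field s t) else 0)"

lemma cfield_measurable[measurable]: "cfield s t \<in> borel_measurable M"
  unfolding cfield_def[abs_def] by measurable

lemma field_axes: "field 0 t = (\<lambda>_. 0)" "field s 0 = (\<lambda>_. 0)" by (simp_all add: field_def fun_eq_iff occ_0)

lemma cfield_axes: "cfield 0 t w = 0" "cfield s 0 w = 0" by (simp_all add: cfield_def field_axes)

lemma field_integrable:
  assumes "0 \<le> s" "0 \<le> t"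
  shows "integrable M (field s t)"
proof -
  have "integrable M (comb_sum 1 (\<lambda>_. 1) (\<lambda>_. s) (\<lambda>_. t))" by (rule comb_sum_mean(1)[where R="max s t"]) (use assms in auto)
  then show ?thesis by (simp add: comb_sum_def[abs_def] pair_comb_def field_def[abs_def])
qed

lemma comb_sum_cfield:
  assumes st: "\<And>j. j < k \<Longrightarrow> 0 \<le> s j \<and> 0 \<le> t j"
  shows "AE w in M. comb_sum k c s t w - expectation (comb_sum k c s t) = (\<Sum>j<k. c j * cfield (s j) (t j) w)"
proof -
  have [measurable]: "comb_sum k c s t \<in> borel_measurable M"
    unfolding comb_sum_def[abs_def] pair_comb_def by measurable
  have ae: "AE w in M. comb_sum k c s t w = (\<Sum>j<k. c j * field (s j) (t j) w)"
  proof (rule eventually_mono[OF good_paths_AE])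
    fix w assume "w \<in> good_paths"
    then show "comb_sum k c s t w = (\<Sum>j<k. c j * field (s j) (t j) w)" by (simp add: comb_sum_field st)
  qed
  have "expectation (comb_sum k c s t) = expectation (\<lambda>w. \<Sum>j<k. c j * field (s j) (t j) w)"
    by (rule integral_cong_AE[OF _ _ ae]) measurable
  also have "\<dots> = (\<Sum>j<k. c j * expectation (field (s j) (t j)))"
    using st by (subst Bochner_Integration.integral_sum) (auto intro!: field_integrable)
  finally have E: "expectation (comb_sum k c s t) = (\<Sum>j<k. c j * expectation (field (s j) (t j)))" .
  show ?thesis using ae good_paths_AE
    by eventually_elim (simp add: E cfield_def right_diff_distrib sum_subtractf)
qed

lemma cfield_char_bound:
  assumes R: "0 \<le> R" and st: "\<And>j. j < k \<Longrightarrow> 0 \<le> s j \<and> s j \<le> R \<and> 0 \<le> t j \<and> t j \<le> R"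
  shows "norm (expectation (\<lambda>w. iexp (\<Sum>j<k. c j * cfield (s j) (t j) w)) - of_real (exp (- comb_var k c s t / 2)))
     \<le> (\<Sum>j<k. \<bar>c j\<bar>) ^ 3 * (third1 R * third2 R) / 2"
proof -
  have [measurable]: "comb_sum k c s t \<in> borel_measurable M"
    unfolding comb_sum_def[abs_def] pair_comb_def by measurable
  have ae: "AE w in M. comb_sum k c s t w - expectation (comb_sum k c s t) = (\<Sum>j<k. c j * cfield (s j) (t j) w)"
    by (rule comb_sum_cfield) (use st in auto)
  have "expectation (\<lambda>w. iexp (comb_sum k c s t w - expectation (comb_sum k c s t))) = expectation (\<lambda>w. iexp (\<Sum>j<k. c j * cfield (s j) (t j) w))"
    by (rule integral_cong_AE) (measurable, use ae in \<open>auto elim!: eventually_mono simp del: of_real_diff of_real_sum\<close>)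
  moreover have "norm (expectation (\<lambda>w. iexp (comb_sum k c s t w - expectation (comb_sum k c s t))) - of_real (exp (- comb_var k c s t / 2)))
     \<le> (\<Sum>j<k. \<bar>c j\<bar>) ^ 3 * (third1 R * third2 R) / 2" by (rule comb_sum_char_bound[OF R], rule st)
  ultimately show ?thesis by simp
qed

definition incr_const :: real where
  "incr_const = (m1.L1\<^sup>2 * m1.p1 * (2 / m1.b)) * (m2.L1\<^sup>2 * m2.p1 * (2 / m2.b))"

lemma incr_const_nonneg: "0 \<le> incr_const"
  unfolding incr_const_def using m1.p1_nonneg m2.p1_nonneg m1.b_pos m2.b_pos by (intro mult_nonneg_nonneg) auto

text \<open>The corner coefficients 1, -1, -1, 1 form a tensor product, so the variance of a
  rectangular increment factorizes into the increment variances of the two types.\<close>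

lemma cfield_rect_moment:
  assumes "0 \<le> l" "0 \<le> r" "0 \<le> l'" "0 \<le> r'"
  shows "(\<integral>\<^sup>+w. ennreal ((rect_incr cfield l r l' r' w)\<^sup>2) \<partial>M) \<le> ennreal (incr_const * (\<bar>r - l\<bar> powr (1 + m1.b) * \<bar>r' - l'\<bar> powr (1 + m2.b)))"
proof -
  let ?c = "\<lambda>j. [1, -1, -1, 1 :: real] ! j" and ?s = "\<lambda>j. [r, l, r, l] ! j" and ?t = "\<lambda>j. [r', r', l', l'] ! j"
  define R where "R = max (max l r) (max l' r')"
  have R: "0 \<le> R" using assms by (simp add: R_def)
  have st: "0 \<le> ?s j \<and> ?s j \<le> R \<and> 0 \<le> ?t j \<and> ?t j \<le> R" if "j < 4" for j :: nat
  proof -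
    have "j = 0 \<or> j = 1 \<or> j = 2 \<or> j = 3" using that by auto
    then show ?thesis using assms by (auto simp: R_def)
  qed
  have sum4: "(\<Sum>j<4. f j) = f 0 + f 1 + f 2 + f 3" for f :: "nat \<Rightarrow> real" by (simp add: eval_nat_numeral)
  have ae: "AE w in M. comb_sum 4 ?c ?s ?t w - expectation (comb_sum 4 ?c ?s ?t) = rect_incr cfield l r l' r' w"
  proof -
    have "AE w in M. comb_sum 4 ?c ?s ?t w - expectation (comb_sum 4 ?c ?s ?t) = (\<Sum>j<4. ?c j * cfield (?s j) (?t j) w)"
      by (rule comb_sum_cfield) (use st in auto)
    then show ?thesis unfolding sum4 by (simp add: rect_incr_def)
  qed
  have "comb_var 4 ?c ?s ?t = (m1.occ_cov 0 r r - 2 * m1.occ_cov 0 r l + m1.occ_cov 0 l l) * (m2.occ_cov 0 r' r' - 2 * m2.occ_cov 0 r' l' + m2.occ_cov 0 l' l')"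
    unfolding comb_var_def sum4 by (simp add: m1.occ_cov_sym[of 0 l r] m2.occ_cov_sym[of 0 l' r']) algebra
  also have "\<dots> \<le> (m1.L1\<^sup>2 * m1.p1 * (2 / m1.b) * \<bar>r - l\<bar> powr (1 + m1.b)) * (m2.L1\<^sup>2 * m2.p1 * (2 / m2.b) * \<bar>r' - l'\<bar> powr (1 + m2.b))"
    using assms m1.p1_nonneg m1.b_pos by (intro mult_mono m1.occ_incr_bound m2.occ_incr_bound m2.occ_incr_nonneg mult_nonneg_nonneg) auto
  also have "\<dots> = incr_const * (\<bar>r - l\<bar> powr (1 + m1.b) * \<bar>r' - l'\<bar> powr (1 + m2.b))" unfolding incr_const_def by (simp only: mult_ac)
  finally have v: "comb_var 4 ?c ?s ?t \<le> incr_const * (\<bar>r - l\<bar> powr (1 + m1.b) * \<bar>r' - l'\<bar> powr (1 + m2.b))" .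
  have "(\<integral>\<^sup>+w. ennreal ((rect_incr cfield l r l' r' w)\<^sup>2) \<partial>M) = (\<integral>\<^sup>+w. ennreal ((comb_sum 4 ?c ?s ?t w - expectation (comb_sum 4 ?c ?s ?t))\<^sup>2) \<partial>M)"
    by (rule nn_integral_cong_AE) (use ae in \<open>auto elim!: eventually_mono\<close>)
  also have "\<dots> \<le> ennreal (comb_var 4 ?c ?s ?t)" by (rule comb_sum_variance[OF R], rule st)
  also have "\<dots> \<le> ennreal (incr_const * (\<bar>r - l\<bar> powr (1 + m1.b) * \<bar>r' - l'\<bar> powr (1 + m2.b)))" by (rule ennreal_leI[OF v])
  finally show ?thesis .
qed

text \<open>Centring subtracts a function of the two times that must itself be continuous; dominated
  convergence applies with the sum of the \<open>pair_bar\<close> as majorant.\<close>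

lemma mean_field_continuous: "0 \<le> R \<Longrightarrow> continuous_on ({0..R} \<times> {0..R}) (\<lambda>p. expectation (field (fst p) (snd p)))"
proof (rule continuous_on_sequentiallyI)
  fix u a assume R: "0 \<le> R" and u: "\<forall>n. u n \<in> {0..R} \<times> {0..R}" and a: "a \<in> {0..R} \<times> {0..R}" and lim: "u \<longlonglongrightarrow> a"
  let ?B = "\<lambda>w. \<Sum>n. pair_bar n R (x n w) w"
  have [measurable]: "?B \<in> borel_measurable M" unfolding pair_bar_def by measurable
  show "(\<lambda>n. expectation (field (fst (u n)) (snd (u n)))) \<longlonglongrightarrow> expectation (field (fst a) (snd a))"
  proof (rule integral_dominated_convergence[where w="\<lambda>w. enn2real (?B w)"])
    have "(\<integral>\<^sup>+w. ennreal (enn2real (?B w)) \<partial>M) \<le> (\<integral>\<^sup>+w. ?B w \<partial>M)"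
      by (intro nn_integral_mono) (simp add: ennreal_enn2real_if)
    also have "\<dots> < \<infinity>" unfolding pair_bar_sum[OF R] by (simp add: ennreal_mult_less_top)
    finally show "integrable M (\<lambda>w. enn2real (?B w))" by (intro integrableI_nonneg) auto
    show "AE w in M. (\<lambda>n. field (fst (u n)) (snd (u n)) w) \<longlonglongrightarrow> field (fst a) (snd a) w"
      using good_paths_AE
    proof (rule eventually_mono)
      fix w assume "w \<in> good_paths"
      from field_continuous[OF this, of R] show "(\<lambda>n. field (fst (u n)) (snd (u n)) w) \<longlonglongrightarrow> field (fst a) (snd a) w"
        using u a lim unfolding continuous_on_sequentially by (auto simp: o_def)
    qed
    show "AE w in M. norm (field (fst (u n)) (snd (u n)) w) \<le> enn2real (?B w)" for n
      using good_paths_AE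
    proof (rule eventually_mono)
      fix w assume w: "w \<in> good_paths"
      have un: "0 \<le> fst (u n)" "fst (u n) \<le> R" "0 \<le> snd (u n)" "snd (u n) \<le> R" using u by (auto simp: mem_Times_iff)
      have "ennreal \<bar>field (fst (u n)) (snd (u n)) w\<bar> \<le> ?B w" by (rule field_bound[OF w un])
      then have "enn2real (ennreal \<bar>field (fst (u n)) (snd (u n)) w\<bar>) \<le> enn2real (?B w)"
        using good_path_finite(1)[OF w, of R] by (intro enn2real_mono) simp_all
      then show "norm (field (fst (u n)) (snd (u n)) w) \<le> enn2real (?B w)" by simp
    qed
  qed measurable
qed

lemma cfield_continuous: "0 \<le> R \<Longrightarrow> continuous_on ({0..R} \<times> {0..R}) (\<lambda>p. cfield (fst p) (snd p) w)"
  using field_continuous[of w R] mean_field_continuous[of R] by (cases "w \<in> good_paths") (auto simp: cfield_def intro!: continuous_on_diff)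

lemma fluctuation_cfield:
  assumes "w \<in> good_paths" "0 \<le> T" "0 \<le> fst p" "0 \<le> snd p"
  shows "fluctuation M x Y1 Y2 \<phi> \<psi> F T p w = cfield (T * fst p) (T * snd p) w / F T"
  using assms occupation_time_field[OF assms(1), of "T * fst p" "T * snd p"] expectation_occupation_time[of "T * fst p" "T * snd p"]
  by (simp add: fluctuation_def cfield_def split_beta)

end

section \<open>Rescaling and estimates uniform in T\<close>

context particle_system
begin

abbreviation "norming T \<equiv> T powr (1 - 1 / (2 * \<alpha>1)) * T powr (1 - 1 / (2 * \<alpha>2))"

lemma norming_sq: "0 < T \<Longrightarrow> (norming T)\<^sup>2 = T powr (1 + m1.b) * T powr (1 + m2.b)"
  by (simp add: power_mult_distrib powr_power field_simps)

text \<open>For each type the third moment grows like T powr (3 - 2 / \<alpha>), while the cube of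
  the norming factor is T powr (3 - 3 / (2 * \<alpha>)).\<close>

lemma third_scaled:
  assumes T: "0 < T" and \<tau>: "0 < \<tau>"
  shows "third1 (T * \<tau>) * third2 (T * \<tau>) / norming T ^ 3 = third1 \<tau> * third2 \<tau> * (T powr (- 1 / (2 * \<alpha>1)) * T powr (- 1 / (2 * \<alpha>2)))"
proof -
  have one: "T * T powr (1 - 1 / \<alpha>) * T powr (1 - 1 / \<alpha>) = (T powr (1 - 1 / (2 * \<alpha>))) ^ 3 * T powr (- 1 / (2 * \<alpha>))" if "1 < \<alpha>" for \<alpha>
  proof -
    have "T * T powr (1 - 1 / \<alpha>) * T powr (1 - 1 / \<alpha>) = T powr 1 * T powr (1 - 1 / \<alpha>) * T powr (1 - 1 / \<alpha>)" using T by simp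
    also have "\<dots> = T powr (1 + (1 - 1 / \<alpha>) + (1 - 1 / \<alpha>))" by (simp only: powr_add)
    also have "1 + (1 - 1 / \<alpha>) + (1 - 1 / \<alpha>) = (1 - 1 / (2 * \<alpha>)) * real 3 + - 1 / (2 * \<alpha>)" using that by (simp add: field_simps)
    also have "T powr ((1 - 1 / (2 * \<alpha>)) * real 3 + - 1 / (2 * \<alpha>)) = (T powr (1 - 1 / (2 * \<alpha>))) ^ 3 * T powr (- 1 / (2 * \<alpha>))"
      using T by (simp only: powr_add powr_powr[symmetric] powr_realpow[OF powr_gt_zero[THEN iffD2, OF order.strict_implies_not_eq[OF T, symmetric]]])
    finally show ?thesis .
  qed
  have t1: "third1 (T * \<tau>) = third1 \<tau> * (T * T powr m1.b * T powr m1.b)" and t2: "third2 (T * \<tau>) = third2 \<tau> * (T * T powr m2.b * T powr m2.b)"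
    using T \<tau> by (simp_all add: powr_mult)
  have "norming T \<noteq> 0" using T by simp
  then show ?thesis unfolding t1 t2 one[OF \<alpha>(1)] one[OF \<alpha>(2)] power_mult_distrib by simp
qed

text \<open>The norming is absorbed into the coefficients, so that \<open>cfield_char_bound\<close>
  applies with an error vanishing by \<open>third_scaled\<close>. Only the square of
  \<open>D\<close> enters, because the limit law is symmetric; the signs of the integrals of \<phi>
  and \<psi> do not matter.\<close>

lemma scaled_char_limit:
  fixes k :: nat
  assumes \<tau>: "0 < \<tau>" and p: "\<And>i. i < k \<Longrightarrow> p i \<in> {0..\<tau>} \<times> {0..\<tau>}" and T: "filterlim T at_top sequentially"
    and D: "D\<^sup>2 = (m1.p1 / m1.b * (LBINT x. \<phi> x)\<^sup>2) * (m2.p1 / m2.b * (LBINT x. \<psi> x)\<^sup>2)"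
  shows "(\<lambda>n. expectation (\<lambda>w. iexp (\<Sum>i<k. c i * (cfield (T n * fst (p i)) (T n * snd (p i)) w / norming (T n)))))
    \<longlonglongrightarrow> of_real (exp (- (\<Sum>i<k. \<Sum>j<k. (c i * D) * (c j * D) * (fbs_cov \<alpha>1 (fst (p i)) (fst (p j)) * fbs_cov \<alpha>2 (snd (p i)) (snd (p j)))) / 2))"
proof -
  define V where "V n = (\<Sum>i<k. \<Sum>j<k. c i * c j * (m1.occ_cov 0 (T n * fst (p i)) (T n * fst (p j)) / T n powr (1 + m1.b) *
    (m2.occ_cov 0 (T n * snd (p i)) (T n * snd (p j)) / T n powr (1 + m2.b))))" for n
  define E where "E n = (\<Sum>i<k. \<bar>c i\<bar>) ^ 3 * (third1 \<tau> * third2 \<tau> * (T n powr (- 1 / (2 * \<alpha>1)) * T n powr (- 1 / (2 * \<alpha>2)))) / 2" for n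
  let ?L = "\<Sum>i<k. \<Sum>j<k. (c i * D) * (c j * D) * (fbs_cov \<alpha>1 (fst (p i)) (fst (p j)) * fbs_cov \<alpha>2 (snd (p i)) (snd (p j)))"
  have pp: "0 \<le> fst (p i)" "0 \<le> snd (p i)" "fst (p i) \<le> \<tau>" "snd (p i) \<le> \<tau>" if "i < k" for i
    using p[OF that] by (auto simp: mem_Times_iff)
  have "V \<longlonglongrightarrow> (\<Sum>i<k. \<Sum>j<k. c i * c j * ((m1.p1 / m1.b * (LBINT x. \<phi> x)\<^sup>2 * fbs_cov \<alpha>1 (fst (p i)) (fst (p j))) *
    (m2.p1 / m2.b * (LBINT x. \<psi> x)\<^sup>2 * fbs_cov \<alpha>2 (snd (p i)) (snd (p j)))))"
    unfolding V_def by (intro tendsto_sum tendsto_mult tendsto_const m1.occ_cov_limit[OF T] m2.occ_cov_limit[OF T]) (auto simp: pp)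
  also have "(\<Sum>i<k. \<Sum>j<k. c i * c j * ((m1.p1 / m1.b * (LBINT x. \<phi> x)\<^sup>2 * fbs_cov \<alpha>1 (fst (p i)) (fst (p j))) *
    (m2.p1 / m2.b * (LBINT x. \<psi> x)\<^sup>2 * fbs_cov \<alpha>2 (snd (p i)) (snd (p j))))) = ?L"
  proof (intro sum.cong refl)
    fix i j
    have "(c i * D) * (c j * D) * (fbs_cov \<alpha>1 (fst (p i)) (fst (p j)) * fbs_cov \<alpha>2 (snd (p i)) (snd (p j))) = c i * c j * D\<^sup>2 * (fbs_cov \<alpha>1 (fst (p i)) (fst (p j)) * fbs_cov \<alpha>2 (snd (p i)) (snd (p j)))"
      by (simp only: power2_eq_square mult_ac)
    then show "c i * c j * ((m1.p1 / m1.b * (LBINT x. \<phi> x)\<^sup>2 * fbs_cov \<alpha>1 (fst (p i)) (fst (p j))) *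
      (m2.p1 / m2.b * (LBINT x. \<psi> x)\<^sup>2 * fbs_cov \<alpha>2 (snd (p i)) (snd (p j)))) =
      (c i * D) * (c j * D) * (fbs_cov \<alpha>1 (fst (p i)) (fst (p j)) * fbs_cov \<alpha>2 (snd (p i)) (snd (p j)))"
      unfolding D by (simp only: mult_ac)
  qed
  finally have V: "V \<longlonglongrightarrow> ?L" .
  then have lim: "(\<lambda>n. complex_of_real (exp (- V n / 2))) \<longlonglongrightarrow> of_real (exp (- ?L / 2))" by (intro tendsto_intros) simp_all
  have z: "(\<lambda>n. T n powr (- 1 / (2 * \<alpha>))) \<longlonglongrightarrow> 0" if "1 < \<alpha>" for \<alpha>
    by (rule tendsto_neg_powr[OF _ T]) (use that in simp)
  have "E \<longlonglongrightarrow> (\<Sum>i<k. \<bar>c i\<bar>) ^ 3 * (third1 \<tau> * third2 \<tau> * (0 * 0)) / 2"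
    unfolding E_def
    by (rule tendsto_divide[OF tendsto_mult[OF tendsto_const tendsto_mult[OF tendsto_const tendsto_mult[OF z[OF \<alpha>(1)] z[OF \<alpha>(2)]]]] tendsto_const]) simp
  then have E: "E \<longlonglongrightarrow> 0" by simp
  have bound: "norm (expectation (\<lambda>w. iexp (\<Sum>i<k. c i * (cfield (T n * fst (p i)) (T n * snd (p i)) w / norming (T n)))) - of_real (exp (- V n / 2))) \<le> E n"
    if Tn: "0 < T n" for n
  proof -
    let ?c = "\<lambda>i. c i / norming (T n)" and ?s = "\<lambda>i. T n * fst (p i)" and ?t = "\<lambda>i. T n * snd (p i)"
    have F: "0 < norming (T n)" using Tn by simp
    have "norm (expectation (\<lambda>w. iexp (\<Sum>i<k. ?c i * cfield (?s i) (?t i) w)) - of_real (exp (- comb_var k ?c ?s ?t / 2)))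
      \<le> (\<Sum>j<k. \<bar>?c j\<bar>) ^ 3 * (third1 (T n * \<tau>) * third2 (T n * \<tau>)) / 2"
      by (rule cfield_char_bound) (use Tn \<tau> pp in auto)
    moreover have "comb_var k ?c ?s ?t = V n"
      unfolding comb_var_def V_def
    proof (intro sum.cong refl)
      fix i j
      have "(a / f) * (b / f) * (A * B) = a * b * (A / u * (B / v))" if "f\<^sup>2 = u * v" for a b f A B u v :: real
        using that by (simp add: power2_eq_square)
      then show "?c i * ?c j * (m1.occ_cov 0 (?s i) (?s j) * m2.occ_cov 0 (?t i) (?t j)) = c i * c j * (m1.occ_cov 0 (?s i) (?s j) / T n powr (1 + m1.b) * (m2.occ_cov 0 (?t i) (?t j) / T n powr (1 + m2.b)))"
        using norming_sq[OF Tn] by blast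
    qed
    moreover have "(\<Sum>j<k. \<bar>?c j\<bar>) ^ 3 * (third1 (T n * \<tau>) * third2 (T n * \<tau>)) / 2 = E n"
    proof -
      have "(\<Sum>j<k. \<bar>?c j\<bar>) = (\<Sum>j<k. \<bar>c j\<bar>) / norming (T n)" using F by (simp only: abs_divide abs_of_pos sum_divide_distrib)
      moreover have "(a / f) ^ 3 * h / 2 = a ^ 3 * (h / f ^ 3) / 2" for a f h :: real by (simp add: power_divide)
      ultimately have "(\<Sum>j<k. \<bar>?c j\<bar>) ^ 3 * (third1 (T n * \<tau>) * third2 (T n * \<tau>)) / 2 = (\<Sum>j<k. \<bar>c j\<bar>) ^ 3 * (third1 (T n * \<tau>) * third2 (T n * \<tau>) / norming (T n) ^ 3) / 2"
        by presburger
      also have "\<dots> = E n" unfolding third_scaled[OF Tn \<tau>] E_def ..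
      finally show ?thesis .
    qed
    moreover have "(\<Sum>i<k. c i * (cfield (?s i) (?t i) w / norming (T n))) = (\<Sum>i<k. ?c i * cfield (?s i) (?t i) w)" for w by simp
    ultimately show ?thesis by (simp only:)
  qed
  have "(\<lambda>n. expectation (\<lambda>w. iexp (\<Sum>i<k. c i * (cfield (T n * fst (p i)) (T n * snd (p i)) w / norming (T n)))) - of_real (exp (- V n / 2))) \<longlonglongrightarrow> 0"
  proof (rule Lim_null_comparison[OF _ E])
    have "eventually (\<lambda>n. 0 < T n) sequentially" using T by (simp add: filterlim_at_top_dense)
    then show "eventually (\<lambda>n. norm (expectation (\<lambda>w. iexp (\<Sum>i<k. c i * (cfield (T n * fst (p i)) (T n * snd (p i)) w / norming (T n)))) - of_real (exp (- V n / 2))) \<le> E n) sequentially"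
      by (rule eventually_mono) (rule bound)
  qed
  from tendsto_add[OF this lim] show ?thesis by simp
qed

text \<open>The field vanishes on the axes, so its value is a rectangular increment with a corner at
  the origin, and the increment bound scales exactly like the squared norming.\<close>

lemma scaled_second_moment:
  assumes \<tau>: "0 < \<tau>"
  shows "\<exists>C. \<forall>T>0. \<forall>p\<in>{0..\<tau>} \<times> {0..\<tau>}. integrable M (\<lambda>w. (cfield (T * fst p) (T * snd p) w / norming T)\<^sup>2) \<and>
    (LINT w|M. (cfield (T * fst p) (T * snd p) w / norming T)\<^sup>2) \<le> C"
proof (intro exI allI impI ballI)
  fix T :: real and p :: "real \<times> real" assume T: "0 < T" and "p \<in> {0..\<tau>} \<times> {0..\<tau>}"
  then have p: "0 \<le> fst p" "fst p \<le> \<tau>" "0 \<le> snd p" "snd p \<le> \<tau>" by (auto simp: mem_Times_iff)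
  let ?C = "incr_const * (\<tau> powr (1 + m1.b) * \<tau> powr (1 + m2.b))" and ?X = "cfield (T * fst p) (T * snd p)"
  let ?Q = "incr_const * ((T * fst p) powr (1 + m1.b) * (T * snd p) powr (1 + m2.b))"
  have Q: "0 \<le> ?Q" using incr_const_nonneg by (intro mult_nonneg_nonneg) auto
  have n: "(\<integral>\<^sup>+w. ennreal ((?X w)\<^sup>2) \<partial>M) \<le> ennreal ?Q"
    using cfield_rect_moment[of 0 "T * fst p" 0 "T * snd p"] p T by (simp add: rect_incr_def cfield_axes)
  then have i: "integrable M (\<lambda>w. (?X w)\<^sup>2)" by (intro integrableI_nonneg) (auto simp: le_less_trans)
  from n have "(LINT w|M. (?X w)\<^sup>2) \<le> ?Q" using Q unfolding nn_integral_eq_integral[OF i AE_I2[OF zero_le_power2]] by (simp only: ennreal_le_iff)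
  then have "(LINT w|M. (?X w)\<^sup>2) / (norming T)\<^sup>2 \<le> ?Q / (norming T)\<^sup>2" by (rule divide_right_mono) simp
  also have "\<dots> = incr_const * (fst p powr (1 + m1.b) * snd p powr (1 + m2.b))"
    unfolding norming_sq[OF T] using T p by (simp add: powr_mult)
  also have "\<dots> \<le> ?C" using p incr_const_nonneg m1.b_pos m2.b_pos by (intro mult_left_mono mult_mono powr_mono2) auto
  finally show "integrable M (\<lambda>w. (?X w / norming T)\<^sup>2) \<and> (LINT w|M. (?X w / norming T)\<^sup>2) \<le> ?C"
    using i unfolding power_divide by simp
qed

text \<open>Time is rescaled to the unit square, where the rectangular bound holds with a constant
  \<open>K\<close> free of T; on the original square the radius becomes \<delta> * \<tau>.\<close>

lemma scaled_modulus:
  assumes \<tau>: "0 < \<tau>" and e: "0 < e"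
  shows "\<exists>\<delta>>0. \<forall>T>0. \<exists>A\<in>sets M. prob A \<le> e \<and> (\<forall>w\<in>space M - A. \<forall>q\<in>{0..\<tau>} \<times> {0..\<tau>}. \<forall>r\<in>{0..\<tau>} \<times> {0..\<tau>}. dist q r < \<delta> \<longrightarrow>
     \<bar>cfield (T * fst q) (T * snd q) w / norming T - cfield (T * fst r) (T * snd r) w / norming T\<bar> \<le> e)"
proof -
  define K where "K = incr_const * (\<tau> powr (1 + m1.b) * \<tau> powr (1 + m2.b))"
  have K: "0 \<le> K" unfolding K_def using incr_const_nonneg by (intro mult_nonneg_nonneg) auto
  obtain \<delta> where \<delta>: "0 < \<delta>" and H: "\<And>X. (\<forall>s\<in>{0..1}. \<forall>t\<in>{0..1}. X s t \<in> borel_measurable M) \<Longrightarrow>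
     (\<forall>w\<in>space M. continuous_on ({0..1} \<times> {0..1}) (\<lambda>p. X (fst p) (snd p) w)) \<Longrightarrow>
     (\<forall>w\<in>space M. \<forall>s\<in>{0..1}. X s 0 w = 0 \<and> X 0 s w = 0) \<Longrightarrow>
     (\<forall>s\<in>{0..1}. \<forall>s'\<in>{0..1}. \<forall>t\<in>{0..1}. \<forall>t'\<in>{0..1}.
        (\<integral>\<^sup>+w. ennreal ((rect_incr X s s' t t' w)\<^sup>2) \<partial>M) \<le> ennreal (K * \<bar>s' - s\<bar> powr (1 + m1.b) * \<bar>t' - t\<bar> powr (1 + m2.b))) \<Longrightarrow>
     (\<exists>A\<in>sets M. prob A \<le> e \<and> (\<forall>w\<in>space M - A. \<forall>s\<in>{0..1}. \<forall>t\<in>{0..1}. \<forall>s'\<in>{0..1}. \<forall>t'\<in>{0..1}.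
        \<bar>s - s'\<bar> < \<delta> \<longrightarrow> \<bar>t - t'\<bar> < \<delta> \<longrightarrow> \<bar>X s t w - X s' t' w\<bar> \<le> e))"
    using uniform_modulus_in_probability[OF K m1.b_pos m2.b_pos e] by blast
  have main: "\<exists>A\<in>sets M. prob A \<le> e \<and> (\<forall>w\<in>space M - A. \<forall>q\<in>{0..\<tau>} \<times> {0..\<tau>}. \<forall>r\<in>{0..\<tau>} \<times> {0..\<tau>}. dist q r < \<delta> * \<tau> \<longrightarrow>
     \<bar>cfield (T * fst q) (T * snd q) w / norming T - cfield (T * fst r) (T * snd r) w / norming T\<bar> \<le> e)" if T: "0 < T" for T
  proof -
    define X where "X s t w = cfield (T * \<tau> * s) (T * \<tau> * t) w / norming T" for s t w
    have F: "0 < norming T" using T by simp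
    have a0: "\<forall>w\<in>space M. \<forall>s\<in>{0..1}. X s 0 w = 0 \<and> X 0 s w = 0" by (simp add: X_def cfield_axes)
    have m: "\<forall>s\<in>{0..1}. \<forall>t\<in>{0..1}. X s t \<in> borel_measurable M" unfolding X_def[abs_def] by auto
    have c: "\<forall>w\<in>space M. continuous_on ({0..1} \<times> {0..1}) (\<lambda>p. X (fst p) (snd p) w)"
    proof
      fix w
      have "continuous_on ({0..1} \<times> {0..1}) (\<lambda>p. (\<lambda>q. cfield (fst q) (snd q) w) (T * \<tau> * fst p, T * \<tau> * snd p))"
        by (rule continuous_on_compose2[OF cfield_continuous[of "T * \<tau>"]]) (use T \<tau> in \<open>auto intro!: continuous_intros mult_left_le\<close>)
      then show "continuous_on ({0..1} \<times> {0..1}) (\<lambda>p. X (fst p) (snd p) w)" unfolding X_def using F by (intro continuous_on_divide continuous_on_const) auto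
    qed
    have r: "\<forall>s\<in>{0..1}. \<forall>s'\<in>{0..1}. \<forall>t\<in>{0..1}. \<forall>t'\<in>{0..1}.
        (\<integral>\<^sup>+w. ennreal ((rect_incr X s s' t t' w)\<^sup>2) \<partial>M) \<le> ennreal (K * \<bar>s' - s\<bar> powr (1 + m1.b) * \<bar>t' - t\<bar> powr (1 + m2.b))"
    proof (intro ballI)
      fix s s' t t' :: real assume st: "s \<in> {0..1}" "s' \<in> {0..1}" "t \<in> {0..1}" "t' \<in> {0..1}"
      let ?S = "T * \<tau>"
      have S: "0 < ?S" using T \<tau> by simp
      have ri: "rect_incr X s s' t t' w = rect_incr cfield (?S * s) (?S * s') (?S * t) (?S * t') w / norming T" for w
        unfolding rect_incr_def X_def by (simp only: diff_divide_distrib add_divide_distrib)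
      have [measurable]: "rect_incr cfield a b c d \<in> borel_measurable M" for a b c d unfolding rect_incr_def[abs_def] by measurable
      have "(\<integral>\<^sup>+w. ennreal ((rect_incr X s s' t t' w)\<^sup>2) \<partial>M) = (\<integral>\<^sup>+w. ennreal (1 / (norming T)\<^sup>2) * ennreal ((rect_incr cfield (?S * s) (?S * s') (?S * t) (?S * t') w)\<^sup>2) \<partial>M)"
        unfolding ri power_divide by (intro nn_integral_cong, subst ennreal_mult[symmetric]) auto
      also have "\<dots> = ennreal (1 / (norming T)\<^sup>2) * (\<integral>\<^sup>+w. ennreal ((rect_incr cfield (?S * s) (?S * s') (?S * t) (?S * t') w)\<^sup>2) \<partial>M)"
        by (rule nn_integral_cmult) measurable
      also have "\<dots> \<le> ennreal (1 / (norming T)\<^sup>2) * ennreal (incr_const * (\<bar>?S * s' - ?S * s\<bar> powr (1 + m1.b) * \<bar>?S * t' - ?S * t\<bar> powr (1 + m2.b)))"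
        by (intro mult_left_mono cfield_rect_moment) (use st S in auto)
      also have "\<dots> = ennreal (1 / (norming T)\<^sup>2 * (incr_const * (\<bar>?S * s' - ?S * s\<bar> powr (1 + m1.b) * \<bar>?S * t' - ?S * t\<bar> powr (1 + m2.b))))"
        by (rule ennreal_mult[symmetric]) (auto intro!: mult_nonneg_nonneg incr_const_nonneg)
      also have "1 / (norming T)\<^sup>2 * (incr_const * (\<bar>?S * s' - ?S * s\<bar> powr (1 + m1.b) * \<bar>?S * t' - ?S * t\<bar> powr (1 + m2.b))) = K * \<bar>s' - s\<bar> powr (1 + m1.b) * \<bar>t' - t\<bar> powr (1 + m2.b)"
      proof -
        have "\<bar>?S * a - ?S * b\<bar> powr h = T powr h * \<tau> powr h * \<bar>a - b\<bar> powr h" for a b h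
        proof -
          have "\<bar>?S * a - ?S * b\<bar> = T * \<tau> * \<bar>a - b\<bar>" using T \<tau> by (simp add: right_diff_distrib[symmetric] abs_mult)
          then show ?thesis using T \<tau> by (simp add: powr_mult)
        qed
        then show ?thesis unfolding norming_sq[OF T] K_def using T by simp
      qed
      finally show "(\<integral>\<^sup>+w. ennreal ((rect_incr X s s' t t' w)\<^sup>2) \<partial>M) \<le> ennreal (K * \<bar>s' - s\<bar> powr (1 + m1.b) * \<bar>t' - t\<bar> powr (1 + m2.b))" .
    qed
    obtain A where A: "A \<in> sets M" "prob A \<le> e" and X: "\<And>w s t s' t'. w \<in> space M - A \<Longrightarrow> s \<in> {0..1} \<Longrightarrow> t \<in> {0..1} \<Longrightarrow> s' \<in> {0..1} \<Longrightarrow> t' \<in> {0..1} \<Longrightarrow>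
        \<bar>s - s'\<bar> < \<delta> \<Longrightarrow> \<bar>t - t'\<bar> < \<delta> \<Longrightarrow> \<bar>X s t w - X s' t' w\<bar> \<le> e"
      using H[OF m c a0 r] by blast
    show ?thesis
    proof (intro bexI[OF _ A(1)] conjI A(2) ballI impI)
      fix w q r assume w: "w \<in> space M - A" and q: "q \<in> {0..\<tau>} \<times> {0..\<tau>}" and r: "r \<in> {0..\<tau>} \<times> {0..\<tau>}" and d: "dist q r < \<delta> * \<tau>"
      have "\<bar>fst q - fst r\<bar> < \<delta> * \<tau>" "\<bar>snd q - snd r\<bar> < \<delta> * \<tau>"
        using d dist_fst_le[of q r] dist_snd_le[of q r] by (auto simp: dist_real_def)
      then have "\<bar>fst q / \<tau> - fst r / \<tau>\<bar> < \<delta>" "\<bar>snd q / \<tau> - snd r / \<tau>\<bar> < \<delta>"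
        using \<tau> by (auto simp: diff_divide_distrib[symmetric] divide_less_eq)
      then have "\<bar>X (fst q / \<tau>) (snd q / \<tau>) w - X (fst r / \<tau>) (snd r / \<tau>) w\<bar> \<le> e"
        by (intro X[OF w]) (use q r \<tau> in \<open>auto simp: mem_Times_iff divide_le_eq\<close>)
      then show "\<bar>cfield (T * fst q) (T * snd q) w / norming T - cfield (T * fst r) (T * snd r) w / norming T\<bar> \<le> e"
        using \<tau> by (simp add: X_def)
    qed
  qed
  have "0 < \<delta> * \<tau>" using \<delta> \<tau> by simp
  with main show ?thesis by blast
qed

lemma scaled_field_continuous:
  assumes "0 < T" "0 < \<tau>"
  shows "continuous_on ({0..\<tau>} \<times> {0..\<tau>}) (\<lambda>p. cfield (T * fst p) (T * snd p) w / norming T)"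
proof -
  have "continuous_on ({0..\<tau>} \<times> {0..\<tau>}) (\<lambda>p. (\<lambda>q. cfield (fst q) (snd q) w) (T * fst p, T * snd p))"
    by (rule continuous_on_compose2[OF cfield_continuous[of "T * \<tau>"]]) (use assms in \<open>auto intro!: continuous_intros\<close>)
  then show ?thesis using assms by (intro continuous_on_divide continuous_on_const) auto
qed

end

theorem theorem3p2:
  fixes \<alpha>1 \<alpha>2 D \<tau> :: real
    and \<phi> \<psi> F :: "real \<Rightarrow> real"
    and M :: "'w measure" and M' :: "'v measure"
    and x :: "nat \<Rightarrow> 'w \<Rightarrow> real \<times> real"
    and Y1 Y2 :: "nat \<Rightarrow> real \<Rightarrow> 'w \<Rightarrow> real"
    and W :: "real \<times> real \<Rightarrow> 'v \<Rightarrow> real"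
  assumes "1 < \<alpha>1" "\<alpha>1 \<le> 2" "1 < \<alpha>2" "\<alpha>2 \<le> 2"
    and "integrable lborel \<phi>" "\<not> (AE y in lborel. \<phi> y = 0)"
    and "integrable lborel \<psi>" "\<not> (AE y in lborel. \<psi> y = 0)"
    and "two_type_particle_system M \<alpha>1 \<alpha>2 x Y1 Y2"
    and "\<And>T. F T = T powr (1 - 1 / (2 * \<alpha>1)) * T powr (1 - 1 / (2 * \<alpha>2))"
    and "fractional_brownian_sheet M' \<alpha>1 \<alpha>2 W"
    and "D = (LBINT y. \<phi> y) * (LBINT y. \<psi> y) *
           sqrt ((1 / (1 - 1 / \<alpha>1) * stable_density \<alpha>1 1 0) *
                 (1 / (1 - 1 / \<alpha>2) * stable_density \<alpha>2 1 0))"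
    and "\<tau> > 0"
  shows "converges_in_law_C ({0..\<tau>} \<times> {0..\<tau>})
           M (fluctuation M x Y1 Y2 \<phi> \<psi> F)
           M' (\<lambda>p \<omega>. D * W p \<omega>)"
proof -
  interpret particle_system M \<alpha>1 \<alpha>2 x Y1 Y2 \<phi> \<psi> by unfold_locales (use assms in auto)
  interpret M': prob_space M' using assms(11) by (simp add: fractional_brownian_sheet_def)
  let ?S = "{0..\<tau>} \<times> {0..\<tau>}"
  have S: "compact ?S" by (intro compact_Times compact_Icc)
  have F: "F = (\<lambda>T. norming T)" using assms(10) by auto
  \<comment> \<open>The quantity under the root is nonnegative, so squaring undoes the root.\<close>
  have D: "D\<^sup>2 = (m1.p1 / m1.b * (LBINT x. \<phi> x)\<^sup>2) * (m2.p1 / m2.b * (LBINT x. \<psi> x)\<^sup>2)"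
  proof -
    have "0 \<le> (1 / m1.b * m1.p1) * (1 / m2.b * m2.p1)" using m1.p1_nonneg m2.p1_nonneg m1.b_pos m2.b_pos by (intro mult_nonneg_nonneg) auto
    then show ?thesis unfolding assms(12) power_mult_distrib real_sqrt_pow2 by simp
  qed
  \<comment> \<open>For T \<le> 0 the zero path is used, so that \<open>Z T\<close> is a random path
    for every T; the limit concerns large T only.\<close>
  define Z where "Z T w = restrict (\<lambda>p. if 0 < T then cfield (T * fst p) (T * snd p) w / norming T else 0) ?S" for T w
  define V where "V w = restrict (\<lambda>p. D * W p w) ?S" for w
  have Z: "Z T \<in> M \<rightarrow>\<^sub>M C_borel ?S" for T
  proof (rule measurable_C_borel_coordinates[OF S])
    fix w
    have "continuous_on ?S (\<lambda>p. if 0 < T then cfield (T * fst p) (T * snd p) w / norming T else 0)"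
      using scaled_field_continuous[of T \<tau> w] assms(13) by (cases "0 < T") auto
    then show "Z T w \<in> mspace (C_space ?S)" unfolding mspace_C_space[OF S] Z_def by (auto cong: continuous_on_cong)
  next
    fix p :: "real \<times> real" assume "p \<in> ?S"
    then show "(\<lambda>w. Z T w p) \<in> borel_measurable M" unfolding Z_def by (cases "0 < T") auto
  qed
  have Wg: "gaussian_rv M' (W p)" if "p \<in> {0..} \<times> {0..}" for p
  proof -
    have "gaussian_rv M' (\<lambda>w. \<Sum>q\<in>J. c q * W q w)" if "finite J" "J \<subseteq> {0..} \<times> {0..}" for J c
      using assms(11) that by (simp add: fractional_brownian_sheet_def centered_gaussian_field_def)
    from this[of "{p}" "\<lambda>_. 1"] that show ?thesis by simp
  qed
  then have Wm: "W p \<in> borel_measurable M'" if "p \<in> {0..} \<times> {0..}" for p using that by (simp add: gaussian_rv_def)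
  have V: "V \<in> M' \<rightarrow>\<^sub>M C_borel ?S"
  proof (rule measurable_C_borel_coordinates[OF S])
    fix w assume "w \<in> space M'"
    then have "continuous_on ({0..} \<times> {0..}) (\<lambda>p. W p w)" using assms(11) by (simp add: fractional_brownian_sheet_def)
    then have "continuous_on ?S (\<lambda>p. D * W p w)" by (intro continuous_on_mult_left) (rule continuous_on_subset, auto)
    then show "V w \<in> mspace (C_space ?S)" unfolding mspace_C_space[OF S] V_def by (auto cong: continuous_on_cong)
  next
    fix p assume p: "p \<in> ?S"
    then have "W p \<in> borel_measurable M'" by (intro Wm) auto
    then show "(\<lambda>w. V w p) \<in> borel_measurable M'" unfolding V_def using p by simp
  qed
  have ZC: "C_element M ?S (fluctuation M x Y1 Y2 \<phi> \<psi> F T) (Z T)" if T: "0 < T" for T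
    unfolding C_element_def
  proof (intro conjI Z eventually_mono[OF good_paths_AE] ballI)
    fix w p assume "w \<in> good_paths" "p \<in> ?S"
    then show "Z T w p = fluctuation M x Y1 Y2 \<phi> \<psi> F T p w"
      using fluctuation_cfield[of w T p F] T by (simp add: Z_def F mem_Times_iff)
  qed
  have VC: "C_element M' ?S (\<lambda>p \<omega>. D * W p \<omega>) V" unfolding C_element_def using V by (simp add: V_def)
  have "weak_conv_on (mtopology_of (C_space ?S)) (\<lambda>T. distr M (C_borel ?S) (Z T)) (distr M' (C_borel ?S) V) at_top"
  proof (rule weak_conv_on_C_space[OF S prob_space_axioms M'.prob_space_axioms Z V])
    fix k :: nat and p :: "nat \<Rightarrow> real \<times> real" and g :: "(nat \<Rightarrow> real) \<Rightarrow> real" and L B :: real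
    assume p: "\<And>i. i < k \<Longrightarrow> p i \<in> ?S" and g: "\<And>a b. \<bar>g a - g b\<bar> \<le> L * (\<Sum>i<k. \<bar>a i - b i\<bar>)" "0 \<le> L" "\<And>a. \<bar>g a\<bar> \<le> B"
    obtain C1 where C1: "\<And>T i. 0 < T \<Longrightarrow> i < k \<Longrightarrow> integrable M (\<lambda>w. (cfield (T * fst (p i)) (T * snd (p i)) w / norming T)\<^sup>2) \<and>
        (LINT w|M. (cfield (T * fst (p i)) (T * snd (p i)) w / norming T)\<^sup>2) \<le> C1"
      using scaled_second_moment[OF assms(13)] p by blast
    define C2 where "C2 = (\<Sum>i<k. LINT w|M'. (D * W (p i) w)\<^sup>2)"
    \<comment> \<open>It suffices to let T run through sequences tending to infinity, as in the
      dominated convergence arguments behind the covariance limit.\<close>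
    show "((\<lambda>T. (LINT w|M. g (\<lambda>i. Z T w (p i)))) \<longlongrightarrow> (LINT w|M'. g (\<lambda>i. V w (p i)))) at_top"
    proof (rule tendsto_at_topI_sequentially)
      fix T :: "nat \<Rightarrow> real" assume T: "filterlim T at_top sequentially"
      show "(\<lambda>n. (LINT w|M. g (\<lambda>i. Z (T n) w (p i)))) \<longlonglongrightarrow> (LINT w|M'. g (\<lambda>i. V w (p i)))"
      proof (rule multivariate_levy_continuity[where X="\<lambda>n w i. Z (T n) w (p i)" and Y="\<lambda>w i. V w (p i)" and C="max (max C1 0) C2",
          OF prob_space_axioms M'.prob_space_axioms g(1,3)])
        show "integrable M (\<lambda>w. (Z (T n) w (p i))\<^sup>2) \<and> (LINT w|M. (Z (T n) w (p i))\<^sup>2) \<le> max (max C1 0) C2" if "i < k" for n i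
          using C1[of "T n" i] p[OF that] that unfolding Z_def by (cases "0 < T n") auto
        show "integrable M' (\<lambda>w. (V w (p i))\<^sup>2) \<and> (LINT w|M'. (V w (p i))\<^sup>2) \<le> max (max C1 0) C2" if "i < k" for i
        proof -
          have "gaussian_rv M' (W (p i))" by (rule Wg) (use p[OF that] in auto)
          from M'.gaussian_second_moment(1)[OF this] have "integrable M' (\<lambda>w. (D * W (p i) w)\<^sup>2)" by (simp add: power_mult_distrib)
          moreover have "(LINT w|M'. (D * W (p i) w)\<^sup>2) \<le> C2" unfolding C2_def using that by (intro member_le_sum) auto
          ultimately show ?thesis using p[OF that] by (simp add: V_def le_max_iff_disj)
        qed
        show "(\<lambda>w. Z (T n) w (p i)) \<in> borel_measurable M" if "i < k" for n i
          using p[OF that] unfolding Z_def by (cases "0 < T n") auto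
        show "(\<lambda>w. V w (p i)) \<in> borel_measurable M'" if "i < k" for i
        proof -
          have "W (p i) \<in> borel_measurable M'" by (rule Wm) (use p[OF that] in auto)
          then show ?thesis unfolding V_def using p[OF that] by simp
        qed
        fix c :: "nat \<Rightarrow> real"
        have "(\<Sum>i<k. c i * V w (p i)) = (\<Sum>i<k. (c i * D) * W (p i) w)" for w
          by (intro sum.cong refl) (use p in \<open>simp add: V_def\<close>)
        then have lim: "(LINT w|M'. iexp (\<Sum>i<k. c i * V w (p i))) = of_real (exp (- (\<Sum>i<k. \<Sum>j<k. (c i * D) * (c j * D) * (fbs_cov \<alpha>1 (fst (p i)) (fst (p j)) * fbs_cov \<alpha>2 (snd (p i)) (snd (p j)))) / 2))"
          using sheet_combination_char[OF assms(11), of k p "\<lambda>i. c i * D"] p by (simp only:) (auto simp: mem_Times_iff)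
        have "eventually (\<lambda>n. 0 < T n) sequentially" using T by (simp add: filterlim_at_top_dense)
        then have ev: "eventually (\<lambda>n. (LINT w|M. iexp (\<Sum>i<k. c i * (cfield (T n * fst (p i)) (T n * snd (p i)) w / norming (T n)))) = (LINT w|M. iexp (\<Sum>i<k. c i * Z (T n) w (p i)))) sequentially"
        proof eventually_elim
          case (elim n)
          have "(\<Sum>i<k. c i * (cfield (T n * fst (p i)) (T n * snd (p i)) w / norming (T n))) = (\<Sum>i<k. c i * Z (T n) w (p i))" for w
            by (intro sum.cong refl) (use p elim in \<open>simp add: Z_def\<close>)
          then show ?case by (simp only:)
        qed
        show "(\<lambda>n. (LINT w|M. iexp (\<Sum>i<k. c i * Z (T n) w (p i)))) \<longlonglongrightarrow> (LINT w|M'. iexp (\<Sum>i<k. c i * V w (p i)))"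
          unfolding lim by (rule Lim_transform_eventually[OF scaled_char_limit[OF assms(13) p T D] ev])
      qed
    qed
  next
    fix \<epsilon> :: real assume "0 < \<epsilon>"
    from scaled_modulus[OF assms(13) this] obtain \<delta> where \<delta>: "0 < \<delta>" and H: "\<And>T. 0 < T \<Longrightarrow> \<exists>A\<in>sets M. prob A \<le> \<epsilon> \<and> (\<forall>w\<in>space M - A. \<forall>q\<in>?S. \<forall>r\<in>?S. dist q r < \<delta> \<longrightarrow>
     \<bar>cfield (T * fst q) (T * snd q) w / norming T - cfield (T * fst r) (T * snd r) w / norming T\<bar> \<le> \<epsilon>)" by blast
    have "eventually (\<lambda>T::real. 0 < T) at_top" by (rule eventually_gt_at_top)
    then have "\<forall>\<^sub>F T in at_top. \<exists>A\<in>sets M. prob A \<le> \<epsilon> \<and> (\<forall>w\<in>space M - A. \<forall>q\<in>?S. \<forall>r\<in>?S. dist q r < \<delta> \<longrightarrow> \<bar>Z T w q - Z T w r\<bar> \<le> \<epsilon>)"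
    proof eventually_elim
      case (elim T)
      from H[OF this] show ?case using elim by (simp add: Z_def)
    qed
    with \<delta> show "\<exists>\<delta>>0. \<forall>\<^sub>F T in at_top. \<exists>A\<in>sets M. prob A \<le> \<epsilon> \<and> (\<forall>w\<in>space M - A. \<forall>q\<in>?S. \<forall>r\<in>?S. dist q r < \<delta> \<longrightarrow> \<bar>Z T w q - Z T w r\<bar> \<le> \<epsilon>)"
      by blast
  qed
  with ZC VC show ?thesis unfolding converges_in_law_C_def by blast
qed

end
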